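(* Let $\mathcal{D}$ be a right co-$H$-category. Then the category ${_{\mathcal{D}}}{\mathscr{M}}^H$ of relative $(\mathcal D,H)$-Hopf modules is a Grothendieck category.
   Context: $K$ is a field and $H$ is a Hopf algebra over $K$ with bijective antipode. Coactions of right $H$-comodules are written $\rho(m)=\sum m_0\otimes m_1$. A right co-$H$-category $\mathcal D$ is a small $K$-linear category such that every $Hom_{\mathcal D}(X,Y)$ is a right $H$-comodule with coaction $\rho_{XY}(f)=\sum f_0\otimes f_1$, $\rho_{XX}(\mathrm{id}_X)=\mathrm{id}_X\otimes 1_H$, and $\rho_{XZ}(fg)=\sum f_0g_0\otimes f_1g_1$ for composable $g:X\to Y$, $f:Y\to Z$. A left $\mathcal D$-module is a $K$-linear functor $\mathcal D\to Vect_K$. A relative $(\mathcal D,H)$-Hopf module is a left $\mathcal D$-module $\mathcal M$ with a right $H$-comodule structure on each $\mathcal M(X)$ such that $\rho_{\mathcal M(Y)}(\mathcal M(f)(m))=\sum\mathcal M(f_0)(m_0)\otimes f_1m_1$ for all $f\in Hom_{\mathcal D}(X,Y)$, $m\in\mathcal M(X)$. The category of these, with morphisms the $\mathcal D$-module morphisms $\eta$ such that every $\eta(X)$ is $H$-colinear, is ${_{\mathcal{D}}}{\mathscr{M}}^H$. *)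

theory Defs
  imports "HOL-Algebra.AbelCoset" "HOL-Algebra.Module" "HOL-Library.FuncSet"
begin

section \<open>Smallness\<close>

text \<open>
  HOL has no type of all sets, so ``small'' is relative to a type \<^typ>\<open>'u\<close> and a family of subsets
  of it, the small sets. The closure conditions below hold for the elements of any Grothendieck
  universe with an infinite member, and also when all subsets of an infinite type are small.
  Closure under power sets is not required.
\<close>

locale universe =
  fixes small :: "'u set \<Rightarrow> bool"
  assumes small_subset: "small A \<Longrightarrow> B \<subseteq> A \<Longrightarrow> small B"
    and small_image: "small A \<Longrightarrow> small (f ` A)"
    and small_Union: "small A \<Longrightarrow> (\<And>a. a \<in> A \<Longrightarrow> small (F a)) \<Longrightarrow> small (\<Union>a\<in>A. F a)"
    and small_infinite: "\<exists>A. small A \<and> infinite A"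

definition small_in :: "('u set \<Rightarrow> bool) \<Rightarrow> 'x set \<Rightarrow> bool" where
  "small_in small S \<longleftrightarrow> (\<exists>f. inj_on f S \<and> small (f ` S))"


section \<open>Categories\<close>

text \<open>
  Arrows need not determine their source and target, so composition takes the objects as
  arguments: \<open>Comp C X Y Z g f\<close> is $g \circ f$ for $f : X \to Y$ and $g : Y \to Z$.
\<close>

record ('o, 'm) cat =
  Obj :: "'o set"
  Hom :: "'o \<Rightarrow> 'o \<Rightarrow> 'm set"
  Comp :: "'o \<Rightarrow> 'o \<Rightarrow> 'o \<Rightarrow> 'm \<Rightarrow> 'm \<Rightarrow> 'm"
  Ident :: "'o \<Rightarrow> 'm"

locale category =
  fixes C :: "('o, 'm) cat"
  assumes Comp_closed: "\<lbrakk>X \<in> Obj C; Y \<in> Obj C; Z \<in> Obj C; f \<in> Hom C X Y; g \<in> Hom C Y Z\<rbrakk>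
      \<Longrightarrow> Comp C X Y Z g f \<in> Hom C X Z"
    and Ident_closed: "X \<in> Obj C \<Longrightarrow> Ident C X \<in> Hom C X X"
    and Comp_assoc: "\<lbrakk>W \<in> Obj C; X \<in> Obj C; Y \<in> Obj C; Z \<in> Obj C;
        f \<in> Hom C W X; g \<in> Hom C X Y; h \<in> Hom C Y Z\<rbrakk>
      \<Longrightarrow> Comp C W X Z (Comp C X Y Z h g) f = Comp C W Y Z h (Comp C W X Y g f)"
    and Comp_Ident_left: "\<lbrakk>X \<in> Obj C; Y \<in> Obj C; f \<in> Hom C X Y\<rbrakk>
      \<Longrightarrow> Comp C X Y Y (Ident C Y) f = f"
    and Comp_Ident_right: "\<lbrakk>X \<in> Obj C; Y \<in> Obj C; f \<in> Hom C X Y\<rbrakk>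
      \<Longrightarrow> Comp C X X Y f (Ident C X) = f"

definition monomorphism :: "('o, 'm) cat \<Rightarrow> 'o \<Rightarrow> 'o \<Rightarrow> 'm \<Rightarrow> bool" where
  "monomorphism C X Y f \<longleftrightarrow> f \<in> Hom C X Y \<and>
    (\<forall>W\<in>Obj C. \<forall>g\<in>Hom C W X. \<forall>h\<in>Hom C W X. Comp C W X Y f g = Comp C W X Y f h \<longrightarrow> g = h)"

definition epimorphism :: "('o, 'm) cat \<Rightarrow> 'o \<Rightarrow> 'o \<Rightarrow> 'm \<Rightarrow> bool" where
  "epimorphism C X Y f \<longleftrightarrow> f \<in> Hom C X Y \<and>
    (\<forall>Z\<in>Obj C. \<forall>g\<in>Hom C Y Z. \<forall>h\<in>Hom C Y Z. Comp C X Y Z g f = Comp C X Y Z h f \<longrightarrow> g = h)"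

definition zero_object :: "('o, 'm) cat \<Rightarrow> 'o \<Rightarrow> bool" where
  "zero_object C Z \<longleftrightarrow> Z \<in> Obj C \<and>
    (\<forall>X\<in>Obj C. (\<exists>!f. f \<in> Hom C X Z) \<and> (\<exists>!f. f \<in> Hom C Z X))"

definition zero_arrow :: "('o, 'm) cat \<Rightarrow> 'o \<Rightarrow> 'o \<Rightarrow> 'm \<Rightarrow> bool" where
  "zero_arrow C X Y f \<longleftrightarrow>
    (\<exists>Z. zero_object C Z \<and> (\<exists>g\<in>Hom C X Z. \<exists>h\<in>Hom C Z Y. f = Comp C X Z Y h g))"

definition is_kernel :: "('o, 'm) cat \<Rightarrow> 'o \<Rightarrow> 'o \<Rightarrow> 'm \<Rightarrow> 'o \<Rightarrow> 'm \<Rightarrow> bool" where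
  "is_kernel C X Y f A k \<longleftrightarrow> A \<in> Obj C \<and> k \<in> Hom C A X \<and> zero_arrow C A Y (Comp C A X Y f k) \<and>
    (\<forall>W\<in>Obj C. \<forall>g\<in>Hom C W X. zero_arrow C W Y (Comp C W X Y f g) \<longrightarrow>
      (\<exists>!u. u \<in> Hom C W A \<and> Comp C W A X k u = g))"

definition is_cokernel :: "('o, 'm) cat \<Rightarrow> 'o \<Rightarrow> 'o \<Rightarrow> 'm \<Rightarrow> 'o \<Rightarrow> 'm \<Rightarrow> bool" where
  "is_cokernel C X Y f Q q \<longleftrightarrow> Q \<in> Obj C \<and> q \<in> Hom C Y Q \<and> zero_arrow C X Q (Comp C X Y Q q f) \<and>
    (\<forall>W\<in>Obj C. \<forall>g\<in>Hom C Y W. zero_arrow C X W (Comp C X Y W g f) \<longrightarrow>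
      (\<exists>!u. u \<in> Hom C Q W \<and> Comp C Y Q W u q = g))"

definition is_product :: "('o, 'm) cat \<Rightarrow> 'o \<Rightarrow> 'o \<Rightarrow> 'o \<Rightarrow> 'm \<Rightarrow> 'm \<Rightarrow> bool" where
  "is_product C X Y P p q \<longleftrightarrow> P \<in> Obj C \<and> p \<in> Hom C P X \<and> q \<in> Hom C P Y \<and>
    (\<forall>W\<in>Obj C. \<forall>f\<in>Hom C W X. \<forall>g\<in>Hom C W Y.
      \<exists>!u. u \<in> Hom C W P \<and> Comp C W P X p u = f \<and> Comp C W P Y q u = g)"

definition preadditive :: "('o, 'm) cat \<Rightarrow> bool" where
  "preadditive C \<longleftrightarrow> category C \<and>
    (\<exists>A :: 'o \<Rightarrow> 'o \<Rightarrow> 'm ring.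
      (\<forall>X\<in>Obj C. \<forall>Y\<in>Obj C. abelian_group (A X Y) \<and> carrier (A X Y) = Hom C X Y) \<and>
      (\<forall>X\<in>Obj C. \<forall>Y\<in>Obj C. \<forall>Z\<in>Obj C.
        \<forall>f\<in>Hom C X Y. \<forall>f'\<in>Hom C X Y. \<forall>g\<in>Hom C Y Z. \<forall>g'\<in>Hom C Y Z.
          Comp C X Y Z g (f \<oplus>\<^bsub>A X Y\<^esub> f') = Comp C X Y Z g f \<oplus>\<^bsub>A X Z\<^esub> Comp C X Y Z g f' \<and>
          Comp C X Y Z (g \<oplus>\<^bsub>A Y Z\<^esub> g') f = Comp C X Y Z g f \<oplus>\<^bsub>A X Z\<^esub> Comp C X Y Z g' f))"

text \<open>In a preadditive category a binary product is automatically a biproduct.\<close>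

definition additive_category :: "('o, 'm) cat \<Rightarrow> bool" where
  "additive_category C \<longleftrightarrow> preadditive C \<and> (\<exists>Z. zero_object C Z) \<and>
    (\<forall>X\<in>Obj C. \<forall>Y\<in>Obj C. \<exists>P p q. is_product C X Y P p q)"

definition abelian_category :: "('o, 'm) cat \<Rightarrow> bool" where
  "abelian_category C \<longleftrightarrow> additive_category C \<and>
    (\<forall>X\<in>Obj C. \<forall>Y\<in>Obj C. \<forall>f\<in>Hom C X Y.
      (\<exists>A k. is_kernel C X Y f A k) \<and> (\<exists>Q q. is_cokernel C X Y f Q q)) \<and>
    (\<forall>X\<in>Obj C. \<forall>Y\<in>Obj C. \<forall>f. monomorphism C X Y f \<longrightarrow>
      (\<exists>Z\<in>Obj C. \<exists>g\<in>Hom C Y Z. is_kernel C Y Z g X f)) \<and>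
    (\<forall>X\<in>Obj C. \<forall>Y\<in>Obj C. \<forall>f. epimorphism C X Y f \<longrightarrow>
      (\<exists>W\<in>Obj C. \<exists>g\<in>Hom C W X. is_cokernel C W X g Y f))"

definition short_exact :: "('o, 'm) cat \<Rightarrow> 'o \<Rightarrow> 'o \<Rightarrow> 'o \<Rightarrow> 'm \<Rightarrow> 'm \<Rightarrow> bool" where
  "short_exact C X Y Z f g \<longleftrightarrow> is_kernel C Y Z g X f \<and> is_cokernel C X Y f Z g"

locale diagram =
  J: category J + C: category C
  for J :: "('j, 'a) cat" and C :: "('o, 'm) cat" +
  fixes Fo :: "'j \<Rightarrow> 'o" and Fa :: "'j \<Rightarrow> 'j \<Rightarrow> 'a \<Rightarrow> 'm"
  assumes Fo_closed: "i \<in> Obj J \<Longrightarrow> Fo i \<in> Obj C"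
    and Fa_closed: "\<lbrakk>i \<in> Obj J; j \<in> Obj J; a \<in> Hom J i j\<rbrakk> \<Longrightarrow> Fa i j a \<in> Hom C (Fo i) (Fo j)"
    and Fa_Ident: "i \<in> Obj J \<Longrightarrow> Fa i i (Ident J i) = Ident C (Fo i)"
    and Fa_Comp: "\<lbrakk>i \<in> Obj J; j \<in> Obj J; k \<in> Obj J; a \<in> Hom J i j; b \<in> Hom J j k\<rbrakk>
      \<Longrightarrow> Fa i k (Comp J i j k b a) = Comp C (Fo i) (Fo j) (Fo k) (Fa j k b) (Fa i j a)"

definition nat_trans ::
  "('j, 'a) cat \<Rightarrow> ('o, 'm) cat \<Rightarrow> ('j \<Rightarrow> 'o) \<Rightarrow> ('j \<Rightarrow> 'j \<Rightarrow> 'a \<Rightarrow> 'm) \<Rightarrow>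
    ('j \<Rightarrow> 'o) \<Rightarrow> ('j \<Rightarrow> 'j \<Rightarrow> 'a \<Rightarrow> 'm) \<Rightarrow> ('j \<Rightarrow> 'm) \<Rightarrow> bool" where
  "nat_trans J C Fo Fa Go Ga t \<longleftrightarrow>
    (\<forall>i\<in>Obj J. t i \<in> Hom C (Fo i) (Go i)) \<and>
    (\<forall>i\<in>Obj J. \<forall>j\<in>Obj J. \<forall>a\<in>Hom J i j.
      Comp C (Fo i) (Fo j) (Go j) (t j) (Fa i j a) = Comp C (Fo i) (Go i) (Go j) (Ga i j a) (t i))"

definition cocone ::
  "('j, 'a) cat \<Rightarrow> ('o, 'm) cat \<Rightarrow> ('j \<Rightarrow> 'o) \<Rightarrow> ('j \<Rightarrow> 'j \<Rightarrow> 'a \<Rightarrow> 'm) \<Rightarrow> 'o \<Rightarrow> ('j \<Rightarrow> 'm) \<Rightarrow> bool" where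
  "cocone J C Fo Fa L c \<longleftrightarrow> L \<in> Obj C \<and> (\<forall>i\<in>Obj J. c i \<in> Hom C (Fo i) L) \<and>
    (\<forall>i\<in>Obj J. \<forall>j\<in>Obj J. \<forall>a\<in>Hom J i j. Comp C (Fo i) (Fo j) L (c j) (Fa i j a) = c i)"

definition is_colimit ::
  "('j, 'a) cat \<Rightarrow> ('o, 'm) cat \<Rightarrow> ('j \<Rightarrow> 'o) \<Rightarrow> ('j \<Rightarrow> 'j \<Rightarrow> 'a \<Rightarrow> 'm) \<Rightarrow> 'o \<Rightarrow> ('j \<Rightarrow> 'm) \<Rightarrow> bool" where
  "is_colimit J C Fo Fa L c \<longleftrightarrow> cocone J C Fo Fa L c \<and>
    (\<forall>W d. cocone J C Fo Fa W d \<longrightarrow>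
      (\<exists>!u. u \<in> Hom C L W \<and> (\<forall>i\<in>Obj J. Comp C (Fo i) L W u (c i) = d i)))"

definition small_category :: "('u set \<Rightarrow> bool) \<Rightarrow> ('u, 'u) cat \<Rightarrow> bool" where
  "small_category small J \<longleftrightarrow> category J \<and> small (Obj J) \<and>
    (\<forall>i\<in>Obj J. \<forall>j\<in>Obj J. small (Hom J i j))"

definition filtered :: "('j, 'a) cat \<Rightarrow> bool" where
  "filtered J \<longleftrightarrow> Obj J \<noteq> {} \<and>
    (\<forall>i\<in>Obj J. \<forall>j\<in>Obj J. \<exists>k\<in>Obj J. Hom J i k \<noteq> {} \<and> Hom J j k \<noteq> {}) \<and>
    (\<forall>i\<in>Obj J. \<forall>j\<in>Obj J. \<forall>a\<in>Hom J i j. \<forall>b\<in>Hom J i j.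
      \<exists>k\<in>Obj J. \<exists>c\<in>Hom J j k. Comp J i j k c a = Comp J i j k c b)"

definition cocomplete :: "('u set \<Rightarrow> bool) \<Rightarrow> ('o, 'm) cat \<Rightarrow> bool" where
  "cocomplete small C \<longleftrightarrow>
    (\<forall>(J :: ('u, 'u) cat) Fo Fa. small_category small J \<and> diagram J C Fo Fa \<longrightarrow>
      (\<exists>L c. is_colimit J C Fo Fa L c))"

definition filtered_colimits_exact :: "('u set \<Rightarrow> bool) \<Rightarrow> ('o, 'm) cat \<Rightarrow> bool" where
  "filtered_colimits_exact small C \<longleftrightarrow>
    (\<forall>(J :: ('u, 'u) cat) Fo Fa Go Ga Ho Ha s t A a B b E e f g.
      small_category small J \<and> filtered J \<and>
      diagram J C Fo Fa \<and> diagram J C Go Ga \<and> diagram J C Ho Ha \<and>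
      nat_trans J C Fo Fa Go Ga s \<and> nat_trans J C Go Ga Ho Ha t \<and>
      (\<forall>i\<in>Obj J. short_exact C (Fo i) (Go i) (Ho i) (s i) (t i)) \<and>
      is_colimit J C Fo Fa A a \<and> is_colimit J C Go Ga B b \<and> is_colimit J C Ho Ha E e \<and>
      f \<in> Hom C A B \<and>
      (\<forall>i\<in>Obj J. Comp C (Fo i) A B f (a i) = Comp C (Fo i) (Go i) B (b i) (s i)) \<and>
      g \<in> Hom C B E \<and>
      (\<forall>i\<in>Obj J. Comp C (Go i) B E g (b i) = Comp C (Go i) (Ho i) E (e i) (t i))
      \<longrightarrow> short_exact C A B E f g)"

definition is_generator :: "('o, 'm) cat \<Rightarrow> 'o \<Rightarrow> bool" where
  "is_generator C G \<longleftrightarrow> G \<in> Obj C \<and>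
    (\<forall>X\<in>Obj C. \<forall>Y\<in>Obj C. \<forall>f\<in>Hom C X Y. \<forall>g\<in>Hom C X Y.
      (\<forall>h\<in>Hom C G X. Comp C G X Y f h = Comp C G X Y g h) \<longrightarrow> f = g)"

definition grothendieck_category :: "('u set \<Rightarrow> bool) \<Rightarrow> ('o, 'm) cat \<Rightarrow> bool" where
  "grothendieck_category small C \<longleftrightarrow> abelian_category C \<and> cocomplete small C \<and>
    filtered_colimits_exact small C \<and> (\<exists>G. is_generator C G)"


section \<open>Tensor products of modules\<close>

text \<open>
  The module record of HOL-Algebra extends the ring record; the multiplicative fields
  \<open>mult\<close> and \<open>one\<close> are irrelevant for a module.
\<close>

definition linear_map ::
  "('k, 'x) ring_scheme \<Rightarrow> ('k, 'v, 'y) module_scheme \<Rightarrow> ('k, 'w, 'z) module_scheme \<Rightarrow> ('v \<Rightarrow> 'w) \<Rightarrow> bool"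
where
  "linear_map K V W f \<longleftrightarrow> f \<in> carrier V \<rightarrow> carrier W \<and>
    (\<forall>x\<in>carrier V. \<forall>y\<in>carrier V. f (x \<oplus>\<^bsub>V\<^esub> y) = f x \<oplus>\<^bsub>W\<^esub> f y) \<and>
    (\<forall>a\<in>carrier K. \<forall>x\<in>carrier V. f (a \<odot>\<^bsub>V\<^esub> x) = a \<odot>\<^bsub>W\<^esub> f x)"

definition free_module :: "('k, 'x) ring_scheme \<Rightarrow> 's set \<Rightarrow> ('k, 's \<Rightarrow> 'k) module" where
  "free_module K S =
    \<lparr>carrier = {f. finite {s. f s \<noteq> \<zero>\<^bsub>K\<^esub>} \<and> (\<forall>s. f s \<in> carrier K) \<and> (\<forall>s. s \<notin> S \<longrightarrow> f s = \<zero>\<^bsub>K\<^esub>)},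
     mult = undefined, one = undefined,
     zero = (\<lambda>s. \<zero>\<^bsub>K\<^esub>), add = (\<lambda>f g s. f s \<oplus>\<^bsub>K\<^esub> g s), smult = (\<lambda>a f s. a \<otimes>\<^bsub>K\<^esub> f s)\<rparr>"

definition free_gen :: "('k, 'x) ring_scheme \<Rightarrow> 's \<Rightarrow> 's \<Rightarrow> 'k" where
  "free_gen K s = (\<lambda>t. if t = s then \<one>\<^bsub>K\<^esub> else \<zero>\<^bsub>K\<^esub>)"

definition submodule_span ::
  "('k, 'x) ring_scheme \<Rightarrow> ('k, 'v, 'y) module_scheme \<Rightarrow> 'v set \<Rightarrow> 'v set" where
  "submodule_span K V S = \<Inter>{N. submodule N K V \<and> S \<subseteq> N}"

definition quotient_module ::
  "('k, 'v, 'y) module_scheme \<Rightarrow> 'v set \<Rightarrow> ('k, 'v set) module" where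
  "quotient_module V N =
    \<lparr>carrier = a_rcosets\<^bsub>V\<^esub> N, mult = undefined, one = undefined,
     zero = N, add = set_add V, smult = (\<lambda>a A. \<Union>x\<in>A. N +>\<^bsub>V\<^esub> (a \<odot>\<^bsub>V\<^esub> x))\<rparr>"

type_synonym ('v, 'w, 'k) tensor = "('v \<times> 'w \<Rightarrow> 'k) set"

definition bilinear_relations ::
  "('k, 'x) ring_scheme \<Rightarrow> ('k, 'v, 'y) module_scheme \<Rightarrow> ('k, 'w, 'z) module_scheme
    \<Rightarrow> ('v \<times> 'w \<Rightarrow> 'k) set" where
  "bilinear_relations K V W =
    (let F = free_module K (carrier V \<times> carrier W); e = (\<lambda>v w. free_gen K (v, w)) in
      {e (v \<oplus>\<^bsub>V\<^esub> v') w \<ominus>\<^bsub>F\<^esub> (e v w \<oplus>\<^bsub>F\<^esub> e v' w) | v v' w.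
         v \<in> carrier V \<and> v' \<in> carrier V \<and> w \<in> carrier W} \<union>
      {e v (w \<oplus>\<^bsub>W\<^esub> w') \<ominus>\<^bsub>F\<^esub> (e v w \<oplus>\<^bsub>F\<^esub> e v w') | v w w'.
         v \<in> carrier V \<and> w \<in> carrier W \<and> w' \<in> carrier W} \<union>
      {e (a \<odot>\<^bsub>V\<^esub> v) w \<ominus>\<^bsub>F\<^esub> a \<odot>\<^bsub>F\<^esub> e v w | a v w.
         a \<in> carrier K \<and> v \<in> carrier V \<and> w \<in> carrier W} \<union>
      {e v (a \<odot>\<^bsub>W\<^esub> w) \<ominus>\<^bsub>F\<^esub> a \<odot>\<^bsub>F\<^esub> e v w | a v w.
         a \<in> carrier K \<and> v \<in> carrier V \<and> w \<in> carrier W})"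

definition tensor_null ::
  "('k, 'x) ring_scheme \<Rightarrow> ('k, 'v, 'y) module_scheme \<Rightarrow> ('k, 'w, 'z) module_scheme
    \<Rightarrow> ('v \<times> 'w \<Rightarrow> 'k) set" where
  "tensor_null K V W =
    submodule_span K (free_module K (carrier V \<times> carrier W)) (bilinear_relations K V W)"

definition tensor_product ::
  "('k, 'x) ring_scheme \<Rightarrow> ('k, 'v, 'y) module_scheme \<Rightarrow> ('k, 'w, 'z) module_scheme
    \<Rightarrow> ('k, ('v, 'w, 'k) tensor) module" where
  "tensor_product K V W =
    quotient_module (free_module K (carrier V \<times> carrier W)) (tensor_null K V W)"

definition pure_tensor ::
  "('k, 'x) ring_scheme \<Rightarrow> ('k, 'v, 'y) module_scheme \<Rightarrow> ('k, 'w, 'z) module_scheme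
    \<Rightarrow> 'v \<Rightarrow> 'w \<Rightarrow> ('v, 'w, 'k) tensor" where
  "pure_tensor K V W v w =
    tensor_null K V W +>\<^bsub>free_module K (carrier V \<times> carrier W)\<^esub> free_gen K (v, w)"

text \<open>
  Sweedler notation. For a tensor $t = \sum t_0 \otimes t_1$ in $V \otimes W$ and a bilinear map
  $b : V \times W \to P$, the following is $\sum b(t_0, t_1) \in P$, computed from an arbitrary
  representative of \<open>t\<close> in the free module; bilinearity of \<open>b\<close> makes it independent of the
  choice. Below it is only used with bilinear \<open>b\<close>.
\<close>

definition sweedler ::
  "('k, 'x) ring_scheme \<Rightarrow> ('k, 'p, 'y) module_scheme \<Rightarrow> ('v, 'w, 'k) tensor \<Rightarrow> ('v \<Rightarrow> 'w \<Rightarrow> 'p) \<Rightarrow> 'p"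
where
  "sweedler K P t b =
    (let r = (SOME r. r \<in> t) in \<Oplus>\<^bsub>P\<^esub>vw \<in> {vw. r vw \<noteq> \<zero>\<^bsub>K\<^esub>}. r vw \<odot>\<^bsub>P\<^esub> b (fst vw) (snd vw))"


section \<open>Hopf algebras and comodules\<close>

record ('k, 'h) hopf = "('k, 'h) module" +
  comult :: "'h \<Rightarrow> ('h, 'h, 'k) tensor"
  counit :: "'h \<Rightarrow> 'k"
  antipode :: "'h \<Rightarrow> 'h"

text \<open>
  Associative unital algebras. The locale \<open>algebra\<close> of HOL-Algebra is restricted to commutative
  ones.
\<close>

locale assoc_algebra =
  module K A + ring A
  for K :: "('k, 'x) ring_scheme" and A :: "('k, 'v, 'y) module_scheme" +
  assumes smult_mult_left: "\<lbrakk>a \<in> carrier K; x \<in> carrier A; y \<in> carrier A\<rbrakk>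
      \<Longrightarrow> (a \<odot>\<^bsub>A\<^esub> x) \<otimes>\<^bsub>A\<^esub> y = a \<odot>\<^bsub>A\<^esub> (x \<otimes>\<^bsub>A\<^esub> y)"
    and smult_mult_right: "\<lbrakk>a \<in> carrier K; x \<in> carrier A; y \<in> carrier A\<rbrakk>
      \<Longrightarrow> x \<otimes>\<^bsub>A\<^esub> (a \<odot>\<^bsub>A\<^esub> y) = a \<odot>\<^bsub>A\<^esub> (x \<otimes>\<^bsub>A\<^esub> y)"

text \<open>
  Coassociativity is stated in $H \otimes (H \otimes H)$:
  $\sum x_{11} \otimes (x_{12} \otimes x_2) = \sum x_1 \otimes \Delta(x_2)$; similarly for
  comodules below. The ground field \<open>K\<close> is a module over itself via its multiplication, which
  is written out for the counit.
\<close>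

locale coalgebra =
  module K H
  for K :: "'k ring" and H :: "('k, 'h) hopf" +
  assumes comult_linear: "linear_map K H (tensor_product K H H) (comult H)"
    and counit_closed: "x \<in> carrier H \<Longrightarrow> counit H x \<in> carrier K"
    and counit_add: "\<lbrakk>x \<in> carrier H; y \<in> carrier H\<rbrakk>
      \<Longrightarrow> counit H (x \<oplus>\<^bsub>H\<^esub> y) = counit H x \<oplus>\<^bsub>K\<^esub> counit H y"
    and counit_smult: "\<lbrakk>a \<in> carrier K; x \<in> carrier H\<rbrakk>
      \<Longrightarrow> counit H (a \<odot>\<^bsub>H\<^esub> x) = a \<otimes>\<^bsub>K\<^esub> counit H x"
    and comult_coassoc: "x \<in> carrier H \<Longrightarrow>
      sweedler K (tensor_product K H (tensor_product K H H)) (comult H x)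
        (\<lambda>x1 x2. sweedler K (tensor_product K H (tensor_product K H H)) (comult H x1)
          (\<lambda>x11 x12. pure_tensor K H (tensor_product K H H) x11 (pure_tensor K H H x12 x2)))
      = sweedler K (tensor_product K H (tensor_product K H H)) (comult H x)
        (\<lambda>x1 x2. pure_tensor K H (tensor_product K H H) x1 (comult H x2))"
    and counit_left: "x \<in> carrier H \<Longrightarrow>
      sweedler K H (comult H x) (\<lambda>x1 x2. counit H x1 \<odot>\<^bsub>H\<^esub> x2) = x"
    and counit_right: "x \<in> carrier H \<Longrightarrow>
      sweedler K H (comult H x) (\<lambda>x1 x2. counit H x2 \<odot>\<^bsub>H\<^esub> x1) = x"

locale hopf_algebra =
  field K + assoc_algebra K H + coalgebra K H
  for K :: "'k ring" and H :: "('k, 'h) hopf" +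
  assumes comult_one: "comult H \<one>\<^bsub>H\<^esub> = pure_tensor K H H \<one>\<^bsub>H\<^esub> \<one>\<^bsub>H\<^esub>"
    and comult_mult: "\<lbrakk>x \<in> carrier H; y \<in> carrier H\<rbrakk> \<Longrightarrow>
      comult H (x \<otimes>\<^bsub>H\<^esub> y) =
        sweedler K (tensor_product K H H) (comult H x) (\<lambda>x1 x2.
          sweedler K (tensor_product K H H) (comult H y) (\<lambda>y1 y2.
            pure_tensor K H H (x1 \<otimes>\<^bsub>H\<^esub> y1) (x2 \<otimes>\<^bsub>H\<^esub> y2)))"
    and counit_one: "counit H \<one>\<^bsub>H\<^esub> = \<one>\<^bsub>K\<^esub>"
    and counit_mult: "\<lbrakk>x \<in> carrier H; y \<in> carrier H\<rbrakk>
      \<Longrightarrow> counit H (x \<otimes>\<^bsub>H\<^esub> y) = counit H x \<otimes>\<^bsub>K\<^esub> counit H y"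
    and antipode_linear: "linear_map K H H (antipode H)"
    and antipode_left: "x \<in> carrier H \<Longrightarrow>
      sweedler K H (comult H x) (\<lambda>x1 x2. antipode H x1 \<otimes>\<^bsub>H\<^esub> x2) = counit H x \<odot>\<^bsub>H\<^esub> \<one>\<^bsub>H\<^esub>"
    and antipode_right: "x \<in> carrier H \<Longrightarrow>
      sweedler K H (comult H x) (\<lambda>x1 x2. x1 \<otimes>\<^bsub>H\<^esub> antipode H x2) = counit H x \<odot>\<^bsub>H\<^esub> \<one>\<^bsub>H\<^esub>"

locale right_comodule =
  module K V
  for K :: "'k ring" and H :: "('k, 'h) hopf" and V :: "('k, 'v, 'y) module_scheme" +
  fixes \<rho> :: "'v \<Rightarrow> ('v, 'h, 'k) tensor"
  assumes coaction_linear: "linear_map K V (tensor_product K V H) \<rho>"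
    and coaction_coassoc: "v \<in> carrier V \<Longrightarrow>
      sweedler K (tensor_product K V (tensor_product K H H)) (\<rho> v)
        (\<lambda>v0 v1. sweedler K (tensor_product K V (tensor_product K H H)) (\<rho> v0)
          (\<lambda>v00 v01. pure_tensor K V (tensor_product K H H) v00 (pure_tensor K H H v01 v1)))
      = sweedler K (tensor_product K V (tensor_product K H H)) (\<rho> v)
        (\<lambda>v0 v1. pure_tensor K V (tensor_product K H H) v0 (comult H v1))"
    and coaction_counit: "v \<in> carrier V \<Longrightarrow>
      sweedler K V (\<rho> v) (\<lambda>v0 v1. counit H v1 \<odot>\<^bsub>V\<^esub> v0) = v"

definition colinear ::
  "'k ring \<Rightarrow> ('k, 'h) hopf \<Rightarrow> ('k, 'v, 'y) module_scheme \<Rightarrow> ('v \<Rightarrow> ('v, 'h, 'k) tensor) \<Rightarrow>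
    ('k, 'w, 'z) module_scheme \<Rightarrow> ('w \<Rightarrow> ('w, 'h, 'k) tensor) \<Rightarrow> ('v \<Rightarrow> 'w) \<Rightarrow> bool" where
  "colinear K H V \<rho> W \<sigma> f \<longleftrightarrow>
    (\<forall>v\<in>carrier V. \<sigma> (f v) =
      sweedler K (tensor_product K W H) (\<rho> v) (\<lambda>v0 v1. pure_tensor K W H (f v0) v1))"


section \<open>Co-H-categories and relative Hopf modules\<close>

record ('o, 'f, 'k) linear_cat =
  LObj :: "'o set"
  LHom :: "'o \<Rightarrow> 'o \<Rightarrow> ('k, 'f) module"
  LComp :: "'o \<Rightarrow> 'o \<Rightarrow> 'o \<Rightarrow> 'f \<Rightarrow> 'f \<Rightarrow> 'f"
  LIdent :: "'o \<Rightarrow> 'f"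

record ('o, 'f, 'k, 'h) co_cat = "('o, 'f, 'k) linear_cat" +
  coact :: "'o \<Rightarrow> 'o \<Rightarrow> 'f \<Rightarrow> ('f, 'h, 'k) tensor"

definition underlying_cat :: "('o, 'f, 'k, 'x) linear_cat_scheme \<Rightarrow> ('o, 'f) cat" where
  "underlying_cat D =
    \<lparr>Obj = LObj D, Hom = (\<lambda>X Y. carrier (LHom D X Y)), Comp = LComp D, Ident = LIdent D\<rparr>"

locale linear_category =
  fixes K :: "'k ring" and D :: "('o, 'f, 'k, 'x) linear_cat_scheme"
  assumes underlying_category: "category (underlying_cat D)"
    and LHom_module: "\<lbrakk>X \<in> LObj D; Y \<in> LObj D\<rbrakk> \<Longrightarrow> module K (LHom D X Y)"
    and LComp_linear_left: "\<lbrakk>X \<in> LObj D; Y \<in> LObj D; Z \<in> LObj D; g \<in> carrier (LHom D X Y)\<rbrakk>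
      \<Longrightarrow> linear_map K (LHom D Y Z) (LHom D X Z) (\<lambda>f. LComp D X Y Z f g)"
    and LComp_linear_right: "\<lbrakk>X \<in> LObj D; Y \<in> LObj D; Z \<in> LObj D; f \<in> carrier (LHom D Y Z)\<rbrakk>
      \<Longrightarrow> linear_map K (LHom D X Y) (LHom D X Z) (\<lambda>g. LComp D X Y Z f g)"

locale right_co_category =
  linear_category K D
  for K :: "'k ring" and H :: "('k, 'h) hopf" and D :: "('o, 'f, 'k, 'h) co_cat" +
  assumes LHom_comodule: "\<lbrakk>X \<in> LObj D; Y \<in> LObj D\<rbrakk>
      \<Longrightarrow> right_comodule K H (LHom D X Y) (coact D X Y)"
    and coact_Ident: "X \<in> LObj D
      \<Longrightarrow> coact D X X (LIdent D X) = pure_tensor K (LHom D X X) H (LIdent D X) \<one>\<^bsub>H\<^esub>"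
    and coact_Comp: "\<lbrakk>X \<in> LObj D; Y \<in> LObj D; Z \<in> LObj D;
        g \<in> carrier (LHom D X Y); f \<in> carrier (LHom D Y Z)\<rbrakk> \<Longrightarrow>
      coact D X Z (LComp D X Y Z f g) =
        sweedler K (tensor_product K (LHom D X Z) H) (coact D Y Z f) (\<lambda>f0 f1.
          sweedler K (tensor_product K (LHom D X Z) H) (coact D X Y g) (\<lambda>g0 g1.
            pure_tensor K (LHom D X Z) H (LComp D X Y Z f0 g0) (f1 \<otimes>\<^bsub>H\<^esub> g1)))"

text \<open>
  A functor $D \to Vect_K$ with coactions: \<open>MObj M X\<close> is $M(X)$, \<open>MAct M X Y f m\<close> is $M(f)(m)$ for
  $f : X \to Y$, and \<open>MCoact M X\<close> is the coaction of $M(X)$.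
\<close>

record ('o, 'f, 'k, 'h, 'u) hopf_mod =
  MObj :: "'o \<Rightarrow> ('k, 'u) module"
  MAct :: "'o \<Rightarrow> 'o \<Rightarrow> 'f \<Rightarrow> 'u \<Rightarrow> 'u"
  MCoact :: "'o \<Rightarrow> 'u \<Rightarrow> ('u, 'h, 'k) tensor"

locale left_module =
  fixes K :: "'k ring" and D :: "('o, 'f, 'k, 'x) linear_cat_scheme"
    and M :: "('o, 'f, 'k, 'h, 'u) hopf_mod"
  assumes MObj_module: "X \<in> LObj D \<Longrightarrow> module K (MObj M X)"
    and MAct_linear: "\<lbrakk>X \<in> LObj D; Y \<in> LObj D; f \<in> carrier (LHom D X Y)\<rbrakk>
      \<Longrightarrow> linear_map K (MObj M X) (MObj M Y) (MAct M X Y f)"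
    and MAct_add: "\<lbrakk>X \<in> LObj D; Y \<in> LObj D; f \<in> carrier (LHom D X Y); g \<in> carrier (LHom D X Y);
        m \<in> carrier (MObj M X)\<rbrakk>
      \<Longrightarrow> MAct M X Y (f \<oplus>\<^bsub>LHom D X Y\<^esub> g) m = MAct M X Y f m \<oplus>\<^bsub>MObj M Y\<^esub> MAct M X Y g m"
    and MAct_smult: "\<lbrakk>X \<in> LObj D; Y \<in> LObj D; a \<in> carrier K; f \<in> carrier (LHom D X Y);
        m \<in> carrier (MObj M X)\<rbrakk>
      \<Longrightarrow> MAct M X Y (a \<odot>\<^bsub>LHom D X Y\<^esub> f) m = a \<odot>\<^bsub>MObj M Y\<^esub> MAct M X Y f m"
    and MAct_Ident: "\<lbrakk>X \<in> LObj D; m \<in> carrier (MObj M X)\<rbrakk> \<Longrightarrow> MAct M X X (LIdent D X) m = m"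
    and MAct_Comp: "\<lbrakk>X \<in> LObj D; Y \<in> LObj D; Z \<in> LObj D;
        g \<in> carrier (LHom D X Y); f \<in> carrier (LHom D Y Z); m \<in> carrier (MObj M X)\<rbrakk>
      \<Longrightarrow> MAct M X Z (LComp D X Y Z f g) m = MAct M Y Z f (MAct M X Y g m)"

locale relative_hopf_module =
  left_module K D M
  for K :: "'k ring" and H :: "('k, 'h) hopf" and D :: "('o, 'f, 'k, 'h) co_cat"
    and M :: "('o, 'f, 'k, 'h, 'u) hopf_mod" +
  assumes MObj_comodule: "X \<in> LObj D \<Longrightarrow> right_comodule K H (MObj M X) (MCoact M X)"
    and MCoact_MAct: "\<lbrakk>X \<in> LObj D; Y \<in> LObj D; f \<in> carrier (LHom D X Y); m \<in> carrier (MObj M X)\<rbrakk> \<Longrightarrow>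
      MCoact M Y (MAct M X Y f m) =
        sweedler K (tensor_product K (MObj M Y) H) (coact D X Y f) (\<lambda>f0 f1.
          sweedler K (tensor_product K (MObj M Y) H) (MCoact M X m) (\<lambda>m0 m1.
            pure_tensor K (MObj M Y) H (MAct M X Y f0 m0) (f1 \<otimes>\<^bsub>H\<^esub> m1)))"

text \<open>
  Families \<open>\<eta>\<close> of maps are required to be \<^const>\<open>undefined\<close> outside their domains, so that
  equality of morphisms is equality of functions. Objects are not normalised: two records that
  differ only in irrelevant values are distinct but isomorphic.
\<close>

definition hopf_mod_homs ::
  "'k ring \<Rightarrow> ('k, 'h) hopf \<Rightarrow> ('o, 'f, 'k, 'h) co_cat \<Rightarrow>
    ('o, 'f, 'k, 'h, 'u) hopf_mod \<Rightarrow> ('o, 'f, 'k, 'h, 'u) hopf_mod \<Rightarrow> ('o \<Rightarrow> 'u \<Rightarrow> 'u) set" where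
  "hopf_mod_homs K H D M N =
    {\<eta>. \<eta> \<in> extensional (LObj D) \<and>
      (\<forall>X\<in>LObj D. \<eta> X \<in> extensional (carrier (MObj M X)) \<and>
        linear_map K (MObj M X) (MObj N X) (\<eta> X) \<and>
        colinear K H (MObj M X) (MCoact M X) (MObj N X) (MCoact N X) (\<eta> X)) \<and>
      (\<forall>X\<in>LObj D. \<forall>Y\<in>LObj D. \<forall>f\<in>carrier (LHom D X Y). \<forall>m\<in>carrier (MObj M X).
        \<eta> Y (MAct M X Y f m) = MAct N X Y f (\<eta> X m))}"

definition hopf_mod_category ::
  "('u set \<Rightarrow> bool) \<Rightarrow> 'k ring \<Rightarrow> ('k, 'h) hopf \<Rightarrow> ('o, 'f, 'k, 'h) co_cat \<Rightarrow>
    (('o, 'f, 'k, 'h, 'u) hopf_mod, 'o \<Rightarrow> 'u \<Rightarrow> 'u) cat" where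
  "hopf_mod_category small K H D =
    \<lparr>Obj = {M. relative_hopf_module K H D M \<and> (\<forall>X\<in>LObj D. small (carrier (MObj M X)))},
     Hom = hopf_mod_homs K H D,
     Comp = (\<lambda>M N P \<zeta> \<eta>. \<lambda>X\<in>LObj D. compose (carrier (MObj M X)) (\<zeta> X) (\<eta> X)),
     Ident = (\<lambda>M. \<lambda>X\<in>LObj D. \<lambda>m\<in>carrier (MObj M X). m)\<rparr>"

end

theory Submission
  imports Defs
begin

text \<open>
  Fix a basis of $H$. A relative Hopf module is then a family of vector spaces, indexed by the objects of
  $D$, with unary linear operators: the arrows of $D$ and, for every basis element $b$, the $b$-coordinate
  $\rho_b$ of the coaction. Morphisms of Hopf modules are exactly the families of linear maps that commute
  with the operators. Conversely, operators come from a Hopf module iff every element $m$ satisfies the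
  module laws and there is a tensor with coordinates $\rho_b(m)$ that satisfies the comodule and
  compatibility laws. This condition on $m$ is preserved by maps and reflected by injective maps, and the
  elements that satisfy it form a submodule. So the Hopf modules are closed under subobjects and under objects
  that are jointly covered by Hopf modules, in particular under direct sums and quotients. Kernels,
  cokernels and colimits are therefore computed on the underlying vector spaces, and filtered colimits
  are exact as they are there.

  For the generator, the coaction embeds $M$ into the cofree Hopf module $M \otimes H$. Only finitely many
  basis elements occur in $\rho(m)$ for $m \in M(X)$, so $\rho(m)$ is the image of an element $u$ of
  $(D(X, X) \otimes H) \otimes H$ under $\theta \otimes H$, for some morphism of $D$-modules
  $\theta : D(X, -) \otimes H \to M$. Hence $\theta \otimes H$ maps the subobject generated by $u$ into
  $M$, with $m$ in the image. The pairs $(X, u)$ form a small set.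
\<close>

section \<open>Small sets\<close>

text \<open>A coaction is not an operation on V: its values lie in V \<otimes> H, and \<rho>_b(m)
  must vanish for almost all b. This finiteness is not an identity and can fail in infinite
  products, so Hopf modules are not simply the operator modules that satisfy certain identities. The
  condition is therefore imposed on single elements and asks only for the existence of a tensor; its
  coordinates make the tensor unique. The generator must come from a small set that is fixed before
  M is known. D(X, -) \<otimes> H serves because it is free on a basis of H placed at X: a map out
  of it can prescribe the finitely many coordinates of \<rho>(m) all at once, and u depends only on
  X and a finite set of basis elements. Direct sums and tensor products live in other types than the
  objects; they enter the category as copies of quotients inside the type of the small sets.\<close>

context universe
begin

text \<open>The members of A may have any type, so an injection into \<open>'u\<close> must be
  produced; an infinite small set has subsets of every finite cardinality.\<close>

lemma small_in_finite: assumes A: "finite A" shows "small_in small A"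
proof -
  obtain S' where S: "small S'" "infinite S'" using small_infinite by blast
  obtain T where T: "T \<subseteq> S'" "card T = card A" "finite T"
    using infinite_arbitrarily_large[OF S(2)] by blast
  then obtain f where "bij_betw f A T" using A by (metis finite_same_card_bij)
  then show ?thesis unfolding small_in_def using small_subset[OF S(1) T(1)] by (auto simp: bij_betw_def)
qed

text \<open>A small copy of A exists by \<open>small_in_finite\<close>. The inverse of the injection
  maps between subsets of \<open>'u\<close>, so \<open>small_image\<close> brings smallness back to
  A itself.\<close>

lemma small_finite: assumes "finite A" shows "small A"
proof -
  obtain f where "inj_on f A" "small (f ` A)" using small_in_finite[OF assms] by (auto simp: small_in_def)
  then show ?thesis using small_image[of "f ` A" "the_inv_into A f"] by (simp add: the_inv_into_onto)
qed

text \<open>\<open>small_Union\<close> wants a small index set inside \<open>'u\<close>. Two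
  distinct elements of an infinite small set serve as indices.\<close>

lemma small_Un: assumes "small A" "small B" shows "small (A \<union> B)"
proof -
  obtain S where S: "small S" "infinite S" using small_infinite by blast
  obtain x y where xy: "x \<in> S" "y \<in> S" "x \<noteq> y"
    using S(2) by (metis finite.simps infinite_imp_nonempty insertE is_singletonI' is_singleton_def ex_in_conv)
  have "small (\<Union>a\<in>{x,y}. if a = x then A else B)"
    by (rule small_Union) (use assms small_finite in auto)
  then show ?thesis using xy by (simp add: insert_commute Un_commute)
qed

lemma small_in_I: "small A \<Longrightarrow> small_in small A"
  unfolding small_in_def by (rule exI[of _ id]) simp

lemma small_in_subset: "small_in small A \<Longrightarrow> B \<subseteq> A \<Longrightarrow> small_in small B"
  unfolding small_in_def by (meson image_mono inj_on_subset small_subset)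

lemma small_in_image: assumes "small_in small A" shows "small_in small (g ` A)"
proof -
  obtain f where f: "inj_on f A" "small (f ` A)" using assms unfolding small_in_def by blast
  let ?h = "inv_into A g"
  have "inj_on (f \<circ> ?h) (g ` A)"
    by (rule comp_inj_on) (auto simp: inj_on_inv_into inv_into_into intro!: inj_on_subset[OF f(1)])
  moreover have "(f \<circ> ?h) ` (g ` A) \<subseteq> f ` A" by (auto simp: inv_into_into)
  ultimately show ?thesis unfolding small_in_def using f(2) small_subset by blast
qed

text \<open>Closure under products is not among the axioms. It follows because an infinite set is
  equipotent to its square: all codes are collected in one infinite small set C, and pairs of codes
  are coded in C again.\<close>

lemma small_in_Sigma:
  assumes A: "small_in small A" and B: "\<And>a. a \<in> A \<Longrightarrow> small_in small (B a)"
  shows "small_in small (Sigma A B)"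
proof -
  obtain f where f: "inj_on f A" "small (f ` A)" using A unfolding small_in_def by blast
  obtain g where g: "\<And>a. a \<in> A \<Longrightarrow> inj_on (g a) (B a) \<and> small (g a ` B a)"
    using B unfolding small_in_def by metis
  obtain S where S: "small S" "infinite S" using small_infinite by blast
  \<comment> \<open>S is added to make C infinite even if all the given sets are finite; the
    bijection of C \<times> C with C requires it.\<close>
  define C where "C = f ` A \<union> (\<Union>a\<in>A. g a ` B a) \<union> S"
  \<comment> \<open>A need not consist of elements of \<open>'u\<close>, so the union is reindexed
    by the small set of codes of A.\<close>
  have "(\<Union>a\<in>A. g a ` B a) = (\<Union>u\<in>f ` A. g (inv_into A f u) ` B (inv_into A f u))"
    using f(1) by auto
  moreover have "small \<dots>"
    by (rule small_Union[OF f(2)]) (use f(1) g in auto)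
  ultimately have C: "small C" unfolding C_def using f(2) S(1) small_Un by metis
  have "infinite C" using S(2) unfolding C_def by simp
  then obtain h where h: "bij_betw h (C \<times> C) C"
    using card_of_Times_same_infinite card_of_ordIso by blast
  let ?k = "\<lambda>(a, b). h (f a, g a b)"
  have mem: "f a \<in> C" "g a b \<in> C" if "a \<in> A" "b \<in> B a" for a b
    using that unfolding C_def by auto
  have "inj_on ?k (Sigma A B)"
  proof (rule inj_onI, clarify)
    fix a b a' b' assume *: "a \<in> A" "b \<in> B a" "a' \<in> A" "b' \<in> B a'" "h (f a, g a b) = h (f a', g a' b')"
    then have "(f a, g a b) = (f a', g a' b')"
      using h mem unfolding bij_betw_def by (meson SigmaI inj_onD)
    then show "a = a' \<and> b = b'" using * f(1) g by (metis inj_onD prod.inject)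
  qed
  moreover have "?k ` Sigma A B \<subseteq> C" using h mem unfolding bij_betw_def by fastforce
  ultimately show ?thesis unfolding small_in_def using C small_subset by blast
qed

text \<open>Lists of fixed length are iterated products. The set of all lists is a projection of a
  dependent sum over the natural numbers, which embed into any infinite small set.\<close>

lemma small_in_lists: assumes "small_in small A" shows "small_in small {xs. set xs \<subseteq> A}"
proof -
  have n: "small_in small {xs. set xs \<subseteq> A \<and> length xs = n}" for n
  proof (induction n)
    case 0 then show ?case
      by (rule small_in_subset[OF small_in_image[OF small_in_I[OF small_finite[of "{undefined}"]], of "\<lambda>_. []"]]) auto
  next
    case (Suc n)
    have "{xs. set xs \<subseteq> A \<and> length xs = Suc n} \<subseteq>
       (\<lambda>(x, xs). x # xs) ` (A \<times> {xs. set xs \<subseteq> A \<and> length xs = n})"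
      by (auto simp: length_Suc_conv image_iff)
    then show ?case using small_in_image[OF small_in_Sigma[OF assms Suc]] small_in_subset by blast
  qed
  obtain S where S: "small S" "infinite S" using small_infinite by blast
  obtain f :: "nat \<Rightarrow> 'u" where f: "inj f" "range f \<subseteq> S" using infinite_countable_subset[OF S(2)] by blast
  have "small_in small (UNIV :: nat set)" unfolding small_in_def using f S small_subset by blast
  from small_in_image[OF small_in_Sigma[OF this n], of snd] show ?thesis
    by (rule small_in_subset) force
qed

text \<open>A finitely supported function is coded by the list of pairs (index, value) on its
  support. The default z may depend on the index, so that one statement covers free modules and
  direct sums, whose default is the zero of each summand inside I and \<open>undefined\<close>
  outside.\<close>

lemma small_in_finite_support:
  assumes I: "small_in small I" and A: "\<And>i. i \<in> I \<Longrightarrow> small_in small (A i)"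
  shows "small_in small {f. finite {i\<in>I. f i \<noteq> z i} \<and> (\<forall>i\<in>I. f i \<in> A i) \<and> (\<forall>i. i \<notin> I \<longrightarrow> f i = z i)}"
proof (rule small_in_subset)
  let ?g = "\<lambda>xs i. case map_of xs i of None \<Rightarrow> z i | Some v \<Rightarrow> v"
  show "small_in small (?g ` {xs. set xs \<subseteq> Sigma I A})"
    by (rule small_in_image[OF small_in_lists[OF small_in_Sigma[OF I A]]])
  show "{f. finite {i\<in>I. f i \<noteq> z i} \<and> (\<forall>i\<in>I. f i \<in> A i) \<and> (\<forall>i. i \<notin> I \<longrightarrow> f i = z i)} \<subseteq>
    ?g ` {xs. set xs \<subseteq> Sigma I A}"
  proof clarify
    fix f assume f: "finite {i\<in>I. f i \<noteq> z i}" "\<forall>i\<in>I. f i \<in> A i" "\<forall>i. i \<notin> I \<longrightarrow> f i = z i"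
    obtain js where js: "set js = {i\<in>I. f i \<noteq> z i}" using finite_list[OF f(1)] by blast
    have "f = ?g (map (\<lambda>i. (i, f i)) js)"
      by (rule ext) (use f(3) js in \<open>auto simp: map_of_map_restrict restrict_map_def\<close>)
    then show "f \<in> ?g ` {xs. set xs \<subseteq> Sigma I A}" using js f(2) by (intro image_eqI) auto
  qed
qed

end

section \<open>Linear maps and submodules\<close>

lemma linear_mapI:
  assumes "\<And>x. x \<in> carrier V \<Longrightarrow> f x \<in> carrier W"
    and "\<And>x y. \<lbrakk>x \<in> carrier V; y \<in> carrier V\<rbrakk> \<Longrightarrow> f (x \<oplus>\<^bsub>V\<^esub> y) = f x \<oplus>\<^bsub>W\<^esub> f y"
    and "\<And>a x. \<lbrakk>a \<in> carrier K; x \<in> carrier V\<rbrakk> \<Longrightarrow> f (a \<odot>\<^bsub>V\<^esub> x) = a \<odot>\<^bsub>W\<^esub> f x"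
  shows "linear_map K V W f"
  using assms unfolding linear_map_def by auto

lemma linear_map_closed: "\<lbrakk>linear_map K V W f; x \<in> carrier V\<rbrakk> \<Longrightarrow> f x \<in> carrier W"
  and linear_map_add: "\<lbrakk>linear_map K V W f; x \<in> carrier V; y \<in> carrier V\<rbrakk> \<Longrightarrow> f (x \<oplus>\<^bsub>V\<^esub> y) = f x \<oplus>\<^bsub>W\<^esub> f y"
  and linear_map_smult: "\<lbrakk>linear_map K V W f; a \<in> carrier K; x \<in> carrier V\<rbrakk> \<Longrightarrow> f (a \<odot>\<^bsub>V\<^esub> x) = a \<odot>\<^bsub>W\<^esub> f x"
  unfolding linear_map_def by auto

lemma linear_map_cong:
  assumes "module K V" "linear_map K V W f" "\<And>x. x \<in> carrier V \<Longrightarrow> g x = f x"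
  shows "linear_map K V W g"
proof -
  interpret V: module K V by fact
  show ?thesis using assms(2,3) unfolding linear_map_def by auto
qed

lemma linear_map_zero:
  assumes "module K V" "module K W" "linear_map K V W f"
  shows "f \<zero>\<^bsub>V\<^esub> = \<zero>\<^bsub>W\<^esub>"
proof -
  interpret V: module K V by fact
  interpret W: module K W by fact
  have "f (\<zero>\<^bsub>K\<^esub> \<odot>\<^bsub>V\<^esub> \<zero>\<^bsub>V\<^esub>) = \<zero>\<^bsub>K\<^esub> \<odot>\<^bsub>W\<^esub> f \<zero>\<^bsub>V\<^esub>" by (rule linear_map_smult[OF assms(3)]) auto
  then show ?thesis using linear_map_closed[OF assms(3)] by simp
qed

lemma module_a_inv:
  assumes "module K V" "x \<in> carrier V"
  shows "\<ominus>\<^bsub>V\<^esub> x = (\<ominus>\<^bsub>K\<^esub> \<one>\<^bsub>K\<^esub>) \<odot>\<^bsub>V\<^esub> x"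
proof -
  interpret V: module K V by fact
  show ?thesis using V.smult_l_minus[of "\<one>\<^bsub>K\<^esub>" x] assms(2) by simp
qed

lemma linear_map_a_inv:
  assumes "module K V" "module K W" "linear_map K V W f" "x \<in> carrier V"
  shows "f (\<ominus>\<^bsub>V\<^esub> x) = \<ominus>\<^bsub>W\<^esub> f x"
proof -
  interpret V: module K V by fact
  interpret W: module K W by fact
  show ?thesis
    using assms(4) linear_map_closed[OF assms(3,4)]
    by (simp add: module_a_inv[OF assms(1)] module_a_inv[OF assms(2)] linear_map_smult[OF assms(3)])
qed

lemma linear_map_minus:
  assumes "module K V" "module K W" "linear_map K V W f" "x \<in> carrier V" "y \<in> carrier V"
  shows "f (x \<ominus>\<^bsub>V\<^esub> y) = f x \<ominus>\<^bsub>W\<^esub> f y"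
proof -
  interpret V: module K V by fact
  show ?thesis unfolding a_minus_def
    using assms(4,5) by (simp add: linear_map_add[OF assms(3)] linear_map_a_inv[OF assms(1-3)])
qed

lemma linear_map_compose:
  "\<lbrakk>linear_map K V W f; linear_map K W P g\<rbrakk> \<Longrightarrow> linear_map K V P (\<lambda>x. g (f x))"
  unfolding linear_map_def by (auto simp: Pi_def)

lemma linear_map_id: "linear_map K V V (\<lambda>x. x)"
  unfolding linear_map_def by auto

lemma linear_map_const_zero:
  assumes "module K W" shows "linear_map K V W (\<lambda>x. \<zero>\<^bsub>W\<^esub>)"
proof -
  interpret W: module K W by fact
  show ?thesis by (rule linear_mapI) auto
qed

lemma linear_map_plus:
  assumes "module K W" "linear_map K V W f" "linear_map K V W g"
  shows "linear_map K V W (\<lambda>x. f x \<oplus>\<^bsub>W\<^esub> g x)"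
proof -
  interpret W: module K W by fact
  show ?thesis
  proof (rule linear_mapI)
    fix x y assume "x \<in> carrier V" "y \<in> carrier V"
    then show "f (x \<oplus>\<^bsub>V\<^esub> y) \<oplus>\<^bsub>W\<^esub> g (x \<oplus>\<^bsub>V\<^esub> y) = (f x \<oplus>\<^bsub>W\<^esub> g x) \<oplus>\<^bsub>W\<^esub> (f y \<oplus>\<^bsub>W\<^esub> g y)"
      using linear_map_closed[OF assms(2)] linear_map_closed[OF assms(3)]
      by (simp add: linear_map_add[OF assms(2)] linear_map_add[OF assms(3)] W.a_ac)
  next
    fix a x assume "a \<in> carrier K" "x \<in> carrier V"
    then show "f (a \<odot>\<^bsub>V\<^esub> x) \<oplus>\<^bsub>W\<^esub> g (a \<odot>\<^bsub>V\<^esub> x) = a \<odot>\<^bsub>W\<^esub> (f x \<oplus>\<^bsub>W\<^esub> g x)"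
      using linear_map_closed[OF assms(2)] linear_map_closed[OF assms(3)]
      by (simp add: linear_map_smult[OF assms(2)] linear_map_smult[OF assms(3)] W.smult_r_distr)
  qed (use linear_map_closed[OF assms(2)] linear_map_closed[OF assms(3)] in auto)
qed

lemma linear_map_scale:
  assumes "module K W" "linear_map K V W f" "c \<in> carrier K"
  shows "linear_map K V W (\<lambda>x. c \<odot>\<^bsub>W\<^esub> f x)"
proof -
  interpret W: module K W by fact
  show ?thesis
    by (rule linear_mapI)
      (auto simp: assms linear_map_closed[OF assms(2)] linear_map_add[OF assms(2)] linear_map_smult[OF assms(2)]
        W.smult_r_distr W.smult_assoc1[symmetric] W.R.m_comm)
qed

lemma linear_map_neg:
  assumes "module K W" "linear_map K V W f"
  shows "linear_map K V W (\<lambda>x. \<ominus>\<^bsub>W\<^esub> f x)"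
proof -
  interpret W: module K W by fact
  show ?thesis
    by (rule linear_mapI)
      (auto simp: assms linear_map_closed[OF assms(2)] linear_map_add[OF assms(2)] linear_map_smult[OF assms(2)]
        W.minus_add W.smult_r_minus)
qed

lemma linear_map_finsum_fun:
  assumes "module K W" "finite A" "\<And>i. i \<in> A \<Longrightarrow> linear_map K V W (f i)"
  shows "linear_map K V W (\<lambda>x. \<Oplus>\<^bsub>W\<^esub>i\<in>A. f i x)"
proof -
  interpret W: module K W by fact
  have cl: "\<And>i x. \<lbrakk>i \<in> A; x \<in> carrier V\<rbrakk> \<Longrightarrow> f i x \<in> carrier W"
    using assms(3) linear_map_closed by metis
  show ?thesis
  proof (rule linear_mapI)
    fix x y assume xy: "x \<in> carrier V" "y \<in> carrier V"
    have "(\<Oplus>\<^bsub>W\<^esub>i\<in>A. f i (x \<oplus>\<^bsub>V\<^esub> y)) = (\<Oplus>\<^bsub>W\<^esub>i\<in>A. f i x \<oplus>\<^bsub>W\<^esub> f i y)"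
      by (rule W.finsum_cong') (use xy cl linear_map_add[OF assms(3)] in auto)
    also have "\<dots> = (\<Oplus>\<^bsub>W\<^esub>i\<in>A. f i x) \<oplus>\<^bsub>W\<^esub> (\<Oplus>\<^bsub>W\<^esub>i\<in>A. f i y)"
      by (rule W.finsum_addf) (use xy cl in auto)
    finally show "(\<Oplus>\<^bsub>W\<^esub>i\<in>A. f i (x \<oplus>\<^bsub>V\<^esub> y)) = (\<Oplus>\<^bsub>W\<^esub>i\<in>A. f i x) \<oplus>\<^bsub>W\<^esub> (\<Oplus>\<^bsub>W\<^esub>i\<in>A. f i y)" .
  next
    fix a x assume ax: "a \<in> carrier K" "x \<in> carrier V"
    have "(\<Oplus>\<^bsub>W\<^esub>i\<in>A. f i (a \<odot>\<^bsub>V\<^esub> x)) = (\<Oplus>\<^bsub>W\<^esub>i\<in>A. a \<odot>\<^bsub>W\<^esub> f i x)"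
      by (rule W.finsum_cong') (use ax cl linear_map_smult[OF assms(3)] in auto)
    also have "\<dots> = a \<odot>\<^bsub>W\<^esub> (\<Oplus>\<^bsub>W\<^esub>i\<in>A. f i x)"
      by (rule W.finsum_smult_ldistr[symmetric]) (use ax cl assms(2) in auto)
    finally show "(\<Oplus>\<^bsub>W\<^esub>i\<in>A. f i (a \<odot>\<^bsub>V\<^esub> x)) = a \<odot>\<^bsub>W\<^esub> (\<Oplus>\<^bsub>W\<^esub>i\<in>A. f i x)" .
  qed (use cl in auto)
qed

lemma linear_map_finsum:
  assumes "module K V" "module K W" "linear_map K V W f" "finite A" "\<And>i. i \<in> A \<Longrightarrow> g i \<in> carrier V"
  shows "f (\<Oplus>\<^bsub>V\<^esub>i\<in>A. g i) = (\<Oplus>\<^bsub>W\<^esub>i\<in>A. f (g i))"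
proof -
  interpret V: module K V by fact
  interpret W: module K W by fact
  show ?thesis using assms(4,5)
  proof (induction A rule: finite_induct)
    case empty then show ?case using linear_map_zero[OF assms(1-3)] by simp
  next
    case (insert x F)
    then show ?case
      using linear_map_closed[OF assms(3)] linear_map_add[OF assms(3)] by simp
  qed
qed

section \<open>Finite sums, submodules and quotient modules\<close>

lemma (in abelian_monoid) finsum_mono_neutral:
  assumes "finite B" "A \<subseteq> B" "\<And>i. i \<in> B - A \<Longrightarrow> f i = \<zero>" "\<And>i. i \<in> A \<Longrightarrow> f i \<in> carrier G"
  shows "finsum G f A = finsum G f B"
  by (rule add.finprod_mono_neutral_cong_left) (use assms in \<open>fastforce simp: Pi_def\<close>)+

lemma (in abelian_monoid) finsum_all_zero:
  assumes "\<And>i. i \<in> A \<Longrightarrow> f i = \<zero>"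
  shows "finsum G f A = \<zero>"
  using add.finprod_one_eqI assms by blast

text \<open>Negatives come from multiplication by -1. The predicate form fits the submodules below,
  which are given by comprehensions.\<close>

lemma (in module) submodule_memI:
  assumes "\<And>x. P x \<Longrightarrow> x \<in> carrier M" "P \<zero>\<^bsub>M\<^esub>"
    and "\<And>x y. \<lbrakk>P x; P y\<rbrakk> \<Longrightarrow> P (x \<oplus>\<^bsub>M\<^esub> y)"
    and "\<And>a x. \<lbrakk>a \<in> carrier R; P x\<rbrakk> \<Longrightarrow> P (a \<odot>\<^bsub>M\<^esub> x)"
  shows "submodule {x. P x} R M"
proof (rule submoduleI)
  fix x assume "x \<in> {x. P x}"
  then show "\<ominus>\<^bsub>M\<^esub> x \<in> {x. P x}"
    using assms(1) assms(4)[of "\<ominus> \<one>" x] by (simp add: smult_l_minus)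
qed (use assms in auto)

lemma submoduleD:
  assumes "module K V" "submodule N K V"
  shows "\<And>x. x \<in> N \<Longrightarrow> x \<in> carrier V" "\<zero>\<^bsub>V\<^esub> \<in> N"
    "\<And>x y. \<lbrakk>x \<in> N; y \<in> N\<rbrakk> \<Longrightarrow> x \<oplus>\<^bsub>V\<^esub> y \<in> N" "\<And>a x. \<lbrakk>a \<in> carrier K; x \<in> N\<rbrakk> \<Longrightarrow> a \<odot>\<^bsub>V\<^esub> x \<in> N"
    "\<And>x. x \<in> N \<Longrightarrow> \<ominus>\<^bsub>V\<^esub> x \<in> N" "\<And>x y. \<lbrakk>x \<in> N; y \<in> N\<rbrakk> \<Longrightarrow> x \<ominus>\<^bsub>V\<^esub> y \<in> N"
proof -
  interpret V: module K V by fact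
  note E = V.submoduleE[OF assms(2)]
  show "\<And>x. x \<in> N \<Longrightarrow> x \<in> carrier V" using E by auto
  show 1: "\<And>x y. \<lbrakk>x \<in> N; y \<in> N\<rbrakk> \<Longrightarrow> x \<oplus>\<^bsub>V\<^esub> y \<in> N" "\<And>a x. \<lbrakk>a \<in> carrier K; x \<in> N\<rbrakk> \<Longrightarrow> a \<odot>\<^bsub>V\<^esub> x \<in> N"
    "\<And>x. x \<in> N \<Longrightarrow> \<ominus>\<^bsub>V\<^esub> x \<in> N"
    using E by auto
  then show "\<And>x y. \<lbrakk>x \<in> N; y \<in> N\<rbrakk> \<Longrightarrow> x \<ominus>\<^bsub>V\<^esub> y \<in> N" unfolding a_minus_def by auto
  obtain x where "x \<in> N" using E by auto
  then show "\<zero>\<^bsub>V\<^esub> \<in> N" using 1(2)[of "\<zero>\<^bsub>K\<^esub>" x] E(1) by auto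
qed

lemma submodule_vimage:
  assumes "module K V" "module K W" "linear_map K V W f" "submodule N K W"
  shows "submodule {x \<in> carrier V. f x \<in> N} K V"
proof -
  interpret V: module K V by fact
  show ?thesis
    by (rule V.submodule_memI)
      (auto simp: submoduleD[OF assms(2,4)] linear_map_zero[OF assms(1-3)] linear_map_add[OF assms(3)]
        linear_map_smult[OF assms(3)])
qed

lemma submodule_image:
  assumes "module K V" "module K W" "linear_map K V W f" "submodule N K V"
  shows "submodule (f ` N) K W"
proof -
  interpret V: module K V by fact
  interpret W: module K W by fact
  note D = submoduleD[OF assms(1,4)]
  have "submodule {x. x \<in> f ` N} K W"
  proof (rule W.submodule_memI)
    show "\<zero>\<^bsub>W\<^esub> \<in> f ` N" using D(2) linear_map_zero[OF assms(1-3)] by force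
    fix x y assume "x \<in> f ` N" "y \<in> f ` N"
    then obtain u v where "u \<in> N" "v \<in> N" "x = f u" "y = f v" by blast
    then show "x \<oplus>\<^bsub>W\<^esub> y \<in> f ` N"
      using D(1,3) by (intro image_eqI[of _ _ "u \<oplus>\<^bsub>V\<^esub> v"]) (simp_all add: linear_map_add[OF assms(3)])
  next
    fix a x assume "a \<in> carrier K" "x \<in> f ` N"
    then show "a \<odot>\<^bsub>W\<^esub> x \<in> f ` N"
      using D(1,4) by (auto simp: linear_map_smult[OF assms(3), symmetric])
  qed (use D(1) linear_map_closed[OF assms(3)] in auto)
  then show ?thesis by simp
qed

lemma submodule_zero: assumes "module K V" shows "submodule {\<zero>\<^bsub>V\<^esub>} K V"
proof -
  interpret V: module K V by fact
  show ?thesis by (rule V.submoduleI) auto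
qed

lemma submodule_carrier: assumes "module K V" shows "submodule (carrier V) K V"
  using module.carrier_is_submodule[OF assms] .

lemma module_inj_iff:
  assumes "module K V" "module K W" "linear_map K V W f"
  shows "inj_on f (carrier V) \<longleftrightarrow> (\<forall>x\<in>carrier V. f x = \<zero>\<^bsub>W\<^esub> \<longrightarrow> x = \<zero>\<^bsub>V\<^esub>)"
proof -
  interpret V: module K V by fact
  interpret W: module K W by fact
  have "x = y" if "\<forall>x\<in>carrier V. f x = \<zero>\<^bsub>W\<^esub> \<longrightarrow> x = \<zero>\<^bsub>V\<^esub>" "x \<in> carrier V" "y \<in> carrier V" "f x = f y" for x y
  proof -
    have "f (x \<ominus>\<^bsub>V\<^esub> y) = \<zero>\<^bsub>W\<^esub>"
      using that linear_map_closed[OF assms(3)] by (simp add: linear_map_minus[OF assms] W.minus_eq W.r_neg)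
    then have "x \<ominus>\<^bsub>V\<^esub> y = \<zero>\<^bsub>V\<^esub>" using that by blast
    then have "x \<ominus>\<^bsub>V\<^esub> y \<oplus>\<^bsub>V\<^esub> y = y" using that by simp
    then show ?thesis using that by (simp add: V.minus_eq V.a_assoc V.l_neg)
  qed
  then show ?thesis
    using linear_map_zero[OF assms] V.zero_closed unfolding inj_on_def by metis
qed

text \<open>The module axioms are identities together with the existence of negatives, so they pass
  along a surjection that respects the operations. This is how quotients get their
  structure.\<close>

lemma module_of_surj:
  fixes Q :: "('k, 'w, 'z) module_scheme" and V :: "('k, 'v, 'y) module_scheme"
  assumes "module K V" and q: "q ` carrier V = carrier Q"
    and add: "\<And>x y. \<lbrakk>x \<in> carrier V; y \<in> carrier V\<rbrakk> \<Longrightarrow> q x \<oplus>\<^bsub>Q\<^esub> q y = q (x \<oplus>\<^bsub>V\<^esub> y)"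
    and smult: "\<And>a x. \<lbrakk>a \<in> carrier K; x \<in> carrier V\<rbrakk> \<Longrightarrow> a \<odot>\<^bsub>Q\<^esub> q x = q (a \<odot>\<^bsub>V\<^esub> x)"
    and zero: "\<zero>\<^bsub>Q\<^esub> = q \<zero>\<^bsub>V\<^esub>"
  shows "module K Q" "linear_map K V Q q"
proof -
  interpret V: module K V by fact
  note [simp] = q[symmetric] add smult zero
  show "module K Q"
  proof (rule moduleI)
    show "abelian_group Q"
    proof (rule abelian_groupI)
      fix x assume "x \<in> carrier Q"
      then obtain v where v: "v \<in> carrier V" "x = q v" by auto
      then show "\<exists>y\<in>carrier Q. y \<oplus>\<^bsub>Q\<^esub> x = \<zero>\<^bsub>Q\<^esub>"
        by (intro bexI[of _ "q (\<ominus>\<^bsub>V\<^esub> v)"]) (auto simp: V.l_neg)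
    qed (auto simp: V.a_ac)
  qed (auto simp: V.smult_l_distr V.smult_r_distr V.smult_assoc1 V.is_cring)
  show "linear_map K V Q q" by (rule linear_mapI) auto
qed

text \<open>Cosets are sets of elements, whereas the objects of the category need carriers that are
  small subsets of \<open>'u\<close>. Each coset is therefore represented by the code of a chosen
  member, and the codes of V already form a small set.\<close>

lemma (in universe) small_quotient_module:
  fixes V :: "('k, 'v, 'y) module_scheme" 
  assumes V: "module K V" and R: "submodule R K V" and sm: "small_in small (carrier V)"
  obtains Q :: "('k, 'u) module" and q where "module K Q" "linear_map K V Q q"
    "q ` carrier V = carrier Q" "\<And>x. x \<in> carrier V \<Longrightarrow> q x = \<zero>\<^bsub>Q\<^esub> \<longleftrightarrow> x \<in> R" "small (carrier Q)"
proof -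
  interpret V: module K V by fact
  note D = submoduleD[OF V R]
  obtain f :: "'v \<Rightarrow> 'u" where f: "inj_on f (carrier V)" "small (f ` carrier V)"
    using sm unfolding small_in_def by blast
  \<comment> \<open>The choice depends only on the coset of x, because congruent elements give the
    same predicate. Hence q x = q y means exactly that x and y are congruent modulo R.\<close>
  define q where "q x = f (SOME y. y \<in> carrier V \<and> y \<ominus>\<^bsub>V\<^esub> x \<in> R)" for x
  have rep: "(SOME y. y \<in> carrier V \<and> y \<ominus>\<^bsub>V\<^esub> x \<in> R) \<in> carrier V"
    "(SOME y. y \<in> carrier V \<and> y \<ominus>\<^bsub>V\<^esub> x \<in> R) \<ominus>\<^bsub>V\<^esub> x \<in> R" if "x \<in> carrier V" for x
  proof -
    have "x \<in> carrier V \<and> x \<ominus>\<^bsub>V\<^esub> x \<in> R" using that D(2) by (simp add: V.minus_eq V.r_neg)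
    from someI[where P = "\<lambda>y. y \<in> carrier V \<and> y \<ominus>\<^bsub>V\<^esub> x \<in> R", OF this]
    show "(SOME y. y \<in> carrier V \<and> y \<ominus>\<^bsub>V\<^esub> x \<in> R) \<in> carrier V"
      "(SOME y. y \<in> carrier V \<and> y \<ominus>\<^bsub>V\<^esub> x \<in> R) \<ominus>\<^bsub>V\<^esub> x \<in> R" by auto
  qed
  have tr: "x \<ominus>\<^bsub>V\<^esub> z \<in> R" if "x \<ominus>\<^bsub>V\<^esub> y \<in> R" "y \<ominus>\<^bsub>V\<^esub> z \<in> R" "x \<in> carrier V" "y \<in> carrier V" "z \<in> carrier V" for x y z
  proof -
    have "x \<ominus>\<^bsub>V\<^esub> z = (x \<ominus>\<^bsub>V\<^esub> y) \<oplus>\<^bsub>V\<^esub> (y \<ominus>\<^bsub>V\<^esub> z)"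
      using that(3-5) by (simp add: V.minus_eq V.a_assoc V.r_neg1)
    then show ?thesis using D(3) that by simp
  qed
  have sy: "y \<ominus>\<^bsub>V\<^esub> x \<in> R" if "x \<ominus>\<^bsub>V\<^esub> y \<in> R" "x \<in> carrier V" "y \<in> carrier V" for x y
    using D(5)[OF that(1)] that(2,3) by (simp add: V.minus_eq V.minus_add V.a_comm)
  have qeq: "q x = q y \<longleftrightarrow> x \<ominus>\<^bsub>V\<^esub> y \<in> R" if "x \<in> carrier V" "y \<in> carrier V" for x y
  proof
    assume "q x = q y"
    then have "(SOME z. z \<in> carrier V \<and> z \<ominus>\<^bsub>V\<^esub> x \<in> R) = (SOME z. z \<in> carrier V \<and> z \<ominus>\<^bsub>V\<^esub> y \<in> R)"
      unfolding q_def using f(1) rep(1) that by (meson inj_onD)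
    moreover have "x \<ominus>\<^bsub>V\<^esub> (SOME z. z \<in> carrier V \<and> z \<ominus>\<^bsub>V\<^esub> x \<in> R) \<in> R"
      using sy rep that by blast
    ultimately show "x \<ominus>\<^bsub>V\<^esub> y \<in> R" using rep[of y] that tr by simp
  next
    assume "x \<ominus>\<^bsub>V\<^esub> y \<in> R"
    then have "(\<lambda>z. z \<in> carrier V \<and> z \<ominus>\<^bsub>V\<^esub> x \<in> R) = (\<lambda>z. z \<in> carrier V \<and> z \<ominus>\<^bsub>V\<^esub> y \<in> R)"
      using that tr sy by (intro ext) blast
    then show "q x = q y" unfolding q_def by simp
  qed
  \<comment> \<open>A section of q: the operations of Q are computed on representatives.\<close>
  define s where "s = inv_into (carrier V) q"
  have s: "s (q x) \<in> carrier V" "q (s (q x)) = q x" if "x \<in> carrier V" for x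
    using that unfolding s_def by (auto intro: inv_into_into f_inv_into_f)
  have s': "s (q x) \<ominus>\<^bsub>V\<^esub> x \<in> R" if "x \<in> carrier V" for x using s qeq that by blast
  define Q :: "('k, 'u) module" where "Q = \<lparr>carrier = q ` carrier V, mult = undefined, one = undefined,
    zero = q \<zero>\<^bsub>V\<^esub>, add = (\<lambda>x y. q (s x \<oplus>\<^bsub>V\<^esub> s y)), smult = (\<lambda>a x. q (a \<odot>\<^bsub>V\<^esub> s x))\<rparr>"
  have add: "q x \<oplus>\<^bsub>Q\<^esub> q y = q (x \<oplus>\<^bsub>V\<^esub> y)" if xy: "x \<in> carrier V" "y \<in> carrier V" for x y
  proof -
    have "(s (q x) \<oplus>\<^bsub>V\<^esub> s (q y)) \<ominus>\<^bsub>V\<^esub> (x \<oplus>\<^bsub>V\<^esub> y) = (s (q x) \<ominus>\<^bsub>V\<^esub> x) \<oplus>\<^bsub>V\<^esub> (s (q y) \<ominus>\<^bsub>V\<^esub> y)"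
      using xy s by (simp add: V.minus_eq V.minus_add V.a_ac)
    then have "(s (q x) \<oplus>\<^bsub>V\<^esub> s (q y)) \<ominus>\<^bsub>V\<^esub> (x \<oplus>\<^bsub>V\<^esub> y) \<in> R" using s' xy D(3) by simp
    then show ?thesis unfolding Q_def using xy s by (simp add: qeq)
  qed
  have sm: "a \<odot>\<^bsub>Q\<^esub> q x = q (a \<odot>\<^bsub>V\<^esub> x)" if ax: "a \<in> carrier K" "x \<in> carrier V" for a x
  proof -
    have "(a \<odot>\<^bsub>V\<^esub> s (q x)) \<ominus>\<^bsub>V\<^esub> (a \<odot>\<^bsub>V\<^esub> x) = a \<odot>\<^bsub>V\<^esub> (s (q x) \<ominus>\<^bsub>V\<^esub> x)"
      using ax s by (simp add: V.minus_eq V.smult_r_distr V.smult_r_minus)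
    then have "(a \<odot>\<^bsub>V\<^esub> s (q x)) \<ominus>\<^bsub>V\<^esub> (a \<odot>\<^bsub>V\<^esub> x) \<in> R" using s' ax D(4) by simp
    then show ?thesis unfolding Q_def using ax s by (simp add: qeq)
  qed
  have cq: "q ` carrier V = carrier Q" "\<zero>\<^bsub>Q\<^esub> = q \<zero>\<^bsub>V\<^esub>" unfolding Q_def by auto
  note m = module_of_surj[OF V cq(1) add sm cq(2)]
  have "q x = \<zero>\<^bsub>Q\<^esub> \<longleftrightarrow> x \<in> R" if "x \<in> carrier V" for x
    using qeq[OF that V.zero_closed] that V.add.inv_one unfolding Q_def by (simp add: V.minus_eq a_inv_def)
  moreover have "small (carrier Q)"
  proof (rule small_subset[OF f(2)])
    show "carrier Q \<subseteq> f ` carrier V" unfolding Q_def q_def using rep by auto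
  qed
  ultimately show thesis using that[OF m cq(1)] by blast
qed

section \<open>Direct sums of modules\<close>

definition dsum_module :: "'i set \<Rightarrow> ('i \<Rightarrow> ('k, 'v) module) \<Rightarrow> ('k, 'i \<Rightarrow> 'v) module" where
  "dsum_module I V =
    \<lparr>carrier = {f. (\<forall>i\<in>I. f i \<in> carrier (V i)) \<and> (\<forall>i. i \<notin> I \<longrightarrow> f i = undefined) \<and>
       finite {i\<in>I. f i \<noteq> \<zero>\<^bsub>V i\<^esub>}},
     mult = undefined, one = undefined, zero = (\<lambda>i\<in>I. \<zero>\<^bsub>V i\<^esub>),
     add = (\<lambda>f g. \<lambda>i\<in>I. f i \<oplus>\<^bsub>V i\<^esub> g i), smult = (\<lambda>a f. \<lambda>i\<in>I. a \<odot>\<^bsub>V i\<^esub> f i)\<rparr>"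

definition dsum_inj :: "'i set \<Rightarrow> ('i \<Rightarrow> ('k, 'v) module) \<Rightarrow> 'i \<Rightarrow> 'v \<Rightarrow> 'i \<Rightarrow> 'v" where
  "dsum_inj I V i x = (\<lambda>j\<in>I. if j = i then x else \<zero>\<^bsub>V j\<^esub>)"

definition dsum_map :: "'i set \<Rightarrow> ('i \<Rightarrow> ('k, 'v) module) \<Rightarrow> ('k, 'w) module \<Rightarrow> ('i \<Rightarrow> 'v \<Rightarrow> 'w) \<Rightarrow> ('i \<Rightarrow> 'v) \<Rightarrow> 'w" where
  "dsum_map I V W \<theta> f = (\<Oplus>\<^bsub>W\<^esub>i\<in>{i\<in>I. f i \<noteq> \<zero>\<^bsub>V i\<^esub>}. \<theta> i (f i))"

lemma dsum_module_sel:
  "f \<in> carrier (dsum_module I V) \<longleftrightarrow> (\<forall>i\<in>I. f i \<in> carrier (V i)) \<and> (\<forall>i. i \<notin> I \<longrightarrow> f i = undefined) \<and>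
       finite {i\<in>I. f i \<noteq> \<zero>\<^bsub>V i\<^esub>}"
  "\<zero>\<^bsub>dsum_module I V\<^esub> = (\<lambda>i\<in>I. \<zero>\<^bsub>V i\<^esub>)"
  "f \<oplus>\<^bsub>dsum_module I V\<^esub> g = (\<lambda>i\<in>I. f i \<oplus>\<^bsub>V i\<^esub> g i)"
  "a \<odot>\<^bsub>dsum_module I V\<^esub> f = (\<lambda>i\<in>I. a \<odot>\<^bsub>V i\<^esub> f i)"
  unfolding dsum_module_def by auto

locale direct_sum =
  fixes K :: "'k ring" and I :: "'i set" and V :: "'i \<Rightarrow> ('k, 'v) module"
  assumes cring_K: "cring K" and module_V: "i \<in> I \<Longrightarrow> module K (V i)"
begin

lemma module_simps:
  assumes "i \<in> I"
  shows "\<zero>\<^bsub>V i\<^esub> \<in> carrier (V i)"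
    "\<lbrakk>x \<in> carrier (V i); y \<in> carrier (V i)\<rbrakk> \<Longrightarrow> x \<oplus>\<^bsub>V i\<^esub> y \<in> carrier (V i)"
    "\<lbrakk>a \<in> carrier K; x \<in> carrier (V i)\<rbrakk> \<Longrightarrow> a \<odot>\<^bsub>V i\<^esub> x \<in> carrier (V i)"
    "x \<in> carrier (V i) \<Longrightarrow> \<ominus>\<^bsub>V i\<^esub> x \<in> carrier (V i)"
    "x \<in> carrier (V i) \<Longrightarrow> \<zero>\<^bsub>V i\<^esub> \<oplus>\<^bsub>V i\<^esub> x = x"
    "x \<in> carrier (V i) \<Longrightarrow> x \<oplus>\<^bsub>V i\<^esub> \<zero>\<^bsub>V i\<^esub> = x"
    "a \<in> carrier K \<Longrightarrow> a \<odot>\<^bsub>V i\<^esub> \<zero>\<^bsub>V i\<^esub> = \<zero>\<^bsub>V i\<^esub>"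
proof -
  interpret module K "V i" using module_V assms by blast
  show "\<zero>\<^bsub>V i\<^esub> \<in> carrier (V i)"
    "\<lbrakk>x \<in> carrier (V i); y \<in> carrier (V i)\<rbrakk> \<Longrightarrow> x \<oplus>\<^bsub>V i\<^esub> y \<in> carrier (V i)"
    "\<lbrakk>a \<in> carrier K; x \<in> carrier (V i)\<rbrakk> \<Longrightarrow> a \<odot>\<^bsub>V i\<^esub> x \<in> carrier (V i)"
    "x \<in> carrier (V i) \<Longrightarrow> \<ominus>\<^bsub>V i\<^esub> x \<in> carrier (V i)"
    "x \<in> carrier (V i) \<Longrightarrow> \<zero>\<^bsub>V i\<^esub> \<oplus>\<^bsub>V i\<^esub> x = x"
    "x \<in> carrier (V i) \<Longrightarrow> x \<oplus>\<^bsub>V i\<^esub> \<zero>\<^bsub>V i\<^esub> = x"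
    "a \<in> carrier K \<Longrightarrow> a \<odot>\<^bsub>V i\<^esub> \<zero>\<^bsub>V i\<^esub> = \<zero>\<^bsub>V i\<^esub>" by auto
qed

lemma module_dsum: "module K (dsum_module I V)"
proof (rule moduleI)
  show "cring K" by (rule cring_K)
  have fin: "finite {i\<in>I. h i \<noteq> \<zero>\<^bsub>V i\<^esub>}"
    if "finite {i\<in>I. f i \<noteq> \<zero>\<^bsub>V i\<^esub>}" "finite {i\<in>I. g i \<noteq> \<zero>\<^bsub>V i\<^esub>}"
      "\<And>i. \<lbrakk>i \<in> I; f i = \<zero>\<^bsub>V i\<^esub>; g i = \<zero>\<^bsub>V i\<^esub>\<rbrakk> \<Longrightarrow> h i = \<zero>\<^bsub>V i\<^esub>" for f g h :: "'i \<Rightarrow> 'v"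
    by (rule finite_subset[OF _ finite_UnI[OF that(1,2)]]) (use that(3) in auto)
  show "abelian_group (dsum_module I V)"
  proof (rule abelian_groupI)
    fix f g assume fg: "f \<in> carrier (dsum_module I V)" "g \<in> carrier (dsum_module I V)"
    have "finite {i\<in>I. (\<lambda>i\<in>I. f i \<oplus>\<^bsub>V i\<^esub> g i) i \<noteq> \<zero>\<^bsub>V i\<^esub>}"
      by (rule fin[of f g]) (use fg in \<open>auto simp: module_simps dsum_module_sel\<close>)
    with fg show "f \<oplus>\<^bsub>dsum_module I V\<^esub> g \<in> carrier (dsum_module I V)"
      unfolding dsum_module_sel by (auto simp: module_simps)
    show "f \<oplus>\<^bsub>dsum_module I V\<^esub> g = g \<oplus>\<^bsub>dsum_module I V\<^esub> f"
      unfolding dsum_module_sel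
    proof (rule restrict_ext)
      fix i assume i: "i \<in> I"
      interpret module K "V i" using module_V i by blast
      show "f i \<oplus>\<^bsub>V i\<^esub> g i = g i \<oplus>\<^bsub>V i\<^esub> f i" using fg i unfolding dsum_module_sel by (auto intro: a_comm)
    qed
    fix h assume h: "h \<in> carrier (dsum_module I V)"
    show "f \<oplus>\<^bsub>dsum_module I V\<^esub> g \<oplus>\<^bsub>dsum_module I V\<^esub> h = f \<oplus>\<^bsub>dsum_module I V\<^esub> (g \<oplus>\<^bsub>dsum_module I V\<^esub> h)"
      unfolding dsum_module_sel
    proof (rule restrict_ext)
      fix i assume i: "i \<in> I"
      interpret module K "V i" using module_V i by blast
      show "(\<lambda>i\<in>I. f i \<oplus>\<^bsub>V i\<^esub> g i) i \<oplus>\<^bsub>V i\<^esub> h i = f i \<oplus>\<^bsub>V i\<^esub> (\<lambda>i\<in>I. g i \<oplus>\<^bsub>V i\<^esub> h i) i"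
        using fg h i unfolding dsum_module_sel by (auto intro: a_assoc)
    qed
  next
    show "\<zero>\<^bsub>dsum_module I V\<^esub> \<in> carrier (dsum_module I V)"
    proof -
      have "{i \<in> I. (\<lambda>i\<in>I. \<zero>\<^bsub>V i\<^esub>) i \<noteq> \<zero>\<^bsub>V i\<^esub>} = {}" by auto
      then show ?thesis unfolding dsum_module_sel by (auto simp: module_simps)
    qed
    fix f assume f: "f \<in> carrier (dsum_module I V)"
    then show "\<zero>\<^bsub>dsum_module I V\<^esub> \<oplus>\<^bsub>dsum_module I V\<^esub> f = f"
      unfolding dsum_module_sel by (auto simp: module_simps)
    show "\<exists>y\<in>carrier (dsum_module I V). y \<oplus>\<^bsub>dsum_module I V\<^esub> f = \<zero>\<^bsub>dsum_module I V\<^esub>"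
    proof (rule bexI[of _ "\<lambda>i\<in>I. \<ominus>\<^bsub>V i\<^esub> f i"])
      show "(\<lambda>i\<in>I. \<ominus>\<^bsub>V i\<^esub> f i) \<oplus>\<^bsub>dsum_module I V\<^esub> f = \<zero>\<^bsub>dsum_module I V\<^esub>"
        unfolding dsum_module_sel
      proof (rule restrict_ext)
        fix i assume i: "i \<in> I"
        interpret module K "V i" using module_V i by blast
        show "(\<lambda>i\<in>I. \<ominus>\<^bsub>V i\<^esub> f i) i \<oplus>\<^bsub>V i\<^esub> f i = \<zero>\<^bsub>V i\<^esub>"
          using f i unfolding dsum_module_sel by (auto simp: M.l_neg)
      qed
      have "finite {i\<in>I. (\<lambda>i\<in>I. \<ominus>\<^bsub>V i\<^esub> f i) i \<noteq> \<zero>\<^bsub>V i\<^esub>}"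
      proof (rule fin[of f f])
        fix i assume i: "i \<in> I" "f i = \<zero>\<^bsub>V i\<^esub>"
        interpret module K "V i" using module_V i by blast
        show "(\<lambda>i\<in>I. \<ominus>\<^bsub>V i\<^esub> f i) i = \<zero>\<^bsub>V i\<^esub>" using i M.add.inv_one by (simp add: a_inv_def)
      qed (use f in \<open>auto simp: dsum_module_sel\<close>)
      then show "(\<lambda>i\<in>I. \<ominus>\<^bsub>V i\<^esub> f i) \<in> carrier (dsum_module I V)"
        using f unfolding dsum_module_sel by (auto simp: module_simps)
    qed
  qed
  fix a b f g assume ab: "a \<in> carrier K" "b \<in> carrier K"
    and f: "f \<in> carrier (dsum_module I V)"
  have "finite {i\<in>I. (\<lambda>i\<in>I. a \<odot>\<^bsub>V i\<^esub> f i) i \<noteq> \<zero>\<^bsub>V i\<^esub>}"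
    by (rule fin[of f f]) (use f in \<open>auto simp: module_simps dsum_module_sel ab\<close>)
  with ab f show "a \<odot>\<^bsub>dsum_module I V\<^esub> f \<in> carrier (dsum_module I V)"
    unfolding dsum_module_sel by (auto simp: module_simps)
  note M = module.smult_l_distr[OF module_V] module.smult_r_distr[OF module_V] module.smult_assoc1[OF module_V]
  show "(a \<oplus>\<^bsub>K\<^esub> b) \<odot>\<^bsub>dsum_module I V\<^esub> f = a \<odot>\<^bsub>dsum_module I V\<^esub> f \<oplus>\<^bsub>dsum_module I V\<^esub> b \<odot>\<^bsub>dsum_module I V\<^esub> f"
    "(a \<otimes>\<^bsub>K\<^esub> b) \<odot>\<^bsub>dsum_module I V\<^esub> f = a \<odot>\<^bsub>dsum_module I V\<^esub> (b \<odot>\<^bsub>dsum_module I V\<^esub> f)"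
    using ab f unfolding dsum_module_sel by (auto simp: M intro!: restrict_ext)
  assume g: "g \<in> carrier (dsum_module I V)"
  show "a \<odot>\<^bsub>dsum_module I V\<^esub> (f \<oplus>\<^bsub>dsum_module I V\<^esub> g) = a \<odot>\<^bsub>dsum_module I V\<^esub> f \<oplus>\<^bsub>dsum_module I V\<^esub> a \<odot>\<^bsub>dsum_module I V\<^esub> g"
    using ab f g unfolding dsum_module_sel by (auto simp: M intro!: restrict_ext)
next
  fix f assume f: "f \<in> carrier (dsum_module I V)"
  then show "\<one>\<^bsub>K\<^esub> \<odot>\<^bsub>dsum_module I V\<^esub> f = f"
    unfolding dsum_module_sel by (auto simp: module.smult_one[OF module_V])
qed

lemma dsum_inj_linear: "i \<in> I \<Longrightarrow> linear_map K (V i) (dsum_module I V) (dsum_inj I V i)"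
proof (rule linear_mapI)
  fix x assume i: "i \<in> I" and x: "x \<in> carrier (V i)"
  have "{j\<in>I. dsum_inj I V i x j \<noteq> \<zero>\<^bsub>V j\<^esub>} \<subseteq> {i}" unfolding dsum_inj_def by auto
  then have "finite {j\<in>I. dsum_inj I V i x j \<noteq> \<zero>\<^bsub>V j\<^esub>}" using finite_subset by blast
  then show "dsum_inj I V i x \<in> carrier (dsum_module I V)"
    using i x unfolding dsum_module_sel by (auto simp: dsum_inj_def module_simps)
qed (auto simp: dsum_inj_def dsum_module_sel module_simps intro!: restrict_ext)

text \<open>A property that cuts out a submodule needs checking on single summands only. The
  induction splits off one coordinate of the support at a time.\<close>

lemma dsum_generated:
  assumes N: "submodule N K (dsum_module I V)"
    and inj: "\<And>i x. \<lbrakk>i \<in> I; x \<in> carrier (V i)\<rbrakk> \<Longrightarrow> dsum_inj I V i x \<in> N"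
  shows "carrier (dsum_module I V) \<subseteq> N"
proof -
  note D = submoduleD[OF module_dsum N]
  have "f \<in> N" if "finite F" "f \<in> carrier (dsum_module I V)" "{i\<in>I. f i \<noteq> \<zero>\<^bsub>V i\<^esub>} \<subseteq> F" "F \<subseteq> I" for F f
    using that
  proof (induction F arbitrary: f rule: finite_induct)
    case empty
    then have "f = \<zero>\<^bsub>dsum_module I V\<^esub>" unfolding dsum_module_sel by (intro ext) auto
    then show ?case using D(2) by simp
  next
    case (insert i F)
    let ?g = "\<lambda>j\<in>I. if j = i then \<zero>\<^bsub>V j\<^esub> else f j"
    have i: "i \<in> I" using insert by auto
    have "{j\<in>I. ?g j \<noteq> \<zero>\<^bsub>V j\<^esub>} \<subseteq> {j\<in>I. f j \<noteq> \<zero>\<^bsub>V j\<^esub>}" by auto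
    then have "finite {j\<in>I. ?g j \<noteq> \<zero>\<^bsub>V j\<^esub>}" using insert(4) finite_subset unfolding dsum_module_sel by blast
    then have "?g \<in> carrier (dsum_module I V)"
      using insert(4) unfolding dsum_module_sel by (auto simp: module_simps)
    then have g: "?g \<in> N" by (rule insert.IH) (use insert in auto)
    have "f = dsum_inj I V i (f i) \<oplus>\<^bsub>dsum_module I V\<^esub> ?g"
      using insert(4) i unfolding dsum_module_sel dsum_inj_def
      by (intro ext) (auto simp: module_simps)
    moreover have "f i \<in> carrier (V i)" using insert(4) i unfolding dsum_module_sel by auto
    ultimately show ?case using D(3)[OF inj[OF i] g] by metis
  qed
  then show ?thesis by (auto simp: dsum_module_sel)
qed

text \<open>\<open>dsum_map\<close> sums over the exact support, which differs for f, g and their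
  sum. Any larger finite set gives the same value, so the sums can be compared over a common
  one.\<close>

lemma dsum_map_eq:
  assumes W: "module K W" and \<theta>: "\<And>i. i \<in> I \<Longrightarrow> linear_map K (V i) W (\<theta> i)"
    and f: "f \<in> carrier (dsum_module I V)" and F: "finite F" "F \<subseteq> I" "\<And>i. i \<in> I - F \<Longrightarrow> f i = \<zero>\<^bsub>V i\<^esub>"
  shows "dsum_map I V W \<theta> f = (\<Oplus>\<^bsub>W\<^esub>i\<in>F. \<theta> i (f i))"
proof -
  interpret W: module K W by fact
  show ?thesis unfolding dsum_map_def
  proof (rule W.finsum_mono_neutral)
    fix i assume "i \<in> F - {i \<in> I. f i \<noteq> \<zero>\<^bsub>V i\<^esub>}"
    then show "\<theta> i (f i) = \<zero>\<^bsub>W\<^esub>" using F linear_map_zero[OF module_V W \<theta>] by auto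
  next
    fix i assume "i \<in> {i \<in> I. f i \<noteq> \<zero>\<^bsub>V i\<^esub>}"
    then show "\<theta> i (f i) \<in> carrier W" using f linear_map_closed[OF \<theta>] unfolding dsum_module_sel by auto
  qed (use F in auto)
qed

lemma dsum_map_linear:
  assumes W: "module K W" and \<theta>: "\<And>i. i \<in> I \<Longrightarrow> linear_map K (V i) W (\<theta> i)"
  shows "linear_map K (dsum_module I V) W (dsum_map I V W \<theta>)"
proof -
  interpret W: module K W by fact
  interpret T: module K "dsum_module I V" by (rule module_dsum)
  let ?s = "\<lambda>f. {i\<in>I. f i \<noteq> \<zero>\<^bsub>V i\<^esub>}"
  have cl: "\<theta> i (f i) \<in> carrier W" if "i \<in> I" "f \<in> carrier (dsum_module I V)" for i f
    using that linear_map_closed[OF \<theta>] unfolding dsum_module_sel by auto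
  show ?thesis
  proof (rule linear_mapI)
    fix f assume f: "f \<in> carrier (dsum_module I V)"
    show "dsum_map I V W \<theta> f \<in> carrier W" unfolding dsum_map_def
      using cl f by (intro W.finsum_closed) auto
    fix g assume g: "g \<in> carrier (dsum_module I V)"
    have fg: "f \<oplus>\<^bsub>dsum_module I V\<^esub> g \<in> carrier (dsum_module I V)" using f g by simp
    let ?F = "?s f \<union> ?s g"
    have F: "finite ?F" "?F \<subseteq> I" using f g unfolding dsum_module_sel by auto
    have "dsum_map I V W \<theta> (f \<oplus>\<^bsub>dsum_module I V\<^esub> g) = (\<Oplus>\<^bsub>W\<^esub>i\<in>?F. \<theta> i ((f \<oplus>\<^bsub>dsum_module I V\<^esub> g) i))"
      by (rule dsum_map_eq[OF W \<theta> fg F]) (auto simp: dsum_module_sel module_simps)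
    also have "\<dots> = (\<Oplus>\<^bsub>W\<^esub>i\<in>?F. \<theta> i (f i) \<oplus>\<^bsub>W\<^esub> \<theta> i (g i))"
    proof (rule W.finsum_cong')
      fix i assume "i \<in> ?F"
      then show "\<theta> i ((f \<oplus>\<^bsub>dsum_module I V\<^esub> g) i) = \<theta> i (f i) \<oplus>\<^bsub>W\<^esub> \<theta> i (g i)"
        using f g linear_map_add[OF \<theta>, of i] unfolding dsum_module_sel by auto
    qed (use cl f g in auto)
    also have "\<dots> = (\<Oplus>\<^bsub>W\<^esub>i\<in>?F. \<theta> i (f i)) \<oplus>\<^bsub>W\<^esub> (\<Oplus>\<^bsub>W\<^esub>i\<in>?F. \<theta> i (g i))"
      by (rule W.finsum_addf) (use cl f g in auto)
    also have "(\<Oplus>\<^bsub>W\<^esub>i\<in>?F. \<theta> i (f i)) = dsum_map I V W \<theta> f"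
      by (rule dsum_map_eq[OF W \<theta> f F, symmetric]) auto
    also have "(\<Oplus>\<^bsub>W\<^esub>i\<in>?F. \<theta> i (g i)) = dsum_map I V W \<theta> g"
      by (rule dsum_map_eq[OF W \<theta> g F, symmetric]) auto
    finally show "dsum_map I V W \<theta> (f \<oplus>\<^bsub>dsum_module I V\<^esub> g) = dsum_map I V W \<theta> f \<oplus>\<^bsub>W\<^esub> dsum_map I V W \<theta> g" .
  next
    fix a f assume a: "a \<in> carrier K" and f: "f \<in> carrier (dsum_module I V)"
    have af: "a \<odot>\<^bsub>dsum_module I V\<^esub> f \<in> carrier (dsum_module I V)" using f a by simp
    have F: "finite (?s f)" "?s f \<subseteq> I" using f unfolding dsum_module_sel by auto
    have "dsum_map I V W \<theta> (a \<odot>\<^bsub>dsum_module I V\<^esub> f) = (\<Oplus>\<^bsub>W\<^esub>i\<in>?s f. \<theta> i ((a \<odot>\<^bsub>dsum_module I V\<^esub> f) i))"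
      by (rule dsum_map_eq[OF W \<theta> af F]) (auto simp: dsum_module_sel module_simps a)
    also have "\<dots> = (\<Oplus>\<^bsub>W\<^esub>i\<in>?s f. a \<odot>\<^bsub>W\<^esub> \<theta> i (f i))"
    proof (rule W.finsum_cong')
      fix i assume "i \<in> ?s f"
      then show "\<theta> i ((a \<odot>\<^bsub>dsum_module I V\<^esub> f) i) = a \<odot>\<^bsub>W\<^esub> \<theta> i (f i)"
        using f a linear_map_smult[OF \<theta>, of i] unfolding dsum_module_sel by auto
    qed (use cl f a in auto)
    also have "\<dots> = a \<odot>\<^bsub>W\<^esub> dsum_map I V W \<theta> f"
      unfolding dsum_map_def by (rule W.finsum_smult_ldistr[symmetric]) (use cl f a F in auto)
    finally show "dsum_map I V W \<theta> (a \<odot>\<^bsub>dsum_module I V\<^esub> f) = a \<odot>\<^bsub>W\<^esub> dsum_map I V W \<theta> f" .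
  qed
qed

lemma dsum_map_inj:
  assumes W: "module K W" and \<theta>: "\<And>i. i \<in> I \<Longrightarrow> linear_map K (V i) W (\<theta> i)"
    and i: "i \<in> I" "x \<in> carrier (V i)"
  shows "dsum_map I V W \<theta> (dsum_inj I V i x) = \<theta> i x"
proof -
  interpret W: module K W by fact
  have "dsum_map I V W \<theta> (dsum_inj I V i x) = (\<Oplus>\<^bsub>W\<^esub>j\<in>{i}. \<theta> j (dsum_inj I V i x j))"
    by (rule dsum_map_eq[OF W \<theta> linear_map_closed[OF dsum_inj_linear]]) (use i in \<open>auto simp: dsum_inj_def\<close>)
  also have "\<dots> = \<theta> i x"
    using i linear_map_closed[OF \<theta>[OF i(1)] i(2)] by (simp add: dsum_inj_def)
  finally show ?thesis .
qed

end

lemma (in universe) small_in_dsum: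
  assumes "small_in small I" "\<And>i. i \<in> I \<Longrightarrow> small_in small (carrier (V i))"
  shows "small_in small (carrier (dsum_module I V))"
proof (rule small_in_subset[OF small_in_finite_support[OF assms]])
  let ?z = "\<lambda>i. if i \<in> I then \<zero>\<^bsub>V i\<^esub> else undefined"
  have "{i\<in>I. f i \<noteq> ?z i} = {i\<in>I. f i \<noteq> \<zero>\<^bsub>V i\<^esub>}" for f by auto
  then show "carrier (dsum_module I V) \<subseteq> {f. finite {i \<in> I. f i \<noteq> ?z i} \<and> (\<forall>i\<in>I. f i \<in> carrier (V i)) \<and> (\<forall>i. i \<notin> I \<longrightarrow> f i = ?z i)}"
    unfolding dsum_module_def by auto
qed

section \<open>Modules with operators\<close>

text \<open>The type \<open>'v\<close> of elements is a parameter because direct sums and tensor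
  products leave the type of the modules they are made from.\<close>

record ('o, 'p, 'k, 'v) opmod =
  Grp :: "'o \<Rightarrow> ('k, 'v) module"
  Op :: "'p \<Rightarrow> 'v \<Rightarrow> 'v"

abbreviation "el A X \<equiv> carrier (Grp A X)"
abbreviation "nul A X \<equiv> \<zero>\<^bsub>Grp A X\<^esub>"

text \<open>The structures are the representations over K of the quiver with vertices S and arrows
  P. No relations are imposed here; they enter elementwise later, through the condition
  \<open>good\<close>.\<close>

locale op_signature =
  fixes K :: "'k ring" and S :: "'o set" and P :: "'p set" and src tgt :: "'p \<Rightarrow> 'o"
  assumes cring_K: "cring K"
    and src_closed: "p \<in> P \<Longrightarrow> src p \<in> S"
    and tgt_closed: "p \<in> P \<Longrightarrow> tgt p \<in> S"
begin

definition is_opmod :: "('o, 'p, 'k, 'v) opmod \<Rightarrow> bool" where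
  "is_opmod A \<longleftrightarrow> (\<forall>X\<in>S. module K (Grp A X)) \<and>
    (\<forall>p\<in>P. linear_map K (Grp A (src p)) (Grp A (tgt p)) (Op A p))"

definition ophom :: "('o, 'p, 'k, 'v) opmod \<Rightarrow> ('o, 'p, 'k, 'w) opmod \<Rightarrow> ('o \<Rightarrow> 'v \<Rightarrow> 'w) \<Rightarrow> bool" where
  "ophom A B \<eta> \<longleftrightarrow> (\<forall>X\<in>S. linear_map K (Grp A X) (Grp B X) (\<eta> X)) \<and>
    (\<forall>p\<in>P. \<forall>x\<in>el A (src p). \<eta> (tgt p) (Op A p x) = Op B p (\<eta> (src p) x))"

definition opsub :: "('o, 'p, 'k, 'v) opmod \<Rightarrow> ('o \<Rightarrow> 'v set) \<Rightarrow> bool" where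
  "opsub A N \<longleftrightarrow> (\<forall>X\<in>S. submodule (N X) K (Grp A X)) \<and>
    (\<forall>p\<in>P. \<forall>x\<in>N (src p). Op A p x \<in> N (tgt p))"

definition opinj :: "('o, 'p, 'k, 'v) opmod \<Rightarrow> ('o \<Rightarrow> 'v \<Rightarrow> 'w) \<Rightarrow> bool" where
  "opinj A \<eta> \<longleftrightarrow> (\<forall>X\<in>S. inj_on (\<eta> X) (el A X))"

definition opsurj :: "('o, 'p, 'k, 'v) opmod \<Rightarrow> ('o, 'p, 'k, 'w) opmod \<Rightarrow> ('o \<Rightarrow> 'v \<Rightarrow> 'w) \<Rightarrow> bool" where
  "opsurj A B \<eta> \<longleftrightarrow> (\<forall>X\<in>S. \<eta> X ` el A X = el B X)"

text \<open>The explicit membership in \<open>el A X\<close> matters when G is not contained in A: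
  there may then be no N at all, and the remaining condition would hold for everything.\<close>

definition opgen :: "('o, 'p, 'k, 'v) opmod \<Rightarrow> ('o \<Rightarrow> 'v set) \<Rightarrow> 'o \<Rightarrow> 'v set" where
  "opgen A G X = {x \<in> el A X. \<forall>N. opsub A N \<and> (\<forall>Y\<in>S. G Y \<subseteq> N Y) \<longrightarrow> x \<in> N X}"

definition sub_opmod :: "('o, 'p, 'k, 'v) opmod \<Rightarrow> ('o \<Rightarrow> 'v set) \<Rightarrow> ('o, 'p, 'k, 'v) opmod" where
  "sub_opmod A N = A\<lparr>Grp := \<lambda>X. (Grp A X)\<lparr>carrier := N X\<rparr>\<rparr>"

definition dsum :: "'i set \<Rightarrow> ('i \<Rightarrow> ('o, 'p, 'k, 'v) opmod) \<Rightarrow> ('o, 'p, 'k, 'i \<Rightarrow> 'v) opmod" where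
  "dsum I A = \<lparr>Grp = (\<lambda>X. dsum_module I (\<lambda>i. Grp (A i) X)), Op = (\<lambda>p f. \<lambda>i\<in>I. Op (A i) p (f i))\<rparr>"

lemma opmod_module: "\<lbrakk>is_opmod A; X \<in> S\<rbrakk> \<Longrightarrow> module K (Grp A X)"
  and opmod_linear: "\<lbrakk>is_opmod A; p \<in> P\<rbrakk> \<Longrightarrow> linear_map K (Grp A (src p)) (Grp A (tgt p)) (Op A p)"
  and ophom_linear: "\<lbrakk>ophom A B \<eta>; X \<in> S\<rbrakk> \<Longrightarrow> linear_map K (Grp A X) (Grp B X) (\<eta> X)"
  and ophom_Op: "\<lbrakk>ophom A B \<eta>; p \<in> P; x \<in> el A (src p)\<rbrakk> \<Longrightarrow> \<eta> (tgt p) (Op A p x) = Op B p (\<eta> (src p) x)"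
  and opsub_submodule: "\<lbrakk>opsub A N; X \<in> S\<rbrakk> \<Longrightarrow> submodule (N X) K (Grp A X)"
  and opsub_Op: "\<lbrakk>opsub A N; p \<in> P; x \<in> N (src p)\<rbrakk> \<Longrightarrow> Op A p x \<in> N (tgt p)"
  unfolding is_opmod_def ophom_def opsub_def by auto

lemma Op_closed: "\<lbrakk>is_opmod A; p \<in> P; x \<in> el A (src p)\<rbrakk> \<Longrightarrow> Op A p x \<in> el A (tgt p)"
  using opmod_linear linear_map_closed by metis

lemma Op_zero: "\<lbrakk>is_opmod A; p \<in> P\<rbrakk> \<Longrightarrow> Op A p (nul A (src p)) = nul A (tgt p)"
  by (rule linear_map_zero[OF opmod_module opmod_module opmod_linear]) (auto simp: src_closed tgt_closed)

lemma ophom_closed: "\<lbrakk>ophom A B \<eta>; X \<in> S; x \<in> el A X\<rbrakk> \<Longrightarrow> \<eta> X x \<in> el B X"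
  using ophom_linear linear_map_closed by metis

lemma ophom_zero: "\<lbrakk>is_opmod A; is_opmod B; ophom A B \<eta>; X \<in> S\<rbrakk> \<Longrightarrow> \<eta> X (nul A X) = nul B X"
  by (rule linear_map_zero[OF opmod_module opmod_module ophom_linear])

lemma opmod_zero_closed: "\<lbrakk>is_opmod A; X \<in> S\<rbrakk> \<Longrightarrow> nul A X \<in> el A X"
  using opmod_module by (metis abelian_group.axioms(1) abelian_monoid.zero_closed module.axioms(2))

lemma ophomI:
  assumes "\<And>X. X \<in> S \<Longrightarrow> linear_map K (Grp A X) (Grp B X) (\<eta> X)"
    and "\<And>p x. \<lbrakk>p \<in> P; x \<in> el A (src p)\<rbrakk> \<Longrightarrow> \<eta> (tgt p) (Op A p x) = Op B p (\<eta> (src p) x)"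
  shows "ophom A B \<eta>"
  using assms unfolding ophom_def by blast

lemma ophom_id: "ophom A A (\<lambda>X x. x)"
  unfolding ophom_def by (simp add: linear_map_id)

lemma ophom_compose: "\<lbrakk>ophom A B \<eta>; ophom B E \<zeta>\<rbrakk> \<Longrightarrow> ophom A E (\<lambda>X x. \<zeta> X (\<eta> X x))"
  by (rule ophomI) (auto intro: linear_map_compose ophom_linear simp: ophom_Op ophom_closed src_closed)

lemma ophom_cong:
  assumes "is_opmod A" "ophom A B \<eta>" "\<And>X x. \<lbrakk>X \<in> S; x \<in> el A X\<rbrakk> \<Longrightarrow> \<zeta> X x = \<eta> X x"
  shows "ophom A B \<zeta>"
proof (rule ophomI)
  fix X assume "X \<in> S"
  then show "linear_map K (Grp A X) (Grp B X) (\<zeta> X)"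
    using linear_map_cong[OF opmod_module[OF assms(1)] ophom_linear[OF assms(2)]] assms(3) by blast
next
  fix p x assume "p \<in> P" "x \<in> el A (src p)"
  then show "\<zeta> (tgt p) (Op A p x) = Op B p (\<zeta> (src p) x)"
    using assms by (simp add: ophom_Op src_closed tgt_closed Op_closed)
qed

lemma ophom_const_zero: assumes "is_opmod B" shows "ophom A B (\<lambda>X x. nul B X)"
proof (rule ophomI)
  fix p x assume "p \<in> P"
  then show "nul B (tgt p) = Op B p (nul B (src p))"
    by (simp add: Op_zero[OF assms])
qed (rule linear_map_const_zero[OF opmod_module[OF assms]])

lemma ophom_plus:
  assumes "is_opmod B" "ophom A B \<eta>" "ophom A B \<zeta>"
  shows "ophom A B (\<lambda>X x. \<eta> X x \<oplus>\<^bsub>Grp B X\<^esub> \<zeta> X x)"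
proof (rule ophomI)
  fix p x assume p: "p \<in> P" and x: "x \<in> el A (src p)"
  then show "\<eta> (tgt p) (Op A p x) \<oplus>\<^bsub>Grp B (tgt p)\<^esub> \<zeta> (tgt p) (Op A p x)
      = Op B p (\<eta> (src p) x \<oplus>\<^bsub>Grp B (src p)\<^esub> \<zeta> (src p) x)"
    using assms by (simp add: ophom_Op linear_map_add[OF opmod_linear[OF assms(1) p]] ophom_closed src_closed)
qed (rule linear_map_plus[OF opmod_module[OF assms(1)] ophom_linear[OF assms(2)] ophom_linear[OF assms(3)]])

lemma ophom_neg:
  assumes "is_opmod B" "ophom A B \<eta>"
  shows "ophom A B (\<lambda>X x. \<ominus>\<^bsub>Grp B X\<^esub> \<eta> X x)"
proof (rule ophomI)
  fix p x assume p: "p \<in> P" and x: "x \<in> el A (src p)"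
  have "module K (Grp B (src p))" "module K (Grp B (tgt p))"
    using assms(1) p opmod_module src_closed tgt_closed by auto
  from linear_map_a_inv[OF this opmod_linear[OF assms(1) p]]
  show "\<ominus>\<^bsub>Grp B (tgt p)\<^esub> \<eta> (tgt p) (Op A p x) = Op B p (\<ominus>\<^bsub>Grp B (src p)\<^esub> \<eta> (src p) x)"
    using assms p x by (simp add: ophom_Op ophom_closed src_closed)
qed (rule linear_map_neg[OF opmod_module[OF assms(1)] ophom_linear[OF assms(2)]])

lemma opsub_vimage:
  assumes "is_opmod A" "is_opmod B" "ophom A B \<eta>" "opsub B N"
  shows "opsub A (\<lambda>X. {x \<in> el A X. \<eta> X x \<in> N X})"
  unfolding opsub_def
proof (intro conjI ballI)
  fix X assume X: "X \<in> S"
  show "submodule {x \<in> el A X. \<eta> X x \<in> N X} K (Grp A X)"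
    by (rule submodule_vimage[OF opmod_module[OF assms(1) X] opmod_module[OF assms(2) X]
          ophom_linear[OF assms(3) X] opsub_submodule[OF assms(4) X]])
qed (use assms in \<open>auto simp: Op_closed ophom_Op opsub_Op\<close>)

lemma opsub_image:
  assumes "is_opmod A" "is_opmod B" "ophom A B \<eta>" "opsub A N"
  shows "opsub B (\<lambda>X. \<eta> X ` N X)"
  unfolding opsub_def
proof (intro conjI ballI)
  fix X assume X: "X \<in> S"
  show "submodule (\<eta> X ` N X) K (Grp B X)"
    by (rule submodule_image[OF opmod_module[OF assms(1) X] opmod_module[OF assms(2) X]
          ophom_linear[OF assms(3) X] opsub_submodule[OF assms(4) X]])
next
  fix p y assume p: "p \<in> P" and "y \<in> \<eta> (src p) ` N (src p)"
  then obtain x where x: "x \<in> N (src p)" "y = \<eta> (src p) x" by blast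
  moreover have "x \<in> el A (src p)"
    using x submoduleD(1)[OF opmod_module[OF assms(1)] opsub_submodule[OF assms(4)]] src_closed[OF p] by blast
  ultimately show "Op B p y \<in> \<eta> (tgt p) ` N (tgt p)"
    using ophom_Op[OF assms(3) p] opsub_Op[OF assms(4) p] by (metis imageI)
qed

lemma opsub_zero: assumes "is_opmod A" shows "opsub A (\<lambda>X. {nul A X})"
  unfolding opsub_def
proof (intro conjI ballI)
  fix p x assume "p \<in> P" "x \<in> {nul A (src p)}"
  then show "Op A p x \<in> {nul A (tgt p)}"
    by (simp add: Op_zero[OF assms])
next
  fix X assume "X \<in> S"
  then show "submodule {nul A X} K (Grp A X)" by (rule submodule_zero[OF opmod_module[OF assms]])
qed

lemma opsub_carrier: assumes "is_opmod A" shows "opsub A (\<lambda>X. el A X)"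
  unfolding opsub_def using submodule_carrier[OF opmod_module[OF assms]] Op_closed[OF assms] by simp

lemma opsub_kernel:
  assumes "is_opmod A" "is_opmod B" "ophom A B \<eta>"
  shows "opsub A (\<lambda>X. {x \<in> el A X. \<eta> X x = nul B X})"
  using opsub_vimage[OF assms opsub_zero[OF assms(2)]] by simp

lemma opsub_range:
  assumes "is_opmod A" "is_opmod B" "ophom A B \<eta>"
  shows "opsub B (\<lambda>X. \<eta> X ` el A X)"
  by (rule opsub_image[OF assms opsub_carrier[OF assms(1)]])

lemma opsub_equalizer:
  assumes "is_opmod A" "is_opmod B" "ophom A B \<eta>" "ophom A B \<zeta>"
  shows "opsub A (\<lambda>X. {x \<in> el A X. \<eta> X x = \<zeta> X x})"
  unfolding opsub_def
proof (intro conjI ballI)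
  fix X assume X: "X \<in> S"
  interpret A: module K "Grp A X" by (rule opmod_module[OF assms(1) X])
  note l = ophom_linear[OF assms(3) X] ophom_linear[OF assms(4) X]
  show "submodule {x \<in> el A X. \<eta> X x = \<zeta> X x} K (Grp A X)"
    by (rule A.submodule_memI)
      (auto simp: linear_map_add[OF l(1)] linear_map_add[OF l(2)] linear_map_smult[OF l(1)] linear_map_smult[OF l(2)]
         ophom_zero[OF assms(1,2,3) X] ophom_zero[OF assms(1,2,4) X])
qed (use assms in \<open>auto simp: Op_closed ophom_Op\<close>)

lemma opsub_subset: "\<lbrakk>is_opmod A; opsub A N; X \<in> S\<rbrakk> \<Longrightarrow> N X \<subseteq> el A X"
  by (rule subsetI) (rule submoduleD(1)[OF opmod_module opsub_submodule])

lemma opsub_opgen: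
  assumes A: "is_opmod A" shows "opsub A (opgen A G)"
  unfolding opsub_def
proof (intro conjI ballI)
  fix X assume X: "X \<in> S"
  interpret A: module K "Grp A X" by (rule opmod_module[OF assms(1) X])
  note D = submoduleD[OF opmod_module[OF A X] opsub_submodule[OF _ X]]
  show "submodule (opgen A G X) K (Grp A X)"
    unfolding opgen_def by (rule A.submodule_memI) (auto simp: D)
next
  fix p x assume "p \<in> P" "x \<in> opgen A G (src p)"
  then show "Op A p x \<in> opgen A G (tgt p)" unfolding opgen_def by (auto simp: Op_closed[OF A] opsub_Op)
qed

lemma opgen_least: "\<lbrakk>opsub A N; \<And>Y. Y \<in> S \<Longrightarrow> G Y \<subseteq> N Y; X \<in> S\<rbrakk> \<Longrightarrow> opgen A G X \<subseteq> N X"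
  unfolding opgen_def by blast

lemma opgen_incl: "\<lbrakk>X \<in> S; x \<in> G X; x \<in> el A X\<rbrakk> \<Longrightarrow> x \<in> opgen A G X"
  unfolding opgen_def by blast

lemma sub_opmod_sel [simp]:
  "el (sub_opmod A N) X = N X" "Op (sub_opmod A N) = Op A"
  unfolding sub_opmod_def by auto

lemma sub_opmod:
  assumes A: "is_opmod A" and N: "opsub A N"
  shows "is_opmod (sub_opmod A N)" "ophom (sub_opmod A N) A (\<lambda>X x. x)"
proof -
  have sub: "\<And>X x. \<lbrakk>X \<in> S; x \<in> N X\<rbrakk> \<Longrightarrow> x \<in> el A X" using opsub_subset[OF A N] by blast
  have lin: "linear_map K (Grp (sub_opmod A N) (src p)) (Grp (sub_opmod A N) (tgt p)) (Op A p)" if p: "p \<in> P" for p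
    using opmod_linear[OF A p] sub[OF src_closed[OF p]] opsub_Op[OF N p]
    unfolding linear_map_def sub_opmod_def by auto
  show "is_opmod (sub_opmod A N)"
    unfolding is_opmod_def
    using lin submodule.submodule_is_module[OF opsub_submodule[OF N] opmod_module[OF A]]
    by (auto simp: sub_opmod_def)
  show "ophom (sub_opmod A N) A (\<lambda>X x. x)"
    unfolding ophom_def linear_map_def sub_opmod_def using sub by auto
qed

text \<open>Elements with the same image under q differ by an element of the kernel, so a map that
  vanishes on the kernel descends. Maps out of cokernels, colimits and copies of objects are
  obtained in this way.\<close>

lemma ophom_lift_surj:
  assumes T: "is_opmod T" and Q: "is_opmod Q" and W: "is_opmod W"
    and q: "ophom T Q q" "opsurj T Q q" and \<eta>: "ophom T W \<eta>"
    and ker: "\<And>X x. \<lbrakk>X \<in> S; x \<in> el T X; q X x = nul Q X\<rbrakk> \<Longrightarrow> \<eta> X x = nul W X"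
  obtains u where "ophom Q W u" "\<And>X x. \<lbrakk>X \<in> S; x \<in> el T X\<rbrakk> \<Longrightarrow> u X (q X x) = \<eta> X x"
proof -
  define u where "u X y = \<eta> X (inv_into (el T X) (q X) y)" for X y
  have qs: "q X ` el T X = el Q X" if "X \<in> S" for X using q(2) that unfolding opsurj_def by auto
  have eq: "\<eta> X x = \<eta> X y" if "X \<in> S" "x \<in> el T X" "y \<in> el T X" "q X x = q X y" for X x y
  proof -
    interpret T: module K "Grp T X" by (rule opmod_module[OF T that(1)])
    interpret Q: module K "Grp Q X" by (rule opmod_module[OF Q that(1)])
    interpret W: module K "Grp W X" by (rule opmod_module[OF W that(1)])
    have "q X (x \<ominus>\<^bsub>Grp T X\<^esub> y) = nul Q X"
      using linear_map_minus[OF T.module_axioms Q.module_axioms ophom_linear[OF q(1) that(1)] that(2,3)]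
        that ophom_closed[OF q(1)] by (simp add: Q.minus_eq Q.r_neg)
    then have "\<eta> X (x \<ominus>\<^bsub>Grp T X\<^esub> y) = nul W X" using ker that by simp
    then have *: "\<eta> X x \<ominus>\<^bsub>Grp W X\<^esub> \<eta> X y = nul W X"
      using linear_map_minus[OF T.module_axioms W.module_axioms ophom_linear[OF \<eta> that(1)] that(2,3)] by simp
    have c: "\<eta> X x \<in> el W X" "\<eta> X y \<in> el W X" using ophom_closed[OF \<eta>] that by auto
    have "\<eta> X x \<ominus>\<^bsub>Grp W X\<^esub> \<eta> X y \<oplus>\<^bsub>Grp W X\<^esub> \<eta> X y = \<eta> X y" using * c by simp
    then show ?thesis using c by (simp add: W.minus_eq W.a_assoc W.l_neg)
  qed
  have uq: "u X (q X x) = \<eta> X x" if "X \<in> S" "x \<in> el T X" for X x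
    unfolding u_def by (rule eq) (use that in \<open>auto intro: inv_into_into f_inv_into_f\<close>)
  have "ophom Q W u"
  proof (rule ophomI)
    fix X assume X: "X \<in> S"
    interpret T: module K "Grp T X" by (rule opmod_module[OF T X])
    note l = ophom_linear[OF q(1) X] ophom_linear[OF \<eta> X]
    show "linear_map K (Grp Q X) (Grp W X) (u X)"
    proof (rule linear_mapI)
      fix x y assume "x \<in> el Q X" "y \<in> el Q X"
      then obtain a b where ab: "a \<in> el T X" "b \<in> el T X" "x = q X a" "y = q X b" using qs[OF X] by (metis imageE)
      then have "x \<oplus>\<^bsub>Grp Q X\<^esub> y = q X (a \<oplus>\<^bsub>Grp T X\<^esub> b)" using linear_map_add[OF l(1)] by simp
      then show "u X (x \<oplus>\<^bsub>Grp Q X\<^esub> y) = u X x \<oplus>\<^bsub>Grp W X\<^esub> u X y"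
        using ab X linear_map_add[OF l(2)] by (simp add: uq)
    next
      fix c x assume c: "c \<in> carrier K" and "x \<in> el Q X"
      then obtain a where ab: "a \<in> el T X" "x = q X a" using qs[OF X] by (metis imageE)
      then have "c \<odot>\<^bsub>Grp Q X\<^esub> x = q X (c \<odot>\<^bsub>Grp T X\<^esub> a)" using linear_map_smult[OF l(1)] c by simp
      then show "u X (c \<odot>\<^bsub>Grp Q X\<^esub> x) = c \<odot>\<^bsub>Grp W X\<^esub> u X x"
        using ab X c linear_map_smult[OF l(2)] by (simp add: uq)
    next
      fix x assume "x \<in> el Q X"
      then obtain a where "a \<in> el T X" "x = q X a" using qs[OF X] by (metis imageE)
      then show "u X x \<in> el W X" using X by (simp add: uq ophom_closed[OF \<eta>])
    qed
  next
    fix p x assume p: "p \<in> P" "x \<in> el Q (src p)"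
    then obtain a where a: "a \<in> el T (src p)" "x = q (src p) a" using qs[OF src_closed[OF p(1)]] by (metis imageE)
    then have "Op Q p x = q (tgt p) (Op T p a)" using ophom_Op[OF q(1) p(1)] by simp
    then show "u (tgt p) (Op Q p x) = Op W p (u (src p) x)"
      using a p src_closed tgt_closed by (simp add: uq Op_closed[OF T] ophom_Op[OF \<eta>])
  qed
  with uq that show thesis by blast
qed

text \<open>Linearity of the factor and its compatibility with the operators are checked after
  applying the injective k, where they become the laws of \<eta>.\<close>

lemma ophom_lift_inj:
  assumes A: "is_opmod A" and M: "is_opmod M" and W: "is_opmod W"
    and k: "ophom A M k" "opinj A k" and \<eta>: "ophom W M \<eta>"
    and im: "\<And>X x. \<lbrakk>X \<in> S; x \<in> el W X\<rbrakk> \<Longrightarrow> \<eta> X x \<in> k X ` el A X"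
  obtains u where "ophom W A u" "\<And>X x. \<lbrakk>X \<in> S; x \<in> el W X\<rbrakk> \<Longrightarrow> k X (u X x) = \<eta> X x"
proof -
  define u where "u X x = inv_into (el A X) (k X) (\<eta> X x)" for X x
  have u: "u X x \<in> el A X" "k X (u X x) = \<eta> X x" if "X \<in> S" "x \<in> el W X" for X x
    unfolding u_def using im[OF that] by (auto intro: inv_into_into f_inv_into_f)
  have inj: "x = y" if "X \<in> S" "k X x = k X y" "x \<in> el A X" "y \<in> el A X" for X x y
    using k(2) that unfolding opinj_def by (meson inj_onD)
  have "ophom W A u"
  proof (rule ophomI)
    fix X assume X: "X \<in> S"
    interpret A: module K "Grp A X" by (rule opmod_module[OF A X])
    interpret W: module K "Grp W X" by (rule opmod_module[OF W X])
    note l = ophom_linear[OF k(1) X] ophom_linear[OF \<eta> X]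
    show "linear_map K (Grp W X) (Grp A X) (u X)"
      by (rule linear_mapI; (rule inj[OF X])?)
        (auto simp: u X linear_map_add[OF l(1)] linear_map_add[OF l(2)] linear_map_smult[OF l(1)] linear_map_smult[OF l(2)])
  next
    fix p x assume p: "p \<in> P" "x \<in> el W (src p)"
    show "u (tgt p) (Op W p x) = Op A p (u (src p) x)"
      by (rule inj[OF tgt_closed[OF p(1)]])
        (auto simp: u p Op_closed[OF W] Op_closed[OF A] src_closed tgt_closed ophom_Op[OF k(1)] ophom_Op[OF \<eta>])
  qed
  with u that show thesis by blast
qed

lemma opinj_iff:
  assumes "is_opmod A" "is_opmod B" "ophom A B \<eta>"
  shows "opinj A \<eta> \<longleftrightarrow> (\<forall>X\<in>S. \<forall>x\<in>el A X. \<eta> X x = nul B X \<longrightarrow> x = nul A X)"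
  unfolding opinj_def using module_inj_iff[OF opmod_module[OF assms(1)] opmod_module[OF assms(2)] ophom_linear[OF assms(3)]] by simp

text \<open>T may live in any type, but the quotient lives in \<open>'u\<close>. Applied to the zero
  submodule, this makes a copy of T with small carriers.\<close>

lemma opmod_quotient:
  fixes T :: "('o, 'p, 'k, 'v) opmod" and small :: "'u set \<Rightarrow> bool"
  assumes "universe small" and T: "is_opmod T" and R: "opsub T R"
    and sm: "\<And>X. X \<in> S \<Longrightarrow> small_in small (el T X)"
  obtains Q :: "('o, 'p, 'k, 'u) opmod" and q where "is_opmod Q" "ophom T Q q" "opsurj T Q q"
    "\<And>X x. \<lbrakk>X \<in> S; x \<in> el T X\<rbrakk> \<Longrightarrow> q X x = nul Q X \<longleftrightarrow> x \<in> R X"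
    "\<And>X. X \<in> S \<Longrightarrow> small (el Q X)"
proof -
  interpret universe small by fact
  define good where "good X Q q \<longleftrightarrow> module K Q \<and> linear_map K (Grp T X) Q q \<and>
    q ` el T X = carrier Q \<and> (\<forall>x\<in>el T X. q x = \<zero>\<^bsub>Q\<^esub> \<longleftrightarrow> x \<in> R X) \<and> small (carrier Q)"
    for X and Q :: "('k, 'u) module" and q
  have "\<exists>Q q. good X Q q" if X: "X \<in> S" for X
    unfolding good_def
    using small_quotient_module[OF opmod_module[OF T X] opsub_submodule[OF R X] sm[OF X]] by metis
  \<comment> \<open>The module and its projection are chosen together as a pair, so that one
    application of \<open>bchoice\<close> yields both for all sorts.\<close>
  then have "\<forall>X\<in>S. \<exists>y. good X (fst y) (snd y)" by simp
  then obtain f where f: "\<And>X. X \<in> S \<Longrightarrow> good X (fst (f X)) (snd (f X))" using bchoice by metis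
  define Qm where "Qm X = fst (f X)" for X
  define q where "q X = snd (f X)" for X
  have Qm: "\<And>X. X \<in> S \<Longrightarrow> module K (Qm X)"
    and q: "\<And>X. X \<in> S \<Longrightarrow> linear_map K (Grp T X) (Qm X) (q X)"
    and qs: "\<And>X. X \<in> S \<Longrightarrow> q X ` el T X = carrier (Qm X)"
    and ker: "\<And>X x. \<lbrakk>X \<in> S; x \<in> el T X\<rbrakk> \<Longrightarrow> q X x = \<zero>\<^bsub>Qm X\<^esub> \<longleftrightarrow> x \<in> R X"
    and smQ: "\<And>X. X \<in> S \<Longrightarrow> small (carrier (Qm X))"
    using f unfolding good_def Qm_def q_def by simp_all
  text \<open>The operators of the quotient come from the universal property, applied with the trivial signature.\<close>
  have "\<exists>h. linear_map K (Qm (src p)) (Qm (tgt p)) h \<and> (\<forall>x\<in>el T (src p). h (q (src p) x) = q (tgt p) (Op T p x))"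
    if p: "p \<in> P" for p
  proof -
    interpret E: op_signature K "{()}" "{} :: unit set" "\<lambda>_. ()" "\<lambda>_. ()"
      unfolding op_signature_def using cring_K by simp
    let ?g = "\<lambda>V. \<lparr>Grp = (\<lambda>_::unit. V), Op = undefined\<rparr>"
    have m: "module K (Qm (src p))" "module K (Qm (tgt p))" using Qm src_closed[OF p] tgt_closed[OF p] by auto
    show ?thesis
    proof (rule E.ophom_lift_surj[of "?g (Grp T (src p))" "?g (Qm (src p))" "?g (Qm (tgt p))" "\<lambda>_. q (src p)" "\<lambda>_ x. q (tgt p) (Op T p x)"])
      fix X x assume "x \<in> el (?g (Grp T (src p))) X" "q (src p) x = nul (?g (Qm (src p))) X"
      then have "Op T p x \<in> R (tgt p)" using ker src_closed[OF p] opsub_Op[OF R p] by simp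
      then show "q (tgt p) (Op T p x) = nul (?g (Qm (tgt p))) X"
        using ker[OF tgt_closed[OF p]] opsub_subset[OF T R tgt_closed[OF p]] by auto
    next
      fix u assume "E.ophom (?g (Qm (src p))) (?g (Qm (tgt p))) u"
        "\<And>X x. \<lbrakk>X \<in> {()}; x \<in> el (?g (Grp T (src p))) X\<rbrakk> \<Longrightarrow> u X (q (src p) x) = q (tgt p) (Op T p x)"
      then show ?thesis unfolding E.ophom_def by (intro exI[of _ "u ()"]) auto
    qed (use q qs m src_closed[OF p] tgt_closed[OF p] opmod_module[OF T] linear_map_compose[OF opmod_linear[OF T p] q[OF tgt_closed[OF p]]]
        in \<open>auto simp: E.is_opmod_def E.ophom_def E.opsurj_def\<close>)
  qed
  then obtain h where h: "\<And>p. p \<in> P \<Longrightarrow> linear_map K (Qm (src p)) (Qm (tgt p)) (h p)"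
    "\<And>p x. \<lbrakk>p \<in> P; x \<in> el T (src p)\<rbrakk> \<Longrightarrow> h p (q (src p) x) = q (tgt p) (Op T p x)" by metis
  show thesis
    by (rule that[of "\<lparr>Grp = Qm, Op = h\<rparr>" q])
      (auto simp: is_opmod_def ophom_def opsurj_def Qm q qs ker smQ h)
qed

section \<open>Direct sums of operator modules\<close>

lemma dsum_sel: "Grp (dsum I A) X = dsum_module I (\<lambda>i. Grp (A i) X)" "Op (dsum I A) p f = (\<lambda>i\<in>I. Op (A i) p (f i))"
  unfolding dsum_def by auto

lemma direct_sumI: "\<lbrakk>\<And>i. i \<in> I \<Longrightarrow> is_opmod (A i); X \<in> S\<rbrakk> \<Longrightarrow> direct_sum K I (\<lambda>i. Grp (A i) X)"
  unfolding direct_sum_def using cring_K opmod_module by blast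

lemma is_opmod_dsum:
  assumes A: "\<And>i. i \<in> I \<Longrightarrow> is_opmod (A i)"
  shows "is_opmod (dsum I A)"
  unfolding is_opmod_def
proof (intro conjI ballI)
  fix X assume X: "X \<in> S"
  show "module K (Grp (dsum I A) X)"
    unfolding dsum_sel by (rule direct_sum.module_dsum[OF direct_sumI[OF A X]])
next
  fix p assume p: "p \<in> P"
  note m = opmod_module[OF A src_closed[OF p]] opmod_module[OF A tgt_closed[OF p]] opmod_linear[OF A p]
  note z = linear_map_zero[OF m]
  show "linear_map K (Grp (dsum I A) (src p)) (Grp (dsum I A) (tgt p)) (Op (dsum I A) p)"
  proof (rule linear_mapI)
    fix f assume f: "f \<in> el (dsum I A) (src p)"
    \<comment> \<open>Operators send zero to zero, so applying one componentwise does not enlarge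
      the support.\<close>
    have "{i \<in> I. Op (dsum I A) p f i \<noteq> (nul (A i) (tgt p))} \<subseteq> {i \<in> I. f i \<noteq> (nul (A i) (src p))}"
      unfolding dsum_sel using z by auto
    then have "finite {i \<in> I. Op (dsum I A) p f i \<noteq> (nul (A i) (tgt p))}"
      using f finite_subset unfolding dsum_sel dsum_module_sel by blast
    then show "Op (dsum I A) p f \<in> el (dsum I A) (tgt p)"
      using f linear_map_closed[OF m(3)] unfolding dsum_sel dsum_module_sel by auto
  qed (auto simp: dsum_sel dsum_module_sel linear_map_add[OF m(3)] linear_map_smult[OF m(3)] intro!: restrict_ext)
qed

abbreviation "dinj I A i \<equiv> (\<lambda>X. dsum_inj I (\<lambda>i. Grp (A i) X) i)"
abbreviation "dmap I A W \<theta> \<equiv> (\<lambda>X. dsum_map I (\<lambda>i. Grp (A i) X) (Grp W X) (\<lambda>i. \<theta> i X))"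

lemma ophom_dinj:
  assumes A: "\<And>i. i \<in> I \<Longrightarrow> is_opmod (A i)" and i: "i \<in> I"
  shows "ophom (A i) (dsum I A) (dinj I A i)"
proof (rule ophomI)
  fix X assume X: "X \<in> S"
  show "linear_map K (Grp (A i) X) (Grp (dsum I A) X) (dsum_inj I (\<lambda>i. Grp (A i) X) i)"
    unfolding dsum_sel by (rule direct_sum.dsum_inj_linear[OF direct_sumI[OF A X] i])
next
  fix p x assume p: "p \<in> P" and x: "x \<in> el (A i) (src p)"
  note m = opmod_module[OF A src_closed[OF p]] opmod_module[OF A tgt_closed[OF p]] opmod_linear[OF A p]
  show "dsum_inj I (\<lambda>i. Grp (A i) (tgt p)) i (Op (A i) p x) = Op (dsum I A) p (dsum_inj I (\<lambda>i. Grp (A i) (src p)) i x)"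
    unfolding dsum_sel dsum_inj_def by (rule restrict_ext) (auto simp: linear_map_zero[OF m])
qed

lemma dsum_generated_op:
  assumes A: "\<And>i. i \<in> I \<Longrightarrow> is_opmod (A i)" and X: "X \<in> S"
    and N: "submodule N K (Grp (dsum I A) X)"
    and inj: "\<And>i x. \<lbrakk>i \<in> I; x \<in> el (A i) X\<rbrakk> \<Longrightarrow> dinj I A i X x \<in> N"
  shows "el (dsum I A) X \<subseteq> N"
proof -
  have "direct_sum K I (\<lambda>i. Grp (A i) X)" by (rule direct_sumI[OF A X])
  from direct_sum.dsum_generated[OF this] N inj show ?thesis unfolding dsum_sel by blast
qed

lemma ophom_dmap:
  assumes A: "\<And>i. i \<in> I \<Longrightarrow> is_opmod (A i)" and W: "is_opmod W"
    and \<theta>: "\<And>i. i \<in> I \<Longrightarrow> ophom (A i) W (\<theta> i)"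
  shows "ophom (dsum I A) W (dmap I A W \<theta>)"
    and "\<And>i X x. \<lbrakk>i \<in> I; X \<in> S; x \<in> el (A i) X\<rbrakk> \<Longrightarrow> dmap I A W \<theta> X (dinj I A i X x) = \<theta> i X x"
proof -
  show inj: "dmap I A W \<theta> X (dinj I A i X x) = \<theta> i X x" if "i \<in> I" "X \<in> S" "x \<in> el (A i) X" for i X x
    by (rule direct_sum.dsum_map_inj[OF direct_sumI[OF A] opmod_module[OF W] ophom_linear[OF \<theta>]]) (use that in auto)
  have lin: "linear_map K (Grp (dsum I A) X) (Grp W X) (dmap I A W \<theta> X)" if X: "X \<in> S" for X
    unfolding dsum_sel
    by (rule direct_sum.dsum_map_linear[OF direct_sumI[OF A] opmod_module[OF W] ophom_linear[OF \<theta>]]) (use X in auto)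
  show "ophom (dsum I A) W (dmap I A W \<theta>)"
  proof (rule ophomI)
    fix p x assume p: "p \<in> P" and x: "x \<in> el (dsum I A) (src p)"
    let ?T = "dsum I A"
    have T: "is_opmod ?T" by (rule is_opmod_dsum[OF A])
    note s = src_closed[OF p] tgt_closed[OF p]
    interpret T: module K "Grp ?T (src p)" by (rule opmod_module[OF T s(1)])
    note l1 = linear_map_compose[OF opmod_linear[OF T p] lin[OF s(2)]]
    note l2 = linear_map_compose[OF lin[OF s(1)] opmod_linear[OF W p]]
    note Wt = opmod_module[OF W s(2)]
    \<comment> \<open>Both composites are linear, so they agree on a submodule; it remains to see
      that it contains the summands.\<close>
    let ?N = "{x. x \<in> el ?T (src p) \<and> dmap I A W \<theta> (tgt p) (Op ?T p x) = Op W p (dmap I A W \<theta> (src p) x)}"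
    have N: "submodule ?N K (Grp ?T (src p))"
      by (rule T.submodule_memI)
       (auto simp: linear_map_add[OF l1] linear_map_smult[OF l1] linear_map_zero[OF T.module_axioms Wt l1]
          linear_map_add[OF l2] linear_map_smult[OF l2] linear_map_zero[OF T.module_axioms Wt l2])
    have "el ?T (src p) \<subseteq> ?N"
    proof (rule dsum_generated_op[OF A s(1) N])
      fix i x assume i: "i \<in> I" and x: "x \<in> el (A i) (src p)"
      have "Op ?T p (dinj I A i (src p) x) = dinj I A i (tgt p) (Op (A i) p x)"
        using ophom_Op[OF ophom_dinj[of I A i] p x] A i by simp
      then show "dinj I A i (src p) x \<in> ?N"
        using i x s p by (simp add: inj Op_closed[OF A] ophom_Op[OF \<theta>] ophom_closed[OF ophom_dinj[OF A]])
    qed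
    then show "dmap I A W \<theta> (tgt p) (Op ?T p x) = Op W p (dmap I A W \<theta> (src p) x)" using x by blast
  qed (use lin in auto)
qed

lemma dsum_hom_eqI:
  assumes A: "\<And>i. i \<in> I \<Longrightarrow> is_opmod (A i)" and W: "is_opmod W"
    and uv: "ophom (dsum I A) W u" "ophom (dsum I A) W v"
    and eq: "\<And>i x. \<lbrakk>i \<in> I; x \<in> el (A i) X\<rbrakk> \<Longrightarrow> u X (dinj I A i X x) = v X (dinj I A i X x)"
    and X: "X \<in> S" and x: "x \<in> el (dsum I A) X"
  shows "u X x = v X x"
proof -
  have "el (dsum I A) X \<subseteq> {x \<in> el (dsum I A) X. u X x = v X x}"
    by (rule dsum_generated_op[OF A X opsub_submodule[OF opsub_equalizer[OF is_opmod_dsum[OF A] W uv] X]])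
      (use eq ophom_closed[OF ophom_dinj[OF A] X] in auto)
  then show ?thesis using x by blast
qed

end

section \<open>Categories of modules with operators\<close>

text \<open>What the construction of limits and colimits needs of a category with a full and
  faithful functor \<open>U\<close> to operator modules. Closure holds up to isomorphism, since
  \<beta> is bijective. The hypothesis of \<open>cover_closed\<close> says that A is, in every sort,
  the sum of the images of maps from objects. This one condition serves quotients and direct sums
  alike, once these have been copied into \<open>'u\<close>.\<close>

locale opcat = op_signature K S P src tgt + universe small
  for K :: "'k ring" and S :: "'o set" and P :: "'p set" and src tgt :: "'p \<Rightarrow> 'o"
    and small :: "'u set \<Rightarrow> bool" +
  fixes C :: "('a, 'o \<Rightarrow> 'u \<Rightarrow> 'u) cat" and U :: "'a \<Rightarrow> ('o, 'p, 'k, 'u) opmod"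
  assumes U_opmod: "M \<in> Obj C \<Longrightarrow> is_opmod (U M)"
    and U_small: "\<lbrakk>M \<in> Obj C; X \<in> S\<rbrakk> \<Longrightarrow> small (el (U M) X)"
    and Hom_eq: "\<lbrakk>M \<in> Obj C; N \<in> Obj C\<rbrakk> \<Longrightarrow> Hom C M N =
      {\<eta>. \<eta> \<in> extensional S \<and> (\<forall>X\<in>S. \<eta> X \<in> extensional (el (U M) X)) \<and> ophom (U M) (U N) \<eta>}"
    and Comp_eq: "\<lbrakk>M \<in> Obj C; N \<in> Obj C; Q \<in> Obj C\<rbrakk> \<Longrightarrow>
      Comp C M N Q \<zeta> \<eta> = (\<lambda>X\<in>S. compose (el (U M) X) (\<zeta> X) (\<eta> X))"
    and Ident_eq: "M \<in> Obj C \<Longrightarrow> Ident C M = (\<lambda>X\<in>S. \<lambda>m\<in>el (U M) X. m)"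
    and sub_closed: "\<lbrakk>is_opmod A; M \<in> Obj C; ophom A (U M) \<eta>; opinj A \<eta>; \<And>X. X \<in> S \<Longrightarrow> small (el A X)\<rbrakk>
      \<Longrightarrow> \<exists>M'\<in>Obj C. \<exists>\<beta>. ophom A (U M') \<beta> \<and> opinj A \<beta> \<and> opsurj A (U M') \<beta>"
    and cover_closed: "\<lbrakk>is_opmod A; \<And>X. X \<in> S \<Longrightarrow> small (el A X);
        \<And>X N. \<lbrakk>X \<in> S; submodule N K (Grp A X);
          \<And>M \<eta>. \<lbrakk>M \<in> Obj C; ophom (U M) A \<eta>\<rbrakk> \<Longrightarrow> \<eta> X ` el (U M) X \<subseteq> N\<rbrakk>
          \<Longrightarrow> el A X \<subseteq> N\<rbrakk>
      \<Longrightarrow> \<exists>M'\<in>Obj C. \<exists>\<beta>. ophom A (U M') \<beta> \<and> opinj A \<beta> \<and> opsurj A (U M') \<beta>"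
    and generators: "\<exists>I \<Gamma>. small I \<and> (\<forall>i\<in>I. \<Gamma> i \<in> Obj C) \<and>
      (\<forall>M\<in>Obj C. \<forall>X\<in>S. \<forall>m\<in>el (U M) X.
        \<exists>i\<in>I. \<exists>\<eta>. ophom (U (\<Gamma> i)) (U M) \<eta> \<and> m \<in> \<eta> X ` el (U (\<Gamma> i)) X)"
begin

abbreviation "car M X \<equiv> el (U M) X"

text \<open>Arrows of C are \<open>undefined\<close> outside the carriers; this is the normal form
  of an arbitrary family of maps.\<close>

definition mor :: "'a \<Rightarrow> ('o \<Rightarrow> 'u \<Rightarrow> 'u) \<Rightarrow> 'o \<Rightarrow> 'u \<Rightarrow> 'u" where
  "mor M \<eta> = (\<lambda>X\<in>S. restrict (\<eta> X) (car M X))"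

lemma mor_app [simp]: "\<lbrakk>X \<in> S; x \<in> car M X\<rbrakk> \<Longrightarrow> mor M \<eta> X x = \<eta> X x"
  unfolding mor_def by simp

lemma mor_Hom:
  assumes "M \<in> Obj C" "N \<in> Obj C" "ophom (U M) (U N) \<eta>"
  shows "mor M \<eta> \<in> Hom C M N"
proof -
  have "ophom (U M) (U N) (mor M \<eta>)"
    by (rule ophom_cong[OF U_opmod[OF assms(1)] assms(3)]) simp
  then show ?thesis using assms by (auto simp: Hom_eq mor_def)
qed

lemma Hom_ophom: "\<lbrakk>\<eta> \<in> Hom C M N; M \<in> Obj C; N \<in> Obj C\<rbrakk> \<Longrightarrow> ophom (U M) (U N) \<eta>"
  by (simp add: Hom_eq)

lemma Hom_eqI:
  assumes "\<eta> \<in> Hom C M N" "\<zeta> \<in> Hom C M N" "M \<in> Obj C" "N \<in> Obj C"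
    and "\<And>X x. \<lbrakk>X \<in> S; x \<in> car M X\<rbrakk> \<Longrightarrow> \<eta> X x = \<zeta> X x"
  shows "\<eta> = \<zeta>"
proof (rule extensionalityI)
  show "\<eta> \<in> extensional S" "\<zeta> \<in> extensional S" using assms by (auto simp: Hom_eq)
  fix X assume X: "X \<in> S"
  show "\<eta> X = \<zeta> X"
    by (rule extensionalityI[of _ "car M X"]) (use assms X in \<open>auto simp: Hom_eq\<close>)
qed

lemma Hom_closed: "\<lbrakk>\<eta> \<in> Hom C M N; M \<in> Obj C; N \<in> Obj C; X \<in> S; x \<in> car M X\<rbrakk> \<Longrightarrow> \<eta> X x \<in> car N X"
  by (rule ophom_closed[OF Hom_ophom])

lemma Comp_app: "\<lbrakk>M \<in> Obj C; N \<in> Obj C; Q \<in> Obj C; X \<in> S; x \<in> car M X\<rbrakk> \<Longrightarrow> Comp C M N Q \<zeta> \<eta> X x = \<zeta> X (\<eta> X x)"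
  by (simp add: Comp_eq compose_def)

lemma Comp_Hom:
  assumes "M \<in> Obj C" "N \<in> Obj C" "Q \<in> Obj C" "\<eta> \<in> Hom C M N" "\<zeta> \<in> Hom C N Q"
  shows "Comp C M N Q \<zeta> \<eta> \<in> Hom C M Q"
proof -
  have "Comp C M N Q \<zeta> \<eta> = mor M (\<lambda>X x. \<zeta> X (\<eta> X x))"
    using assms by (simp add: Comp_eq compose_def mor_def)
  then show ?thesis
    using mor_Hom[OF assms(1,3) ophom_compose[OF Hom_ophom Hom_ophom]] assms by simp
qed

lemma Ident_app: "\<lbrakk>M \<in> Obj C; X \<in> S; x \<in> car M X\<rbrakk> \<Longrightarrow> Ident C M X x = x"
  by (simp add: Ident_eq)

lemma Ident_Hom: assumes "M \<in> Obj C" shows "Ident C M \<in> Hom C M M"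
proof -
  have "Ident C M = mor M (\<lambda>X x. x)" using assms by (simp add: Ident_eq mor_def)
  then show ?thesis using mor_Hom[OF assms assms ophom_id] by simp
qed

lemma category_C: "category C"
proof
  fix W X Y Z f g h
  assume o: "W \<in> Obj C" "X \<in> Obj C" "Y \<in> Obj C" "Z \<in> Obj C"
    and m: "f \<in> Hom C W X" "g \<in> Hom C X Y" "h \<in> Hom C Y Z"
  show "Comp C W X Z (Comp C X Y Z h g) f = Comp C W Y Z h (Comp C W X Y g f)"
    by (rule Hom_eqI[of _ W Z]) (use o m in \<open>auto intro!: Comp_Hom simp: Comp_app Hom_closed[of f W X]\<close>)
next
  fix X Y f assume o: "X \<in> Obj C" "Y \<in> Obj C" "f \<in> Hom C X Y"
  show "Comp C X Y Y (Ident C Y) f = f"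
    by (rule Hom_eqI[of _ X Y]) (use o in \<open>auto intro!: Comp_Hom Ident_Hom simp: Comp_app Ident_app Hom_closed[of f X Y]\<close>)
  show "Comp C X X Y f (Ident C X) = f"
    by (rule Hom_eqI[of _ X Y]) (use o in \<open>auto intro!: Comp_Hom Ident_Hom simp: Comp_app Ident_app Hom_closed[of f X Y]\<close>)
qed (auto intro: Comp_Hom Ident_Hom)

section \<open>Addition of morphisms\<close>

definition hom_ring :: "'a \<Rightarrow> 'a \<Rightarrow> ('o \<Rightarrow> 'u \<Rightarrow> 'u) ring" where
  "hom_ring M N = \<lparr>carrier = Hom C M N, mult = undefined, one = undefined,
    zero = mor M (\<lambda>X x. nul (U N) X),
    add = (\<lambda>\<eta> \<zeta>. mor M (\<lambda>X x. \<eta> X x \<oplus>\<^bsub>Grp (U N) X\<^esub> \<zeta> X x))\<rparr>"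

lemma hom_ring_sel:
  "carrier (hom_ring M N) = Hom C M N" "\<zero>\<^bsub>hom_ring M N\<^esub> = mor M (\<lambda>X x. nul (U N) X)"
  "\<eta> \<oplus>\<^bsub>hom_ring M N\<^esub> \<zeta> = mor M (\<lambda>X x. \<eta> X x \<oplus>\<^bsub>Grp (U N) X\<^esub> \<zeta> X x)"
  unfolding hom_ring_def by auto

lemma zero_Hom: "\<lbrakk>M \<in> Obj C; N \<in> Obj C\<rbrakk> \<Longrightarrow> mor M (\<lambda>X x. nul (U N) X) \<in> Hom C M N"
  by (rule mor_Hom) (auto intro: ophom_const_zero U_opmod)

lemma plus_Hom: "\<lbrakk>M \<in> Obj C; N \<in> Obj C; \<eta> \<in> Hom C M N; \<zeta> \<in> Hom C M N\<rbrakk>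
    \<Longrightarrow> mor M (\<lambda>X x. \<eta> X x \<oplus>\<^bsub>Grp (U N) X\<^esub> \<zeta> X x) \<in> Hom C M N"
  by (rule mor_Hom) (auto intro: ophom_plus U_opmod Hom_ophom)

lemma abelian_group_Hom:
  assumes M: "M \<in> Obj C" and N: "N \<in> Obj C" shows "abelian_group (hom_ring M N)"
proof (rule abelian_groupI; (unfold hom_ring_sel)?)
  have ab: "abelian_group (Grp (U N) X)" if "X \<in> S" for X
    using opmod_module[OF U_opmod[OF N] that] by (simp add: module_def)
  then have mo: "abelian_monoid (Grp (U N) X)" if "X \<in> S" for X using that by (simp add: abelian_group_def)
  show "mor M (\<lambda>X x. nul (U N) X) \<in> Hom C M N" by (rule zero_Hom[OF M N])
  fix f g h assume f: "f \<in> Hom C M N"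
  note cl = Hom_closed[OF _ M N]
  show "mor M (\<lambda>X x. mor M (\<lambda>X x. nul (U N) X) X x \<oplus>\<^bsub>Grp (U N) X\<^esub> f X x) = f"
    by (rule Hom_eqI[OF plus_Hom[OF M N zero_Hom[OF M N] f] f M N]) (simp add: cl[OF f] abelian_monoid.l_zero[OF mo])
  show "\<exists>y\<in>Hom C M N. mor M (\<lambda>X x. y X x \<oplus>\<^bsub>Grp (U N) X\<^esub> f X x) = mor M (\<lambda>X x. nul (U N) X)"
  proof (rule bexI)
    show n: "mor M (\<lambda>X x. \<ominus>\<^bsub>Grp (U N) X\<^esub> f X x) \<in> Hom C M N"
      by (rule mor_Hom[OF M N ophom_neg[OF U_opmod[OF N] Hom_ophom[OF f M N]]])
    show "mor M (\<lambda>X x. mor M (\<lambda>X x. \<ominus>\<^bsub>Grp (U N) X\<^esub> f X x) X x \<oplus>\<^bsub>Grp (U N) X\<^esub> f X x) = mor M (\<lambda>X x. nul (U N) X)"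
      by (rule Hom_eqI[OF plus_Hom[OF M N n f] zero_Hom[OF M N] M N]) (simp add: cl[OF f] abelian_group.l_neg[OF ab])
  qed
  assume g: "g \<in> Hom C M N"
  show "mor M (\<lambda>X x. f X x \<oplus>\<^bsub>Grp (U N) X\<^esub> g X x) \<in> Hom C M N" by (rule plus_Hom[OF M N f g])
  show "mor M (\<lambda>X x. f X x \<oplus>\<^bsub>Grp (U N) X\<^esub> g X x) = mor M (\<lambda>X x. g X x \<oplus>\<^bsub>Grp (U N) X\<^esub> f X x)"
    by (rule Hom_eqI[OF plus_Hom[OF M N f g] plus_Hom[OF M N g f] M N]) (simp add: cl[OF f] cl[OF g] abelian_monoid.a_comm[OF mo])
  assume h: "h \<in> Hom C M N"
  show "mor M (\<lambda>X x. mor M (\<lambda>X x. f X x \<oplus>\<^bsub>Grp (U N) X\<^esub> g X x) X x \<oplus>\<^bsub>Grp (U N) X\<^esub> h X x) =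
    mor M (\<lambda>X x. f X x \<oplus>\<^bsub>Grp (U N) X\<^esub> mor M (\<lambda>X x. g X x \<oplus>\<^bsub>Grp (U N) X\<^esub> h X x) X x)"
    by (rule Hom_eqI[OF plus_Hom[OF M N plus_Hom[OF M N f g] h] plus_Hom[OF M N f plus_Hom[OF M N g h]] M N])
      (simp add: cl[OF f] cl[OF g] cl[OF h] abelian_monoid.a_assoc[OF mo])
qed

lemma preadditive_C: "preadditive C"
  unfolding preadditive_def
proof (intro conjI exI[of _ hom_ring] ballI)
  fix X Y Z f f' g g'
  assume o: "X \<in> Obj C" "Y \<in> Obj C" "Z \<in> Obj C" and f: "f \<in> Hom C X Y" "f' \<in> Hom C X Y" and g: "g \<in> Hom C Y Z" "g' \<in> Hom C Y Z"
  note pf = plus_Hom[OF o(1,2) f] and pg = plus_Hom[OF o(2,3) g]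
  have lin: "linear_map K (Grp (U Y) A) (Grp (U Z) A) (g A)" if "A \<in> S" for A
    using ophom_linear[OF Hom_ophom[OF g(1) o(2,3)] that] .
  show "Comp C X Y Z g (f \<oplus>\<^bsub>hom_ring X Y\<^esub> f') = Comp C X Y Z g f \<oplus>\<^bsub>hom_ring X Z\<^esub> Comp C X Y Z g f'"
    unfolding hom_ring_sel
    by (rule Hom_eqI[of _ X Z])
      (auto simp: o f g pf Comp_Hom plus_Hom Comp_app Hom_closed[OF f(1) o(1,2)] Hom_closed[OF f(2) o(1,2)] linear_map_add[OF lin])
  show "Comp C X Y Z (g \<oplus>\<^bsub>hom_ring Y Z\<^esub> g') f = Comp C X Y Z g f \<oplus>\<^bsub>hom_ring X Z\<^esub> Comp C X Y Z g' f"
    unfolding hom_ring_sel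
    by (rule Hom_eqI[of _ X Z])
      (auto simp: o f g pg Comp_Hom plus_Hom Comp_app Hom_closed[OF f(1) o(1,2)])
qed (auto simp: category_C abelian_group_Hom hom_ring_sel)

section \<open>Subobjects, quotients and the zero object\<close>

lemma opinj_zero_iff:
  assumes "is_opmod A" "is_opmod B" "ophom A B \<eta>" "opinj A \<eta>" "X \<in> S" "x \<in> el A X"
  shows "\<eta> X x = nul B X \<longleftrightarrow> x = nul A X"
  using assms(4-6) ophom_zero[OF assms(1-3,5)] unfolding opinj_iff[OF assms(1-3)] by auto

text \<open>\<open>sub_closed\<close> returns an object isomorphic to N by some \<beta>, not N
  itself. The inclusion of N is factored through \<beta> to obtain k.\<close>

lemma sub_obj:
  assumes M: "M \<in> Obj C" and N: "opsub (U M) N"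
  obtains A k where "A \<in> Obj C" "ophom (U A) (U M) k" "opinj (U A) k" "\<And>X. X \<in> S \<Longrightarrow> k X ` car A X = N X"
proof -
  note Mo = U_opmod[OF M]
  let ?A = "sub_opmod (U M) N"
  note s = sub_opmod[OF Mo N]
  have inj: "opinj ?A (\<lambda>X x. x)" unfolding opinj_def by simp
  have "small (el ?A X)" if "X \<in> S" for X
    using small_subset[OF U_small[OF M that]] opsub_subset[OF Mo N that] by simp
  from sub_closed[OF s(1) M s(2) inj this] obtain A \<beta> where A: "A \<in> Obj C"
    and b: "ophom ?A (U A) \<beta>" "opinj ?A \<beta>" "opsurj ?A (U A) \<beta>" by blast
  obtain k where k: "ophom (U A) (U M) k" "\<And>X x. \<lbrakk>X \<in> S; x \<in> el ?A X\<rbrakk> \<Longrightarrow> k X (\<beta> X x) = x"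
  proof (rule ophom_lift_surj[OF s(1) U_opmod[OF A] Mo b(1,3) s(2)])
    fix X x assume x: "X \<in> S" "x \<in> el ?A X" "\<beta> X x = nul (U A) X"
    then have "x = nul ?A X" using opinj_zero_iff[OF s(1) U_opmod[OF A] b(1,2) x(1,2)] by simp
    then show "x = nul (U M) X" using ophom_zero[OF s(1) Mo s(2) x(1)] by simp
  qed blast
  have surj: "car A X = \<beta> X ` N X" if "X \<in> S" for X
    using b(3) that unfolding opsurj_def by simp
  show thesis
  proof (rule that[OF A k(1)])
    show "opinj (U A) k" unfolding opinj_def using surj k(2) by (auto simp: inj_on_def)
    show "k X ` car A X = N X" if "X \<in> S" for X using surj[OF that] k(2)[OF that] by force
  qed
qed

text \<open>The hypothesis of \<open>cover_closed\<close> for modules over any type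
  \<open>'v\<close>, such as direct sums, which are not objects themselves.\<close>

definition covered :: "('o, 'p, 'k, 'v) opmod \<Rightarrow> bool" where
  "covered T \<longleftrightarrow> (\<forall>X\<in>S. \<forall>N. submodule N K (Grp T X) \<and>
     (\<forall>M\<in>Obj C. \<forall>\<eta>. ophom (U M) T \<eta> \<longrightarrow> \<eta> X ` car M X \<subseteq> N) \<longrightarrow> (el T X) \<subseteq> N)"

lemma coveredD:
  assumes "covered T" "X \<in> S" "submodule N K (Grp T X)"
    and "\<And>M \<eta>. \<lbrakk>M \<in> Obj C; ophom (U M) T \<eta>\<rbrakk> \<Longrightarrow> \<eta> X ` car M X \<subseteq> N"
  shows "el T X \<subseteq> N"
  using assms unfolding covered_def by simp

lemma covered_U: "M \<in> Obj C \<Longrightarrow> covered (U M)"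
  unfolding covered_def using ophom_id by fastforce

lemma covered_dsum:
  assumes M: "\<And>i. i \<in> I \<Longrightarrow> M i \<in> Obj C" shows "covered (dsum I (\<lambda>i. U (M i)))"
  unfolding covered_def
proof (intro ballI allI impI)
  fix X N assume X: "X \<in> S"
  assume N: "submodule N K (Grp (dsum I (\<lambda>i. U (M i))) X) \<and>
    (\<forall>M'\<in>Obj C. \<forall>\<eta>. ophom (U M') (dsum I (\<lambda>i. U (M i))) \<eta> \<longrightarrow> \<eta> X ` car M' X \<subseteq> N)"
  have op: "\<And>i. i \<in> I \<Longrightarrow> is_opmod (U (M i))" using M U_opmod by blast
  show "el (dsum I (\<lambda>i. U (M i))) X \<subseteq> N"
  proof (rule dsum_generated_op[where A = "\<lambda>i. U (M i)", OF op X])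
    fix i x assume i: "i \<in> I" "x \<in> car (M i) X"
    have "ophom (U (M i)) (dsum I (\<lambda>i. U (M i))) (dinj I (\<lambda>i. U (M i)) i)"
      by (rule ophom_dinj[where A = "\<lambda>i. U (M i)"]) (use op i in auto)
    then show "dinj I (\<lambda>i. U (M i)) i X x \<in> N" using N i M by (auto simp: image_subset_iff)
  qed (use N in auto)
qed

text \<open>The quotient is formed in \<open>'u\<close>. Maps from objects to T, followed by the
  projection, still cover it: a submodule N of the quotient is pulled back to T, where
  \<open>covered\<close> applies.\<close>

lemma quot_obj:
  assumes T: "is_opmod T" and R: "opsub T R" and c: "covered T"
    and sm: "\<And>X. X \<in> S \<Longrightarrow> small_in small (el T X)"
  obtains Q q where "Q \<in> Obj C" "ophom T (U Q) q" "opsurj T (U Q) q"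
    "\<And>X x. \<lbrakk>X \<in> S; x \<in> el T X\<rbrakk> \<Longrightarrow> q X x = nul (U Q) X \<longleftrightarrow> x \<in> R X"
proof -
  obtain Q0 :: "('o, 'p, 'k, 'u) opmod" and q0 where Q0: "is_opmod Q0" and q0: "ophom T Q0 q0" "opsurj T Q0 q0"
    "\<And>X x. \<lbrakk>X \<in> S; x \<in> el T X\<rbrakk> \<Longrightarrow> q0 X x = nul Q0 X \<longleftrightarrow> x \<in> R X"
    and smQ: "\<And>X. X \<in> S \<Longrightarrow> small (el Q0 X)"
    using opmod_quotient[OF universe_axioms T R sm] by metis
  have "\<exists>M'\<in>Obj C. \<exists>\<beta>. ophom Q0 (U M') \<beta> \<and> opinj Q0 \<beta> \<and> opsurj Q0 (U M') \<beta>"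
  proof (rule cover_closed[OF Q0 smQ])
    fix X N assume X: "X \<in> S" and N: "submodule N K (Grp Q0 X)"
      and cov: "\<And>M \<eta>. \<lbrakk>M \<in> Obj C; ophom (U M) Q0 \<eta>\<rbrakk> \<Longrightarrow> \<eta> X ` el (U M) X \<subseteq> N"
    have s: "submodule {x \<in> el T X. q0 X x \<in> N} K (Grp T X)"
      by (rule submodule_vimage[OF opmod_module[OF T X] opmod_module[OF Q0 X] ophom_linear[OF q0(1) X] N])
    have "\<eta> X ` car M X \<subseteq> {x \<in> el T X. q0 X x \<in> N}" if "M \<in> Obj C" "ophom (U M) T \<eta>" for M \<eta>
      using cov[OF that(1) ophom_compose[OF that(2) q0(1)]] ophom_closed[OF that(2) X] by auto
    then have "el T X \<subseteq> {x \<in> el T X. q0 X x \<in> N}"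
      by (intro coveredD[OF c X s])
    then have "q0 X ` el T X \<subseteq> N" by auto
    then show "el Q0 X \<subseteq> N" using q0(2) X unfolding opsurj_def by simp
  qed
  then obtain Q \<beta> where Q: "Q \<in> Obj C" and b: "ophom Q0 (U Q) \<beta>" "opinj Q0 \<beta>" "opsurj Q0 (U Q) \<beta>" by blast
  show thesis
  proof (rule that[OF Q ophom_compose[OF q0(1) b(1)]])
    show "opsurj T (U Q) (\<lambda>X x. \<beta> X (q0 X x))"
      using q0(2) b(3) unfolding opsurj_def by (simp add: image_image[symmetric])
    fix X x assume x: "X \<in> S" "x \<in> el T X"
    have "\<beta> X (q0 X x) = nul (U Q) X \<longleftrightarrow> q0 X x = nul Q0 X"
      by (rule opinj_zero_iff[OF Q0 U_opmod[OF Q] b(1,2) x(1) ophom_closed[OF q0(1) x]])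
    then show "\<beta> X (q0 X x) = nul (U Q) X \<longleftrightarrow> x \<in> R X" using q0(3)[OF x] by simp
  qed
qed

lemma small_in_U: "\<lbrakk>M \<in> Obj C; X \<in> S\<rbrakk> \<Longrightarrow> small_in small (car M X)"
  using U_small small_in_I by blast

lemma small_in_dsum_U:
  assumes "small_in small I" "\<And>i. i \<in> I \<Longrightarrow> M i \<in> Obj C" "X \<in> S"
  shows "small_in small (el (dsum I (\<lambda>i. U (M i))) X)"
  unfolding dsum_sel by (rule small_in_dsum[OF assms(1) small_in_U[OF assms(2,3)]])

text \<open>The source of most new objects: R zero gives coproducts, R everything the zero object,
  and R generated by the relations of a diagram its colimit.\<close>

lemma dsum_quot_obj:
  assumes I: "small_in small I" and M: "\<And>i. i \<in> I \<Longrightarrow> M i \<in> Obj C"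
    and R: "opsub (dsum I (\<lambda>i. U (M i))) R"
  obtains Q q where "Q \<in> Obj C" "ophom (dsum I (\<lambda>i. U (M i))) (U Q) q" "opsurj (dsum I (\<lambda>i. U (M i))) (U Q) q"
    "\<And>X x. \<lbrakk>X \<in> S; x \<in> el (dsum I (\<lambda>i. U (M i))) X\<rbrakk> \<Longrightarrow> q X x = nul (U Q) X \<longleftrightarrow> x \<in> R X"
proof -
  have "is_opmod (dsum I (\<lambda>i. U (M i)))" by (rule is_opmod_dsum) (rule U_opmod[OF M])
  from quot_obj[OF this R covered_dsum[OF M] small_in_dsum_U[OF I M] that] show thesis .
qed

lemma zero_obj_ex: obtains Z where "Z \<in> Obj C" "\<And>X. X \<in> S \<Longrightarrow> car Z X = {nul (U Z) X}"
proof -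
  \<comment> \<open>The empty direct sum; with no index present, \<open>undefined\<close> stands for
    an arbitrary family.\<close>
  let ?T = "dsum {} (\<lambda>i::unit. U undefined)"
  have T: "is_opmod ?T" by (rule is_opmod_dsum) auto
  have i: "small_in small ({} :: unit set)" by (rule small_in_finite) simp
  obtain Q q where Q: "Q \<in> Obj C" "ophom ?T (U Q) q" "opsurj ?T (U Q) q"
    "\<And>X x. \<lbrakk>X \<in> S; x \<in> el ?T X\<rbrakk> \<Longrightarrow> q X x = nul (U Q) X \<longleftrightarrow> x \<in> el ?T X"
    by (rule dsum_quot_obj[OF i _ opsub_carrier[OF T]]) auto
  have "car Q X = {nul (U Q) X}" if "X \<in> S" for X
    using Q(3,4) that opmod_zero_closed[OF T that] unfolding opsurj_def by (metis (no_types, lifting) image_cong image_constant)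
  with Q(1) that show thesis by blast
qed

text \<open>On a zero object the identity and the zero map coincide, being endomorphisms, so every
  element is zero.\<close>

lemma zero_object_iff:
  "zero_object C Z \<longleftrightarrow> Z \<in> Obj C \<and> (\<forall>X\<in>S. car Z X = {nul (U Z) X})"
proof
  assume z: "zero_object C Z"
  then have Z: "Z \<in> Obj C" unfolding zero_object_def by blast
  then have "\<exists>!f. f \<in> Hom C Z Z" using z unfolding zero_object_def by blast
  then have eq: "Ident C Z = mor Z (\<lambda>X x. nul (U Z) X)" using Ident_Hom[OF Z] zero_Hom[OF Z Z] by blast
  have "x = nul (U Z) X" if "X \<in> S" "x \<in> car Z X" for X x
    using Ident_app[OF Z that] that unfolding eq by simp
  then show "Z \<in> Obj C \<and> (\<forall>X\<in>S. car Z X = {nul (U Z) X})"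
    using Z opmod_zero_closed[OF U_opmod[OF Z]] by auto
next
  assume z: "Z \<in> Obj C \<and> (\<forall>X\<in>S. car Z X = {nul (U Z) X})"
  then have Z: "Z \<in> Obj C" by simp
  show "zero_object C Z" unfolding zero_object_def
  proof (intro conjI Z ballI)
    fix X assume X: "X \<in> Obj C"
    show "\<exists>!f. f \<in> Hom C X Z"
    proof (rule ex1I[where P = "\<lambda>f. f \<in> Hom C X Z", OF zero_Hom[OF X Z]])
      fix f assume f: "f \<in> Hom C X Z"
      show "f = mor X (\<lambda>X x. nul (U Z) X)"
      proof (rule Hom_eqI[OF f zero_Hom[OF X Z] X Z])
        fix Y x assume "Y \<in> S" "x \<in> car X Y"
        then show "f Y x = mor X (\<lambda>X x. nul (U Z) X) Y x"
          using Hom_closed[OF f X Z, of Y x] z by simp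
      qed
    qed
    show "\<exists>!f. f \<in> Hom C Z X"
    proof (rule ex1I[where P = "\<lambda>f. f \<in> Hom C Z X", OF zero_Hom[OF Z X]])
      fix f assume f: "f \<in> Hom C Z X"
      show "f = mor Z (\<lambda>Y x. nul (U X) Y)"
      proof (rule Hom_eqI[OF f zero_Hom[OF Z X] Z X])
        fix Y x assume "Y \<in> S" "x \<in> car Z Y"
        then show "f Y x = mor Z (\<lambda>Y x. nul (U X) Y) Y x"
          using ophom_zero[OF U_opmod[OF Z] U_opmod[OF X] Hom_ophom[OF f Z X], of Y] z by simp
      qed
    qed
  qed
qed

text \<open>Kernels and cokernels are defined by arrows that factor through a zero object. Here this
  becomes pointwise vanishing, which makes arguments with elements possible.\<close>

lemma zero_arrow_iff:
  assumes M: "M \<in> Obj C" and N: "N \<in> Obj C"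
  shows "zero_arrow C M N f \<longleftrightarrow> f \<in> Hom C M N \<and> (\<forall>X\<in>S. \<forall>x\<in>car M X. f X x = nul (U N) X)"
proof
  assume "zero_arrow C M N f"
  then obtain Z g h where Z: "zero_object C Z" and g: "g \<in> Hom C M Z" and h: "h \<in> Hom C Z N" and f: "f = Comp C M Z N h g"
    unfolding zero_arrow_def by blast
  have Zo: "Z \<in> Obj C" and z: "\<And>X. X \<in> S \<Longrightarrow> car Z X = {nul (U Z) X}" using Z zero_object_iff by auto
  have "f X x = nul (U N) X" if "X \<in> S" "x \<in> car M X" for X x
  proof -
    have "g X x = nul (U Z) X" using Hom_closed[OF g M Zo that] z that by simp
    then show ?thesis
      using ophom_zero[OF U_opmod[OF Zo] U_opmod[OF N] Hom_ophom[OF h Zo N] that(1)]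
      by (simp add: f Comp_app[OF M Zo N that])
  qed
  then show "f \<in> Hom C M N \<and> (\<forall>X\<in>S. \<forall>x\<in>car M X. f X x = nul (U N) X)"
    using Comp_Hom[OF M Zo N g h] f by simp
next
  assume f: "f \<in> Hom C M N \<and> (\<forall>X\<in>S. \<forall>x\<in>car M X. f X x = nul (U N) X)"
  obtain Z where Zo: "Z \<in> Obj C" and z: "\<And>X. X \<in> S \<Longrightarrow> car Z X = {nul (U Z) X}" using zero_obj_ex by metis
  let ?g = "mor M (\<lambda>X x. nul (U Z) X)" and ?h = "mor Z (\<lambda>X x. nul (U N) X)"
  have "f = Comp C M Z N ?h ?g"
    by (rule Hom_eqI[OF _ Comp_Hom[OF M Zo N zero_Hom[OF M Zo] zero_Hom[OF Zo N]] M N])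
      (use f in \<open>auto simp: Comp_app[OF M Zo N] z\<close>)
  moreover have "zero_object C Z" using zero_object_iff Zo z by blast
  ultimately show "zero_arrow C M N f" unfolding zero_arrow_def using zero_Hom[OF M Zo] zero_Hom[OF Zo N] by blast
qed

section \<open>Kernels, cokernels, monomorphisms and epimorphisms on elements\<close>

lemma is_kernelI:
  assumes o: "M \<in> Obj C" "N \<in> Obj C" "A \<in> Obj C" and f: "f \<in> Hom C M N" and k: "k \<in> Hom C A M"
    and inj: "opinj (U A) k" and im: "\<And>X. X \<in> S \<Longrightarrow> k X ` car A X = {x \<in> car M X. f X x = nul (U N) X}"
  shows "is_kernel C M N f A k"
  unfolding is_kernel_def
proof (intro conjI o k ballI impI)
  show "zero_arrow C A N (Comp C A M N f k)"
    using im Comp_Hom[OF o(3,1,2) k f] by (auto simp: zero_arrow_iff o Comp_app)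
  fix W g assume W: "W \<in> Obj C" and g: "g \<in> Hom C W M" and z: "zero_arrow C W N (Comp C W M N f g)"
  have "g X x \<in> k X ` car A X" if "X \<in> S" "x \<in> car W X" for X x
    using z that Hom_closed[OF g W o(1) that] by (simp add: im zero_arrow_iff o W Comp_app)
  from ophom_lift_inj[OF U_opmod[OF o(3)] U_opmod[OF o(1)] U_opmod[OF W] Hom_ophom[OF k o(3,1)] inj Hom_ophom[OF g W o(1)] this]
  obtain u where u: "ophom (U W) (U A) u" "\<And>X x. \<lbrakk>X \<in> S; x \<in> car W X\<rbrakk> \<Longrightarrow> k X (u X x) = g X x" by blast
  show "\<exists>!u. u \<in> Hom C W A \<and> Comp C W A M k u = g"
  proof (rule ex1I[of _ "mor W u"])
    have m: "mor W u \<in> Hom C W A" by (rule mor_Hom[OF W o(3) u(1)])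
    show "mor W u \<in> Hom C W A \<and> Comp C W A M k (mor W u) = g"
      using m by (auto intro!: Hom_eqI[OF Comp_Hom[OF W o(3,1) m k] g W o(1)] simp: Comp_app W o u)
    fix v assume v: "v \<in> Hom C W A \<and> Comp C W A M k v = g"
    show "v = mor W u"
    proof (rule Hom_eqI[OF _ m W o(3)])
      fix X x assume x: "X \<in> S" "x \<in> car W X"
      have "k X (v X x) = g X x" using v x Comp_app[OF W o(3,1) x, of k v] by simp
      then have "k X (v X x) = k X (u X x)" using u x by simp
      then show "v X x = mor W u X x"
        using inj x v Hom_closed[of v W A] ophom_closed[OF u(1)] W o unfolding opinj_def by (simp add: inj_on_def)
    qed (use v in simp)
  qed
qed

lemma is_cokernelI:
  assumes o: "M \<in> Obj C" "N \<in> Obj C" "Q \<in> Obj C" and f: "f \<in> Hom C M N" and q: "q \<in> Hom C N Q"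
    and surj: "opsurj (U N) (U Q) q" and ker: "\<And>X. X \<in> S \<Longrightarrow> f X ` car M X = {x \<in> car N X. q X x = nul (U Q) X}"
  shows "is_cokernel C M N f Q q"
  unfolding is_cokernel_def
proof (intro conjI o q ballI impI)
  show "zero_arrow C M Q (Comp C M N Q q f)"
    using ker Comp_Hom[OF o f q] by (auto simp: zero_arrow_iff o Comp_app)
  fix W g assume W: "W \<in> Obj C" and g: "g \<in> Hom C N W" and z: "zero_arrow C M W (Comp C M N W g f)"
  have gz: "g X y = nul (U W) X" if "X \<in> S" "y \<in> car N X" "q X y = nul (U Q) X" for X y
  proof -
    have "y \<in> f X ` car M X" using that ker by simp
    then show ?thesis using z that by (auto simp: zero_arrow_iff o W Comp_app)
  qed
  from ophom_lift_surj[OF U_opmod[OF o(2)] U_opmod[OF o(3)] U_opmod[OF W] Hom_ophom[OF q o(2,3)] surj Hom_ophom[OF g o(2) W] this]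
  obtain u where u: "ophom (U Q) (U W) u" "\<And>X x. \<lbrakk>X \<in> S; x \<in> car N X\<rbrakk> \<Longrightarrow> u X (q X x) = g X x" by blast
  have qc: "q X x \<in> car Q X" if "X \<in> S" "x \<in> car N X" for X x using Hom_closed[OF q o(2,3) that] .
  show "\<exists>!u. u \<in> Hom C Q W \<and> Comp C N Q W u q = g"
  proof (rule ex1I[of _ "mor Q u"])
    have m: "mor Q u \<in> Hom C Q W" by (rule mor_Hom[OF o(3) W u(1)])
    show "mor Q u \<in> Hom C Q W \<and> Comp C N Q W (mor Q u) q = g"
      using m by (auto intro!: Hom_eqI[OF Comp_Hom[OF o(2,3) W q m] g o(2) W] simp: Comp_app W o u qc)
    fix v assume v: "v \<in> Hom C Q W \<and> Comp C N Q W v q = g"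
    show "v = mor Q u"
    proof (rule Hom_eqI[OF _ m o(3) W])
      fix X y assume y: "X \<in> S" "y \<in> car Q X"
      then obtain x where x: "x \<in> car N X" "y = q X x" using surj unfolding opsurj_def by (metis imageE)
      then show "v X y = mor Q u X y" using v y Comp_app[OF o(2,3) W y(1) x(1), of v q] u by simp
    qed (use v in simp)
  qed
qed

lemma kernel_ex:
  assumes o: "M \<in> Obj C" "N \<in> Obj C" and f: "f \<in> Hom C M N"
  obtains A k where "A \<in> Obj C" "k \<in> Hom C A M" "opinj (U A) k"
    "\<And>X. X \<in> S \<Longrightarrow> k X ` car A X = {x \<in> car M X. f X x = nul (U N) X}"
proof (rule sub_obj[OF o(1) opsub_kernel[OF U_opmod[OF o(1)] U_opmod[OF o(2)] Hom_ophom[OF f o]]])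
  fix A k assume A: "A \<in> Obj C" "ophom (U A) (U M) k" "opinj (U A) k"
    "\<And>X. X \<in> S \<Longrightarrow> k X ` car A X = {x \<in> car M X. f X x = nul (U N) X}"
  show thesis
    by (rule that[OF A(1) mor_Hom[OF A(1) o(1) A(2)]]) (use A(3,4) in \<open>auto simp: opinj_def inj_on_def image_def\<close>)
qed

lemma cokernel_ex:
  assumes o: "M \<in> Obj C" "N \<in> Obj C" and f: "f \<in> Hom C M N"
  obtains Q q where "Q \<in> Obj C" "q \<in> Hom C N Q" "opsurj (U N) (U Q) q"
    "\<And>X. X \<in> S \<Longrightarrow> f X ` car M X = {x \<in> car N X. q X x = nul (U Q) X}"
proof (rule quot_obj[OF U_opmod[OF o(2)] opsub_range[OF U_opmod[OF o(1)] U_opmod[OF o(2)] Hom_ophom[OF f o]]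
     covered_U[OF o(2)] small_in_U[OF o(2)]])
  fix Q q assume Q: "Q \<in> Obj C" "ophom (U N) (U Q) q" "opsurj (U N) (U Q) q"
    "\<And>X x. \<lbrakk>X \<in> S; x \<in> car N X\<rbrakk> \<Longrightarrow> q X x = nul (U Q) X \<longleftrightarrow> x \<in> f X ` car M X"
  show thesis
    by (rule that[OF Q(1) mor_Hom[OF o(2) Q(1,2)]])
      (use Q(3,4) Hom_closed[OF f o] in \<open>auto simp: opsurj_def image_def\<close>)
qed

text \<open>The kernel inclusion k and the zero map have the same composite with f. As f is a
  monomorphism, k is zero, and so is the kernel.\<close>

lemma mono_inj:
  assumes o: "M \<in> Obj C" "N \<in> Obj C" and f: "monomorphism C M N f"
  shows "opinj (U M) f"
proof -
  have fH: "f \<in> Hom C M N" using f unfolding monomorphism_def by blast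
  obtain A k where A: "A \<in> Obj C" "k \<in> Hom C A M" "opinj (U A) k" "\<And>X. X \<in> S \<Longrightarrow> k X ` car A X = {x \<in> car M X. f X x = nul (U N) X}"
    by (fact kernel_ex[OF o fH])
  let ?z = "mor A (\<lambda>X x. nul (U M) X)"
  have "Comp C A M N f k = Comp C A M N f ?z"
  proof (rule Hom_eqI[OF Comp_Hom[OF A(1) o A(2) fH] Comp_Hom[OF A(1) o zero_Hom[OF A(1) o(1)] fH] A(1) o(2)])
    fix X x assume x: "X \<in> S" "x \<in> car A X"
    then have "f X (k X x) = nul (U N) X" using A(4) by blast
    then show "Comp C A M N f k X x = Comp C A M N f ?z X x"
      using x by (simp add: Comp_app A o ophom_zero[OF U_opmod U_opmod Hom_ophom[OF fH o]])
  qed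
  then have kz: "k = ?z" using f A zero_Hom[OF A(1) o(1)] unfolding monomorphism_def by blast
  show ?thesis unfolding opinj_iff[OF U_opmod[OF o(1)] U_opmod[OF o(2)] Hom_ophom[OF fH o]]
  proof (intro ballI impI)
    fix X x assume x: "X \<in> S" "x \<in> car M X" "f X x = nul (U N) X"
    then have "x \<in> k X ` car A X" using A(4) by simp
    then show "x = nul (U M) X" unfolding kz using x by auto
  qed
qed

text \<open>The cokernel projection and the zero map have the same composite with f. Hence the
  projection is zero and the image of f is everything.\<close>

lemma epi_surj:
  assumes o: "M \<in> Obj C" "N \<in> Obj C" and f: "epimorphism C M N f"
  shows "opsurj (U M) (U N) f"
proof -
  have fH: "f \<in> Hom C M N" using f unfolding epimorphism_def by blast
  obtain Q q where Q: "Q \<in> Obj C" "q \<in> Hom C N Q" "opsurj (U N) (U Q) q" "\<And>X. X \<in> S \<Longrightarrow> f X ` car M X = {x \<in> car N X. q X x = nul (U Q) X}"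
    by (fact cokernel_ex[OF o fH])
  let ?z = "mor N (\<lambda>X x. nul (U Q) X)"
  have "Comp C M N Q q f = Comp C M N Q ?z f"
  proof (rule Hom_eqI[OF Comp_Hom[OF o Q(1) fH Q(2)] Comp_Hom[OF o Q(1) fH zero_Hom[OF o(2) Q(1)]] o(1) Q(1)])
    fix X x assume x: "X \<in> S" "x \<in> car M X"
    then have "q X (f X x) = nul (U Q) X" using Q(4) by blast
    then show "Comp C M N Q q f X x = Comp C M N Q ?z f X x"
      using x by (simp add: Comp_app Q o Hom_closed[OF fH o])
  qed
  then have "q = ?z" using f Q zero_Hom[OF o(2) Q(1)] unfolding epimorphism_def by blast
  then have "\<And>X x. \<lbrakk>X \<in> S; x \<in> car N X\<rbrakk> \<Longrightarrow> q X x = nul (U Q) X" by simp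
  then show ?thesis unfolding opsurj_def using Q(4) by auto
qed

text \<open>Converse of \<open>is_kernelI\<close>, needed because short exact sequences are given by
  universal properties alone. Uniqueness of factorizations makes k a monomorphism; comparison with
  the concrete kernel k' determines the image.\<close>

lemma is_kernelD:
  assumes o: "M \<in> Obj C" "N \<in> Obj C" and f: "f \<in> Hom C M N" and k: "is_kernel C M N f A k"
  shows "A \<in> Obj C" "k \<in> Hom C A M" "opinj (U A) k" "\<And>X. X \<in> S \<Longrightarrow> k X ` car A X = {x \<in> car M X. f X x = nul (U N) X}"
proof -
  show A: "A \<in> Obj C" and kH: "k \<in> Hom C A M" using k unfolding is_kernel_def by auto
  have z: "zero_arrow C A N (Comp C A M N f k)" using k unfolding is_kernel_def by auto
  have un: "\<exists>!u. u \<in> Hom C W A \<and> Comp C W A M k u = g"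
    if "W \<in> Obj C" "g \<in> Hom C W M" "zero_arrow C W N (Comp C W M N f g)" for W g
    using k that unfolding is_kernel_def by blast
  have fk: "f X (k X x) = nul (U N) X" if "X \<in> S" "x \<in> car A X" for X x
    using z that by (simp add: zero_arrow_iff A o Comp_app)
  have "monomorphism C A M k" unfolding monomorphism_def
  proof (intro conjI kH ballI impI)
    fix W g h assume W: "W \<in> Obj C" and g: "g \<in> Hom C W A" and h: "h \<in> Hom C W A" and eq: "Comp C W A M k g = Comp C W A M k h"
    have c: "Comp C W A M k g \<in> Hom C W M" by (rule Comp_Hom[OF W A o(1) g kH])
    have "zero_arrow C W N (Comp C W M N f (Comp C W A M k g))"
      using Comp_Hom[OF W o c f] Hom_closed[OF g W A] fk by (simp add: zero_arrow_iff W o Comp_app A)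
    from un[OF W c this] show "g = h" using g h eq by metis
  qed
  then show "opinj (U A) k" by (rule mono_inj[OF A o(1)])
  obtain A' k' where A': "A' \<in> Obj C" "k' \<in> Hom C A' M" and _: "opinj (U A') k'" and k': "\<And>X. X \<in> S \<Longrightarrow> k' X ` car A' X = {x \<in> car M X. f X x = nul (U N) X}"
    by (fact kernel_ex[OF o f])
  have "zero_arrow C A' N (Comp C A' M N f k')"
    using k' Comp_Hom[OF A'(1) o A'(2) f] by (auto simp: zero_arrow_iff o Comp_app A')
  from un[OF A' this] obtain u where u: "u \<in> Hom C A' A" "Comp C A' A M k u = k'" by blast
  fix X assume X: "X \<in> S"
  have "k' X x = k X (u X x)" "u X x \<in> car A X" if "x \<in> car A' X" for x
    using Comp_app[OF A'(1) A o(1) X that, of k u] u(2) Hom_closed[OF u(1) A'(1) A X that] by auto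
  then have "k' X ` car A' X \<subseteq> k X ` car A X" by auto
  then show "k X ` car A X = {x \<in> car M X. f X x = nul (U N) X}"
    using fk X Hom_closed[OF kH A o(1) X] unfolding k'[OF X] by blast
qed

text \<open>Uniqueness of factorizations makes q an epimorphism, and the concrete cokernel q'
  factors through q, so q vanishes only on the image of f.\<close>

lemma is_cokernelD:
  assumes o: "M \<in> Obj C" "N \<in> Obj C" and f: "f \<in> Hom C M N" and q: "is_cokernel C M N f Q q"
  shows "Q \<in> Obj C" "q \<in> Hom C N Q" "opsurj (U N) (U Q) q" "\<And>X. X \<in> S \<Longrightarrow> f X ` car M X = {x \<in> car N X. q X x = nul (U Q) X}"
proof -
  show Q: "Q \<in> Obj C" and qH: "q \<in> Hom C N Q" using q unfolding is_cokernel_def by auto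
  have z: "zero_arrow C M Q (Comp C M N Q q f)" using q unfolding is_cokernel_def by auto
  have un: "\<exists>!u. u \<in> Hom C Q W \<and> Comp C N Q W u q = g"
    if "W \<in> Obj C" "g \<in> Hom C N W" "zero_arrow C M W (Comp C M N W g f)" for W g
    using q that unfolding is_cokernel_def by blast
  have qf: "q X (f X x) = nul (U Q) X" if "X \<in> S" "x \<in> car M X" for X x
    using z that by (simp add: zero_arrow_iff Q o Comp_app)
  have "epimorphism C N Q q" unfolding epimorphism_def
  proof (intro conjI qH ballI impI)
    fix W g h assume W: "W \<in> Obj C" and g: "g \<in> Hom C Q W" and h: "h \<in> Hom C Q W" and eq: "Comp C N Q W g q = Comp C N Q W h q"
    have c: "Comp C N Q W g q \<in> Hom C N W" by (rule Comp_Hom[OF o(2) Q W qH g])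
    have "zero_arrow C M W (Comp C M N W (Comp C N Q W g q) f)"
      using Comp_Hom[OF o W f c] Hom_closed[OF f o] qf ophom_zero[OF U_opmod[OF Q] U_opmod[OF W] Hom_ophom[OF g Q W]]
      by (simp add: zero_arrow_iff W o Comp_app Q)
    from un[OF W c this] show "g = h" using g h eq by metis
  qed
  then show "opsurj (U N) (U Q) q" by (rule epi_surj[OF o(2) Q])
  obtain Q' q' where Q': "Q' \<in> Obj C" "q' \<in> Hom C N Q'" and _: "opsurj (U N) (U Q') q'" and q': "\<And>X. X \<in> S \<Longrightarrow> f X ` car M X = {x \<in> car N X. q' X x = nul (U Q') X}"
    by (fact cokernel_ex[OF o f])
  have "zero_arrow C M Q' (Comp C M N Q' q' f)"
    using q' Comp_Hom[OF o Q'(1) f Q'(2)] by (auto simp: zero_arrow_iff o Comp_app Q')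
  from un[OF Q' this] obtain u where u: "u \<in> Hom C Q Q'" "Comp C N Q Q' u q = q'" by blast
  fix X assume X: "X \<in> S"
  have "q' X x = u X (q X x)" if "x \<in> car N X" for x
    using Comp_app[OF o(2) Q Q'(1) X that, of u q] u(2) by auto
  then have "{x \<in> car N X. q X x = nul (U Q) X} \<subseteq> f X ` car M X"
    unfolding q'[OF X] using ophom_zero[OF U_opmod[OF Q] U_opmod[OF Q'(1)] Hom_ophom[OF u(1) Q Q'(1)] X] by auto
  then show "f X ` car M X = {x \<in> car N X. q X x = nul (U Q) X}"
    using qf X Hom_closed[OF f o X] by blast
qed

text \<open>The finite direct sum Q, available as a coproduct, is also the product. Everything
  follows from p_b j_b = id, from p_b j_c = 0 for b different from c, and from the sum of the j_b
  p_b being the identity of Q.\<close>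

lemma product_ex:
  assumes o: "M \<in> Obj C" "N \<in> Obj C" shows "\<exists>Pr p q. is_product C M N Pr p q"
proof -
  let ?F = "\<lambda>b. if b then M else N"
  let ?A = "\<lambda>b. U (?F b)" and ?I = "UNIV :: bool set"
  let ?T = "dsum ?I ?A"
  have F: "\<And>b. ?F b \<in> Obj C" using o by simp
  have A: "\<And>b. is_opmod (?A b)" using F U_opmod by blast
  have T: "is_opmod ?T" by (rule is_opmod_dsum) (rule A)
  have sI: "small_in small ?I"
    by (rule small_in_finite) simp
  \<comment> \<open>Dividing by zero only turns the direct sum, whose elements are functions, into
    an object.\<close>
  obtain Q q where Q: "Q \<in> Obj C" and q: "ophom ?T (U Q) q" "opsurj ?T (U Q) q"
    and ker: "\<And>X x. \<lbrakk>X \<in> S; x \<in> el ?T X\<rbrakk> \<Longrightarrow> q X x = nul (U Q) X \<longleftrightarrow> x \<in> {nul ?T X}"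
    by (fact dsum_quot_obj[of ?I ?F, OF sI F opsub_zero[OF T]])
  note Qo = U_opmod[OF Q]
  define \<iota> where "\<iota> b = dinj ?I ?A b" for b
  have \<iota>: "ophom (?A b) ?T (\<iota> b)" for b unfolding \<iota>_def by (rule ophom_dinj[where A = ?A, OF A]) simp
  have pr: "\<exists>p. p \<in> Hom C Q (?F b) \<and> (\<forall>X\<in>S. \<forall>x\<in>car (?F b) X. p X (q X (\<iota> b X x)) = x) \<and>
      (\<forall>X\<in>S. \<forall>x\<in>car (?F (\<not> b)) X. p X (q X (\<iota> (\<not> b) X x)) = nul (?A b) X)" for b
  proof -
    \<comment> \<open>The projection p_b is the map out of the direct sum that is the identity on
      the summand b and zero on the other.\<close>
    let ?\<theta> = "\<lambda>c. if c = b then (\<lambda>X x. x) else (\<lambda>X x. nul (?A b) X)"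
    have \<theta>: "ophom (?A c) (?A b) (?\<theta> c)" for c using ophom_id ophom_const_zero[OF U_opmod[OF o(1)]] ophom_const_zero[OF U_opmod[OF o(2)]] by auto
    note d = ophom_dmap[where A = ?A and I = ?I, OF A A \<theta>]
    have kz: "dmap ?I ?A (?A b) ?\<theta> X x = nul (?A b) X"
      if x: "X \<in> S" "x \<in> el ?T X" "q X x = nul (U Q) X" for X x
    proof -
      have "x = nul ?T X" using ker x by simp
      then show ?thesis using ophom_zero[OF T A d(1) x(1)] by simp
    qed
    obtain u where u: "ophom (U Q) (?A b) u" "\<And>X x. \<lbrakk>X \<in> S; x \<in> el ?T X\<rbrakk> \<Longrightarrow> u X (q X x) = dmap ?I ?A (?A b) ?\<theta> X x"
      using ophom_lift_surj[OF T Qo A[of b] q d(1) kz] by blast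
    have e0: "u X (q X (\<iota> c X x)) = ?\<theta> c X x" if "X \<in> S" "x \<in> car (?F c) X" for X x c
      using u(2)[OF that(1) ophom_closed[OF \<iota> that]] d(2)[OF UNIV_I that] unfolding \<iota>_def by simp
    have e: "u X (q X (\<iota> b X x)) = x" if "X \<in> S" "x \<in> car (?F b) X" for X x
      using e0[of X x b] that by simp
    have e': "u X (q X (\<iota> (\<not> b) X x)) = nul (?A b) X" if "X \<in> S" "x \<in> car (?F (\<not> b)) X" for X x
      using e0[of X x "\<not> b"] that by simp
    have qc: "q X (\<iota> c X x) \<in> car Q X" if "X \<in> S" "x \<in> car (?F c) X" for X x c
      by (rule ophom_closed[OF q(1) that(1) ophom_closed[OF \<iota> that]])
    show ?thesis
      by (rule exI[of _ "mor Q u"]) (intro conjI ballI mor_Hom[OF Q F u(1)]; simp only: mor_app qc e e')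
  qed
  obtain p where p: "\<And>b. p b \<in> Hom C Q (?F b)" "\<And>b X x. \<lbrakk>X \<in> S; x \<in> car (?F b) X\<rbrakk> \<Longrightarrow> p b X (q X (\<iota> b X x)) = x"
    "\<And>b X x. \<lbrakk>X \<in> S; x \<in> car (?F (\<not> b)) X\<rbrakk> \<Longrightarrow> p b X (q X (\<iota> (\<not> b) X x)) = nul (?A b) X"
    using pr by metis
  define j where "j b X x = q X (\<iota> b X x)" for b X x
  have j: "ophom (?A b) (U Q) (j b)" for b unfolding j_def by (rule ophom_compose[OF \<iota> q(1)])
  note ppo = Hom_ophom[OF p(1) Q F]
  define s where "s X y = j True X (p True X y) \<oplus>\<^bsub>Grp (U Q) X\<^esub> j False X (p False X y)" for X y
  have so: "ophom (U Q) (U Q) s" unfolding s_def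
    by (rule ophom_plus[OF Qo ophom_compose[OF ppo j] ophom_compose[OF ppo j]])
  \<comment> \<open>Both sides are maps out of the direct sum, so it is enough to compare them on
    the summands. Uniqueness in the universal property rests on this.\<close>
  have sid: "s X y = y" if X: "X \<in> S" and y: "y \<in> car Q X" for X y
  proof -
    interpret Qm: module K "Grp (U Q) X" by (rule opmod_module[OF Qo X])
    have "y \<in> q X ` el ?T X" using q(2) X y unfolding opsurj_def by simp
    then obtain t where t: "t \<in> el ?T X" "y = q X t" by blast
    have sq: "ophom ?T (U Q) (\<lambda>X x. s X (q X x))" by (rule ophom_compose[OF q(1) so])
    have "s X (q X t) = q X t"
    proof (rule dsum_hom_eqI[where A = ?A and u = "\<lambda>X x. s X (q X x)" and v = q, OF A Qo sq q(1) _ X t(1)])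
      fix b x assume x: "x \<in> car (?F b) X"
      have jc: "j b X x \<in> car Q X" by (rule ophom_closed[OF j X x])
      have z: "j c X (nul (?A c) X) = nul (U Q) X" for c by (rule ophom_zero[OF A Qo j X])
      have "p b X (j b X x) = x" using p(2)[OF X x] unfolding j_def .
      moreover have "p (\<not> b) X (j b X x) = nul (?A (\<not> b)) X" using p(3)[of X x "\<not> b"] X x unfolding j_def by simp
      ultimately have "s X (j b X x) = j b X x" using z[of "\<not> b"] jc unfolding s_def by (cases b) simp_all
      then show "s X (q X (dinj ?I ?A b X x)) = q X (dinj ?I ?A b X x)" unfolding j_def \<iota>_def .
    qed
    then show ?thesis using t by simp
  qed
  have "is_product C M N Q (p True) (p False)"
    unfolding is_product_def
  proof (intro conjI Q ballI)
    show "p True \<in> Hom C Q M" "p False \<in> Hom C Q N" using p(1)[of True] p(1)[of False] by simp_all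
    fix W f g assume W: "W \<in> Obj C" and f: "f \<in> Hom C W M" and g: "g \<in> Hom C W N"
    define fg where "fg b = (if b then f else g)" for b
    have fg: "fg b \<in> Hom C W (?F b)" for b using f g unfolding fg_def by simp
    note fgo = Hom_ophom[OF fg W F]
    define u where "u X x = j True X (fg True X x) \<oplus>\<^bsub>Grp (U Q) X\<^esub> j False X (fg False X x)" for X x
    have uo: "ophom (U W) (U Q) u" unfolding u_def
      by (rule ophom_plus[OF Qo ophom_compose[OF fgo j] ophom_compose[OF fgo j]])
    have pu: "p b X (u X x) = fg b X x" if X: "X \<in> S" and x: "x \<in> car W X" for b X x
    proof -
      interpret M: module K "Grp (U M) X" by (rule opmod_module[OF U_opmod[OF o(1)] X])
      interpret N: module K "Grp (U N) X" by (rule opmod_module[OF U_opmod[OF o(2)] X])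
      have c: "fg c X x \<in> car (?F c) X" for c by (rule ophom_closed[OF fgo X x])
      have jc: "j c X (fg c X x) \<in> car Q X" for c by (rule ophom_closed[OF j X c])
      have "p b X (u X x) = p b X (j True X (fg True X x)) \<oplus>\<^bsub>Grp (?A b) X\<^esub> p b X (j False X (fg False X x))"
        unfolding u_def by (rule linear_map_add[OF ophom_linear[OF ppo X] jc jc])
      moreover have "p b X (j b X (fg b X x)) = fg b X x" using p(2)[OF X c] unfolding j_def .
      moreover have "p b X (j (\<not> b) X (fg (\<not> b) X x)) = nul (?A b) X" using p(3)[OF X c] unfolding j_def .
      ultimately show ?thesis using c[of b] by (cases b) simp_all
    qed
    have m: "mor W u \<in> Hom C W Q" by (rule mor_Hom[OF W Q uo])
    show "\<exists>!u. u \<in> Hom C W Q \<and> Comp C W Q M (p True) u = f \<and> Comp C W Q N (p False) u = g"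
    proof (rule ex1I[of _ "mor W u"])
      have cp: "Comp C W Q (?F b) (p b) (mor W u) = fg b" for b
        by (rule Hom_eqI[OF Comp_Hom[OF W Q F m p(1)] fg W F]) (simp add: Comp_app[OF W Q F] pu)
      show "mor W u \<in> Hom C W Q \<and> Comp C W Q M (p True) (mor W u) = f \<and> Comp C W Q N (p False) (mor W u) = g"
        using m cp[of True] cp[of False] unfolding fg_def by simp
      fix v assume v: "v \<in> Hom C W Q \<and> Comp C W Q M (p True) v = f \<and> Comp C W Q N (p False) v = g"
      show "v = mor W u"
      proof (rule Hom_eqI[OF _ m W Q])
        fix X x assume X: "X \<in> S" and x: "x \<in> car W X"
        have vx: "v X x \<in> car Q X" using v Hom_closed[OF _ W Q X x] by blast
        have "p True X (v X x) = fg True X x" "p False X (v X x) = fg False X x"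
          using v Comp_app[OF W Q o(1) X x, of "p True" v] Comp_app[OF W Q o(2) X x, of "p False" v] unfolding fg_def by simp_all
        then have "s X (v X x) = u X x" unfolding s_def u_def by simp
        then show "v X x = mor W u X x" using sid[OF X vx] X x by simp
      qed (use v in simp)
    qed
  qed
  then show ?thesis by blast
qed

text \<open>A monomorphism is the kernel of its cokernel, and an epimorphism is the cokernel of its
  kernel.\<close>

lemma abelian_C: "abelian_category C"
  unfolding abelian_category_def additive_category_def
proof (intro conjI ballI allI impI preadditive_C product_ex)
  obtain Z where "Z \<in> Obj C" "\<And>X. X \<in> S \<Longrightarrow> car Z X = {nul (U Z) X}" by (fact zero_obj_ex)
  then have "zero_object C Z" unfolding zero_object_iff by simp
  then show "\<exists>Z. zero_object C Z" by blast
next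
  fix M N f assume o: "M \<in> Obj C" "N \<in> Obj C" and f: "f \<in> Hom C M N"
  show "\<exists>A k. is_kernel C M N f A k" by (rule kernel_ex[OF o f]) (use is_kernelI[OF o _ f] in blast)
  show "\<exists>Q q. is_cokernel C M N f Q q" by (rule cokernel_ex[OF o f]) (use is_cokernelI[OF o _ f] in blast)
next
  fix M N f assume o: "M \<in> Obj C" "N \<in> Obj C" and f: "monomorphism C M N f"
  then have fH: "f \<in> Hom C M N" unfolding monomorphism_def by blast
  obtain Q q where Q: "Q \<in> Obj C" "q \<in> Hom C N Q" "opsurj (U N) (U Q) q"
    "\<And>X. X \<in> S \<Longrightarrow> f X ` car M X = {x \<in> car N X. q X x = nul (U Q) X}" by (fact cokernel_ex[OF o fH])
  have "is_kernel C N Q q M f" by (rule is_kernelI[OF o(2) Q(1) o(1) Q(2) fH mono_inj[OF o f] Q(4)])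
  then show "\<exists>Z\<in>Obj C. \<exists>g\<in>Hom C N Z. is_kernel C N Z g M f" using Q by blast
next
  fix M N f assume o: "M \<in> Obj C" "N \<in> Obj C" and f: "epimorphism C M N f"
  then have fH: "f \<in> Hom C M N" unfolding epimorphism_def by blast
  obtain A k where A: "A \<in> Obj C" "k \<in> Hom C A M" "opinj (U A) k"
    "\<And>X. X \<in> S \<Longrightarrow> k X ` car A X = {x \<in> car M X. f X x = nul (U N) X}" by (fact kernel_ex[OF o fH])
  have "is_cokernel C A M k N f" by (rule is_cokernelI[OF A(1) o A(2) fH epi_surj[OF o f] A(4)])
  then show "\<exists>W\<in>Obj C. \<exists>g\<in>Hom C W M. is_cokernel C W M g N f" using A by blast
qed

end

section \<open>Colimits\<close>

lemma (in abelian_group) minus_eq_zero_iff: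
  assumes "x \<in> carrier G" "y \<in> carrier G" shows "x \<ominus> y = \<zero> \<longleftrightarrow> x = y"
proof
  assume "x \<ominus> y = \<zero>"
  then have "x \<ominus> y \<oplus> y = y" using assms by simp
  then show "x = y" using assms by (simp add: minus_eq a_assoc l_neg)
qed (use assms in \<open>simp add: minus_eq r_neg\<close>)

context opcat
begin

text \<open>The colimit is the direct sum modulo the relations that identify x with its image under
  every arrow of J. Closing \<open>Gn\<close> under the operators does not affect the universal
  property, as kernels of maps are closed under them.\<close>

lemma cocomplete_C: "cocomplete small C"
  unfolding cocomplete_def
proof (intro allI impI)
  fix J :: "('u, 'u) cat" and Fo Fa
  assume JD: "small_category small J \<and> diagram J C Fo Fa"
  interpret D: diagram J C Fo Fa using JD by simp
  have smJ: "small (Obj J)" using JD unfolding small_category_def by simp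
  let ?I = "Obj J" and ?A = "\<lambda>i. U (Fo i)"
  let ?T = "dsum ?I ?A"
  have A: "\<And>i. i \<in> ?I \<Longrightarrow> is_opmod (?A i)" using U_opmod[OF D.Fo_closed] .
  have T: "is_opmod ?T" by (rule is_opmod_dsum) (rule A)
  define \<iota> where "\<iota> i = dinj ?I ?A i" for i
  have \<iota>: "ophom (?A i) ?T (\<iota> i)" if "i \<in> ?I" for i
    unfolding \<iota>_def by (rule ophom_dinj[where A = ?A, OF A that])
  note \<iota>c = ophom_closed[OF \<iota>]
  have Fao: "ophom (?A i) (?A j) (Fa i j a)" if "i \<in> ?I" "j \<in> ?I" "a \<in> Hom J i j" for i j a
    by (rule Hom_ophom[OF D.Fa_closed[OF that] D.Fo_closed[OF that(1)] D.Fo_closed[OF that(2)]])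
  define Gn where "Gn X = {\<iota> j X (Fa i j a X x) \<ominus>\<^bsub>Grp ?T X\<^esub> \<iota> i X x | i j a x.
      i \<in> ?I \<and> j \<in> ?I \<and> a \<in> Hom J i j \<and> x \<in> car (Fo i) X}" for X
  have Gn: "Gn X \<subseteq> el ?T X" if X: "X \<in> S" for X
  proof -
    interpret T: module K "Grp ?T X" by (rule opmod_module[OF T X])
    show ?thesis unfolding Gn_def using \<iota>c ophom_closed[OF Fao] X by (auto intro!: T.minus_closed)
  qed
  obtain L q where L: "L \<in> Obj C" and q: "ophom ?T (U L) q" "opsurj ?T (U L) q"
    and ker: "\<And>X x. \<lbrakk>X \<in> S; x \<in> el ?T X\<rbrakk> \<Longrightarrow> q X x = nul (U L) X \<longleftrightarrow> x \<in> opgen ?T Gn X"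
    using dsum_quot_obj[of ?I Fo, OF small_in_I[OF smJ] D.Fo_closed opsub_opgen[OF T, of Gn]] by blast
  note Lo = U_opmod[OF L]
  define c where "c i = mor (Fo i) (\<lambda>X x. q X (\<iota> i X x))" for i
  have c: "c i \<in> Hom C (Fo i) L" if "i \<in> ?I" for i
    unfolding c_def by (rule mor_Hom[OF D.Fo_closed[OF that] L ophom_compose[OF \<iota>[OF that] q(1)]])
  have capp: "c i X x = q X (\<iota> i X x)" if "X \<in> S" "x \<in> car (Fo i) X" for i X x
    unfolding c_def using that by simp
  have cc: "cocone J C Fo Fa L c" unfolding cocone_def
  proof (intro conjI L ballI c)
    fix i j a assume ij: "i \<in> ?I" "j \<in> ?I" "a \<in> Hom J i j"
    note Fo = D.Fo_closed[OF ij(1)] D.Fo_closed[OF ij(2)]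
    show "Comp C (Fo i) (Fo j) L (c j) (Fa i j a) = c i"
    proof (rule Hom_eqI[OF Comp_Hom[OF Fo L D.Fa_closed[OF ij] c[OF ij(2)]] c[OF ij(1)] Fo(1) L])
      fix X x assume X: "X \<in> S" and x: "x \<in> car (Fo i) X"
      interpret T: module K "Grp ?T X" by (rule opmod_module[OF T X])
      interpret L: module K "Grp (U L) X" by (rule opmod_module[OF Lo X])
      have fx: "Fa i j a X x \<in> car (Fo j) X" by (rule ophom_closed[OF Fao[OF ij] X x])
      have e: "\<iota> j X (Fa i j a X x) \<in> el ?T X" "\<iota> i X x \<in> el ?T X"
        using \<iota>c[OF ij(2) X fx] \<iota>c[OF ij(1) X x] .
      have g: "\<iota> j X (Fa i j a X x) \<ominus>\<^bsub>Grp ?T X\<^esub> \<iota> i X x \<in> Gn X" unfolding Gn_def using ij x by blast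
      then have "q X (\<iota> j X (Fa i j a X x) \<ominus>\<^bsub>Grp ?T X\<^esub> \<iota> i X x) = nul (U L) X"
        using ker[OF X subsetD[OF Gn[OF X] g]] opgen_incl[of X _ Gn, OF X g subsetD[OF Gn[OF X] g]] by simp
      then have "q X (\<iota> j X (Fa i j a X x)) = q X (\<iota> i X x)"
        using linear_map_minus[OF T.module_axioms L.module_axioms ophom_linear[OF q(1) X] e]
          L.minus_eq_zero_iff ophom_closed[OF q(1) X e(1)] ophom_closed[OF q(1) X e(2)] by simp
      then show "Comp C (Fo i) (Fo j) L (c j) (Fa i j a) X x = c i X x"
        by (simp add: Comp_app[OF Fo L X x] capp X x fx)
    qed
  qed
  show "\<exists>L c. is_colimit J C Fo Fa L c"
  proof (intro exI)
    show "is_colimit J C Fo Fa L c" unfolding is_colimit_def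
    proof (intro conjI cc allI impI)
      fix W d assume "cocone J C Fo Fa W d"
      then have W: "W \<in> Obj C" and d: "\<And>i. i \<in> ?I \<Longrightarrow> d i \<in> Hom C (Fo i) W"
        and dd: "\<And>i j a. \<lbrakk>i \<in> ?I; j \<in> ?I; a \<in> Hom J i j\<rbrakk> \<Longrightarrow> Comp C (Fo i) (Fo j) W (d j) (Fa i j a) = d i"
        unfolding cocone_def by auto
      note Wo = U_opmod[OF W]
      have do: "ophom (?A i) (U W) (d i)" if "i \<in> ?I" for i by (rule Hom_ophom[OF d[OF that] D.Fo_closed[OF that] W])
      let ?m = "dmap ?I ?A (U W) d"
      have m\<iota>: "?m X (\<iota> i X x) = d i X x" if "i \<in> ?I" "X \<in> S" "x \<in> car (Fo i) X" for i X x
        unfolding \<iota>_def by (rule ophom_dmap(2)[where A = ?A, OF A Wo do]) (use that in auto)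
      have mo: "ophom ?T (U W) ?m" by (rule ophom_dmap(1)[where A = ?A, OF A Wo do])
      let ?N = "\<lambda>X. {x \<in> el ?T X. ?m X x = nul (U W) X}"
      \<comment> \<open>The cocone condition says precisely that the induced map kills every
        relation.\<close>
      have "Gn X \<subseteq> ?N X" if X: "X \<in> S" for X
      proof
        fix t assume t: "t \<in> Gn X"
        then obtain i j a x where ij: "i \<in> ?I" "j \<in> ?I" "a \<in> Hom J i j" and x: "x \<in> car (Fo i) X"
          and te: "t = \<iota> j X (Fa i j a X x) \<ominus>\<^bsub>Grp ?T X\<^esub> \<iota> i X x" unfolding Gn_def by blast
        interpret T: module K "Grp ?T X" by (rule opmod_module[OF T X])
        interpret W: module K "Grp (U W) X" by (rule opmod_module[OF Wo X])
        have fx: "Fa i j a X x \<in> car (Fo j) X" by (rule ophom_closed[OF Fao[OF ij] X x])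
        have "?m X t = d j X (Fa i j a X x) \<ominus>\<^bsub>Grp (U W) X\<^esub> d i X x"
          unfolding te
          using linear_map_minus[OF T.module_axioms W.module_axioms ophom_linear[OF mo X] \<iota>c[OF ij(2) X fx] \<iota>c[OF ij(1) X x]]
          by (simp add: m\<iota> ij X x fx)
        also have "d j X (Fa i j a X x) = d i X x"
          using dd[OF ij] Comp_app[OF D.Fo_closed[OF ij(1)] D.Fo_closed[OF ij(2)] W X x, of "d j" "Fa i j a"] by simp
        finally have "?m X t = nul (U W) X"
          using W.minus_eq_zero_iff ophom_closed[OF do[OF ij(1)] X x] by simp
        then show "t \<in> ?N X" using Gn[OF X] t by blast
      qed
      from opgen_least[OF opsub_kernel[OF T Wo mo] this]
      have sub: "opgen ?T Gn X \<subseteq> ?N X" if "X \<in> S" for X using that by blast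
      have mz: "?m X x = nul (U W) X" if "X \<in> S" "x \<in> el ?T X" "q X x = nul (U L) X" for X x
        using sub[OF that(1)] ker[OF that(1,2)] that(3) by blast
      obtain u where u: "ophom (U L) (U W) u" "\<And>X x. \<lbrakk>X \<in> S; x \<in> el ?T X\<rbrakk> \<Longrightarrow> u X (q X x) = ?m X x"
        using ophom_lift_surj[OF T Lo Wo q mo mz] by blast
      have mu: "mor L u \<in> Hom C L W" by (rule mor_Hom[OF L W u(1)])
      show "\<exists>!u. u \<in> Hom C L W \<and> (\<forall>i\<in>?I. Comp C (Fo i) L W u (c i) = d i)"
      proof (rule ex1I[of _ "mor L u"])
        show "mor L u \<in> Hom C L W \<and> (\<forall>i\<in>?I. Comp C (Fo i) L W (mor L u) (c i) = d i)"
        proof (intro conjI mu ballI)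
          fix i assume i: "i \<in> ?I"
          note Fo = D.Fo_closed[OF i]
          show "Comp C (Fo i) L W (mor L u) (c i) = d i"
          proof (rule Hom_eqI[OF Comp_Hom[OF Fo L W c[OF i] mu] d[OF i] Fo W])
            fix X x assume X: "X \<in> S" and x: "x \<in> car (Fo i) X"
            have "q X (\<iota> i X x) \<in> car L X" by (rule ophom_closed[OF q(1) X \<iota>c[OF i X x]])
            then show "Comp C (Fo i) L W (mor L u) (c i) X x = d i X x"
              by (simp add: Comp_app[OF Fo L W X x] capp X x u(2) \<iota>c[OF i X x] m\<iota>[OF i X x])
          qed
        qed
        fix v assume v: "v \<in> Hom C L W \<and> (\<forall>i\<in>?I. Comp C (Fo i) L W v (c i) = d i)"
        then have vH: "v \<in> Hom C L W" by blast
        note vo = Hom_ophom[OF vH L W]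
        show "v = mor L u"
        proof (rule Hom_eqI[OF vH mu L W])
          fix X y assume X: "X \<in> S" and y: "y \<in> car L X"
          have "y \<in> q X ` el ?T X" using q(2) X y unfolding opsurj_def by simp
          then obtain t where t: "t \<in> el ?T X" "y = q X t" by blast
          note vq = ophom_compose[OF q(1) vo] and uq = ophom_compose[OF q(1) u(1)]
          \<comment> \<open>A map out of L is determined by its composite with the projection from
            the direct sum, hence by its values on the summands.\<close>
          have "v X (q X t) = u X (q X t)"
          proof (rule dsum_hom_eqI[where A = ?A and u = "\<lambda>X x. v X (q X x)" and v = "\<lambda>X x. u X (q X x)", OF A Wo vq uq _ X t(1)])
            fix i x assume i: "i \<in> ?I" and x: "x \<in> car (Fo i) X"
            have "v X (q X (\<iota> i X x)) = d i X x"
              using v i Comp_app[OF D.Fo_closed[OF i] L W X x, of v "c i"] capp[OF X x] by simp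
            also have "\<dots> = u X (q X (\<iota> i X x))" using u(2)[OF X \<iota>c[OF i X x]] m\<iota>[OF i X x] by simp
            finally show "v X (q X (dinj ?I ?A i X x)) = u X (q X (dinj ?I ?A i X x))" unfolding \<iota>_def .
          qed
          then show "v X y = mor L u X y" using t X y by simp
        qed
      qed
    qed
  qed
qed

text \<open>L is known only by its universal property. By filteredness, the elements that come from
  some stage form a submodule ?N closed under the operators. The projection from L to its quotient
  by ?N and the zero map agree on the cocone, hence coincide, so ?N is everything.\<close>

lemma colimit_elementE:
  assumes dg: "diagram J C Fo Fa" and fl: "filtered J" and col: "is_colimit J C Fo Fa L c"
    and X: "X \<in> S" and y: "y \<in> car L X"
  obtains i x where "i \<in> Obj J" "x \<in> car (Fo i) X" "y = c i X x"
proof -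
  interpret D: diagram J C Fo Fa by fact
  have L: "L \<in> Obj C" and c: "\<And>i. i \<in> Obj J \<Longrightarrow> c i \<in> Hom C (Fo i) L"
    and cc: "\<And>i j a. \<lbrakk>i \<in> Obj J; j \<in> Obj J; a \<in> Hom J i j\<rbrakk> \<Longrightarrow> Comp C (Fo i) (Fo j) L (c j) (Fa i j a) = c i"
    using col unfolding is_colimit_def cocone_def by auto
  have un: "\<exists>!u. u \<in> Hom C L W \<and> (\<forall>i\<in>Obj J. Comp C (Fo i) L W u (c i) = d i)" if "cocone J C Fo Fa W d" for W d
    using col that unfolding is_colimit_def by blast
  note Lo = U_opmod[OF L]
  have co: "ophom (U (Fo i)) (U L) (c i)" if "i \<in> Obj J" for i by (rule Hom_ophom[OF c[OF that] D.Fo_closed[OF that] L])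
  have cF: "c j X (Fa i j a X x) = c i X x" "Fa i j a X x \<in> car (Fo j) X"
    if "i \<in> Obj J" "j \<in> Obj J" "a \<in> Hom J i j" "X \<in> S" "x \<in> car (Fo i) X" for i j a X x
    using cc[OF that(1-3)] Comp_app[OF D.Fo_closed[OF that(1)] D.Fo_closed[OF that(2)] L that(4,5), of "c j" "Fa i j a"]
      Hom_closed[OF D.Fa_closed[OF that(1-3)] D.Fo_closed[OF that(1)] D.Fo_closed[OF that(2)] that(4,5)] by simp_all
  let ?N = "\<lambda>X. {y. \<exists>i\<in>Obj J. \<exists>x\<in>car (Fo i) X. y = c i X x}"
  have N: "opsub (U L) ?N" unfolding opsub_def
  proof (intro conjI ballI)
    fix X assume X: "X \<in> S"
    interpret Lm: module K "Grp (U L) X" by (rule opmod_module[OF Lo X])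
    show "submodule (?N X) K (Grp (U L) X)"
    proof (rule Lm.submodule_memI)
      obtain i where i: "i \<in> Obj J" using fl unfolding filtered_def by blast
      note Fi = U_opmod[OF D.Fo_closed[OF i]]
      show "\<exists>i\<in>Obj J. \<exists>x\<in>car (Fo i) X. nul (U L) X = c i X x"
        using i opmod_zero_closed[OF Fi X] ophom_zero[OF Fi Lo co[OF i] X] by metis
    next
      fix y z assume "\<exists>i\<in>Obj J. \<exists>x\<in>car (Fo i) X. y = c i X x" "\<exists>i\<in>Obj J. \<exists>x\<in>car (Fo i) X. z = c i X x"
      then obtain i j x x' where i: "i \<in> Obj J" "x \<in> car (Fo i) X" "y = c i X x"
        and j: "j \<in> Obj J" "x' \<in> car (Fo j) X" "z = c j X x'" by blast
      obtain k a b where k: "k \<in> Obj J" "a \<in> Hom J i k" "b \<in> Hom J j k" using fl i j unfolding filtered_def by blast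
      interpret Fk: module K "Grp (U (Fo k)) X" by (rule opmod_module[OF U_opmod[OF D.Fo_closed[OF k(1)]] X])
      have "y \<oplus>\<^bsub>Grp (U L) X\<^esub> z = c k X (Fa i k a X x \<oplus>\<^bsub>Grp (U (Fo k)) X\<^esub> Fa j k b X x')"
        using cF[OF i(1) k(1,2) X i(2)] cF[OF j(1) k(1,3) X j(2)] linear_map_add[OF ophom_linear[OF co[OF k(1)] X]] i j by simp
      moreover have "Fa i k a X x \<oplus>\<^bsub>Grp (U (Fo k)) X\<^esub> Fa j k b X x' \<in> car (Fo k) X"
        using cF(2)[OF i(1) k(1,2) X i(2)] cF(2)[OF j(1) k(1,3) X j(2)] by simp
      ultimately show "\<exists>i\<in>Obj J. \<exists>x\<in>car (Fo i) X. y \<oplus>\<^bsub>Grp (U L) X\<^esub> z = c i X x" using k(1) by blast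
    next
      fix r y assume r: "r \<in> carrier K" and "\<exists>i\<in>Obj J. \<exists>x\<in>car (Fo i) X. y = c i X x"
      then obtain i x where i: "i \<in> Obj J" "x \<in> car (Fo i) X" "y = c i X x" by blast
      interpret Fi: module K "Grp (U (Fo i)) X" by (rule opmod_module[OF U_opmod[OF D.Fo_closed[OF i(1)]] X])
      show "\<exists>i\<in>Obj J. \<exists>x\<in>car (Fo i) X. r \<odot>\<^bsub>Grp (U L) X\<^esub> y = c i X x"
        using i r linear_map_smult[OF ophom_linear[OF co[OF i(1)] X] r i(2)] Fi.smult_closed[OF r i(2)] by metis
    next
      fix y assume "\<exists>i\<in>Obj J. \<exists>x\<in>car (Fo i) X. y = c i X x"
      then show "y \<in> car L X" using ophom_closed[OF co X] by blast
    qed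
  next
    fix p y assume p: "p \<in> P" and "y \<in> ?N (src p)"
    then obtain i x where i: "i \<in> Obj J" "x \<in> car (Fo i) (src p)" "y = c i (src p) x" by blast
    then show "Op (U L) p y \<in> ?N (tgt p)"
      using ophom_Op[OF co[OF i(1)] p i(2)] Op_closed[OF U_opmod[OF D.Fo_closed[OF i(1)]] p i(2)] by (metis (mono_tags, lifting) mem_Collect_eq)
  qed
  obtain Q q where Q: "Q \<in> Obj C" and q: "ophom (U L) (U Q) q" "opsurj (U L) (U Q) q"
    and ker: "\<And>X x. \<lbrakk>X \<in> S; x \<in> car L X\<rbrakk> \<Longrightarrow> q X x = nul (U Q) X \<longleftrightarrow> x \<in> ?N X"
    using quot_obj[OF Lo N covered_U[OF L] small_in_U[OF L]] by blast
  define d where "d i = mor (Fo i) (\<lambda>X x. nul (U Q) X)" for i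
  have dH: "d i \<in> Hom C (Fo i) Q" if "i \<in> Obj J" for i unfolding d_def by (rule zero_Hom[OF D.Fo_closed[OF that] Q])
  have "cocone J C Fo Fa Q d" unfolding cocone_def
  proof (intro conjI Q ballI dH)
    fix i j a assume ij: "i \<in> Obj J" "j \<in> Obj J" "a \<in> Hom J i j"
    note Fo = D.Fo_closed[OF ij(1)] D.Fo_closed[OF ij(2)]
    show "Comp C (Fo i) (Fo j) Q (d j) (Fa i j a) = d i"
      by (rule Hom_eqI[OF Comp_Hom[OF Fo Q D.Fa_closed[OF ij] dH[OF ij(2)]] dH[OF ij(1)] Fo(1) Q])
        (simp add: Comp_app[OF Fo Q] d_def cF(2)[OF ij])
  qed
  from un[OF this] have ex1: "\<exists>!u. u \<in> Hom C L Q \<and> (\<forall>i\<in>Obj J. Comp C (Fo i) L Q u (c i) = d i)" .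
  have qH: "mor L q \<in> Hom C L Q" and zH: "mor L (\<lambda>X x. nul (U Q) X) \<in> Hom C L Q"
    using mor_Hom[OF L Q q(1)] zero_Hom[OF L Q] by auto
  have e: "Comp C (Fo i) L Q (mor L q) (c i) = d i" "Comp C (Fo i) L Q (mor L (\<lambda>X x. nul (U Q) X)) (c i) = d i"
    if i: "i \<in> Obj J" for i
  proof -
    note Fo = D.Fo_closed[OF i]
    have "q X (c i X x) = nul (U Q) X" if "X \<in> S" "x \<in> car (Fo i) X" for X x
      using ker[OF that(1) ophom_closed[OF co[OF i] that]] i that by blast
    then show "Comp C (Fo i) L Q (mor L q) (c i) = d i"
      by (intro Hom_eqI[OF Comp_Hom[OF Fo L Q c[OF i] qH] dH[OF i] Fo Q])
        (simp add: Comp_app[OF Fo L Q] d_def ophom_closed[OF co[OF i]])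
    show "Comp C (Fo i) L Q (mor L (\<lambda>X x. nul (U Q) X)) (c i) = d i"
      by (rule Hom_eqI[OF Comp_Hom[OF Fo L Q c[OF i] zH] dH[OF i] Fo Q])
        (simp add: Comp_app[OF Fo L Q] d_def ophom_closed[OF co[OF i]])
  qed
  have "mor L q = mor L (\<lambda>X x. nul (U Q) X)" using ex1 qH zH e by blast
  then have "mor L q X y = nul (U Q) X" using X y by simp
  then have "y \<in> ?N X" using ker[OF X y] X y by simp
  then show thesis using that by blast
qed

end

text \<open>Filteredness treats one parallel pair at a time. A further arrow v keeps equal what w
  has already made equal, so induction works.\<close>

lemma filtered_coequalize:
  assumes "category J" and fl: "filtered J" and E: "finite E" "E \<subseteq> Obj J" and k: "k \<in> Obj J"
    and ab: "\<And>i. i \<in> E \<Longrightarrow> a i \<in> Hom J i k \<and> b i \<in> Hom J i k"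
  shows "\<exists>l\<in>Obj J. \<exists>w\<in>Hom J k l. \<forall>i\<in>E. Comp J i k l w (a i) = Comp J i k l w (b i)"
  using E ab
proof (induction E rule: finite_induct)
  case empty
  then show ?case using k category.Ident_closed[OF assms(1)] by blast
next
  case (insert i E)
  interpret J: category J by fact
  obtain l w where l: "l \<in> Obj J" "w \<in> Hom J k l" "\<forall>i\<in>E. Comp J i k l w (a i) = Comp J i k l w (b i)"
    using insert by auto
  have i: "i \<in> Obj J" "a i \<in> Hom J i k" "b i \<in> Hom J i k" using insert by auto
  have c: "Comp J i k l w (a i) \<in> Hom J i l" "Comp J i k l w (b i) \<in> Hom J i l"
    using J.Comp_closed[OF i(1) k l(1) _ l(2)] i by auto
  obtain m v where m: "m \<in> Obj J" "v \<in> Hom J l m"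
    "Comp J i l m v (Comp J i k l w (a i)) = Comp J i l m v (Comp J i k l w (b i))"
    using fl i l(1) c unfolding filtered_def by blast
  have "Comp J j k m (Comp J k l m v w) (a j) = Comp J j k m (Comp J k l m v w) (b j)" if j: "j \<in> insert i E" for j
  proof -
    have jj: "j \<in> Obj J" "a j \<in> Hom J j k" "b j \<in> Hom J j k" using insert j by auto
    have "Comp J j l m v (Comp J j k l w (a j)) = Comp J j l m v (Comp J j k l w (b j))"
      using j m(3) l(3) by auto
    then show ?thesis
      using J.Comp_assoc[OF jj(1) k l(1) m(1) jj(2) l(2) m(2)] J.Comp_assoc[OF jj(1) k l(1) m(1) jj(3) l(2) m(2)] by simp
  qed
  then show ?case using m(1) J.Comp_closed[OF k l(1) m(1) l(2) m(2)] by blast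
qed

locale filtered_diagram = opcat K S P src tgt small C U + diagram J C Fo Fa
  for K :: "'k ring" and S :: "'o set" and P :: "'p set" and src tgt :: "'p \<Rightarrow> 'o"
    and small :: "'u set \<Rightarrow> bool" and C :: "('a, 'o \<Rightarrow> 'u \<Rightarrow> 'u) cat" and U :: "'a \<Rightarrow> ('o, 'p, 'k, 'u) opmod"
    and J :: "('u, 'u) cat" and Fo Fa +
  assumes fil: "filtered J" and small_J: "small (Obj J)"
begin

abbreviation "V i X \<equiv> Grp (U (Fo i)) X"

lemma Fo_opmod: "i \<in> Obj J \<Longrightarrow> is_opmod (U (Fo i))"
  by (rule U_opmod[OF Fo_closed])

lemma V_module: "\<lbrakk>i \<in> Obj J; X \<in> S\<rbrakk> \<Longrightarrow> module K (V i X)"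
  by (rule opmod_module[OF Fo_opmod])

lemma Fa_ophom: "\<lbrakk>i \<in> Obj J; j \<in> Obj J; a \<in> Hom J i j\<rbrakk> \<Longrightarrow> ophom (U (Fo i)) (U (Fo j)) (Fa i j a)"
  by (rule Hom_ophom[OF Fa_closed Fo_closed Fo_closed])

lemma Fa_comp_app:
  assumes "i \<in> Obj J" "j \<in> Obj J" "k \<in> Obj J" "a \<in> Hom J i j" "b \<in> Hom J j k" "X \<in> S" "x \<in> carrier (V i X)"
  shows "Fa i k (Comp J i j k b a) X x = Fa j k b X (Fa i j a X x)"
  using Fa_Comp[OF assms(1-5)] Comp_app[OF Fo_closed[OF assms(1)] Fo_closed[OF assms(2)] Fo_closed[OF assms(3)] assms(6,7)] by simp

text \<open>A family of elements vanishes in the filtered colimit iff its members can be pushed to one index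
  where they sum to zero.\<close>

definition vanishes_at :: "'o \<Rightarrow> ('u \<Rightarrow> 'u) \<Rightarrow> 'u \<Rightarrow> 'u set \<Rightarrow> ('u \<Rightarrow> 'u) \<Rightarrow> bool" where
  "vanishes_at X t k F a \<longleftrightarrow> k \<in> Obj J \<and> finite F \<and> F \<subseteq> Obj J \<and> (\<forall>i\<in>F. a i \<in> Hom J i k) \<and>
    (\<forall>i\<in>Obj J - F. t i = \<zero>\<^bsub>V i X\<^esub>) \<and> (\<Oplus>\<^bsub>V k X\<^esub>i\<in>F. Fa i k (a i) X (t i)) = \<zero>\<^bsub>V k X\<^esub>"

text \<open>Passing to a later index and adding indices at which t is zero are done together,
  because \<open>vanishes_at_merge\<close> needs both.\<close>

lemma vanishes_at_push:
  assumes X: "X \<in> S" and t: "\<And>i. i \<in> Obj J \<Longrightarrow> t i \<in> carrier (V i X)" and v: "vanishes_at X t k F a"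
    and l: "l \<in> Obj J" "w \<in> Hom J k l" and F2: "finite F2" "F \<subseteq> F2" "F2 \<subseteq> Obj J"
    and b: "\<And>i. i \<in> F2 \<Longrightarrow> b i \<in> Hom J i l" "\<And>i. i \<in> F \<Longrightarrow> b i = Comp J i k l w (a i)"
  shows "vanishes_at X t l F2 b"
proof -
  have k: "k \<in> Obj J" "finite F" "F \<subseteq> Obj J" "\<And>i. i \<in> F \<Longrightarrow> a i \<in> Hom J i k" "\<And>i. i \<in> Obj J - F \<Longrightarrow> t i = \<zero>\<^bsub>V i X\<^esub>"
    and s: "(\<Oplus>\<^bsub>V k X\<^esub>i\<in>F. Fa i k (a i) X (t i)) = \<zero>\<^bsub>V k X\<^esub>" using v unfolding vanishes_at_def by auto
  interpret L: module K "V l X" by (rule V_module[OF l(1) X])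
  have cl: "Fa i k (a i) X (t i) \<in> carrier (V k X)" if "i \<in> F" for i
    using ophom_closed[OF Fa_ophom[OF _ k(1) k(4)[OF that]] X t] that k(3) by blast
  have "(\<Oplus>\<^bsub>V l X\<^esub>i\<in>F2. Fa i l (b i) X (t i)) = (\<Oplus>\<^bsub>V l X\<^esub>i\<in>F. Fa i l (b i) X (t i))"
  proof (rule L.finsum_mono_neutral[OF F2(1,2), symmetric])
    fix i assume i: "i \<in> F2 - F"
    then have iJ: "i \<in> Obj J" "t i = \<zero>\<^bsub>V i X\<^esub>" "b i \<in> Hom J i l" using F2(3) k(5) b(1) by auto
    show "Fa i l (b i) X (t i) = \<zero>\<^bsub>V l X\<^esub>"
      using ophom_zero[OF Fo_opmod[OF iJ(1)] Fo_opmod[OF l(1)] Fa_ophom[OF iJ(1) l(1) iJ(3)] X] iJ(2) by simp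
  next
    fix i assume "i \<in> F"
    then have "i \<in> Obj J" "b i \<in> Hom J i l" using k(3) b(1) F2(2) by auto
    then show "Fa i l (b i) X (t i) \<in> carrier (V l X)" using ophom_closed[OF Fa_ophom[OF _ l(1)] X t] by blast
  qed
  also have "\<dots> = (\<Oplus>\<^bsub>V l X\<^esub>i\<in>F. Fa k l w X (Fa i k (a i) X (t i)))"
  proof (rule L.finsum_cong')
    fix i assume i: "i \<in> F"
    then have iJ: "i \<in> Obj J" using k(3) by blast
    show "Fa i l (b i) X (t i) = Fa k l w X (Fa i k (a i) X (t i))"
      using Fa_comp_app[OF iJ k(1) l(1) k(4)[OF i] l(2) X t[OF iJ]] b(2)[OF i] by simp
  qed (use cl ophom_closed[OF Fa_ophom[OF k(1) l] X] in auto)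
  also have "\<dots> = Fa k l w X (\<Oplus>\<^bsub>V k X\<^esub>i\<in>F. Fa i k (a i) X (t i))"
    by (rule linear_map_finsum[OF V_module[OF k(1) X] V_module[OF l(1) X] ophom_linear[OF Fa_ophom[OF k(1) l] X] k(2) cl, symmetric])
  also have "\<dots> = \<zero>\<^bsub>V l X\<^esub>"
    unfolding s by (rule ophom_zero[OF Fo_opmod[OF k(1)] Fo_opmod[OF l(1)] Fa_ophom[OF k(1) l] X])
  finally show ?thesis unfolding vanishes_at_def using l F2 b(1) k(5) by auto
qed

text \<open>Termwise addition of two null families requires the same arrows for both. A common later
  index is not enough: on the overlap of F and F' the two arrows out of i may differ, and
  \<open>filtered_coequalize\<close> makes them equal.\<close>

lemma vanishes_at_merge:
  assumes X: "X \<in> S" and t: "\<And>i. i \<in> Obj J \<Longrightarrow> t i \<in> carrier (V i X)" "\<And>i. i \<in> Obj J \<Longrightarrow> t' i \<in> carrier (V i X)"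
    and v: "vanishes_at X t k F a" "vanishes_at X t' k' F' a'"
  obtains l F2 b where "vanishes_at X t l F2 b" "vanishes_at X t' l F2 b"
proof -
  have k: "k \<in> Obj J" "finite F" "F \<subseteq> Obj J" "\<And>i. i \<in> F \<Longrightarrow> a i \<in> Hom J i k" using v(1) unfolding vanishes_at_def by auto
  have k': "k' \<in> Obj J" "finite F'" "F' \<subseteq> Obj J" "\<And>i. i \<in> F' \<Longrightarrow> a' i \<in> Hom J i k'" using v(2) unfolding vanishes_at_def by auto
  obtain m u u' where m: "m \<in> Obj J" "u \<in> Hom J k m" "u' \<in> Hom J k' m" using fil k(1) k'(1) unfolding filtered_def by blast
  have ua: "Comp J i k m u (a i) \<in> Hom J i m" if "i \<in> F" for i
    using that k(3) J.Comp_closed[OF _ k(1) m(1) k(4) m(2)] by blast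
  have ua': "Comp J i k' m u' (a' i) \<in> Hom J i m" if "i \<in> F'" for i
    using that k'(3) J.Comp_closed[OF _ k'(1) m(1) k'(4) m(3)] by blast
  obtain l w where l: "l \<in> Obj J" "w \<in> Hom J m l"
    "\<And>i. i \<in> F \<inter> F' \<Longrightarrow> Comp J i m l w (Comp J i k m u (a i)) = Comp J i m l w (Comp J i k' m u' (a' i))"
    using filtered_coequalize[OF J.category_axioms fil, of "F \<inter> F'" m "\<lambda>i. Comp J i k m u (a i)" "\<lambda>i. Comp J i k' m u' (a' i)"]
      k(2,3) m(1) ua ua' by blast
  \<comment> \<open>On the overlap of F and F' both branches agree by the choice of w.\<close>
  define b where "b i = (if i \<in> F then Comp J i m l w (Comp J i k m u (a i)) else Comp J i m l w (Comp J i k' m u' (a' i)))" for i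
  have bH: "b i \<in> Hom J i l" if "i \<in> F \<union> F'" for i
    using that ua ua' J.Comp_closed[OF _ m(1) l(1) _ l(2)] k(3) k'(3) unfolding b_def by auto
  have b1: "b i = Comp J i k l (Comp J k m l w u) (a i)" if "i \<in> F" for i
    using that k J.Comp_assoc[OF _ k(1) m(1) l(1) k(4) m(2) l(2)] unfolding b_def by auto
  have b2: "b i = Comp J i k' l (Comp J k' m l w u') (a' i)" if "i \<in> F'" for i
  proof -
    have "b i = Comp J i m l w (Comp J i k' m u' (a' i))" unfolding b_def using l(3) that by auto
    then show ?thesis using that k' J.Comp_assoc[OF _ k'(1) m(1) l(1) k'(4) m(3) l(2)] by auto
  qed
  show thesis
  proof (rule that)
    show "vanishes_at X t l (F \<union> F') b"
      by (rule vanishes_at_push[OF X t(1) v(1) l(1) J.Comp_closed[OF k(1) m(1) l(1) m(2) l(2)]])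
        (use k k' bH b1 in auto)
    show "vanishes_at X t' l (F \<union> F') b"
      by (rule vanishes_at_push[OF X t(2) v(2) l(1) J.Comp_closed[OF k'(1) m(1) l(1) m(3) l(2)]])
        (use k k' bH b2 in auto)
  qed
qed

abbreviation "T \<equiv> dsum (Obj J) (\<lambda>i. U (Fo i))"

lemma T_opmod: "is_opmod T"
  by (rule is_opmod_dsum) (rule Fo_opmod)

lemma T_sel: "t \<in> el T X \<Longrightarrow> i \<in> Obj J \<Longrightarrow> t i \<in> carrier (V i X)"
  unfolding dsum_sel dsum_module_sel by blast

definition null_families :: "'o \<Rightarrow> ('u \<Rightarrow> 'u) set" where
  "null_families X = {t. t \<in> el T X \<and> (\<exists>k F a. vanishes_at X t k F a)}"

lemma Fa_term_closed:
  "\<lbrakk>vanishes_at X t k F a; X \<in> S; t' \<in> el T X; i \<in> F\<rbrakk> \<Longrightarrow> Fa i k (a i) X (t' i) \<in> carrier (V k X)"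
  unfolding vanishes_at_def using ophom_closed[OF Fa_ophom] T_sel by blast

text \<open>Only addition has to reconcile two sets of data (k, F, a), by
  \<open>vanishes_at_merge\<close>; scalars and operators keep the data.\<close>

lemma opsub_null_families: "opsub T null_families"
  unfolding opsub_def
proof (intro conjI ballI)
  fix X assume X: "X \<in> S"
  interpret Tm: module K "Grp T X" by (rule opmod_module[OF T_opmod X])
  show "submodule (null_families X) K (Grp T X)"
    unfolding null_families_def
  proof (rule Tm.submodule_memI)
    obtain k where k: "k \<in> Obj J" using fil unfolding filtered_def by blast
    interpret Vk: module K "V k X" by (rule V_module[OF k X])
    have "vanishes_at X (nul T X) k {} a" for a
      unfolding vanishes_at_def using k by (simp add: dsum_sel dsum_module_sel)
    then show "nul T X \<in> el T X \<and> (\<exists>k F a. vanishes_at X (nul T X) k F a)" by blast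
  next
    fix s t assume s: "s \<in> el T X \<and> (\<exists>k F a. vanishes_at X s k F a)"
      and t: "t \<in> el T X \<and> (\<exists>k F a. vanishes_at X t k F a)"
    have sc: "s \<in> el T X" and tc: "t \<in> el T X" using s t by auto
    obtain k F a where vs: "vanishes_at X s k F a" using s by blast
    obtain k' F' a' where vt: "vanishes_at X t k' F' a'" using t by blast
    obtain l F b where v: "vanishes_at X s l F b" "vanishes_at X t l F b"
      using vanishes_at_merge[OF X T_sel[OF sc] T_sel[OF tc] vs vt] by blast
    have l: "l \<in> Obj J" "finite F" "F \<subseteq> Obj J" "\<And>i. i \<in> F \<Longrightarrow> b i \<in> Hom J i l"
      using v(1) unfolding vanishes_at_def by auto
    interpret Vl: module K "V l X" by (rule V_module[OF l(1) X])
    have st: "(s \<oplus>\<^bsub>Grp T X\<^esub> t) i = s i \<oplus>\<^bsub>V i X\<^esub> t i" if "i \<in> Obj J" for i using that by (simp add: dsum_sel dsum_module_sel)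
    have "(\<Oplus>\<^bsub>V l X\<^esub>i\<in>F. Fa i l (b i) X ((s \<oplus>\<^bsub>Grp T X\<^esub> t) i)) =
      (\<Oplus>\<^bsub>V l X\<^esub>i\<in>F. Fa i l (b i) X (s i) \<oplus>\<^bsub>V l X\<^esub> Fa i l (b i) X (t i))"
    proof (rule Vl.finsum_cong')
      fix i assume i: "i \<in> F"
      then have iJ: "i \<in> Obj J" using l(3) by blast
      show "Fa i l (b i) X ((s \<oplus>\<^bsub>Grp T X\<^esub> t) i) = Fa i l (b i) X (s i) \<oplus>\<^bsub>V l X\<^esub> Fa i l (b i) X (t i)"
        unfolding st[OF iJ]
        by (rule linear_map_add[OF ophom_linear[OF Fa_ophom[OF iJ l(1) l(4)[OF i]] X]]) (use s t T_sel iJ in auto)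
    qed (use Fa_term_closed[OF v(1) X] s t in auto)
    also have "\<dots> = (\<Oplus>\<^bsub>V l X\<^esub>i\<in>F. Fa i l (b i) X (s i)) \<oplus>\<^bsub>V l X\<^esub> (\<Oplus>\<^bsub>V l X\<^esub>i\<in>F. Fa i l (b i) X (t i))"
      by (rule Vl.finsum_addf) (use Fa_term_closed[OF v(1) X] s t in auto)
    also have "\<dots> = \<zero>\<^bsub>V l X\<^esub>" using v unfolding vanishes_at_def by simp
    finally have "vanishes_at X (s \<oplus>\<^bsub>Grp T X\<^esub> t) l F b"
      unfolding vanishes_at_def using l v st V_module[OF _ X]
      by (auto simp: vanishes_at_def module_def abelian_group_def abelian_monoid.l_zero abelian_monoid.zero_closed)
    then show "s \<oplus>\<^bsub>Grp T X\<^esub> t \<in> el T X \<and> (\<exists>k F a. vanishes_at X (s \<oplus>\<^bsub>Grp T X\<^esub> t) k F a)"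
      using s t by blast
  next
    fix r t assume r: "r \<in> carrier K" and t: "t \<in> el T X \<and> (\<exists>k F a. vanishes_at X t k F a)"
    then obtain l F b where v: "vanishes_at X t l F b" by blast
    have l: "l \<in> Obj J" "finite F" "F \<subseteq> Obj J" "\<And>i. i \<in> F \<Longrightarrow> b i \<in> Hom J i l"
      using v unfolding vanishes_at_def by auto
    interpret Vl: module K "V l X" by (rule V_module[OF l(1) X])
    have rt: "(r \<odot>\<^bsub>Grp T X\<^esub> t) i = r \<odot>\<^bsub>V i X\<^esub> t i" if "i \<in> Obj J" for i using that by (simp add: dsum_sel dsum_module_sel)
    have "(\<Oplus>\<^bsub>V l X\<^esub>i\<in>F. Fa i l (b i) X ((r \<odot>\<^bsub>Grp T X\<^esub> t) i)) = (\<Oplus>\<^bsub>V l X\<^esub>i\<in>F. r \<odot>\<^bsub>V l X\<^esub> Fa i l (b i) X (t i))"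
    proof (rule Vl.finsum_cong')
      fix i assume i: "i \<in> F"
      then have iJ: "i \<in> Obj J" using l(3) by blast
      show "Fa i l (b i) X ((r \<odot>\<^bsub>Grp T X\<^esub> t) i) = r \<odot>\<^bsub>V l X\<^esub> Fa i l (b i) X (t i)"
        unfolding rt[OF iJ]
        by (rule linear_map_smult[OF ophom_linear[OF Fa_ophom[OF iJ l(1) l(4)[OF i]] X] r]) (use t T_sel iJ in auto)
    qed (use Fa_term_closed[OF v X] t r in auto)
    also have "\<dots> = r \<odot>\<^bsub>V l X\<^esub> (\<Oplus>\<^bsub>V l X\<^esub>i\<in>F. Fa i l (b i) X (t i))"
      by (rule Vl.finsum_smult_ldistr[symmetric]) (use Fa_term_closed[OF v X] t r l(2) in auto)
    also have "\<dots> = \<zero>\<^bsub>V l X\<^esub>" using v r unfolding vanishes_at_def by simp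
    finally have "vanishes_at X (r \<odot>\<^bsub>Grp T X\<^esub> t) l F b"
      unfolding vanishes_at_def using l v rt module.smult_r_null[OF V_module[OF _ X] r]
      by (auto simp: vanishes_at_def)
    then show "r \<odot>\<^bsub>Grp T X\<^esub> t \<in> el T X \<and> (\<exists>k F a. vanishes_at X (r \<odot>\<^bsub>Grp T X\<^esub> t) k F a)"
      using r t by blast
  qed simp
next
  fix p t assume p: "p \<in> P" and t: "t \<in> null_families (src p)"
  note s = src_closed[OF p] tgt_closed[OF p]
  have tc: "t \<in> el T (src p)" using t unfolding null_families_def by blast
  obtain l F b where v: "vanishes_at (src p) t l F b" using t unfolding null_families_def by blast
  have l: "l \<in> Obj J" "finite F" "F \<subseteq> Obj J" "\<And>i. i \<in> F \<Longrightarrow> b i \<in> Hom J i l"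
    using v unfolding vanishes_at_def by auto
  note pl = opmod_linear[OF Fo_opmod[OF l(1)] p]
  interpret Vl: module K "V l (tgt p)" by (rule V_module[OF l(1) s(2)])
  have Opt: "Op T p t i = Op (U (Fo i)) p (t i)" if "i \<in> Obj J" for i using that by (simp add: dsum_sel)
  have "(\<Oplus>\<^bsub>V l (tgt p)\<^esub>i\<in>F. Fa i l (b i) (tgt p) (Op T p t i)) =
    (\<Oplus>\<^bsub>V l (tgt p)\<^esub>i\<in>F. Op (U (Fo l)) p (Fa i l (b i) (src p) (t i)))"
  proof (rule Vl.finsum_cong')
    fix i assume i: "i \<in> F"
    then have iJ: "i \<in> Obj J" using l(3) by blast
    show "Fa i l (b i) (tgt p) (Op T p t i) = Op (U (Fo l)) p (Fa i l (b i) (src p) (t i))"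
      unfolding Opt[OF iJ] by (rule ophom_Op[OF Fa_ophom[OF iJ l(1) l(4)[OF i]] p T_sel[OF tc iJ]])
  qed (use Fa_term_closed[OF v s(1) tc] linear_map_closed[OF pl] in auto)
  also have "\<dots> = Op (U (Fo l)) p (\<Oplus>\<^bsub>V l (src p)\<^esub>i\<in>F. Fa i l (b i) (src p) (t i))"
    by (rule linear_map_finsum[OF V_module[OF l(1) s(1)] V_module[OF l(1) s(2)] pl l(2) Fa_term_closed[OF v s(1) tc], symmetric])
  also have "\<dots> = \<zero>\<^bsub>V l (tgt p)\<^esub>" using v Op_zero[OF Fo_opmod[OF l(1)] p] unfolding vanishes_at_def by simp
  finally have "vanishes_at (tgt p) (Op T p t) l F b"
    unfolding vanishes_at_def using l v Opt Op_zero[OF Fo_opmod p] by (auto simp: vanishes_at_def)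
  then show "Op T p t \<in> null_families (tgt p)"
    unfolding null_families_def using Op_closed[OF T_opmod p tc] by blast
qed

definition \<iota> where "\<iota> i = dinj (Obj J) (\<lambda>i. U (Fo i)) i"

lemma \<iota>_ophom: "i \<in> Obj J \<Longrightarrow> ophom (U (Fo i)) T (\<iota> i)"
  unfolding \<iota>_def by (rule ophom_dinj[where A = "\<lambda>i. U (Fo i)", OF Fo_opmod])

lemma \<iota>_app: "j \<in> Obj J \<Longrightarrow> \<iota> i X x j = (if j = i then x else \<zero>\<^bsub>V j X\<^esub>)"
  unfolding \<iota>_def dsum_inj_def by simp

text \<open>These are the relations of the colimit. If i = j, both entries fall into the same
  coordinate of the family, hence the case distinction.\<close>

lemma relation_null:
  assumes X: "X \<in> S" and ij: "i \<in> Obj J" "j \<in> Obj J" "a \<in> Hom J i j" and x: "x \<in> carrier (V i X)"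
  shows "\<iota> j X (Fa i j a X x) \<oplus>\<^bsub>Grp T X\<^esub> \<iota> i X (\<ominus>\<^bsub>V i X\<^esub> x) \<in> null_families X"
proof -
  let ?y = "Fa i j a X x" and ?t = "\<iota> j X (Fa i j a X x) \<oplus>\<^bsub>Grp T X\<^esub> \<iota> i X (\<ominus>\<^bsub>V i X\<^esub> x)"
  interpret Tm: module K "Grp T X" by (rule opmod_module[OF T_opmod X])
  interpret Vi: module K "V i X" by (rule V_module[OF ij(1) X])
  interpret Vj: module K "V j X" by (rule V_module[OF ij(2) X])
  have y: "?y \<in> carrier (V j X)" by (rule ophom_closed[OF Fa_ophom[OF ij] X x])
  have tc: "?t \<in> el T X"
    using ophom_closed[OF \<iota>_ophom[OF ij(2)] X y] ophom_closed[OF \<iota>_ophom[OF ij(1)] X] x by simp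
  have t: "?t l = (if l = j then ?y else \<zero>\<^bsub>V l X\<^esub>) \<oplus>\<^bsub>V l X\<^esub> (if l = i then \<ominus>\<^bsub>V i X\<^esub> x else \<zero>\<^bsub>V l X\<^esub>)" if "l \<in> Obj J" for l
    using that \<iota>_app[OF that] by (simp add: dsum_sel dsum_module_sel)
  have t0: "?t l = \<zero>\<^bsub>V l X\<^esub>" if "l \<in> Obj J - {i, j}" for l
    using that t[of l] V_module[OF _ X, of l] by (simp add: module_def abelian_group_def abelian_monoid.l_zero abelian_monoid.zero_closed)
  have "\<exists>k F a. vanishes_at X ?t k F a"
  proof (cases "i = j")
    case True
    \<comment> \<open>An endomorphism a of i need not be the identity; c equalizes the two, and the
      difference of a(x) and x vanishes at k.\<close>
    obtain k c where k: "k \<in> Obj J" "c \<in> Hom J i k" "Comp J i i k c a = Comp J i i k c (Ident J i)"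
      using fil ij J.Ident_closed[OF ij(1)] unfolding filtered_def True by blast
    interpret Vk: module K "V k X" by (rule V_module[OF k(1) X])
    have aii: "a \<in> Hom J i i" using ij True by simp
    have cx: "Fa i k c X x \<in> carrier (V k X)" by (rule ophom_closed[OF Fa_ophom[OF ij(1) k(1,2)] X x])
    have ti: "?t i = Fa i i a X x \<oplus>\<^bsub>V i X\<^esub> \<ominus>\<^bsub>V i X\<^esub> x" using t[OF ij(1)] True by simp
    have "Fa i k c X (Fa i i a X x) = Fa i k c X x"
      using Fa_comp_app[OF ij(1) ij(1) k(1) aii k(2) X x] k(3) J.Comp_Ident_right[OF ij(1) k(1,2)] by simp
    then have "Fa i k c X (?t i) = \<zero>\<^bsub>V k X\<^esub>" unfolding ti
      using y True x linear_map_add[OF ophom_linear[OF Fa_ophom[OF ij(1) k(1,2)] X]]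
        linear_map_a_inv[OF Vi.module_axioms Vk.module_axioms ophom_linear[OF Fa_ophom[OF ij(1) k(1,2)] X] x] cx
      by (simp add: Vk.r_neg)
    then have "vanishes_at X ?t k {i} (\<lambda>_. c)"
      unfolding vanishes_at_def using k ij t0 True by simp
    then show ?thesis by blast
  next
    case False
    have ti: "?t i = \<ominus>\<^bsub>V i X\<^esub> x" "?t j = ?y" using t[OF ij(1)] t[OF ij(2)] False x y by simp_all
    \<comment> \<open>Both entries are pushed to j, one along a and the other along the identity;
      there they cancel.\<close>
    let ?b = "\<lambda>l. if l = i then a else Ident J j"
    have "Fa j j (Ident J j) X ?y = ?y" using Fa_Ident[OF ij(2)] Ident_app[OF Fo_closed[OF ij(2)] X y] by simp
    then have "(\<Oplus>\<^bsub>V j X\<^esub>l\<in>{i, j}. Fa l j (?b l) X (?t l)) = \<zero>\<^bsub>V j X\<^esub>"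
      using False y ti linear_map_a_inv[OF Vi.module_axioms Vj.module_axioms ophom_linear[OF Fa_ophom[OF ij] X] x]
      by (simp add: Vj.l_neg)
    then have "vanishes_at X ?t j {i, j} ?b"
      unfolding vanishes_at_def using ij t0 J.Ident_closed by auto
    then show ?thesis by blast
  qed
  then show ?thesis unfolding null_families_def using tc by blast
qed

text \<open>The quotient of the direct sum by the null families carries a cocone, so L maps to it,
  and c i x = 0 makes the family with the single entry x null. The arrow along which x vanishes is
  read off from this. Only a map out of L is needed, not an explicit description of L.\<close>

lemma colimit_zero:
  assumes col: "is_colimit J C Fo Fa L c" and X: "X \<in> S" and i: "i \<in> Obj J" and x: "x \<in> carrier (V i X)"
    and z: "c i X x = nul (U L) X"
  obtains k a where "k \<in> Obj J" "a \<in> Hom J i k" "Fa i k a X x = \<zero>\<^bsub>V k X\<^esub>"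
proof -
  have L: "L \<in> Obj C" and c: "\<And>i. i \<in> Obj J \<Longrightarrow> c i \<in> Hom C (Fo i) L" using col unfolding is_colimit_def cocone_def by auto
  obtain Q q where Q: "Q \<in> Obj C" and q: "ophom T (U Q) q" "opsurj T (U Q) q"
    and ker: "\<And>X x. \<lbrakk>X \<in> S; x \<in> el T X\<rbrakk> \<Longrightarrow> q X x = nul (U Q) X \<longleftrightarrow> x \<in> null_families X"
    using dsum_quot_obj[of "Obj J" Fo, OF small_in_I[OF small_J] Fo_closed opsub_null_families] by blast
  note Qo = U_opmod[OF Q]
  define d where "d i = mor (Fo i) (\<lambda>X x. q X (\<iota> i X x))" for i
  have d: "d i \<in> Hom C (Fo i) Q" if "i \<in> Obj J" for i
    unfolding d_def by (rule mor_Hom[OF Fo_closed[OF that] Q ophom_compose[OF \<iota>_ophom[OF that] q(1)]])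
  have dapp: "d i X x = q X (\<iota> i X x)" if "X \<in> S" "x \<in> carrier (V i X)" for i X x
    unfolding d_def using that by simp
  have "cocone J C Fo Fa Q d" unfolding cocone_def
  proof (intro conjI Q ballI d)
    fix i j a assume ij: "i \<in> Obj J" "j \<in> Obj J" "a \<in> Hom J i j"
    note Fo = Fo_closed[OF ij(1)] Fo_closed[OF ij(2)]
    show "Comp C (Fo i) (Fo j) Q (d j) (Fa i j a) = d i"
    proof (rule Hom_eqI[OF Comp_Hom[OF Fo Q Fa_closed[OF ij] d[OF ij(2)]] d[OF ij(1)] Fo(1) Q])
      fix X x assume X: "X \<in> S" and x: "x \<in> carrier (V i X)"
      interpret Tm: module K "Grp T X" by (rule opmod_module[OF T_opmod X])
      interpret Qm: module K "Grp (U Q) X" by (rule opmod_module[OF Qo X])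
      interpret Vi: module K "V i X" by (rule V_module[OF ij(1) X])
      have fx: "Fa i j a X x \<in> carrier (V j X)" by (rule ophom_closed[OF Fa_ophom[OF ij] X x])
      have e: "\<iota> j X (Fa i j a X x) \<in> el T X" "\<iota> i X x \<in> el T X"
        using ophom_closed[OF \<iota>_ophom[OF ij(2)] X fx] ophom_closed[OF \<iota>_ophom[OF ij(1)] X x] .
      have "\<iota> i X (\<ominus>\<^bsub>V i X\<^esub> x) = \<ominus>\<^bsub>Grp T X\<^esub> \<iota> i X x"
        by (rule linear_map_a_inv[OF Vi.module_axioms Tm.module_axioms ophom_linear[OF \<iota>_ophom[OF ij(1)] X] x])
      then have "\<iota> j X (Fa i j a X x) \<ominus>\<^bsub>Grp T X\<^esub> \<iota> i X x \<in> null_families X"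
        using relation_null[OF X ij x] by (simp add: Tm.minus_eq)
      then have "q X (\<iota> j X (Fa i j a X x) \<ominus>\<^bsub>Grp T X\<^esub> \<iota> i X x) = nul (U Q) X"
        using ker[OF X] e by simp
      then have "q X (\<iota> j X (Fa i j a X x)) = q X (\<iota> i X x)"
        using linear_map_minus[OF Tm.module_axioms Qm.module_axioms ophom_linear[OF q(1) X] e]
          Qm.minus_eq_zero_iff ophom_closed[OF q(1) X e(1)] ophom_closed[OF q(1) X e(2)] by simp
      then show "Comp C (Fo i) (Fo j) Q (d j) (Fa i j a) X x = d i X x"
        by (simp add: Comp_app[OF Fo Q X x] dapp X x fx)
    qed
  qed
  then obtain u where u: "u \<in> Hom C L Q" "\<And>i. i \<in> Obj J \<Longrightarrow> Comp C (Fo i) L Q u (c i) = d i"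
    using col unfolding is_colimit_def by blast
  have "q X (\<iota> i X x) = u X (c i X x)"
    using u(2)[OF i] Comp_app[OF Fo_closed[OF i] L Q X x, of u "c i"] dapp[OF X x] by simp
  also have "\<dots> = nul (U Q) X" unfolding z by (rule ophom_zero[OF U_opmod[OF L] Qo Hom_ophom[OF u(1) L Q] X])
  finally have "\<iota> i X x \<in> null_families X" using ker[OF X ophom_closed[OF \<iota>_ophom[OF i] X x]] by simp
  then obtain k F a where v: "vanishes_at X (\<iota> i X x) k F a" unfolding null_families_def by blast
  have k: "k \<in> Obj J" "finite F" "F \<subseteq> Obj J" "\<And>i. i \<in> F \<Longrightarrow> a i \<in> Hom J i k"
    and nz: "\<And>l. l \<in> Obj J - F \<Longrightarrow> \<iota> i X x l = \<zero>\<^bsub>V l X\<^esub>"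
    and s: "(\<Oplus>\<^bsub>V k X\<^esub>l\<in>F. Fa l k (a l) X (\<iota> i X x l)) = \<zero>\<^bsub>V k X\<^esub>" using v unfolding vanishes_at_def by auto
  show thesis
  proof (cases "i \<in> F")
    case True
    interpret Vk: module K "V k X" by (rule V_module[OF k(1) X])
    have fx: "Fa i k (a i) X x \<in> carrier (V k X)" by (rule ophom_closed[OF Fa_ophom[OF i k(1) k(4)[OF True]] X x])
    have "(\<Oplus>\<^bsub>V k X\<^esub>l\<in>{i}. Fa l k (a l) X (\<iota> i X x l)) = (\<Oplus>\<^bsub>V k X\<^esub>l\<in>F. Fa l k (a l) X (\<iota> i X x l))"
    proof (rule Vk.finsum_mono_neutral[OF k(2)])
      fix l assume l: "l \<in> F - {i}"
      then have lJ: "l \<in> Obj J" "a l \<in> Hom J l k" using k(3,4) by auto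
      then show "Fa l k (a l) X (\<iota> i X x l) = \<zero>\<^bsub>V k X\<^esub>"
        using \<iota>_app[OF lJ(1), of i X x] l ophom_zero[OF Fo_opmod[OF lJ(1)] Fo_opmod[OF k(1)] Fa_ophom[OF lJ(1) k(1) lJ(2)] X] by simp
    qed (use True fx \<iota>_app[OF i, of i X x] in auto)
    then have "Fa i k (a i) X x = \<zero>\<^bsub>V k X\<^esub>" using s fx \<iota>_app[OF i, of i X x] by simp
    then show thesis using that k True by blast
  next
    \<comment> \<open>A null family vanishes outside F, so x is zero already at its own
      index.\<close>
    case False
    then have "x = \<zero>\<^bsub>V i X\<^esub>" using nz[of i] i \<iota>_app[OF i, of i X x] by simp
    then have "Fa i i (Ident J i) X x = \<zero>\<^bsub>V i X\<^esub>"
      using Fa_Ident[OF i] Ident_app[OF Fo_closed[OF i] X x] by simp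
    then show thesis using that[OF i J.Ident_closed[OF i]] by blast
  qed
qed

end

context opcat
begin

text \<open>An element chase: every element of a filtered colimit comes from a stage, by
  \<open>colimit_elementE\<close>, and an element that dies in the colimit dies at a later stage, by
  \<open>colimit_zero\<close>. Exactness at the stages does the rest.\<close>

lemma filtered_colimits_exact_C: "filtered_colimits_exact small C"
  unfolding filtered_colimits_exact_def
proof (intro allI impI, elim conjE)
  fix J :: "('u, 'u) cat" and Fo Fa Go Ga Ho Ha s t A a B b E e f g
  assume sJ: "small_category small J" and fl: "filtered J"
    and dF: "diagram J C Fo Fa" and dG: "diagram J C Go Ga" and dH: "diagram J C Ho Ha"
    and ns: "nat_trans J C Fo Fa Go Ga s" and nt: "nat_trans J C Go Ga Ho Ha t"
    and se: "\<forall>i\<in>Obj J. short_exact C (Fo i) (Go i) (Ho i) (s i) (t i)"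
    and cA: "is_colimit J C Fo Fa A a" and cB: "is_colimit J C Go Ga B b" and cE: "is_colimit J C Ho Ha E e"
    and f: "f \<in> Hom C A B" and fs: "\<forall>i\<in>Obj J. Comp C (Fo i) A B f (a i) = Comp C (Fo i) (Go i) B (b i) (s i)"
    and g: "g \<in> Hom C B E" and gt: "\<forall>i\<in>Obj J. Comp C (Go i) B E g (b i) = Comp C (Go i) (Ho i) E (e i) (t i)"
  have smJ: "small (Obj J)" using sJ unfolding small_category_def by blast
  interpret F: filtered_diagram K S P src tgt small C U J Fo Fa
    by (rule filtered_diagram.intro[OF opcat_axioms dF]) (unfold_locales, rule fl, rule smJ)
  interpret G: filtered_diagram K S P src tgt small C U J Go Ga
    by (rule filtered_diagram.intro[OF opcat_axioms dG]) (unfold_locales, rule fl, rule smJ)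
  interpret H: filtered_diagram K S P src tgt small C U J Ho Ha
    by (rule filtered_diagram.intro[OF opcat_axioms dH]) (unfold_locales, rule fl, rule smJ)
  have A: "A \<in> Obj C" and aH: "\<And>i. i \<in> Obj J \<Longrightarrow> a i \<in> Hom C (Fo i) A" 
    and aF: "\<And>i j c. \<lbrakk>i \<in> Obj J; j \<in> Obj J; c \<in> Hom J i j\<rbrakk> \<Longrightarrow> Comp C (Fo i) (Fo j) A (a j) (Fa i j c) = a i"
    using cA unfolding is_colimit_def cocone_def by auto
  have B: "B \<in> Obj C" and bH: "\<And>i. i \<in> Obj J \<Longrightarrow> b i \<in> Hom C (Go i) B"
    and bG: "\<And>i j c. \<lbrakk>i \<in> Obj J; j \<in> Obj J; c \<in> Hom J i j\<rbrakk> \<Longrightarrow> Comp C (Go i) (Go j) B (b j) (Ga i j c) = b i"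
    using cB unfolding is_colimit_def cocone_def by auto
  have E: "E \<in> Obj C" and eH: "\<And>i. i \<in> Obj J \<Longrightarrow> e i \<in> Hom C (Ho i) E" using cE unfolding is_colimit_def cocone_def by auto
  have sH: "\<And>i. i \<in> Obj J \<Longrightarrow> s i \<in> Hom C (Fo i) (Go i)"
    and sn: "\<And>i j c. \<lbrakk>i \<in> Obj J; j \<in> Obj J; c \<in> Hom J i j\<rbrakk> \<Longrightarrow>
        Comp C (Fo i) (Fo j) (Go j) (s j) (Fa i j c) = Comp C (Fo i) (Go i) (Go j) (Ga i j c) (s i)"
    using ns unfolding nat_trans_def by auto
  have tH: "\<And>i. i \<in> Obj J \<Longrightarrow> t i \<in> Hom C (Go i) (Ho i)"
    and tn: "\<And>i j c. \<lbrakk>i \<in> Obj J; j \<in> Obj J; c \<in> Hom J i j\<rbrakk> \<Longrightarrow>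
        Comp C (Go i) (Go j) (Ho j) (t j) (Ga i j c) = Comp C (Go i) (Ho i) (Ho j) (Ha i j c) (t i)"
    using nt unfolding nat_trans_def by auto
  note Fo = F.Fo_closed and Go = G.Fo_closed and Ho = H.Fo_closed
  have k: "is_kernel C (Go i) (Ho i) (t i) (Fo i) (s i)" "is_cokernel C (Fo i) (Go i) (s i) (Ho i) (t i)" if "i \<in> Obj J" for i
    using se that unfolding short_exact_def by auto
  have sinj: "x = nul (U (Fo i)) X" if "i \<in> Obj J" "X \<in> S" "x \<in> car (Fo i) X" "s i X x = nul (U (Go i)) X" for i X x
    using opinj_zero_iff[OF U_opmod[OF Fo] U_opmod[OF Go] Hom_ophom[OF sH Fo Go] is_kernelD(3)[OF Go Ho tH k(1)]] that by simp
  have sim: "s i X ` car (Fo i) X = {x \<in> car (Go i) X. t i X x = nul (U (Ho i)) X}" if "i \<in> Obj J" "X \<in> S" for i X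
    by (rule is_kernelD(4)[OF Go Ho tH k(1)]) (use that in auto)
  have tsurj: "t i X ` car (Go i) X = car (Ho i) X" if "i \<in> Obj J" "X \<in> S" for i X
    using is_cokernelD(3)[OF Fo Go sH k(2)] that unfolding opsurj_def by blast
  have sc: "s i X x \<in> car (Go i) X" if "i \<in> Obj J" "X \<in> S" "x \<in> car (Fo i) X" for i X x
    using Hom_closed[OF sH Fo Go] that by blast
  have tc: "t i X x \<in> car (Ho i) X" if "i \<in> Obj J" "X \<in> S" "x \<in> car (Go i) X" for i X x
    using Hom_closed[OF tH Go Ho] that by blast
  have fa: "f X (a i X x) = b i X (s i X x)" if "i \<in> Obj J" "X \<in> S" "x \<in> car (Fo i) X" for i X x
    using fs that Comp_app[OF Fo A B, of i X x f "a i"] Comp_app[OF Fo Go B, of i i X x "b i" "s i"] by simp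
  have gb: "g X (b i X x) = e i X (t i X x)" if "i \<in> Obj J" "X \<in> S" "x \<in> car (Go i) X" for i X x
    using gt that Comp_app[OF Go B E, of i X x g "b i"] Comp_app[OF Go Ho E, of i i X x "e i" "t i"] by simp
  have aFx: "a j X (Fa i j c X x) = a i X x" if "i \<in> Obj J" "j \<in> Obj J" "c \<in> Hom J i j" "X \<in> S" "x \<in> car (Fo i) X" for i j c X x
    using aF[OF that(1-3)] Comp_app[OF Fo Fo A, of i j X x "a j" "Fa i j c"] that by simp
  have bGx: "b j X (Ga i j c X x) = b i X x" if "i \<in> Obj J" "j \<in> Obj J" "c \<in> Hom J i j" "X \<in> S" "x \<in> car (Go i) X" for i j c X x
    using bG[OF that(1-3)] Comp_app[OF Go Go B, of i j X x "b j" "Ga i j c"] that by simp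
  have snx: "s j X (Fa i j c X x) = Ga i j c X (s i X x)" if "i \<in> Obj J" "j \<in> Obj J" "c \<in> Hom J i j" "X \<in> S" "x \<in> car (Fo i) X" for i j c X x
    using sn[OF that(1-3)] Comp_app[OF Fo Fo Go, of i j j X x "s j" "Fa i j c"] Comp_app[OF Fo Go Go, of i i j X x "Ga i j c" "s i"] that by simp
  have tnx: "t j X (Ga i j c X x) = Ha i j c X (t i X x)" if "i \<in> Obj J" "j \<in> Obj J" "c \<in> Hom J i j" "X \<in> S" "x \<in> car (Go i) X" for i j c X x
    using tn[OF that(1-3)] Comp_app[OF Go Go Ho, of i j j X x "t j" "Ga i j c"] Comp_app[OF Go Ho Ho, of i i j X x "Ha i j c" "t i"] that by simp
  have fz: "f X (nul (U A) X) = nul (U B) X" if "X \<in> S" for X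
    by (rule ophom_zero[OF U_opmod[OF A] U_opmod[OF B] Hom_ophom[OF f A B] that])
  have finj: "opinj (U A) f"
    unfolding opinj_iff[OF U_opmod[OF A] U_opmod[OF B] Hom_ophom[OF f A B]]
  proof (intro ballI impI)
    fix X y assume X: "X \<in> S" and y: "y \<in> car A X" and z: "f X y = nul (U B) X"
    obtain i x where i: "i \<in> Obj J" and x: "x \<in> car (Fo i) X" "y = a i X x" by (rule colimit_elementE[OF dF fl cA X y])
    have "b i X (s i X x) = nul (U B) X" using z fa[OF i X x(1)] x(2) by simp
    \<comment> \<open>s(x) is zero in the colimit and hence at some stage j. There s is injective,
      so x dies at j as well.\<close>
    then obtain j c where j: "j \<in> Obj J" "c \<in> Hom J i j" "Ga i j c X (s i X x) = nul (U (Go j)) X"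
      using G.colimit_zero[OF cB X i sc[OF i X x(1)]] by blast
    have Fx: "Fa i j c X x \<in> car (Fo j) X" by (rule ophom_closed[OF F.Fa_ophom[OF i j(1,2)] X x(1)])
    have "Fa i j c X x = nul (U (Fo j)) X"
      using sinj[OF j(1) X Fx] snx[OF i j(1,2) X x(1)] j(3) by simp
    then have "y = a j X (nul (U (Fo j)) X)" using aFx[OF i j(1,2) X x(1)] x(2) by simp
    then show "y = nul (U A) X"
      using ophom_zero[OF U_opmod[OF Fo[OF j(1)]] U_opmod[OF A] Hom_ophom[OF aH[OF j(1)] Fo[OF j(1)] A] X] by simp
  qed
  have im: "f X ` car A X = {y \<in> car B X. g X y = nul (U E) X}" if X: "X \<in> S" for X
  proof (intro Set.set_eqI iffI)
    fix y assume "y \<in> f X ` car A X"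
    then obtain w where w: "w \<in> car A X" "y = f X w" by blast
    obtain i x where i: "i \<in> Obj J" and x: "x \<in> car (Fo i) X" "w = a i X x" by (rule colimit_elementE[OF dF fl cA X w(1)])
    have "s i X x \<in> {x \<in> car (Go i) X. t i X x = nul (U (Ho i)) X}" using sim[OF i X] x(1) by blast
    then have "t i X (s i X x) = nul (U (Ho i)) X" by blast
    then have "g X y = nul (U E) X"
      using gb[OF i X sc[OF i X x(1)]] fa[OF i X x(1)] x(2) w(2)
        ophom_zero[OF U_opmod[OF Ho[OF i]] U_opmod[OF E] Hom_ophom[OF eH[OF i] Ho[OF i] E] X] by simp
    then show "y \<in> {y \<in> car B X. g X y = nul (U E) X}" using w Hom_closed[OF f A B X] by simp
  next
    fix y assume "y \<in> {y \<in> car B X. g X y = nul (U E) X}"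
    then have y: "y \<in> car B X" "g X y = nul (U E) X" by auto
    obtain i x where i: "i \<in> Obj J" and x: "x \<in> car (Go i) X" "y = b i X x" by (rule colimit_elementE[OF dG fl cB X y(1)])
    have "e i X (t i X x) = nul (U E) X" using gb[OF i X x(1)] x(2) y(2) by simp
    \<comment> \<open>x comes from the first diagram only after it has been moved to a stage where
      t(x) is zero.\<close>
    then obtain j c where j: "j \<in> Obj J" "c \<in> Hom J i j" "Ha i j c X (t i X x) = nul (U (Ho j)) X"
      using H.colimit_zero[OF cE X i tc[OF i X x(1)]] by blast
    have Gx: "Ga i j c X x \<in> car (Go j) X" by (rule ophom_closed[OF G.Fa_ophom[OF i j(1,2)] X x(1)])
    have "Ga i j c X x \<in> s j X ` car (Fo j) X" unfolding sim[OF j(1) X] using Gx tnx[OF i j(1,2) X x(1)] j(3) by simp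
    then obtain w where w: "w \<in> car (Fo j) X" "Ga i j c X x = s j X w" by blast
    have "y = b j X (s j X w)" using bGx[OF i j(1,2) X x(1)] x(2) w(2) by simp
    then have "y = f X (a j X w)" using fa[OF j(1) X w(1)] by simp
    then show "y \<in> f X ` car A X" using Hom_closed[OF aH[OF j(1)] Fo[OF j(1)] A X w(1)] by blast
  qed
  have gsurj: "opsurj (U B) (U E) g" unfolding opsurj_def
  proof (intro ballI Set.set_eqI iffI)
    fix X y assume X: "X \<in> S" and "y \<in> g X ` car B X"
    then show "y \<in> car E X" using Hom_closed[OF g B E X] by blast
  next
    fix X y assume X: "X \<in> S" and y: "y \<in> car E X"
    obtain i x where i: "i \<in> Obj J" and x: "x \<in> car (Ho i) X" "y = e i X x" by (rule colimit_elementE[OF dH fl cE X y])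
    obtain w where w: "w \<in> car (Go i) X" "x = t i X w" using tsurj[OF i X] x(1) by blast
    have "y = g X (b i X w)" using gb[OF i X w(1)] w x by simp
    then show "y \<in> g X ` car B X" using Hom_closed[OF bH[OF i] Go[OF i] B X w(1)] by blast
  qed
  show "short_exact C A B E f g" unfolding short_exact_def
    using is_kernelI[OF B E A g f finj im] is_cokernelI[OF A B E f g gsurj im] by blast
qed

text \<open>The generator is the direct sum of all \<Gamma> i. Arrows that agree after every map
  from it agree at every element, since each element is reached from some summand.\<close>

lemma generator_ex: "\<exists>G. is_generator C G"
proof -
  obtain I \<Gamma> where g: "small I" "\<forall>i\<in>I. \<Gamma> i \<in> Obj C" "\<forall>M\<in>Obj C. \<forall>X\<in>S. \<forall>m\<in>car M X.
      \<exists>i\<in>I. \<exists>\<eta>. ophom (U (\<Gamma> i)) (U M) \<eta> \<and> m \<in> \<eta> X ` car (\<Gamma> i) X"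
    using generators by (elim exE conjE) (rule that)
  have I: "small I" "\<And>i. i \<in> I \<Longrightarrow> \<Gamma> i \<in> Obj C" using g(1,2) by auto
  have gen: "\<exists>i\<in>I. \<exists>\<eta>. ophom (U (\<Gamma> i)) (U M) \<eta> \<and> m \<in> \<eta> X ` car (\<Gamma> i) X"
    if "M \<in> Obj C" "X \<in> S" "m \<in> car M X" for M X m
    by (rule g(3)[rule_format, OF that])
  let ?A = "\<lambda>i. U (\<Gamma> i)"
  let ?T = "dsum I ?A"
  have A: "\<And>i. i \<in> I \<Longrightarrow> is_opmod (?A i)" using U_opmod[OF I(2)] .
  have T: "is_opmod ?T" by (rule is_opmod_dsum) (rule A)
  obtain Q q where Q: "Q \<in> Obj C" and q: "ophom ?T (U Q) q" "opsurj ?T (U Q) q"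
    and ker: "\<And>X x. \<lbrakk>X \<in> S; x \<in> el ?T X\<rbrakk> \<Longrightarrow> q X x = nul (U Q) X \<longleftrightarrow> x \<in> {nul ?T X}"
    using dsum_quot_obj[of I \<Gamma>, OF small_in_I[OF I(1)] I(2) opsub_zero[OF T]] by blast
  note Qo = U_opmod[OF Q]
  have "is_generator C Q" unfolding is_generator_def
  proof (intro conjI Q ballI impI)
    fix M N f g assume M: "M \<in> Obj C" and N: "N \<in> Obj C" and f: "f \<in> Hom C M N" and g: "g \<in> Hom C M N"
      and eq: "\<forall>h\<in>Hom C Q M. Comp C Q M N f h = Comp C Q M N g h"
    note Mo = U_opmod[OF M]
    show "f = g"
    proof (rule Hom_eqI[OF f g M N])
      fix X m assume X: "X \<in> S" and m: "m \<in> car M X"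
      obtain i \<eta> y where i: "i \<in> I" and \<eta>: "ophom (?A i) (U M) \<eta>" and y: "y \<in> car (\<Gamma> i) X" "m = \<eta> X y"
        using gen[OF M X m] by blast
      \<comment> \<open>The map from one summand is extended by zero to the whole direct
        sum.\<close>
      define \<theta> where "\<theta> j = (if j = i then \<eta> else (\<lambda>X x. nul (U M) X))" for j
      have \<theta>: "ophom (?A j) (U M) (\<theta> j)" for j unfolding \<theta>_def using \<eta> ophom_const_zero[OF Mo, of "?A j"] by simp
      let ?m = "dmap I ?A (U M) \<theta>"
      have mo: "ophom ?T (U M) ?m" by (rule ophom_dmap(1)[where A = ?A, OF A Mo \<theta>])
      have mz: "?m X x = nul (U M) X" if "X \<in> S" "x \<in> el ?T X" "q X x = nul (U Q) X" for X x
        using ker[OF that(1,2)] that(3) ophom_zero[OF T Mo mo that(1)] by simp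
      obtain u where u: "ophom (U Q) (U M) u" "\<And>X x. \<lbrakk>X \<in> S; x \<in> el ?T X\<rbrakk> \<Longrightarrow> u X (q X x) = ?m X x"
        using ophom_lift_surj[OF T Qo Mo q mo mz] by blast
      let ?z = "dinj I ?A i X y"
      have z: "?z \<in> el ?T X"
        by (rule ophom_closed[OF ophom_dinj[where A = ?A, OF A i] X y(1)])
      have qz: "q X ?z \<in> car Q X" by (rule ophom_closed[OF q(1) X z])
      have "?m X ?z = \<theta> i X y" by (rule ophom_dmap(2)[where A = ?A, OF A Mo \<theta>]) (use i X y(1) in auto)
      then have uz: "u X (q X ?z) = m" using u(2)[OF X z] y(2) unfolding \<theta>_def by simp
      have "Comp C Q M N f (mor Q u) X (q X ?z) = Comp C Q M N g (mor Q u) X (q X ?z)"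
        using eq mor_Hom[OF Q M u(1)] by simp
      then show "f X m = g X m" using Comp_app[OF Q M N X qz] uz X qz by simp
    qed
  qed
  then show ?thesis by blast
qed

theorem grothendieck_C: "grothendieck_category small C"
  unfolding grothendieck_category_def
  using abelian_C cocomplete_C filtered_colimits_exact_C generator_ex by blast

end

section \<open>Tensor products\<close>

lemma free_module_sel:
  "r \<in> carrier (free_module K S) \<longleftrightarrow> finite {s. r s \<noteq> \<zero>\<^bsub>K\<^esub>} \<and> (\<forall>s. r s \<in> carrier K) \<and> (\<forall>s. s \<notin> S \<longrightarrow> r s = \<zero>\<^bsub>K\<^esub>)"
  "\<zero>\<^bsub>free_module K S\<^esub> = (\<lambda>s. \<zero>\<^bsub>K\<^esub>)"
  "f \<oplus>\<^bsub>free_module K S\<^esub> g = (\<lambda>s. f s \<oplus>\<^bsub>K\<^esub> g s)"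
  "a \<odot>\<^bsub>free_module K S\<^esub> f = (\<lambda>s. a \<otimes>\<^bsub>K\<^esub> f s)"
  unfolding free_module_def by auto

text \<open>The linear extension of b to the free module; \<open>sweedler\<close> is its value at a
  representative of the tensor.\<close>

definition free_ext :: "('k, 'x) ring_scheme \<Rightarrow> ('k, 'p, 'y) module_scheme \<Rightarrow> ('s \<Rightarrow> 'p) \<Rightarrow> ('s \<Rightarrow> 'k) \<Rightarrow> 'p" where
  "free_ext K P b r = (\<Oplus>\<^bsub>P\<^esub>s\<in>{s. r s \<noteq> \<zero>\<^bsub>K\<^esub>}. r s \<odot>\<^bsub>P\<^esub> b s)"

context cring
begin

lemma free_module_module: "module R (free_module R S)"
proof (rule moduleI)
  have fin: "finite {s. h s \<noteq> \<zero>}"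
    if "finite {s. f s \<noteq> \<zero>}" "finite {s. g s \<noteq> \<zero>}" "\<And>s. \<lbrakk>f s = \<zero>; g s = \<zero>\<rbrakk> \<Longrightarrow> h s = \<zero>" for f g h :: "'s \<Rightarrow> 'a"
    by (rule finite_subset[OF _ finite_UnI[OF that(1,2)]]) (use that(3) in auto)
  show "cring R" by (rule is_cring)
  show "abelian_group (free_module R S)"
  proof (rule abelian_groupI)
    fix f g assume fg: "f \<in> carrier (free_module R S)" "g \<in> carrier (free_module R S)"
    have "finite {s. f s \<oplus> g s \<noteq> \<zero>}" by (rule fin[of f g]) (use fg in \<open>auto simp: free_module_sel\<close>)
    then show "f \<oplus>\<^bsub>free_module R S\<^esub> g \<in> carrier (free_module R S)" using fg by (auto simp: free_module_sel)
    show "f \<oplus>\<^bsub>free_module R S\<^esub> g = g \<oplus>\<^bsub>free_module R S\<^esub> f" using fg by (auto simp: free_module_sel a_comm)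
    fix h assume "h \<in> carrier (free_module R S)"
    then show "f \<oplus>\<^bsub>free_module R S\<^esub> g \<oplus>\<^bsub>free_module R S\<^esub> h = f \<oplus>\<^bsub>free_module R S\<^esub> (g \<oplus>\<^bsub>free_module R S\<^esub> h)"
      using fg by (auto simp: free_module_sel a_assoc)
  next
    fix f assume f: "f \<in> carrier (free_module R S)"
    then show "\<zero>\<^bsub>free_module R S\<^esub> \<oplus>\<^bsub>free_module R S\<^esub> f = f" by (auto simp: free_module_sel)
    have "finite {s. \<ominus> f s \<noteq> \<zero>}" by (rule fin[of f f]) (use f in \<open>auto simp: free_module_sel\<close>)
    then show "\<exists>y\<in>carrier (free_module R S). y \<oplus>\<^bsub>free_module R S\<^esub> f = \<zero>\<^bsub>free_module R S\<^esub>"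
      using f by (intro bexI[of _ "\<lambda>s. \<ominus> f s"]) (auto simp: free_module_sel l_neg)
  qed (auto simp: free_module_sel)
  fix a f assume a: "a \<in> carrier R" and f: "f \<in> carrier (free_module R S)"
  have "finite {s. a \<otimes> f s \<noteq> \<zero>}" by (rule fin[of f f]) (use f a in \<open>auto simp: free_module_sel\<close>)
  then show "a \<odot>\<^bsub>free_module R S\<^esub> f \<in> carrier (free_module R S)" using f a by (auto simp: free_module_sel)
qed (auto simp: free_module_sel l_distr r_distr m_assoc)

lemma free_gen_closed: "s \<in> S \<Longrightarrow> free_gen R s \<in> carrier (free_module R S)"
proof -
  have "{t. free_gen R s t \<noteq> \<zero>} \<subseteq> {s}" by (auto simp: free_gen_def)
  then have "finite {t. free_gen R s t \<noteq> \<zero>}" using finite_subset by blast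
  then show "s \<in> S \<Longrightarrow> free_gen R s \<in> carrier (free_module R S)" by (auto simp: free_module_sel free_gen_def)
qed

lemma free_module_generated:
  assumes N: "submodule N R (free_module R S)" and g: "\<And>s. s \<in> S \<Longrightarrow> free_gen R s \<in> N"
  shows "carrier (free_module R S) \<subseteq> N"
proof -
  note D = submoduleD[OF free_module_module N]
  have "r \<in> N" if "finite F" "r \<in> carrier (free_module R S)" "{s. r s \<noteq> \<zero>} \<subseteq> F" "F \<subseteq> S" for F r
    using that
  proof (induction F arbitrary: r rule: finite_induct)
    case empty
    then have "r = \<zero>\<^bsub>free_module R S\<^esub>" unfolding free_module_sel by (intro ext) auto
    then show ?case using D(2) by simp
  next
    case (insert i F)
    let ?g = "\<lambda>s. if s = i then \<zero> else r s"
    have "{s. ?g s \<noteq> \<zero>} \<subseteq> {s. r s \<noteq> \<zero>}" by auto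
    then have "finite {s. ?g s \<noteq> \<zero>}" using insert(4) finite_subset unfolding free_module_sel by blast
    then have "?g \<in> carrier (free_module R S)" using insert(4) unfolding free_module_sel by auto
    then have g': "?g \<in> N" by (rule insert.IH) (use insert in auto)
    have ri: "r i \<in> carrier R" using insert(4) unfolding free_module_sel by auto
    have "r = r i \<odot>\<^bsub>free_module R S\<^esub> free_gen R i \<oplus>\<^bsub>free_module R S\<^esub> ?g"
      using insert(4) unfolding free_module_sel free_gen_def by (intro ext) auto
    moreover have "i \<in> S" using insert by auto
    ultimately show ?case using D(3)[OF D(4)[OF ri g] g'] by metis
  qed
  note claim = this
  show ?thesis
  proof
    fix r assume r: "r \<in> carrier (free_module R S)"
    then have "finite {s. r s \<noteq> \<zero>}" "{s. r s \<noteq> \<zero>} \<subseteq> S" unfolding free_module_sel by auto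
    then show "r \<in> N" using claim r by simp
  qed
qed

lemma free_ext_eq:
  assumes P: "module R P" and b: "\<And>s. s \<in> S \<Longrightarrow> b s \<in> carrier P" and r: "r \<in> carrier (free_module R S)"
    and F: "finite F" "{s. r s \<noteq> \<zero>} \<subseteq> F" "F \<subseteq> S"
  shows "free_ext R P b r = (\<Oplus>\<^bsub>P\<^esub>s\<in>F. r s \<odot>\<^bsub>P\<^esub> b s)"
proof -
  interpret P: module R P by fact
  show ?thesis unfolding free_ext_def
    by (rule P.finsum_mono_neutral[OF F(1,2)]) (use F(2,3) b r in \<open>auto simp: free_module_sel\<close>)
qed

lemma free_ext_linear:
  assumes P: "module R P" and b: "\<And>s. s \<in> S \<Longrightarrow> b s \<in> carrier P"
  shows "linear_map R (free_module R S) P (free_ext R P b)"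
proof -
  interpret P: module R P by fact
  interpret F: module R "free_module R S" by (rule free_module_module)
  have supp: "{s. r s \<noteq> \<zero>} \<subseteq> S" "finite {s. r s \<noteq> \<zero>}" "\<And>s. r s \<in> carrier R" if "r \<in> carrier (free_module R S)" for r
    using that unfolding free_module_sel by auto
  show ?thesis
  proof (rule linear_mapI)
    fix r assume r: "r \<in> carrier (free_module R S)"
    show "free_ext R P b r \<in> carrier P" unfolding free_ext_def
      by (rule P.finsum_closed) (use supp[OF r] b in auto)
    fix t assume t: "t \<in> carrier (free_module R S)"
    let ?F = "{s. r s \<noteq> \<zero>} \<union> {s. t s \<noteq> \<zero>}"
    have F: "finite ?F" "?F \<subseteq> S" using supp[OF r] supp[OF t] by auto
    have rt: "r \<oplus>\<^bsub>free_module R S\<^esub> t \<in> carrier (free_module R S)" using r t by simp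
    have "free_ext R P b (r \<oplus>\<^bsub>free_module R S\<^esub> t) = (\<Oplus>\<^bsub>P\<^esub>s\<in>?F. (r \<oplus>\<^bsub>free_module R S\<^esub> t) s \<odot>\<^bsub>P\<^esub> b s)"
      by (rule free_ext_eq[OF P b rt F(1) _ F(2)]) (auto simp: free_module_sel)
    also have "\<dots> = (\<Oplus>\<^bsub>P\<^esub>s\<in>?F. r s \<odot>\<^bsub>P\<^esub> b s \<oplus>\<^bsub>P\<^esub> t s \<odot>\<^bsub>P\<^esub> b s)"
    proof (rule P.finsum_cong')
      fix s assume "s \<in> ?F"
      then have "b s \<in> carrier P" using F(2) b by blast
      then show "(r \<oplus>\<^bsub>free_module R S\<^esub> t) s \<odot>\<^bsub>P\<^esub> b s = r s \<odot>\<^bsub>P\<^esub> b s \<oplus>\<^bsub>P\<^esub> t s \<odot>\<^bsub>P\<^esub> b s"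
        using supp(3)[OF r] supp(3)[OF t] by (simp add: free_module_sel P.smult_l_distr)
    qed (use F(2) b supp(3)[OF r] supp(3)[OF t] in auto)
    also have "\<dots> = (\<Oplus>\<^bsub>P\<^esub>s\<in>?F. r s \<odot>\<^bsub>P\<^esub> b s) \<oplus>\<^bsub>P\<^esub> (\<Oplus>\<^bsub>P\<^esub>s\<in>?F. t s \<odot>\<^bsub>P\<^esub> b s)"
      by (rule P.finsum_addf) (use F(2) b supp(3)[OF r] supp(3)[OF t] in auto)
    also have "(\<Oplus>\<^bsub>P\<^esub>s\<in>?F. r s \<odot>\<^bsub>P\<^esub> b s) = free_ext R P b r" by (rule free_ext_eq[OF P b r F(1) _ F(2), symmetric]) auto
    also have "(\<Oplus>\<^bsub>P\<^esub>s\<in>?F. t s \<odot>\<^bsub>P\<^esub> b s) = free_ext R P b t" by (rule free_ext_eq[OF P b t F(1) _ F(2), symmetric]) auto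
    finally show "free_ext R P b (r \<oplus>\<^bsub>free_module R S\<^esub> t) = free_ext R P b r \<oplus>\<^bsub>P\<^esub> free_ext R P b t" .
  next
    fix a r assume a: "a \<in> carrier R" and r: "r \<in> carrier (free_module R S)"
    let ?F = "{s. r s \<noteq> \<zero>}"
    have ar: "a \<odot>\<^bsub>free_module R S\<^esub> r \<in> carrier (free_module R S)" using r a by simp
    have "free_ext R P b (a \<odot>\<^bsub>free_module R S\<^esub> r) = (\<Oplus>\<^bsub>P\<^esub>s\<in>?F. (a \<odot>\<^bsub>free_module R S\<^esub> r) s \<odot>\<^bsub>P\<^esub> b s)"
      by (rule free_ext_eq[OF P b ar supp(2)[OF r] _ supp(1)[OF r]]) (auto simp: free_module_sel a)
    also have "\<dots> = (\<Oplus>\<^bsub>P\<^esub>s\<in>?F. a \<odot>\<^bsub>P\<^esub> (r s \<odot>\<^bsub>P\<^esub> b s))"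
    proof (rule P.finsum_cong')
      fix s assume "s \<in> ?F"
      then have "b s \<in> carrier P" using supp(1)[OF r] b by blast
      then show "(a \<odot>\<^bsub>free_module R S\<^esub> r) s \<odot>\<^bsub>P\<^esub> b s = a \<odot>\<^bsub>P\<^esub> (r s \<odot>\<^bsub>P\<^esub> b s)"
        using supp(3)[OF r] a by (simp add: free_module_sel P.smult_assoc1)
    qed (use supp(1)[OF r] b supp(3)[OF r] a in auto)
    also have "\<dots> = a \<odot>\<^bsub>P\<^esub> free_ext R P b r" unfolding free_ext_def
      by (rule P.finsum_smult_ldistr[symmetric]) (use supp[OF r] b a in auto)
    finally show "free_ext R P b (a \<odot>\<^bsub>free_module R S\<^esub> r) = a \<odot>\<^bsub>P\<^esub> free_ext R P b r" .
  qed
qed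

lemma free_ext_gen:
  assumes P: "module R P" and b: "\<And>s. s \<in> S \<Longrightarrow> b s \<in> carrier P" and s: "s \<in> S"
  shows "free_ext R P b (free_gen R s) = b s"
proof -
  interpret P: module R P by fact
  have "free_ext R P b (free_gen R s) = (\<Oplus>\<^bsub>P\<^esub>t\<in>{s}. free_gen R s t \<odot>\<^bsub>P\<^esub> b t)"
    by (rule free_ext_eq[OF P b free_gen_closed[OF s]]) (use s in \<open>auto simp: free_gen_def\<close>)
  then show ?thesis using b[OF s] by (simp add: free_gen_def)
qed

end

lemma quotient_module_props:
  assumes F: "module K F" and N: "submodule N K F"
  shows quotient_module_module: "module K (quotient_module F N)"
    and quotient_map_linear: "linear_map K F (quotient_module F N) (\<lambda>x. N +>\<^bsub>F\<^esub> x)"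
    and quotient_carrier: "carrier (quotient_module F N) = (\<lambda>x. N +>\<^bsub>F\<^esub> x) ` carrier F"
    and coset_mem_iff: "\<And>x y. \<lbrakk>x \<in> carrier F; y \<in> carrier F\<rbrakk> \<Longrightarrow> y \<in> N +>\<^bsub>F\<^esub> x \<longleftrightarrow> y \<ominus>\<^bsub>F\<^esub> x \<in> N"
    and coset_subset: "\<And>x. x \<in> carrier F \<Longrightarrow> N +>\<^bsub>F\<^esub> x \<subseteq> carrier F"
proof -
  interpret F: module K F by fact
  note D = submoduleD[OF F N]
  have "additive_subgroup N F" using submodule.axioms(1)[OF N] by (simp add: additive_subgroup_def)
  then interpret N: abelian_subgroup N F by (rule abelian_subgroupI3) (rule F.abelian_group_axioms)
  show c: "carrier (quotient_module F N) = (\<lambda>x. N +>\<^bsub>F\<^esub> x) ` carrier F"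
    unfolding quotient_module_def A_RCOSETS_def' by auto
  show sub: "N +>\<^bsub>F\<^esub> x \<subseteq> carrier F" if "x \<in> carrier F" for x
    using F.a_r_coset_subset_G N.a_subset that by blast
  show mem: "y \<in> N +>\<^bsub>F\<^esub> x \<longleftrightarrow> y \<ominus>\<^bsub>F\<^esub> x \<in> N" if "x \<in> carrier F" "y \<in> carrier F" for x y
    unfolding a_minus_def using N.a_rcos_module[OF that] .
  \<comment> \<open>The scalar multiple of a coset is defined as a union over its members; all of
    them contribute the same coset.\<close>
  have sm: "(\<Union>z\<in>N +>\<^bsub>F\<^esub> x. N +>\<^bsub>F\<^esub> (a \<odot>\<^bsub>F\<^esub> z)) = N +>\<^bsub>F\<^esub> (a \<odot>\<^bsub>F\<^esub> x)" if a: "a \<in> carrier K" and x: "x \<in> carrier F" for a x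
  proof -
    have "N +>\<^bsub>F\<^esub> (a \<odot>\<^bsub>F\<^esub> z) = N +>\<^bsub>F\<^esub> (a \<odot>\<^bsub>F\<^esub> x)" if z: "z \<in> N +>\<^bsub>F\<^esub> x" for z
    proof -
      have zc: "z \<in> carrier F" using sub[OF x] z by blast
      have "(a \<odot>\<^bsub>F\<^esub> z) \<ominus>\<^bsub>F\<^esub> (a \<odot>\<^bsub>F\<^esub> x) = a \<odot>\<^bsub>F\<^esub> (z \<ominus>\<^bsub>F\<^esub> x)"
        using a x zc by (simp add: F.minus_eq F.smult_r_distr F.smult_r_minus)
      then have "a \<odot>\<^bsub>F\<^esub> z \<in> N +>\<^bsub>F\<^esub> (a \<odot>\<^bsub>F\<^esub> x)" using mem a x zc z D(4) by simp
      then show ?thesis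
        using F.a_repr_independence'[of "a \<odot>\<^bsub>F\<^esub> z" N "a \<odot>\<^bsub>F\<^esub> x"] a x N.a_subgroup by (simp add: a_r_coset_def)
    qed
    moreover have "x \<in> N +>\<^bsub>F\<^esub> x" using N.a_rcos_self[OF x] .
    ultimately show ?thesis by blast
  qed
  have add: "set_add F (N +>\<^bsub>F\<^esub> x) (N +>\<^bsub>F\<^esub> y) = N +>\<^bsub>F\<^esub> (x \<oplus>\<^bsub>F\<^esub> y)" if "x \<in> carrier F" "y \<in> carrier F" for x y
    using N.a_rcos_sum that by blast
  have zero: "N = N +>\<^bsub>F\<^esub> \<zero>\<^bsub>F\<^esub>" using N.a_subset by simp
  show "module K (quotient_module F N)" "linear_map K F (quotient_module F N) (\<lambda>x. N +>\<^bsub>F\<^esub> x)"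
    by (rule module_of_surj[OF F c[symmetric]]; (use sm add zero in \<open>simp add: quotient_module_def\<close>))+
qed

definition bilinear_map ::
  "('k, 'x) ring_scheme \<Rightarrow> ('k, 'v, 'y) module_scheme \<Rightarrow> ('k, 'w, 'z) module_scheme \<Rightarrow> ('k, 'p, 'q) module_scheme
    \<Rightarrow> ('v \<Rightarrow> 'w \<Rightarrow> 'p) \<Rightarrow> bool" where
  "bilinear_map K V W P b \<longleftrightarrow> (\<forall>v\<in>carrier V. linear_map K W P (b v)) \<and> (\<forall>w\<in>carrier W. linear_map K V P (\<lambda>v. b v w))"

lemma bilinear_mapI:
  assumes "\<And>v. v \<in> carrier V \<Longrightarrow> linear_map K W P (b v)" "\<And>w. w \<in> carrier W \<Longrightarrow> linear_map K V P (\<lambda>v. b v w)"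
  shows "bilinear_map K V W P b"
  using assms unfolding bilinear_map_def by simp

lemma bilinear_right: "\<lbrakk>bilinear_map K V W P b; v \<in> carrier V\<rbrakk> \<Longrightarrow> linear_map K W P (b v)"
  and bilinear_left: "\<lbrakk>bilinear_map K V W P b; w \<in> carrier W\<rbrakk> \<Longrightarrow> linear_map K V P (\<lambda>v. b v w)"
  unfolding bilinear_map_def by auto

lemma bilinear_closed: "\<lbrakk>bilinear_map K V W P b; v \<in> carrier V; w \<in> carrier W\<rbrakk> \<Longrightarrow> b v w \<in> carrier P"
  by (rule linear_map_closed[OF bilinear_right])

lemma bilinear_compose: "\<lbrakk>bilinear_map K V W P b; linear_map K P Q L\<rbrakk> \<Longrightarrow> bilinear_map K V W Q (\<lambda>v w. L (b v w))"
  unfolding bilinear_map_def by (auto intro: linear_map_compose)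

locale module_pair = V: module K V + W: module K W
  for K :: "('k, 'x) ring_scheme" and V :: "('k, 'v, 'y) module_scheme" and W :: "('k, 'w, 'z) module_scheme"
begin

abbreviation "F \<equiv> free_module K (carrier V \<times> carrier W)"
abbreviation "T \<equiv> tensor_product K V W"
abbreviation "N \<equiv> tensor_null K V W"
abbreviation "e v w \<equiv> free_gen K (v, w)"

lemma F_module: "module K F" by (rule V.R.free_module_module)

lemma e_closed: "\<lbrakk>v \<in> carrier V; w \<in> carrier W\<rbrakk> \<Longrightarrow> e v w \<in> carrier F"
  by (rule V.R.free_gen_closed) simp

lemma relations_closed: "bilinear_relations K V W \<subseteq> carrier F"
proof -
  interpret F: module K F by (rule F_module)
  show ?thesis unfolding bilinear_relations_def Let_def by (auto intro!: F.minus_closed e_closed)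
qed

lemma N_submodule: "submodule N K F"
proof -
  interpret F: module K F by (rule F_module)
  have D: "x \<in> carrier F \<and> \<zero>\<^bsub>F\<^esub> \<in> A \<and> (y \<in> A \<longrightarrow> x \<oplus>\<^bsub>F\<^esub> y \<in> A) \<and> (a \<in> carrier K \<longrightarrow> a \<odot>\<^bsub>F\<^esub> x \<in> A)"
    if "submodule A K F" "x \<in> A" for x y a A using submoduleD[OF F_module that(1)] that(2) by simp
  \<comment> \<open>An intersection of submodules. The whole free module is one of them, because it
    contains the relations, and this keeps the intersection inside the carrier.\<close>
  have "submodule {x. x \<in> N} K F" unfolding tensor_null_def submodule_span_def
    by (rule F.submodule_memI)
      (use relations_closed submodule_carrier[OF F_module] submoduleD[OF F_module] in \<open>auto 0 3\<close>)
  then show ?thesis by simp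
qed

lemma relations_null: "bilinear_relations K V W \<subseteq> N"
  unfolding tensor_null_def submodule_span_def by blast

lemma tensor_module: "module K T"
  unfolding tensor_product_def by (rule quotient_module_module[OF F_module N_submodule])

lemma proj_linear: "linear_map K F T (\<lambda>r. N +>\<^bsub>F\<^esub> r)"
  unfolding tensor_product_def by (rule quotient_map_linear[OF F_module N_submodule])

lemma tensor_carrier: "carrier T = (\<lambda>r. N +>\<^bsub>F\<^esub> r) ` carrier F"
  unfolding tensor_product_def by (rule quotient_carrier[OF F_module N_submodule])

lemma pure_tensor_eq: "pure_tensor K V W v w = N +>\<^bsub>F\<^esub> e v w"
  unfolding pure_tensor_def by simp

lemma pure_tensor_closed: "\<lbrakk>v \<in> carrier V; w \<in> carrier W\<rbrakk> \<Longrightarrow> pure_tensor K V W v w \<in> carrier T"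
  unfolding pure_tensor_eq tensor_carrier using e_closed by blast

lemma proj_eq_of_relation:
  assumes "x \<in> carrier F" "y \<in> carrier F" "x \<ominus>\<^bsub>F\<^esub> y \<in> bilinear_relations K V W"
  shows "N +>\<^bsub>F\<^esub> x = N +>\<^bsub>F\<^esub> y"
proof -
  interpret F: module K F by (rule F_module)
  have "x \<in> N +>\<^bsub>F\<^esub> y" using coset_mem_iff[OF F_module N_submodule assms(2,1)] relations_null assms(3) by blast
  then show ?thesis using F.a_repr_independence'[of x N y] assms submodule.axioms(1)[OF N_submodule] by (simp add: a_r_coset_def)
qed

lemma pure_tensor_bilinear: "bilinear_map K V W T (pure_tensor K V W)"
proof -
  interpret F: module K F by (rule F_module)
  show ?thesis
  proof (rule bilinear_mapI)
    fix v assume v: "v \<in> carrier V"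
    show "linear_map K W T (pure_tensor K V W v)"
    proof (rule linear_mapI)
      fix w w' assume w: "w \<in> carrier W" "w' \<in> carrier W"
      have "pure_tensor K V W v (w \<oplus>\<^bsub>W\<^esub> w') = N +>\<^bsub>F\<^esub> (e v w \<oplus>\<^bsub>F\<^esub> e v w')"
        unfolding pure_tensor_eq
        by (rule proj_eq_of_relation) (use v w in \<open>auto simp: e_closed bilinear_relations_def Let_def\<close>)
      then show "pure_tensor K V W v (w \<oplus>\<^bsub>W\<^esub> w') = pure_tensor K V W v w \<oplus>\<^bsub>T\<^esub> pure_tensor K V W v w'"
        unfolding pure_tensor_eq using linear_map_add[OF proj_linear e_closed e_closed] v w by simp
    next
      fix a w assume w: "a \<in> carrier K" "w \<in> carrier W"
      have "pure_tensor K V W v (a \<odot>\<^bsub>W\<^esub> w) = N +>\<^bsub>F\<^esub> (a \<odot>\<^bsub>F\<^esub> e v w)"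
        unfolding pure_tensor_eq
        by (rule proj_eq_of_relation) (use v w in \<open>auto simp: e_closed bilinear_relations_def Let_def\<close>)
      then show "pure_tensor K V W v (a \<odot>\<^bsub>W\<^esub> w) = a \<odot>\<^bsub>T\<^esub> pure_tensor K V W v w"
        unfolding pure_tensor_eq using linear_map_smult[OF proj_linear _ e_closed] v w by simp
    qed (use v pure_tensor_closed in auto)
  next
    fix w assume w: "w \<in> carrier W"
    show "linear_map K V T (\<lambda>v. pure_tensor K V W v w)"
    proof (rule linear_mapI)
      fix v v' assume v: "v \<in> carrier V" "v' \<in> carrier V"
      have "pure_tensor K V W (v \<oplus>\<^bsub>V\<^esub> v') w = N +>\<^bsub>F\<^esub> (e v w \<oplus>\<^bsub>F\<^esub> e v' w)"
        unfolding pure_tensor_eq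
        by (rule proj_eq_of_relation) (use v w in \<open>auto simp: e_closed bilinear_relations_def Let_def\<close>)
      then show "pure_tensor K V W (v \<oplus>\<^bsub>V\<^esub> v') w = pure_tensor K V W v w \<oplus>\<^bsub>T\<^esub> pure_tensor K V W v' w"
        unfolding pure_tensor_eq using linear_map_add[OF proj_linear e_closed e_closed] v w by simp
    next
      fix a v assume v: "a \<in> carrier K" "v \<in> carrier V"
      have "pure_tensor K V W (a \<odot>\<^bsub>V\<^esub> v) w = N +>\<^bsub>F\<^esub> (a \<odot>\<^bsub>F\<^esub> e v w)"
        unfolding pure_tensor_eq
        by (rule proj_eq_of_relation) (use v w in \<open>auto simp: e_closed bilinear_relations_def Let_def\<close>)
      then show "pure_tensor K V W (a \<odot>\<^bsub>V\<^esub> v) w = a \<odot>\<^bsub>T\<^esub> pure_tensor K V W v w"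
        unfolding pure_tensor_eq using linear_map_smult[OF proj_linear _ e_closed] v w by simp
    qed (use w pure_tensor_closed in auto)
  qed
qed

lemma tensor_generated:
  assumes A: "submodule A K T" and p: "\<And>v w. \<lbrakk>v \<in> carrier V; w \<in> carrier W\<rbrakk> \<Longrightarrow> pure_tensor K V W v w \<in> A"
  shows "carrier T \<subseteq> A"
proof -
  have "carrier F \<subseteq> {r \<in> carrier F. N +>\<^bsub>F\<^esub> r \<in> A}"
    by (rule V.R.free_module_generated[OF submodule_vimage[OF F_module tensor_module proj_linear A]])
      (use p e_closed pure_tensor_eq in auto)
  then show ?thesis unfolding tensor_carrier by blast
qed

text \<open>The extension of a bilinear b kills the bilinear relations, hence the submodule they
  span, so it takes the same value at every representative. This removes the choice made in
  \<open>sweedler\<close>.\<close>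

lemma sweedler_rep:
  assumes P: "module K P" and b: "bilinear_map K V W P b" and r: "r \<in> carrier F"
  shows "sweedler K P (N +>\<^bsub>F\<^esub> r) b = free_ext K P (\<lambda>vw. b (fst vw) (snd vw)) r"
proof -
  interpret F: module K F by (rule F_module)
  interpret P: module K P by fact
  let ?\<beta> = "\<lambda>vw. b (fst vw) (snd vw)"
  have \<beta>: "\<And>s. s \<in> carrier V \<times> carrier W \<Longrightarrow> ?\<beta> s \<in> carrier P" using bilinear_closed[OF b] by auto
  have l: "linear_map K F P (free_ext K P ?\<beta>)" by (rule V.R.free_ext_linear[OF P \<beta>])
  have g: "free_ext K P ?\<beta> (e v w) = b v w" if "v \<in> carrier V" "w \<in> carrier W" for v w
    using V.R.free_ext_gen[OF P \<beta>, where s = "(v, w)"] that by simp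
  note bc = bilinear_closed[OF b]
  let ?Z = "{x \<in> carrier F. free_ext K P ?\<beta> x \<in> {\<zero>\<^bsub>P\<^esub>}}"
  have "submodule ?Z K F" by (rule submodule_vimage[OF F_module P l submodule_zero[OF P]])
  moreover have "bilinear_relations K V W \<subseteq> ?Z"
  proof
    fix x assume x: "x \<in> bilinear_relations K V W"
    have eqz: "free_ext K P ?\<beta> (y \<ominus>\<^bsub>F\<^esub> z) = \<zero>\<^bsub>P\<^esub>" if "y \<in> carrier F" "z \<in> carrier F" "free_ext K P ?\<beta> y = free_ext K P ?\<beta> z" for y z
      using linear_map_minus[OF F_module P l that(1,2)] P.minus_eq_zero_iff linear_map_closed[OF l] that by simp
    have "free_ext K P ?\<beta> x = \<zero>\<^bsub>P\<^esub>"
      using x unfolding bilinear_relations_def Let_def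
      by (auto intro!: eqz e_closed F.a_closed F.smult_closed
        simp: g linear_map_add[OF l] linear_map_smult[OF l] e_closed
          linear_map_add[OF bilinear_right[OF b]] linear_map_smult[OF bilinear_right[OF b]]
          linear_map_add[OF bilinear_left[OF b]] linear_map_smult[OF bilinear_left[OF b]])
    then show "x \<in> ?Z" using x relations_closed by blast
  qed
  ultimately have Z: "N \<subseteq> ?Z" unfolding tensor_null_def submodule_span_def by blast
  have "r \<in> N +>\<^bsub>F\<^esub> r" using coset_mem_iff[OF F_module N_submodule r r] submoduleD(2)[OF F_module N_submodule] r
    by (simp add: F.minus_eq F.r_neg)
  then have s: "(SOME r'. r' \<in> N +>\<^bsub>F\<^esub> r) \<in> N +>\<^bsub>F\<^esub> r" using some_in_eq by blast
  let ?s = "SOME r'. r' \<in> N +>\<^bsub>F\<^esub> r"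
  have sF: "?s \<in> carrier F" using s coset_subset[OF F_module N_submodule r] by blast
  have "?s \<ominus>\<^bsub>F\<^esub> r \<in> ?Z" using s coset_mem_iff[OF F_module N_submodule r sF] Z by blast
  then have "free_ext K P ?\<beta> ?s = free_ext K P ?\<beta> r"
    using linear_map_minus[OF F_module P l sF r] P.minus_eq_zero_iff linear_map_closed[OF l] sF r by simp
  then show ?thesis unfolding sweedler_def Let_def free_ext_def .
qed

lemma sweedler_linear:
  assumes P: "module K P" and b: "bilinear_map K V W P b"
  shows "linear_map K T P (\<lambda>t. sweedler K P t b)"
proof -
  interpret F: module K F by (rule F_module)
  have \<beta>: "\<And>s. s \<in> carrier V \<times> carrier W \<Longrightarrow> b (fst s) (snd s) \<in> carrier P" using bilinear_closed[OF b] by auto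
  have l: "linear_map K F P (free_ext K P (\<lambda>s. b (fst s) (snd s)))" by (rule V.R.free_ext_linear[OF P \<beta>])
  note r = sweedler_rep[OF P b]
  show ?thesis
  proof (rule linear_mapI)
    fix t assume "t \<in> carrier T"
    then show "sweedler K P t b \<in> carrier P" unfolding tensor_carrier using r linear_map_closed[OF l] by auto
  next
    fix s t assume "s \<in> carrier T" "t \<in> carrier T"
    then obtain x y where x: "x \<in> carrier F" "s = N +>\<^bsub>F\<^esub> x" and y: "y \<in> carrier F" "t = N +>\<^bsub>F\<^esub> y" unfolding tensor_carrier by blast
    have "s \<oplus>\<^bsub>T\<^esub> t = N +>\<^bsub>F\<^esub> (x \<oplus>\<^bsub>F\<^esub> y)" using linear_map_add[OF proj_linear x(1) y(1)] x y by simp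
    then show "sweedler K P (s \<oplus>\<^bsub>T\<^esub> t) b = sweedler K P s b \<oplus>\<^bsub>P\<^esub> sweedler K P t b"
      using x y r linear_map_add[OF l x(1) y(1)] by simp
  next
    fix a s assume a: "a \<in> carrier K" and "s \<in> carrier T"
    then obtain x where x: "x \<in> carrier F" "s = N +>\<^bsub>F\<^esub> x" unfolding tensor_carrier by blast
    have "a \<odot>\<^bsub>T\<^esub> s = N +>\<^bsub>F\<^esub> (a \<odot>\<^bsub>F\<^esub> x)" using linear_map_smult[OF proj_linear a x(1)] x by simp
    then show "sweedler K P (a \<odot>\<^bsub>T\<^esub> s) b = a \<odot>\<^bsub>P\<^esub> sweedler K P s b"
      using x r a linear_map_smult[OF l a x(1)] by simp
  qed
qed

lemma sweedler_pure:
  assumes P: "module K P" and b: "bilinear_map K V W P b" and "v \<in> carrier V" "w \<in> carrier W"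
  shows "sweedler K P (pure_tensor K V W v w) b = b v w"
  using sweedler_rep[OF P b e_closed[OF assms(3,4)]] bilinear_closed[OF b]
    V.R.free_ext_gen[OF P, where S = "carrier V \<times> carrier W" and b = "\<lambda>vw. b (fst vw) (snd vw)" and s = "(v, w)"] assms(3,4)
  unfolding pure_tensor_eq by auto

lemma sweedler_closed:
  assumes P: "module K P" and b: "bilinear_map K V W P b" and t: "t \<in> carrier T"
  shows "sweedler K P t b \<in> carrier P"
  by (rule linear_map_closed[OF sweedler_linear[OF P b] t])

lemma tensor_hom_eqI:
  assumes P: "module K P" and f: "linear_map K T P f" and g: "linear_map K T P g"
    and eq: "\<And>v w. \<lbrakk>v \<in> carrier V; w \<in> carrier W\<rbrakk> \<Longrightarrow> f (pure_tensor K V W v w) = g (pure_tensor K V W v w)"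
    and t: "t \<in> carrier T"
  shows "f t = g t"
proof -
  interpret T: module K T by (rule tensor_module)
  have "submodule {t. t \<in> carrier T \<and> f t = g t} K T"
    by (rule T.submodule_memI)
      (auto simp: linear_map_add[OF f] linear_map_add[OF g] linear_map_smult[OF f] linear_map_smult[OF g]
        linear_map_zero[OF tensor_module P f] linear_map_zero[OF tensor_module P g])
  from tensor_generated[OF this] eq pure_tensor_closed t show ?thesis by blast
qed

text \<open>To evaluate a Sweedler sum it is enough to guess a linear map with the right values on
  pure tensors.\<close>

lemma sweedler_unique:
  assumes P: "module K P" and b: "bilinear_map K V W P b" and f: "linear_map K T P f"
    and eq: "\<And>v w. \<lbrakk>v \<in> carrier V; w \<in> carrier W\<rbrakk> \<Longrightarrow> f (pure_tensor K V W v w) = b v w" and t: "t \<in> carrier T"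
  shows "sweedler K P t b = f t"
  by (rule tensor_hom_eqI[OF P sweedler_linear[OF P b] f _ t]) (simp add: sweedler_pure[OF P b] eq)

text \<open>Bilinearity is assumed of b alone; b' inherits it, as it concerns arguments in the
  carriers only. So each step in a chain of equalities needs bilinearity on one side.\<close>

lemma sweedler_cong:
  assumes P: "module K P" and b: "bilinear_map K V W P b" and t: "t \<in> carrier T"
    and eq: "\<And>v w. \<lbrakk>v \<in> carrier V; w \<in> carrier W\<rbrakk> \<Longrightarrow> b' v w = b v w"
  shows "sweedler K P t b' = sweedler K P t b"
proof -
  have b': "bilinear_map K V W P b'"
  proof (rule bilinear_mapI)
    show "linear_map K W P (b' v)" if "v \<in> carrier V" for v
      by (rule linear_map_cong[OF W.module_axioms bilinear_right[OF b that]]) (simp add: eq that)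
    show "linear_map K V P (\<lambda>v. b' v w)" if "w \<in> carrier W" for w
      by (rule linear_map_cong[OF V.module_axioms bilinear_left[OF b that]]) (simp add: eq that)
  qed
  show ?thesis
    by (rule sweedler_unique[OF P b' sweedler_linear[OF P b] _ t]) (simp add: sweedler_pure[OF P b] eq)
qed

lemma linear_sweedler:
  assumes P: "module K P" and Q: "module K Q" and b: "bilinear_map K V W P b" and L: "linear_map K P Q L" and t: "t \<in> carrier T"
  shows "L (sweedler K P t b) = sweedler K Q t (\<lambda>v w. L (b v w))"
  by (rule sweedler_unique[OF Q bilinear_compose[OF b L] linear_map_compose[OF sweedler_linear[OF P b] L] _ t, symmetric])
    (simp add: sweedler_pure[OF P b])

lemma sweedler_pure_id: "t \<in> carrier T \<Longrightarrow> sweedler K T t (pure_tensor K V W) = t"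
  by (rule sweedler_unique[OF tensor_module pure_tensor_bilinear linear_map_id]) auto

text \<open>A nested Sweedler sum makes sense only if the inner sum depends linearly on the outer
  variables. The tensors for which it does form a submodule containing all pure tensors.\<close>

lemma sweedler_param_linear:
  assumes P: "module K P" and X: "module K X" and b: "\<And>x. x \<in> carrier X \<Longrightarrow> bilinear_map K V W P (b x)"
    and l: "\<And>v w. \<lbrakk>v \<in> carrier V; w \<in> carrier W\<rbrakk> \<Longrightarrow> linear_map K X P (\<lambda>x. b x v w)" and t: "t \<in> carrier T"
  shows "linear_map K X P (\<lambda>x. sweedler K P t (b x))"
proof -
  interpret T: module K T by (rule tensor_module)
  interpret P: module K P by fact
  note sl = sweedler_linear[OF P b]
  let ?A = "{t. t \<in> carrier T \<and> linear_map K X P (\<lambda>x. sweedler K P t (b x))}"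
  have "submodule ?A K T"
  proof (rule T.submodule_memI)
    show "\<zero>\<^bsub>T\<^esub> \<in> carrier T \<and> linear_map K X P (\<lambda>x. sweedler K P \<zero>\<^bsub>T\<^esub> (b x))"
      using linear_map_cong[OF X linear_map_const_zero[OF P]] linear_map_zero[OF tensor_module P sl] by auto
    fix s t assume st: "s \<in> carrier T \<and> linear_map K X P (\<lambda>x. sweedler K P s (b x))"
      "t \<in> carrier T \<and> linear_map K X P (\<lambda>x. sweedler K P t (b x))"
    then show "s \<oplus>\<^bsub>T\<^esub> t \<in> carrier T \<and> linear_map K X P (\<lambda>x. sweedler K P (s \<oplus>\<^bsub>T\<^esub> t) (b x))"
      using linear_map_cong[OF X linear_map_plus[OF P conjunct2[OF st(1)] conjunct2[OF st(2)]]] linear_map_add[OF sl] by auto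
  next
    fix a t assume a: "a \<in> carrier K" and t: "t \<in> carrier T \<and> linear_map K X P (\<lambda>x. sweedler K P t (b x))"
    then show "a \<odot>\<^bsub>T\<^esub> t \<in> carrier T \<and> linear_map K X P (\<lambda>x. sweedler K P (a \<odot>\<^bsub>T\<^esub> t) (b x))"
      using linear_map_cong[OF X linear_map_scale[OF P conjunct2[OF t] a]] linear_map_smult[OF sl] by auto
  qed auto
  moreover have "pure_tensor K V W v w \<in> ?A" if "v \<in> carrier V" "w \<in> carrier W" for v w
    using linear_map_cong[OF X l[OF that]] sweedler_pure[OF P b that] pure_tensor_closed[OF that] by auto
  ultimately have "carrier T \<subseteq> ?A" by (rule tensor_generated)
  then show ?thesis using t by blast
qed

end

section \<open>Coordinates with respect to a basis\<close>

text \<open>K as a module over itself, so that linear functionals are instances of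
  \<open>linear_map\<close>.\<close>

definition ground :: "('k, 'x) ring_scheme \<Rightarrow> ('k, 'k) module" where
  "ground K = \<lparr>carrier = carrier K, mult = undefined, one = undefined, zero = \<zero>\<^bsub>K\<^esub>, add = (\<oplus>\<^bsub>K\<^esub>), smult = (\<otimes>\<^bsub>K\<^esub>)\<rparr>"

lemma ground_sel [simp]:
  "carrier (ground K) = carrier K" "\<zero>\<^bsub>ground K\<^esub> = \<zero>\<^bsub>K\<^esub>" "x \<oplus>\<^bsub>ground K\<^esub> y = x \<oplus>\<^bsub>K\<^esub> y" "a \<odot>\<^bsub>ground K\<^esub> x = a \<otimes>\<^bsub>K\<^esub> x"
  unfolding ground_def by auto

lemma (in cring) ground_module: "module R (ground R)"
proof (rule moduleI)
  show "abelian_group (ground R)"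
  proof (rule abelian_groupI)
    fix x assume "x \<in> carrier (ground R)"
    then show "\<exists>y\<in>carrier (ground R). y \<oplus>\<^bsub>ground R\<^esub> x = \<zero>\<^bsub>ground R\<^esub>"
      by (intro bexI[of _ "\<ominus> x"]) (simp_all add: l_neg)
  qed (simp_all add: a_ac)
qed (auto simp: is_cring l_distr r_distr m_assoc)

lemma functional_bilinear:
  assumes V: "module K V" and \<phi>: "linear_map K W (ground K) \<phi>"
  shows "bilinear_map K V W V (\<lambda>v w. \<phi> w \<odot>\<^bsub>V\<^esub> v)"
proof -
  interpret V: module K V by fact
  note c = linear_map_closed[OF \<phi>, simplified]
  show ?thesis
  proof (rule bilinear_mapI)
    fix v assume "v \<in> carrier V"
    then show "linear_map K W V (\<lambda>w. \<phi> w \<odot>\<^bsub>V\<^esub> v)"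
      by (intro linear_mapI) (auto simp: c linear_map_add[OF \<phi>] linear_map_smult[OF \<phi>] V.smult_l_distr V.smult_assoc1)
  next
    fix w assume "w \<in> carrier W"
    then show "linear_map K V V (\<lambda>v. \<phi> w \<odot>\<^bsub>V\<^esub> v)" by (intro linear_map_scale[OF V linear_map_id] c)
  qed
qed

text \<open>A basis is presented by its coordinate functionals, since these are what the later
  arguments use.\<close>

locale based_module = module K W
  for K :: "('k, 'x) ring_scheme" and W :: "('k, 'w, 'z) module_scheme" +
  fixes B :: "'w set" and cf :: "'w \<Rightarrow> 'w \<Rightarrow> 'k"
  assumes B_closed: "B \<subseteq> carrier W"
    and cf_linear: "b \<in> B \<Longrightarrow> linear_map K W (ground K) (cf b)"
    and cf_finite: "w \<in> carrier W \<Longrightarrow> finite {b \<in> B. cf b w \<noteq> \<zero>\<^bsub>K\<^esub>}"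
    and cf_expand: "w \<in> carrier W \<Longrightarrow> (\<Oplus>\<^bsub>W\<^esub>b\<in>{b \<in> B. cf b w \<noteq> \<zero>\<^bsub>K\<^esub>}. cf b w \<odot>\<^bsub>W\<^esub> b) = w"
    and cf_delta: "\<lbrakk>b \<in> B; c \<in> B\<rbrakk> \<Longrightarrow> cf b c = (if b = c then \<one>\<^bsub>K\<^esub> else \<zero>\<^bsub>K\<^esub>)"

section \<open>Existence of a basis\<close>

definition independent_set :: "('k, 'x) ring_scheme \<Rightarrow> ('k, 'w, 'z) module_scheme \<Rightarrow> 'w set \<Rightarrow> bool" where
  "independent_set K W B \<longleftrightarrow> B \<subseteq> carrier W \<and>
    (\<forall>r\<in>carrier (free_module K B). free_ext K W (\<lambda>b. b) r = \<zero>\<^bsub>W\<^esub> \<longrightarrow> r = \<zero>\<^bsub>free_module K B\<^esub>)"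

lemma maximal_independent_ex:
  assumes "module K W"
  shows "\<exists>B. independent_set K W B \<and> (\<forall>B'. independent_set K W B' \<longrightarrow> B \<subseteq> B' \<longrightarrow> B' = B)"
proof -
  have "\<exists>M\<in>{B. independent_set K W B}. \<forall>X\<in>{B. independent_set K W B}. M \<subseteq> X \<longrightarrow> X = M"
  proof (rule subset_Zorn_nonempty)
    have "independent_set K W {}" unfolding independent_set_def by (auto simp: free_module_sel)
    then show "{B. independent_set K W B} \<noteq> {}" by blast
    fix C assume C: "C \<noteq> {}" "subset.chain {B. independent_set K W B} C"
    have ind: "independent_set K W B" if "B \<in> C" for B using C(2) that unfolding subset.chain_def by blast
    show "\<Union>C \<in> {B. independent_set K W B}"
      unfolding mem_Collect_eq independent_set_def
    proof (intro conjI ballI impI)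
      show "\<Union>C \<subseteq> carrier W" using ind unfolding independent_set_def by blast
      fix r assume r: "r \<in> carrier (free_module K (\<Union>C))" and z: "free_ext K W (\<lambda>b. b) r = \<zero>\<^bsub>W\<^esub>"
      have "finite {s. r s \<noteq> \<zero>\<^bsub>K\<^esub>}" "{s. r s \<noteq> \<zero>\<^bsub>K\<^esub>} \<subseteq> \<Union>C" using r unfolding free_module_sel by auto
      \<comment> \<open>A linear relation involves finitely many elements of the union, and these
        lie in one member of the chain.\<close>
      then obtain B where B: "B \<in> C" "{s. r s \<noteq> \<zero>\<^bsub>K\<^esub>} \<subseteq> B" using finite_subset_Union_chain[OF _ _ C] by metis
      then have "r \<in> carrier (free_module K B)" using r unfolding free_module_sel by auto
      then have "r = \<zero>\<^bsub>free_module K B\<^esub>" using ind[OF B(1)] z unfolding independent_set_def by blast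
      then show "r = \<zero>\<^bsub>free_module K (\<Union>C)\<^esub>" by (simp add: free_module_sel)
    qed
  qed
  then show ?thesis by blast
qed

text \<open>A vector h outside the span could be adjoined: if h occurred in a linear relation, its
  coefficient would be invertible in K and h would lie in the span.\<close>

lemma maximal_independent_span:
  assumes "field K" and W: "module K W" and ind: "independent_set K W B"
    and max: "\<And>B'. independent_set K W B' \<Longrightarrow> B \<subseteq> B' \<Longrightarrow> B' = B"
  shows "free_ext K W (\<lambda>b. b) ` carrier (free_module K B) = carrier W"
proof -
  interpret K: field K by fact
  interpret W: module K W by fact
  have Bc: "B \<subseteq> carrier W" using ind unfolding independent_set_def by blast
  let ?\<Phi> = "free_ext K W (\<lambda>b. b)"
  have l: "linear_map K (free_module K A) W ?\<Phi>" if "A \<subseteq> carrier W" for A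
    by (rule K.free_ext_linear[OF W]) (use that in auto)
  let ?U = "?\<Phi> ` carrier (free_module K B)"
  have U: "submodule ?U K W"
    by (rule submodule_image[OF K.free_module_module W l[OF Bc] submodule_carrier[OF K.free_module_module]])
  note D = submoduleD[OF W U]
  have "h \<in> ?U" if h: "h \<in> carrier W" for h
  proof (rule ccontr)
    assume hU: "h \<notin> ?U"
    have hB: "h \<notin> B"
    proof
      assume "h \<in> B"
      then have "?\<Phi> (free_gen K h) = h" by (intro K.free_ext_gen[OF W, of B]) (use Bc in auto)
      then show False using hU K.free_gen_closed[OF \<open>h \<in> B\<close>] by (metis imageI)
    qed
    have ic: "insert h B \<subseteq> carrier W" using h Bc by blast
    have "independent_set K W (insert h B)" unfolding independent_set_def
    proof (intro conjI ic ballI impI)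
      fix r assume r: "r \<in> carrier (free_module K (insert h B))" and z: "?\<Phi> r = \<zero>\<^bsub>W\<^esub>"
      define r' where "r' = (\<lambda>s. if s = h then \<zero>\<^bsub>K\<^esub> else r s)"
      have "{s. r' s \<noteq> \<zero>\<^bsub>K\<^esub>} \<subseteq> {s. r s \<noteq> \<zero>\<^bsub>K\<^esub>}" unfolding r'_def by auto
      then have "finite {s. r' s \<noteq> \<zero>\<^bsub>K\<^esub>}" using r finite_subset unfolding free_module_sel by blast
      then have r': "r' \<in> carrier (free_module K B)" using r unfolding free_module_sel r'_def by auto
      then have r'i: "r' \<in> carrier (free_module K (insert h B))" unfolding free_module_sel by auto
      have rh: "r h \<in> carrier K" using r unfolding free_module_sel by auto
      interpret FI: module K "free_module K (insert h B)" by (rule K.free_module_module)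
      have gc: "free_gen K h \<in> carrier (free_module K (insert h B))" by (rule K.free_gen_closed) simp
      have re: "r = r h \<odot>\<^bsub>free_module K (insert h B)\<^esub> free_gen K h \<oplus>\<^bsub>free_module K (insert h B)\<^esub> r'"
        using r unfolding free_module_sel free_gen_def r'_def by (intro ext) auto
      have gh: "?\<Phi> (free_gen K h) = h" by (rule K.free_ext_gen[OF W, of "insert h B"]) (use ic in auto)
      have "?\<Phi> r = r h \<odot>\<^bsub>W\<^esub> h \<oplus>\<^bsub>W\<^esub> ?\<Phi> r'"
        by (subst re) (use rh gc r'i in \<open>simp add: linear_map_add[OF l[OF ic]] linear_map_smult[OF l[OF ic]] gh\<close>)
      then have e: "r h \<odot>\<^bsub>W\<^esub> h \<oplus>\<^bsub>W\<^esub> ?\<Phi> r' = \<zero>\<^bsub>W\<^esub>" using z by simp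
      have pU: "?\<Phi> r' \<in> ?U" using r' by blast
      have "r h = \<zero>\<^bsub>K\<^esub>"
      proof (rule ccontr)
        assume nz: "r h \<noteq> \<zero>\<^bsub>K\<^esub>"
        have "r h \<odot>\<^bsub>W\<^esub> h = \<ominus>\<^bsub>W\<^esub> ?\<Phi> r'"
          using W.minus_equality[OF e] D(1)[OF pU] rh h by simp
        then have "r h \<odot>\<^bsub>W\<^esub> h \<in> ?U" using D(5)[OF pU] by simp
        then have "inv\<^bsub>K\<^esub> (r h) \<odot>\<^bsub>W\<^esub> (r h \<odot>\<^bsub>W\<^esub> h) \<in> ?U" using D(4) rh nz K.field_Units by simp
        moreover have "inv\<^bsub>K\<^esub> (r h) \<odot>\<^bsub>W\<^esub> (r h \<odot>\<^bsub>W\<^esub> h) = h"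
          using rh nz h K.field_Units W.smult_assoc1[of "inv\<^bsub>K\<^esub> (r h)" "r h" h] by simp
        ultimately show False using hU by simp
      qed
      then have "r = r'" unfolding r'_def by auto
      then have "r = \<zero>\<^bsub>free_module K B\<^esub>" using ind r' z unfolding independent_set_def by blast
      then show "r = \<zero>\<^bsub>free_module K (insert h B)\<^esub>" by (simp add: free_module_sel)
    qed
    from max[OF this] hB show False by blast
  qed
  then show ?thesis using D(1) by blast
qed

lemma basis_ex:
  assumes "field K" and W: "module K W"
  shows "\<exists>B cf. based_module K W B cf"
proof -
  interpret K: field K by fact
  interpret W: module K W by fact
  obtain B where ind: "independent_set K W B" and max: "\<And>B'. independent_set K W B' \<Longrightarrow> B \<subseteq> B' \<Longrightarrow> B' = B"
    using maximal_independent_ex[OF W] by blast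
  have Bc: "B \<subseteq> carrier W" using ind unfolding independent_set_def by blast
  let ?F = "free_module K B" and ?\<Phi> = "free_ext K W (\<lambda>b. b)"
  have l: "linear_map K ?F W ?\<Phi>" by (rule K.free_ext_linear[OF W]) (use Bc in auto)
  have F: "module K ?F" by (rule K.free_module_module)
  interpret F: module K ?F by (rule F)
  have inj: "inj_on ?\<Phi> (carrier ?F)" using module_inj_iff[OF F W l] ind unfolding independent_set_def by blast
  note surj = maximal_independent_span[OF assms ind max]
  \<comment> \<open>The inverse of the isomorphism from the free module on B to W; its values are
    the coordinates.\<close>
  define g where "g = inv_into (carrier ?F) ?\<Phi>"
  have g: "g w \<in> carrier ?F" "?\<Phi> (g w) = w" if "w \<in> carrier W" for w
  proof -
    have "w \<in> ?\<Phi> ` carrier ?F" using surj that by simp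
    then show "g w \<in> carrier ?F" "?\<Phi> (g w) = w" unfolding g_def by (rule inv_into_into, rule f_inv_into_f)
  qed
  have gu: "g w = r" if "w \<in> carrier W" "r \<in> carrier ?F" "?\<Phi> r = w" for w r
    using inj that unfolding g_def by auto
  have ga: "g (x \<oplus>\<^bsub>W\<^esub> y) = g x \<oplus>\<^bsub>?F\<^esub> g y" if "x \<in> carrier W" "y \<in> carrier W" for x y
    by (rule gu) (use that g linear_map_add[OF l] in auto)
  have gs: "g (a \<odot>\<^bsub>W\<^esub> x) = a \<odot>\<^bsub>?F\<^esub> g x" if "a \<in> carrier K" "x \<in> carrier W" for a x
    by (rule gu) (use that g linear_map_smult[OF l] in auto)
  have gc: "g w b \<in> carrier K" if "w \<in> carrier W" for w b using g(1)[OF that] unfolding free_module_sel by auto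
  have "based_module K W B (\<lambda>b w. g w b)"
  proof (unfold_locales, rule Bc)
    fix b assume "b \<in> B"
    show "linear_map K W (ground K) (\<lambda>w. g w b)"
      by (rule linear_mapI) (auto simp: gc ga gs free_module_sel(3,4))
  next
    fix w assume w: "w \<in> carrier W"
    have s: "{b \<in> B. g w b \<noteq> \<zero>\<^bsub>K\<^esub>} = {b. g w b \<noteq> \<zero>\<^bsub>K\<^esub>}" using g(1)[OF w] unfolding free_module_sel by auto
    show "finite {b \<in> B. g w b \<noteq> \<zero>\<^bsub>K\<^esub>}" unfolding s using g(1)[OF w] unfolding free_module_sel by auto
    show "(\<Oplus>\<^bsub>W\<^esub>b\<in>{b \<in> B. g w b \<noteq> \<zero>\<^bsub>K\<^esub>}. g w b \<odot>\<^bsub>W\<^esub> b) = w" unfolding s using g(2)[OF w] unfolding free_ext_def .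
  next
    fix b c assume bc: "b \<in> B" "c \<in> B"
    have "g c = free_gen K c"
      by (rule gu) (use bc Bc K.free_gen_closed K.free_ext_gen[OF W, of B "\<lambda>b. b" c] in auto)
    then show "g c b = (if b = c then \<one>\<^bsub>K\<^esub> else \<zero>\<^bsub>K\<^esub>)" by (simp add: free_gen_def)
  qed
  then show ?thesis by blast
qed

section \<open>Coordinates of a tensor\<close>

context based_module
begin

lemma cf_closed: "\<lbrakk>b \<in> B; w \<in> carrier W\<rbrakk> \<Longrightarrow> cf b w \<in> carrier K"
  using linear_map_closed[OF cf_linear] by simp

text \<open>The identity of V tensored with the functional \<open>cf b\<close>, followed by V
  \<otimes> K = V. Applied to \<rho>(m) it gives \<rho>_b(m).\<close>

definition cd :: "('k, 'v, 'y) module_scheme \<Rightarrow> 'w \<Rightarrow> ('v, 'w, 'k) tensor \<Rightarrow> 'v" where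
  "cd V b t = sweedler K V t (\<lambda>v w. cf b w \<odot>\<^bsub>V\<^esub> v)"

lemma pairI: "module K V \<Longrightarrow> module_pair K V W"
  unfolding module_pair_def using module_axioms by blast

lemma cd_bilinear: "\<lbrakk>module K V; b \<in> B\<rbrakk> \<Longrightarrow> bilinear_map K V W V (\<lambda>v w. cf b w \<odot>\<^bsub>V\<^esub> v)"
  by (rule functional_bilinear[OF _ cf_linear])

lemma cd_linear: "\<lbrakk>module K V; b \<in> B\<rbrakk> \<Longrightarrow> linear_map K (tensor_product K V W) V (cd V b)"
  unfolding cd_def by (rule module_pair.sweedler_linear[OF pairI _ cd_bilinear])

lemma cd_closed: "\<lbrakk>module K V; b \<in> B; t \<in> carrier (tensor_product K V W)\<rbrakk> \<Longrightarrow> cd V b t \<in> carrier V"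
  by (rule linear_map_closed[OF cd_linear])

lemma cd_pure: "\<lbrakk>module K V; b \<in> B; v \<in> carrier V; w \<in> carrier W\<rbrakk> \<Longrightarrow> cd V b (pure_tensor K V W v w) = cf b w \<odot>\<^bsub>V\<^esub> v"
  unfolding cd_def by (rule module_pair.sweedler_pure[OF pairI _ cd_bilinear])

lemma cf_expand_superset:
  assumes w: "w \<in> carrier W" and F: "finite F" "F \<subseteq> B" "{b \<in> B. cf b w \<noteq> \<zero>\<^bsub>K\<^esub>} \<subseteq> F"
  shows "(\<Oplus>\<^bsub>W\<^esub>b\<in>F. cf b w \<odot>\<^bsub>W\<^esub> b) = w"
proof -
  have "(\<Oplus>\<^bsub>W\<^esub>b\<in>{b \<in> B. cf b w \<noteq> \<zero>\<^bsub>K\<^esub>}. cf b w \<odot>\<^bsub>W\<^esub> b) = (\<Oplus>\<^bsub>W\<^esub>b\<in>F. cf b w \<odot>\<^bsub>W\<^esub> b)"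
    by (rule M.finsum_mono_neutral[OF F(1,3)]) (use F(2) B_closed cf_closed w in auto)
  then show ?thesis using cf_expand[OF w] by simp
qed

lemma cd_expand:
  assumes V: "module K V" and t: "t \<in> carrier (tensor_product K V W)"
  obtains F0 where "finite F0" "F0 \<subseteq> B" "\<And>b. b \<in> B - F0 \<Longrightarrow> cd V b t = \<zero>\<^bsub>V\<^esub>"
    "\<And>F. \<lbrakk>finite F; F0 \<subseteq> F; F \<subseteq> B\<rbrakk> \<Longrightarrow> (\<Oplus>\<^bsub>tensor_product K V W\<^esub>b\<in>F. pure_tensor K V W (cd V b t) b) = t"
proof -
  let ?T = "tensor_product K V W"
  interpret V: module K V by fact
  interpret p: module_pair K V W by (rule pairI[OF V])
  interpret T: module K ?T by (rule p.tensor_module)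
  note bil = p.pure_tensor_bilinear
  have sl: "linear_map K ?T ?T (\<lambda>t. pure_tensor K V W (cd V b t) b)" if "b \<in> B" for b
    using linear_map_compose[OF cd_linear[OF V that] bilinear_left[OF bil]] B_closed that by blast
  have sml: "linear_map K ?T ?T (\<lambda>t. \<Oplus>\<^bsub>?T\<^esub>b\<in>F. pure_tensor K V W (cd V b t) b)" if "finite F" "F \<subseteq> B" for F
    by (rule linear_map_finsum_fun[OF p.tensor_module that(1)]) (use sl that(2) in blast)
  \<comment> \<open>The expansion is verified on pure tensors and inherited by linear combinations;
    for a sum, F0 is the union of the two sets.\<close>
  let ?Q = "\<lambda>t F0. finite F0 \<and> F0 \<subseteq> B \<and> (\<forall>b\<in>B - F0. cd V b t = \<zero>\<^bsub>V\<^esub>) \<and>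
    (\<forall>F. finite F \<and> F0 \<subseteq> F \<and> F \<subseteq> B \<longrightarrow> (\<Oplus>\<^bsub>?T\<^esub>b\<in>F. pure_tensor K V W (cd V b t) b) = t)"
  let ?A = "{t. t \<in> carrier ?T \<and> (\<exists>F0. ?Q t F0)}"
  note l = cd_linear[OF V]
  have "submodule ?A K ?T"
  proof (rule T.submodule_memI)
    have "?Q \<zero>\<^bsub>?T\<^esub> {}"
      using linear_map_zero[OF p.tensor_module V l] linear_map_zero[OF p.tensor_module p.tensor_module sml] by auto
    then show "\<zero>\<^bsub>?T\<^esub> \<in> carrier ?T \<and> (\<exists>F0. ?Q \<zero>\<^bsub>?T\<^esub> F0)" by blast
    fix s t assume s: "s \<in> carrier ?T \<and> (\<exists>F0. ?Q s F0)" and t: "t \<in> carrier ?T \<and> (\<exists>F0. ?Q t F0)"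
    obtain F1 where F1: "?Q s F1" using s by blast
    obtain F2 where F2: "?Q t F2" using t by blast
    have q: "?Q (s \<oplus>\<^bsub>?T\<^esub> t) (F1 \<union> F2)"
    proof (intro conjI ballI allI impI)
      fix b assume "b \<in> B - (F1 \<union> F2)"
      then show "cd V b (s \<oplus>\<^bsub>?T\<^esub> t) = \<zero>\<^bsub>V\<^esub>" using linear_map_add[OF l] s t F1 F2 by simp
    next
      fix F assume F: "finite F \<and> F1 \<union> F2 \<subseteq> F \<and> F \<subseteq> B"
      then show "(\<Oplus>\<^bsub>?T\<^esub>b\<in>F. pure_tensor K V W (cd V b (s \<oplus>\<^bsub>?T\<^esub> t)) b) = s \<oplus>\<^bsub>?T\<^esub> t"
        using linear_map_add[OF sml, of F s t] s t F1 F2 by simp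
    qed (use F1 F2 in auto)
    show "s \<oplus>\<^bsub>?T\<^esub> t \<in> carrier ?T \<and> (\<exists>F0. ?Q (s \<oplus>\<^bsub>?T\<^esub> t) F0)"
      by (rule conjI[OF _ exI[of _ "F1 \<union> F2"]]) (use s t in simp, rule q)
  next
    fix a t assume a: "a \<in> carrier K" and t: "t \<in> carrier ?T \<and> (\<exists>F0. ?Q t F0)"
    obtain F2 where F2: "?Q t F2" using t by blast
    have q: "?Q (a \<odot>\<^bsub>?T\<^esub> t) F2"
    proof (intro conjI ballI allI impI)
      fix b assume "b \<in> B - F2"
      then show "cd V b (a \<odot>\<^bsub>?T\<^esub> t) = \<zero>\<^bsub>V\<^esub>" using linear_map_smult[OF l] a t F2 by simp
    next
      fix F assume F: "finite F \<and> F2 \<subseteq> F \<and> F \<subseteq> B"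
      then show "(\<Oplus>\<^bsub>?T\<^esub>b\<in>F. pure_tensor K V W (cd V b (a \<odot>\<^bsub>?T\<^esub> t)) b) = a \<odot>\<^bsub>?T\<^esub> t"
        using linear_map_smult[OF sml, of F a t] a t F2 by simp
    qed (use F2 in auto)
    show "a \<odot>\<^bsub>?T\<^esub> t \<in> carrier ?T \<and> (\<exists>F0. ?Q (a \<odot>\<^bsub>?T\<^esub> t) F0)"
      by (rule conjI[OF _ exI[of _ F2]]) (use a t in simp, rule q)
  qed simp
  moreover have "pure_tensor K V W v w \<in> ?A" if v: "v \<in> carrier V" and w: "w \<in> carrier W" for v w
  proof -
    let ?p = "pure_tensor K V W v w" and ?S = "{b \<in> B. cf b w \<noteq> \<zero>\<^bsub>K\<^esub>}"
    have q: "?Q ?p ?S"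
    proof (intro conjI ballI allI impI)
      show "finite ?S" by (rule cf_finite[OF w])
      show "cd V b ?p = \<zero>\<^bsub>V\<^esub>" if "b \<in> B - ?S" for b using that v by (simp add: cd_pure[OF V _ v w])
      fix F assume F: "finite F \<and> ?S \<subseteq> F \<and> F \<subseteq> B"
      have wb: "cf b w \<odot>\<^bsub>W\<^esub> b \<in> carrier W" if "b \<in> F" for b
      proof -
        have "b \<in> B" "b \<in> carrier W" using that F B_closed by auto
        then show ?thesis using cf_closed[OF _ w] by simp
      qed
      have "(\<Oplus>\<^bsub>?T\<^esub>b\<in>F. pure_tensor K V W (cd V b ?p) b) = (\<Oplus>\<^bsub>?T\<^esub>b\<in>F. pure_tensor K V W v (cf b w \<odot>\<^bsub>W\<^esub> b))"
      proof (rule T.finsum_cong')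
        fix b assume "b \<in> F"
        then have b: "b \<in> B" "b \<in> carrier W" using F B_closed by auto
        then show "pure_tensor K V W (cd V b ?p) b = pure_tensor K V W v (cf b w \<odot>\<^bsub>W\<^esub> b)"
          using linear_map_smult[OF bilinear_left[OF bil b(2)] cf_closed[OF b(1) w] v]
            linear_map_smult[OF bilinear_right[OF bil v] cf_closed[OF b(1) w] b(2)] by (simp add: cd_pure[OF V b(1) v w])
      next
        show "(\<lambda>b. pure_tensor K V W v (cf b w \<odot>\<^bsub>W\<^esub> b)) \<in> F \<rightarrow> carrier ?T"
        proof
          fix b assume "b \<in> F"
          then have "b \<in> B" "b \<in> carrier W" using F B_closed by auto
          then show "pure_tensor K V W v (cf b w \<odot>\<^bsub>W\<^esub> b) \<in> carrier ?T"
            using cf_closed[OF _ w] by (intro p.pure_tensor_closed v) simp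
        qed
      qed simp
      also have "\<dots> = pure_tensor K V W v (\<Oplus>\<^bsub>W\<^esub>b\<in>F. cf b w \<odot>\<^bsub>W\<^esub> b)"
        by (rule linear_map_finsum[OF module_axioms p.tensor_module bilinear_right[OF bil v], symmetric])
          (use F wb in auto)
      also have "(\<Oplus>\<^bsub>W\<^esub>b\<in>F. cf b w \<odot>\<^bsub>W\<^esub> b) = w" by (rule cf_expand_superset[OF w]) (use F in auto)
      finally show "(\<Oplus>\<^bsub>?T\<^esub>b\<in>F. pure_tensor K V W (cd V b ?p) b) = ?p" .
    qed auto
    show ?thesis by (rule CollectI, rule conjI[OF p.pure_tensor_closed[OF v w] exI[of _ ?S]], rule q)
  qed
  ultimately have "carrier ?T \<subseteq> ?A" by (rule p.tensor_generated)
  then have "t \<in> ?A" using t by (rule subsetD)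
  then obtain F0 where "?Q t F0" by (elim CollectE conjE exE) (rule that, intro conjI)
  then show thesis by (intro that[of F0]) auto
qed

lemma cd_eqI:
  assumes V: "module K V" and s: "s \<in> carrier (tensor_product K V W)" and t: "t \<in> carrier (tensor_product K V W)"
    and eq: "\<And>b. b \<in> B \<Longrightarrow> cd V b s = cd V b t"
  shows "s = t"
proof -
  interpret p: module_pair K V W by (rule pairI[OF V])
  interpret T: module K "tensor_product K V W" by (rule p.tensor_module)
  obtain F1 where F1: "finite F1" "F1 \<subseteq> B"
    "\<And>F. \<lbrakk>finite F; F1 \<subseteq> F; F \<subseteq> B\<rbrakk> \<Longrightarrow> (\<Oplus>\<^bsub>tensor_product K V W\<^esub>b\<in>F. pure_tensor K V W (cd V b s) b) = s"
    by (rule cd_expand[OF V s]) blast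
  obtain F2 where F2: "finite F2" "F2 \<subseteq> B"
    "\<And>F. \<lbrakk>finite F; F2 \<subseteq> F; F \<subseteq> B\<rbrakk> \<Longrightarrow> (\<Oplus>\<^bsub>tensor_product K V W\<^esub>b\<in>F. pure_tensor K V W (cd V b t) b) = t"
    by (rule cd_expand[OF V t]) blast
  have "s = (\<Oplus>\<^bsub>tensor_product K V W\<^esub>b\<in>F1 \<union> F2. pure_tensor K V W (cd V b s) b)"
    using F1(3)[of "F1 \<union> F2"] F1 F2 by simp
  also have "\<dots> = (\<Oplus>\<^bsub>tensor_product K V W\<^esub>b\<in>F1 \<union> F2. pure_tensor K V W (cd V b t) b)"
  proof (rule T.finsum_cong')
    show "(\<lambda>b. pure_tensor K V W (cd V b t) b) \<in> F1 \<union> F2 \<rightarrow> carrier (tensor_product K V W)"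
    proof (rule Pi_I)
      fix b assume "b \<in> F1 \<union> F2"
      then have b: "b \<in> B" "b \<in> carrier W" using F1(2) F2(2) B_closed by auto
      show "pure_tensor K V W (cd V b t) b \<in> carrier (tensor_product K V W)"
        by (rule p.pure_tensor_closed[OF cd_closed[OF V b(1) t] b(2)])
    qed
  qed (use eq F1(2) F2(2) in auto)
  also have "\<dots> = t" using F2(3)[of "F1 \<union> F2"] F1 F2 by simp
  finally show ?thesis .
qed

text \<open>Finite support is the only condition on a family of coordinates. This is what rebuilds a
  coaction from operators.\<close>

lemma cd_of_family:
  assumes V: "module K V" and F: "finite F" "F \<subseteq> B" and x: "\<And>b. b \<in> B \<Longrightarrow> x b \<in> carrier V"
    and z: "\<And>b. b \<in> B - F \<Longrightarrow> x b = \<zero>\<^bsub>V\<^esub>"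
  obtains t where "t \<in> carrier (tensor_product K V W)" "\<And>b. b \<in> B \<Longrightarrow> cd V b t = x b"
proof -
  interpret V: module K V by fact
  interpret p: module_pair K V W by (rule pairI[OF V])
  interpret T: module K "tensor_product K V W" by (rule p.tensor_module)
  let ?t = "\<Oplus>\<^bsub>tensor_product K V W\<^esub>b\<in>F. pure_tensor K V W (x b) b"
  have pc: "pure_tensor K V W (x b) b \<in> carrier (tensor_product K V W)" if "b \<in> F" for b
    using that F(2) B_closed x p.pure_tensor_closed by blast
  have "cd V c ?t = x c" if c: "c \<in> B" for c
  proof -
    have "cd V c ?t = (\<Oplus>\<^bsub>V\<^esub>b\<in>F. cd V c (pure_tensor K V W (x b) b))"
      by (rule linear_map_finsum[OF p.tensor_module V cd_linear[OF V c] F(1) pc])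
    also have "\<dots> = (\<Oplus>\<^bsub>V\<^esub>b\<in>F. if c = b then x b else \<zero>\<^bsub>V\<^esub>)"
    proof (rule V.finsum_cong')
      fix b assume "b \<in> F"
      then have b: "b \<in> B" "b \<in> carrier W" using F B_closed by auto
      show "cd V c (pure_tensor K V W (x b) b) = (if c = b then x b else \<zero>\<^bsub>V\<^esub>)"
        using cd_pure[OF V c x[OF b(1)] b(2)] cf_delta[OF c b(1)] x[OF b(1)] by simp
    qed (use F x in auto)
    also have "\<dots> = x c"
    proof (cases "c \<in> F")
      case True
      then show ?thesis using V.add.finprod_singleton[OF True F(1), of x] x F(2) by (auto simp: finsum_def)
    next
      case False
      then have "(\<Oplus>\<^bsub>V\<^esub>b\<in>F. if c = b then x b else \<zero>\<^bsub>V\<^esub>) = \<zero>\<^bsub>V\<^esub>" by (intro V.finsum_all_zero) auto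
      then show ?thesis using z c False by simp
    qed
    finally show ?thesis .
  qed
  then show thesis by (intro that[of ?t]) (use pc in auto)
qed

end

section \<open>Bilinearity of nested tensor expressions\<close>

lemma linear_pure_left:
  assumes "module K A" "module K B" "linear_map K V A g" "y \<in> carrier B"
  shows "linear_map K V (tensor_product K A B) (\<lambda>v. pure_tensor K A B (g v) y)"
proof -
  interpret module_pair K A B using assms by (simp add: module_pair_def)
  show ?thesis by (rule linear_map_compose[OF assms(3) bilinear_left[OF pure_tensor_bilinear assms(4)]])
qed

lemma linear_pure_right:
  assumes "module K A" "module K B" "linear_map K V B g" "x \<in> carrier A"
  shows "linear_map K V (tensor_product K A B) (\<lambda>v. pure_tensor K A B x (g v))"
proof -
  interpret module_pair K A B using assms by (simp add: module_pair_def)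
  show ?thesis by (rule linear_map_compose[OF assms(3) bilinear_right[OF pure_tensor_bilinear assms(4)]])
qed

lemma bilinear_pure:
  assumes A: "module K A" and B: "module K B" and f: "linear_map K V A f" and g: "linear_map K W B g"
  shows "bilinear_map K V W (tensor_product K A B) (\<lambda>v w. pure_tensor K A B (f v) (g w))"
  by (rule bilinear_mapI)
    (auto intro: linear_pure_left[OF A B f] linear_pure_right[OF A B g] linear_map_closed[OF f] linear_map_closed[OF g])

lemma linear_functional_smult:
  assumes "module K P" "linear_map K V (ground K) \<phi>" "p \<in> carrier P"
  shows "linear_map K V P (\<lambda>v. \<phi> v \<odot>\<^bsub>P\<^esub> p)"
  using bilinear_right[OF functional_bilinear[OF assms(1,2)] assms(3)] .

lemma bilinear_functional_smult:
  assumes P: "module K P" and \<phi>: "linear_map K W (ground K) \<phi>" and f: "linear_map K V P f"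
  shows "bilinear_map K V W P (\<lambda>v w. \<phi> w \<odot>\<^bsub>P\<^esub> f v)"
proof (rule bilinear_mapI)
  show "linear_map K W P (\<lambda>w. \<phi> w \<odot>\<^bsub>P\<^esub> f v)" if "v \<in> carrier V" for v
    by (rule linear_functional_smult[OF P \<phi> linear_map_closed[OF f that]])
  show "linear_map K V P (\<lambda>v. \<phi> w \<odot>\<^bsub>P\<^esub> f v)" if "w \<in> carrier W" for w
    by (rule linear_map_scale[OF P f]) (use linear_map_closed[OF \<phi> that] in simp)
qed

lemma bilinear_map_flip: "bilinear_map K V W P b \<Longrightarrow> bilinear_map K W V P (\<lambda>w v. b v w)"
  unfolding bilinear_map_def by auto

lemma bilinear_precompose:
  "\<lbrakk>bilinear_map K V W P b; linear_map K V' V f; linear_map K W' W g\<rbrakk> \<Longrightarrow> bilinear_map K V' W' P (\<lambda>v w. b (f v) (g w))"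
  by (rule bilinear_mapI) (metis bilinear_right linear_map_closed linear_map_compose, metis bilinear_left linear_map_closed linear_map_compose[where g = "\<lambda>v. b v (g w)" for w])

lemma sweedler_bilinear:
  assumes P: "module K P" and V: "module K V" and X: "module K X" and Y: "module K Y"
    and b: "\<And>v. v \<in> carrier V \<Longrightarrow> bilinear_map K X Y P (b v)"
    and l: "\<And>x y. \<lbrakk>x \<in> carrier X; y \<in> carrier Y\<rbrakk> \<Longrightarrow> linear_map K V P (\<lambda>v. b v x y)"
  shows "bilinear_map K V (tensor_product K X Y) P (\<lambda>v u. sweedler K P u (b v))"
proof -
  interpret p: module_pair K X Y using X Y by (simp add: module_pair_def)
  show ?thesis
    by (rule bilinear_mapI) (auto intro: p.sweedler_linear[OF P b] p.sweedler_param_linear[OF P V b l])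
qed

text \<open>Fubini for Sweedler sums over two independent tensors. Both sides are linear in s, so s
  may be taken pure.\<close>

lemma sweedler_swap:
  assumes P: "module K P" and V: "module K V" and W: "module K W" and X: "module K X" and Y: "module K Y"
    and s: "s \<in> carrier (tensor_product K V W)" and t: "t \<in> carrier (tensor_product K X Y)"
    and b1: "\<And>v w. \<lbrakk>v \<in> carrier V; w \<in> carrier W\<rbrakk> \<Longrightarrow> bilinear_map K X Y P (b v w)"
    and b2: "\<And>x y. \<lbrakk>x \<in> carrier X; y \<in> carrier Y\<rbrakk> \<Longrightarrow> bilinear_map K V W P (\<lambda>v w. b v w x y)"
  shows "sweedler K P s (\<lambda>v w. sweedler K P t (b v w)) = sweedler K P t (\<lambda>x y. sweedler K P s (\<lambda>v w. b v w x y))"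
proof -
  interpret p: module_pair K V W using V W by (simp add: module_pair_def)
  interpret q: module_pair K X Y using X Y by (simp add: module_pair_def)
  have o: "bilinear_map K V W P (\<lambda>v w. sweedler K P t (b v w))"
  proof (rule bilinear_mapI)
    show "linear_map K W P (\<lambda>w. sweedler K P t (b v w))" if v: "v \<in> carrier V" for v
      by (rule q.sweedler_param_linear[OF P W b1[OF v] bilinear_right[OF b2 v] t])
    show "linear_map K V P (\<lambda>v. sweedler K P t (b v w))" if w: "w \<in> carrier W" for w
      by (rule q.sweedler_param_linear[OF P V b1[OF _ w] bilinear_left[OF b2 w] t])
  qed
  have i: "bilinear_map K X Y P (\<lambda>x y. sweedler K P s (\<lambda>v w. b v w x y))" if s: "s \<in> carrier (tensor_product K V W)" for s
  proof (rule bilinear_mapI)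
    show "linear_map K Y P (\<lambda>y. sweedler K P s (\<lambda>v w. b v w x y))" if x: "x \<in> carrier X" for x
      by (rule p.sweedler_param_linear[OF P Y b2[OF x] bilinear_right[OF b1 x] s])
    show "linear_map K X P (\<lambda>x. sweedler K P s (\<lambda>v w. b v w x y))" if y: "y \<in> carrier Y" for y
      by (rule p.sweedler_param_linear[OF P X b2[OF _ y] bilinear_left[OF b1 y] s])
  qed
  have l: "linear_map K (tensor_product K V W) P (\<lambda>s. sweedler K P t (\<lambda>x y. sweedler K P s (\<lambda>v w. b v w x y)))"
    by (rule q.sweedler_param_linear[OF P p.tensor_module i p.sweedler_linear[OF P b2] t])
  show ?thesis
  proof (rule p.sweedler_unique[OF P o l _ s])
    fix v w assume vw: "v \<in> carrier V" "w \<in> carrier W"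
    show "sweedler K P t (\<lambda>x y. sweedler K P (pure_tensor K V W v w) (\<lambda>v w. b v w x y)) = sweedler K P t (b v w)"
      by (rule q.sweedler_cong[OF P b1[OF vw] t]) (rule p.sweedler_pure[OF P b2 vw])
  qed
qed

text \<open>The map \<eta> \<otimes> id with values in V \<otimes> H. The source module is not a
  parameter because \<open>sweedler\<close> reads everything from the tensor.\<close>

definition tensor_push :: "('k, 'x) ring_scheme \<Rightarrow> ('k, 'v, 'y) module_scheme \<Rightarrow> ('k, 'h, 'z) module_scheme \<Rightarrow>
    ('u \<Rightarrow> 'v) \<Rightarrow> ('u, 'h, 'k) tensor \<Rightarrow> ('v, 'h, 'k) tensor" where
  "tensor_push K V H \<eta> t = sweedler K (tensor_product K V H) t (\<lambda>u h. pure_tensor K V H (\<eta> u) h)"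

lemma tensor_push_props:
  assumes A: "module K A" and V: "module K V" and H: "module K H" and \<eta>: "linear_map K A V \<eta>"
  shows tensor_push_linear: "linear_map K (tensor_product K A H) (tensor_product K V H) (tensor_push K V H \<eta>)"
    and tensor_push_pure: "\<And>u h. \<lbrakk>u \<in> carrier A; h \<in> carrier H\<rbrakk> \<Longrightarrow>
      tensor_push K V H \<eta> (pure_tensor K A H u h) = pure_tensor K V H (\<eta> u) h"
    and sweedler_push: "\<And>P b t. \<lbrakk>module K P; bilinear_map K V H P b; t \<in> carrier (tensor_product K A H)\<rbrakk> \<Longrightarrow>
      sweedler K P (tensor_push K V H \<eta> t) b = sweedler K P t (\<lambda>u h. b (\<eta> u) h)"
proof -
  interpret p: module_pair K A H using A H by (simp add: module_pair_def)
  interpret q: module_pair K V H using V H by (simp add: module_pair_def)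
  have bil: "bilinear_map K A H (tensor_product K V H) (\<lambda>u h. pure_tensor K V H (\<eta> u) h)"
    by (rule bilinear_pure[OF V H \<eta> linear_map_id])
  show l: "linear_map K (tensor_product K A H) (tensor_product K V H) (tensor_push K V H \<eta>)"
    unfolding tensor_push_def by (rule p.sweedler_linear[OF q.tensor_module bil])
  show pu: "tensor_push K V H \<eta> (pure_tensor K A H u h) = pure_tensor K V H (\<eta> u) h" if "u \<in> carrier A" "h \<in> carrier H" for u h
    unfolding tensor_push_def by (rule p.sweedler_pure[OF q.tensor_module bil that])
  fix P b t assume P: "module K P" and b: "bilinear_map K V H P b" and t: "t \<in> carrier (tensor_product K A H)"
  have b': "bilinear_map K A H P (\<lambda>u h. b (\<eta> u) h)"
  proof (rule bilinear_mapI)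
    show "linear_map K H P (b (\<eta> u))" if "u \<in> carrier A" for u by (rule bilinear_right[OF b linear_map_closed[OF \<eta> that]])
    show "linear_map K A P (\<lambda>u. b (\<eta> u) h)" if "h \<in> carrier H" for h by (rule linear_map_compose[OF \<eta> bilinear_left[OF b that]])
  qed
  show "sweedler K P (tensor_push K V H \<eta> t) b = sweedler K P t (\<lambda>u h. b (\<eta> u) h)"
    by (rule p.sweedler_unique[OF P b' linear_map_compose[OF l q.sweedler_linear[OF P b]] _ t, symmetric])
      (simp add: pu q.sweedler_pure[OF P b] linear_map_closed[OF \<eta>])
qed

section \<open>Coordinates of threefold tensors\<close>

context based_module
begin

abbreviation "WW \<equiv> tensor_product K W W"

text \<open>The functional \<open>cf c\<close> \<otimes> \<open>cf b\<close> on W \<otimes>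
  W.\<close>

definition pairing :: "'w \<Rightarrow> 'w \<Rightarrow> ('w, 'w, 'k) tensor \<Rightarrow> 'k" where
  "pairing c b u = sweedler K (ground K) u (\<lambda>x y. cf c x \<otimes>\<^bsub>K\<^esub> cf b y)"

lemma pair_WW: "module_pair K W W" by (rule pairI[OF module_axioms])

lemma WW_module: "module K WW" by (rule module_pair.tensor_module[OF pair_WW])

lemma pairing_bilinear: "\<lbrakk>c \<in> B; b \<in> B\<rbrakk> \<Longrightarrow> bilinear_map K W W (ground K) (\<lambda>x y. cf c x \<otimes>\<^bsub>K\<^esub> cf b y)"
proof -
  assume cb: "c \<in> B" "b \<in> B"
  have "bilinear_map K W W (ground K) (\<lambda>x y. cf b y \<odot>\<^bsub>ground K\<^esub> cf c x)"
    by (rule bilinear_functional_smult[OF R.ground_module cf_linear[OF cb(2)] cf_linear[OF cb(1)]])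
  then show ?thesis unfolding bilinear_map_def linear_map_def
    using cf_closed[OF cb(1)] cf_closed[OF cb(2)] by (auto simp: R.m_comm Pi_def)
qed

lemma pairing_linear: "\<lbrakk>c \<in> B; b \<in> B\<rbrakk> \<Longrightarrow> linear_map K WW (ground K) (pairing c b)"
  unfolding pairing_def by (rule module_pair.sweedler_linear[OF pair_WW R.ground_module pairing_bilinear])

lemma pairing_pure: "\<lbrakk>c \<in> B; b \<in> B; x \<in> carrier W; y \<in> carrier W\<rbrakk> \<Longrightarrow> pairing c b (pure_tensor K W W x y) = cf c x \<otimes>\<^bsub>K\<^esub> cf b y"
  unfolding pairing_def by (rule module_pair.sweedler_pure[OF pair_WW R.ground_module pairing_bilinear])

text \<open>The coordinate of V \<otimes> (W \<otimes> W) at the pair (c, b), namely id \<otimes>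
  \<open>cf c\<close> \<otimes> \<open>cf b\<close>.\<close>

definition cd2 :: "('k, 'v, 'y) module_scheme \<Rightarrow> 'w \<Rightarrow> 'w \<Rightarrow> ('v, ('w, 'w, 'k) tensor, 'k) tensor \<Rightarrow> 'v" where
  "cd2 V c b t = sweedler K V t (\<lambda>v u. pairing c b u \<odot>\<^bsub>V\<^esub> v)"

lemma pair_V_WW: "module K V \<Longrightarrow> module_pair K V WW"
  using WW_module by (simp add: module_pair_def)

lemma cd2_linear: "\<lbrakk>module K V; c \<in> B; b \<in> B\<rbrakk> \<Longrightarrow> linear_map K (tensor_product K V WW) V (cd2 V c b)"
  unfolding cd2_def by (rule module_pair.sweedler_linear[OF pair_V_WW _ functional_bilinear[OF _ pairing_linear]])

lemma cd2_pure: "\<lbrakk>module K V; c \<in> B; b \<in> B; v \<in> carrier V; u \<in> carrier WW\<rbrakk> \<Longrightarrow>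
    cd2 V c b (pure_tensor K V WW v u) = pairing c b u \<odot>\<^bsub>V\<^esub> v"
  unfolding cd2_def by (rule module_pair.sweedler_pure[OF pair_V_WW _ functional_bilinear[OF _ pairing_linear]])

lemma tensor3_hom_eqI:
  assumes V: "module K V" and P: "module K P"
    and f: "linear_map K (tensor_product K V WW) P f" and g: "linear_map K (tensor_product K V WW) P g"
    and eq: "\<And>v x y. \<lbrakk>v \<in> carrier V; x \<in> carrier W; y \<in> carrier W\<rbrakk> \<Longrightarrow>
      f (pure_tensor K V WW v (pure_tensor K W W x y)) = g (pure_tensor K V WW v (pure_tensor K W W x y))"
    and t: "t \<in> carrier (tensor_product K V WW)"
  shows "f t = g t"
proof (rule module_pair.tensor_hom_eqI[OF pair_V_WW[OF V] P f g _ t])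
  fix v u assume v: "v \<in> carrier V" and u: "u \<in> carrier WW"
  have l: "linear_map K WW (tensor_product K V WW) (pure_tensor K V WW v)"
    by (rule linear_pure_right[OF V WW_module linear_map_id v])
  show "f (pure_tensor K V WW v u) = g (pure_tensor K V WW v u)"
    by (rule module_pair.tensor_hom_eqI[OF pair_WW P linear_map_compose[OF l f] linear_map_compose[OF l g] eq[OF v] u])
qed

text \<open>Injectivity of the associator reduces separation of threefold tensors to the coordinates \<open>cd\<close>.\<close>

lemma cd2_eqI:
  assumes V: "module K V" and s: "s \<in> carrier (tensor_product K V WW)" and t: "t \<in> carrier (tensor_product K V WW)"
    and eq: "\<And>c b. \<lbrakk>c \<in> B; b \<in> B\<rbrakk> \<Longrightarrow> cd2 V c b s = cd2 V c b t"
  shows "s = t"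
proof -
  let ?VW = "tensor_product K V W" and ?V2 = "tensor_product K V WW"
  interpret p: module_pair K V W by (rule pairI[OF V])
  interpret q: module_pair K V WW by (rule pair_V_WW[OF V])
  interpret pp: module_pair K ?VW W by (rule pairI[OF p.tensor_module])
  note W = module_axioms
  let ?T = "tensor_product K ?VW W"
  \<comment> \<open>\<alpha> is the associator to (V \<otimes> W) \<otimes> W, where
    \<open>cd\<close> can be applied twice; a gives its values on tensors that are pure in the outer
    product.\<close>
  define a where "a v u = sweedler K ?T u (\<lambda>x y. pure_tensor K ?VW W (pure_tensor K V W v x) y)" for v u
  define \<alpha> where "\<alpha> t = sweedler K ?T t a" for t
  have ib: "bilinear_map K W W ?T (\<lambda>x y. pure_tensor K ?VW W (pure_tensor K V W v x) y)" if "v \<in> carrier V" for v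
    by (rule bilinear_pure[OF p.tensor_module W linear_pure_right[OF V W linear_map_id that] linear_map_id])
  have il: "linear_map K V ?T (\<lambda>v. pure_tensor K ?VW W (pure_tensor K V W v x) y)" if "x \<in> carrier W" "y \<in> carrier W" for x y
    by (rule linear_pure_left[OF p.tensor_module W linear_pure_left[OF V W linear_map_id that(1)] that(2)])
  have ab: "bilinear_map K V WW ?T a" unfolding a_def
    by (rule sweedler_bilinear[OF pp.tensor_module V W W ib il])
  have \<alpha>l: "linear_map K ?V2 ?T \<alpha>" unfolding \<alpha>_def by (rule q.sweedler_linear[OF pp.tensor_module ab])
  have \<alpha>p: "\<alpha> (pure_tensor K V WW v (pure_tensor K W W x y)) = pure_tensor K ?VW W (pure_tensor K V W v x) y"
    if "v \<in> carrier V" "x \<in> carrier W" "y \<in> carrier W" for v x y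
    unfolding \<alpha>_def q.sweedler_pure[OF pp.tensor_module ab that(1) module_pair.pure_tensor_closed[OF pair_WW that(2,3)]]
    unfolding a_def by (rule module_pair.sweedler_pure[OF pair_WW pp.tensor_module ib[OF that(1)] that(2,3)])
  \<comment> \<open>\<beta> is the associator in the opposite direction. Only \<beta> \<alpha> = id
    is established, since this is the injectivity of \<alpha>.\<close>
  define e where "e s y = sweedler K ?V2 s (\<lambda>v x. pure_tensor K V WW v (pure_tensor K W W x y))" for s y
  define \<beta> where "\<beta> t = sweedler K ?V2 t e" for t
  have jb: "bilinear_map K V W ?V2 (\<lambda>v x. pure_tensor K V WW v (pure_tensor K W W x y))" if "y \<in> carrier W" for y
    by (rule bilinear_pure[OF V WW_module linear_map_id linear_pure_left[OF W W linear_map_id that]])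
  have jl: "linear_map K W ?V2 (\<lambda>y. pure_tensor K V WW v (pure_tensor K W W x y))" if "v \<in> carrier V" "x \<in> carrier W" for v x
    by (rule linear_pure_right[OF V WW_module linear_pure_right[OF W W linear_map_id that(2)] that(1)])
  have "bilinear_map K W ?VW ?V2 (\<lambda>y s. e s y)" unfolding e_def
    by (rule sweedler_bilinear[OF q.tensor_module W V W jb jl])
  then have eb: "bilinear_map K ?VW W ?V2 e" by (rule bilinear_map_flip)
  have \<beta>l: "linear_map K ?T ?V2 \<beta>" unfolding \<beta>_def by (rule pp.sweedler_linear[OF q.tensor_module eb])
  have \<beta>p: "\<beta> (pure_tensor K ?VW W (pure_tensor K V W v x) y) = pure_tensor K V WW v (pure_tensor K W W x y)"
    if "v \<in> carrier V" "x \<in> carrier W" "y \<in> carrier W" for v x y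
    unfolding \<beta>_def pp.sweedler_pure[OF q.tensor_module eb p.pure_tensor_closed[OF that(1,2)] that(3)]
    unfolding e_def by (rule p.sweedler_pure[OF q.tensor_module jb[OF that(3)] that(1,2)])
  have \<beta>\<alpha>: "\<beta> (\<alpha> t) = t" if "t \<in> carrier ?V2" for t
    by (rule tensor3_hom_eqI[OF V q.tensor_module linear_map_compose[OF \<alpha>l \<beta>l] linear_map_id _ that]) (simp add: \<alpha>p \<beta>p)
  \<comment> \<open>After \<alpha>, the coordinate \<open>cd2\<close> becomes an iterated
    \<open>cd\<close>: first of the last factor, then of the middle one.\<close>
  have cc: "cd V c (cd ?VW b (\<alpha> t)) = cd2 V c b t" if cb: "c \<in> B" "b \<in> B" and t: "t \<in> carrier ?V2" for c b t
  proof (rule tensor3_hom_eqI[OF V V _ cd2_linear[OF V cb] _ t])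
    show "linear_map K ?V2 V (\<lambda>t. cd V c (cd ?VW b (\<alpha> t)))"
      by (rule linear_map_compose[OF linear_map_compose[OF \<alpha>l cd_linear[OF p.tensor_module cb(2)]] cd_linear[OF V cb(1)]])
    fix v x y assume vxy: "v \<in> carrier V" "x \<in> carrier W" "y \<in> carrier W"
    note vx = p.pure_tensor_closed[OF vxy(1,2)]
    have "cd V c (cd ?VW b (\<alpha> (pure_tensor K V WW v (pure_tensor K W W x y)))) = cd V c (cf b y \<odot>\<^bsub>?VW\<^esub> pure_tensor K V W v x)"
      unfolding \<alpha>p[OF vxy] cd_pure[OF p.tensor_module cb(2) vx vxy(3)] ..
    also have "\<dots> = cf b y \<odot>\<^bsub>V\<^esub> (cf c x \<odot>\<^bsub>V\<^esub> v)"
      using linear_map_smult[OF cd_linear[OF V cb(1)] cf_closed[OF cb(2) vxy(3)] vx] cd_pure[OF V cb(1) vxy(1,2)] by simp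
    also have "\<dots> = (cf c x \<otimes>\<^bsub>K\<^esub> cf b y) \<odot>\<^bsub>V\<^esub> v"
      using module.smult_assoc1[OF V cf_closed[OF cb(2) vxy(3)] cf_closed[OF cb(1) vxy(2)] vxy(1)]
        R.m_comm[OF cf_closed[OF cb(2) vxy(3)] cf_closed[OF cb(1) vxy(2)]] by simp
    also have "\<dots> = cd2 V c b (pure_tensor K V WW v (pure_tensor K W W x y))"
      using cd2_pure[OF V cb vxy(1) module_pair.pure_tensor_closed[OF pair_WW vxy(2,3)]] pairing_pure[OF cb vxy(2,3)] by simp
    finally show "cd V c (cd ?VW b (\<alpha> (pure_tensor K V WW v (pure_tensor K W W x y)))) = cd2 V c b (pure_tensor K V WW v (pure_tensor K W W x y))" .
  qed
  have \<alpha>c: "\<alpha> u \<in> carrier ?T" if "u \<in> carrier ?V2" for u by (rule linear_map_closed[OF \<alpha>l that])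
  have "\<alpha> s = \<alpha> t"
  proof (rule cd_eqI[OF p.tensor_module \<alpha>c[OF s] \<alpha>c[OF t]])
    fix b assume b: "b \<in> B"
    show "cd ?VW b (\<alpha> s) = cd ?VW b (\<alpha> t)"
      by (rule cd_eqI[OF V cd_closed[OF p.tensor_module b \<alpha>c[OF s]] cd_closed[OF p.tensor_module b \<alpha>c[OF t]]])
        (simp add: cc b s t eq)
  qed
  then show ?thesis using \<beta>\<alpha> s t by metis
qed

end

section \<open>Relative Hopf modules as modules with operators\<close>

lemma submodule_equalizer:
  assumes V: "module K V" and W: "module K W" and f: "linear_map K V W f" and g: "linear_map K V W g"
  shows "submodule {x \<in> carrier V. f x = g x} K V"
proof -
  interpret V: module K V by (rule V)
  show ?thesis
    by (rule V.submodule_memI)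
      (auto simp: linear_map_zero[OF V W f] linear_map_zero[OF V W g] linear_map_add[OF f] linear_map_add[OF g] linear_map_smult[OF f] linear_map_smult[OF g])
qed

type_synonym ('o, 'f, 'h) hopf_op = "('o \<times> 'o \<times> 'f) + ('o \<times> 'h)"
type_synonym ('o, 'f, 'h, 'k, 'v) hopf_opmod = "('o, ('o, 'f, 'h) hopf_op, 'k, 'v) opmod"

locale hopf_setting = based_module K H B cf
  for K :: "'k ring" and H :: "('k, 'h) hopf" and B :: "'h set" and cf :: "'h \<Rightarrow> 'h \<Rightarrow> 'k" +
  fixes D :: "('o, 'f, 'k, 'h) co_cat"
  assumes hopf: "hopf_algebra K H" and co_category: "right_co_category K H D"
begin

abbreviation Hmult (infixl "\<cdot>" 70) where "x \<cdot> y \<equiv> x \<otimes>\<^bsub>H\<^esub> y"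
abbreviation "sw \<equiv> sweedler K"
abbreviation "lin \<equiv> linear_map K"
abbreviation "bilin \<equiv> bilinear_map K"
abbreviation "Ob \<equiv> LObj D"
abbreviation "ten V \<equiv> tensor_product K V H"
abbreviation "tenW V \<equiv> tensor_product K V WW"
abbreviation "ptH V \<equiv> pure_tensor K V H"
abbreviation "ptW V \<equiv> pure_tensor K V WW"
abbreviation "pushH V \<equiv> tensor_push K V H"

lemma H_module: "module K H" by (rule module_axioms)

lemma coalgebra_H: "coalgebra K H" using hopf by (simp add: hopf_algebra_def)
lemma algebra_H: "assoc_algebra K H" using hopf by (simp add: hopf_algebra_def)
lemma ring_H: "ring H" using algebra_H by (simp add: assoc_algebra_def)

lemma D_linear: "linear_category K D" using co_category by (simp add: right_co_category_def)

lemma D_module: "\<lbrakk>X \<in> Ob; Y \<in> Ob\<rbrakk> \<Longrightarrow> module K (LHom D X Y)"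
  by (rule linear_category.LHom_module[OF D_linear])

lemma D_category: "category (underlying_cat D)"
  by (rule linear_category.underlying_category[OF D_linear])

lemma D_Comp_closed: "\<lbrakk>X \<in> Ob; Y \<in> Ob; Z \<in> Ob; g \<in> carrier (LHom D X Y); f \<in> carrier (LHom D Y Z)\<rbrakk>
    \<Longrightarrow> LComp D X Y Z f g \<in> carrier (LHom D X Z)"
  using category.Comp_closed[OF D_category, of X Y Z g f] by (simp add: underlying_cat_def)

lemma D_Ident_closed: "X \<in> Ob \<Longrightarrow> LIdent D X \<in> carrier (LHom D X X)"
  using category.Ident_closed[OF D_category, of X] by (simp add: underlying_cat_def)

lemma D_Comp_assoc: "\<lbrakk>W \<in> Ob; X \<in> Ob; Y \<in> Ob; Z \<in> Ob; f \<in> carrier (LHom D W X);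
      g \<in> carrier (LHom D X Y); h \<in> carrier (LHom D Y Z)\<rbrakk>
    \<Longrightarrow> LComp D W X Z (LComp D X Y Z h g) f = LComp D W Y Z h (LComp D W X Y g f)"
  using category.Comp_assoc[OF D_category, of W X Y Z f g h] by (simp add: underlying_cat_def)

lemma D_Comp_Ident: "\<lbrakk>X \<in> Ob; Y \<in> Ob; f \<in> carrier (LHom D X Y)\<rbrakk> \<Longrightarrow> LComp D X Y Y (LIdent D Y) f = f"
    "\<lbrakk>X \<in> Ob; Y \<in> Ob; f \<in> carrier (LHom D X Y)\<rbrakk> \<Longrightarrow> LComp D X X Y f (LIdent D X) = f"
  using category.Comp_Ident_left[OF D_category, of X Y f] category.Comp_Ident_right[OF D_category, of X Y f]
  by (simp_all add: underlying_cat_def)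

lemmas D_Comp_left = linear_category.LComp_linear_left[OF D_linear]
lemmas D_Comp_right = linear_category.LComp_linear_right[OF D_linear]

lemma D_comodule: "\<lbrakk>X \<in> Ob; Y \<in> Ob\<rbrakk> \<Longrightarrow> right_comodule K H (LHom D X Y) (coact D X Y)"
  by (rule right_co_category.LHom_comodule[OF co_category])

lemma coact_linear: "\<lbrakk>X \<in> Ob; Y \<in> Ob\<rbrakk> \<Longrightarrow>
    lin (LHom D X Y) (ten (LHom D X Y)) (coact D X Y)"
  by (rule right_comodule.coaction_linear[OF D_comodule])

lemma coact_closed: "\<lbrakk>X \<in> Ob; Y \<in> Ob; f \<in> carrier (LHom D X Y)\<rbrakk> \<Longrightarrow>
    coact D X Y f \<in> carrier (ten (LHom D X Y))"
  by (rule linear_map_closed[OF coact_linear])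

lemma comult_linear: "lin H WW (comult H)"
  by (rule coalgebra.comult_linear[OF coalgebra_H])

lemma comult_closed: "h \<in> carrier H \<Longrightarrow> comult H h \<in> carrier WW"
  by (rule linear_map_closed[OF comult_linear])

lemma counit_linear: "lin H (ground K) (counit H)"
  by (rule linear_mapI)
    (auto simp: coalgebra.counit_closed[OF coalgebra_H] coalgebra.counit_add[OF coalgebra_H] coalgebra.counit_smult[OF coalgebra_H])

lemma mult_left_linear: "x \<in> carrier H \<Longrightarrow> lin H H (\<lambda>y. x \<cdot> y)"
  using ring.ring_simprules[OF ring_H] assoc_algebra.smult_mult_right[OF algebra_H]
  by (intro linear_mapI) auto

lemma mult_right_linear: "y \<in> carrier H \<Longrightarrow> lin H H (\<lambda>x. x \<cdot> y)"
  using ring.ring_simprules[OF ring_H] assoc_algebra.smult_mult_left[OF algebra_H]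
  by (intro linear_mapI) auto

lemma H_mult_closed: "\<lbrakk>x \<in> carrier H; y \<in> carrier H\<rbrakk> \<Longrightarrow> x \<cdot> y \<in> carrier H"
  by (rule linear_map_closed[OF mult_left_linear])

lemma comult_pairing_linear: "\<lbrakk>c \<in> B; b \<in> B\<rbrakk> \<Longrightarrow> lin H (ground K) (\<lambda>h. pairing c b (comult H h))"
  by (rule linear_map_compose[OF comult_linear pairing_linear])

text \<open>Operators: the arrows of \<open>D\<close> and, for every object, the coordinates of the coaction.\<close>

definition ops :: "(('o, 'f, 'h) hopf_op) set" where
  "ops = {Inl (X, Y, f) | X Y f. X \<in> Ob \<and> Y \<in> Ob \<and> f \<in> carrier (LHom D X Y)} \<union>
    {Inr (X, b) | X b. X \<in> Ob \<and> b \<in> B}"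

definition op_src :: "('o, 'f, 'h) hopf_op \<Rightarrow> 'o" where
  "op_src p = (case p of Inl (X, Y, f) \<Rightarrow> X | Inr (X, b) \<Rightarrow> X)"

definition op_tgt :: "('o, 'f, 'h) hopf_op \<Rightarrow> 'o" where
  "op_tgt p = (case p of Inl (X, Y, f) \<Rightarrow> Y | Inr (X, b) \<Rightarrow> X)"

lemma op_simps [simp]: "op_src (Inl (X, Y, f)) = X" "op_tgt (Inl (X, Y, f)) = Y" "op_src (Inr (X, b)) = X" "op_tgt (Inr (X, b)) = X"
  unfolding op_src_def op_tgt_def by auto

lemma ops_simps [simp]: "Inl (X, Y, f) \<in> ops \<longleftrightarrow> X \<in> Ob \<and> Y \<in> Ob \<and> f \<in> carrier (LHom D X Y)"
  "Inr (X, b) \<in> ops \<longleftrightarrow> X \<in> Ob \<and> b \<in> B"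
  unfolding ops_def by auto

lemma ops_cases:
  assumes "p \<in> ops"
  obtains X Y f where "p = Inl (X, Y, f)" "X \<in> Ob" "Y \<in> Ob" "f \<in> carrier (LHom D X Y)"
  | X b where "p = Inr (X, b)" "X \<in> Ob" "b \<in> B"
  using assms unfolding ops_def by blast

end

sublocale hopf_setting \<subseteq> OS: op_signature K "LObj D" ops op_src op_tgt
proof (rule op_signature.intro)
  show "cring K" by (rule R.is_cring)
qed (auto elim!: ops_cases)

context hopf_setting
begin

abbreviation "act A X Y f \<equiv> Op A (Inl (X, Y, f))"
abbreviation "rho A X b \<equiv> Op A (Inr (X, b))"
abbreviation "DH X Y \<equiv> carrier (LHom D X Y)"

lemma act_linear: "\<lbrakk>OS.is_opmod A; X \<in> Ob; Y \<in> Ob; f \<in> DH X Y\<rbrakk> \<Longrightarrow> lin (Grp A X) (Grp A Y) (act A X Y f)"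
  using OS.opmod_linear[of A "Inl (X, Y, f)"] by simp

lemma rho_linear: "\<lbrakk>OS.is_opmod A; X \<in> Ob; b \<in> B\<rbrakk> \<Longrightarrow> lin (Grp A X) (Grp A X) (rho A X b)"
  using OS.opmod_linear[of A "Inr (X, b)"] by simp

lemma ophom_act: "\<lbrakk>OS.ophom A A' \<eta>; X \<in> Ob; Y \<in> Ob; f \<in> DH X Y; m \<in> el A X\<rbrakk>
    \<Longrightarrow> \<eta> Y (act A X Y f m) = act A' X Y f (\<eta> X m)"
  using OS.ophom_Op[of A A' \<eta> "Inl (X, Y, f)" m] by simp

lemma ophom_rho: "\<lbrakk>OS.ophom A A' \<eta>; X \<in> Ob; b \<in> B; m \<in> el A X\<rbrakk>
    \<Longrightarrow> \<eta> X (rho A X b m) = rho A' X b (\<eta> X m)"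
  using OS.ophom_Op[of A A' \<eta> "Inr (X, b)" m] by simp

text \<open>The laws are stated at one element, so that a map carries them from its source to an
  element of the image without any assumption on the rest of the target.\<close>

definition module_laws_at :: "('o, 'f, 'h, 'k, 'v) hopf_opmod \<Rightarrow> 'o \<Rightarrow> 'v \<Rightarrow> bool" where
  "module_laws_at A X m \<longleftrightarrow>
    (\<forall>Y\<in>Ob. \<forall>f\<in>DH X Y. \<forall>g\<in>DH X Y.
      act A X Y (f \<oplus>\<^bsub>LHom D X Y\<^esub> g) m = act A X Y f m \<oplus>\<^bsub>Grp A Y\<^esub> act A X Y g m) \<and>
    (\<forall>Y\<in>Ob. \<forall>a\<in>carrier K. \<forall>f\<in>DH X Y. act A X Y (a \<odot>\<^bsub>LHom D X Y\<^esub> f) m = a \<odot>\<^bsub>Grp A Y\<^esub> act A X Y f m) \<and>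
    act A X X (LIdent D X) m = m \<and>
    (\<forall>Y\<in>Ob. \<forall>Z\<in>Ob. \<forall>g\<in>DH X Y. \<forall>f\<in>DH Y Z.
      act A X Z (LComp D X Y Z f g) m = act A Y Z f (act A X Y g m))"

definition module_laws :: "('o, 'f, 'h, 'k, 'v) hopf_opmod \<Rightarrow> bool" where
  "module_laws A \<longleftrightarrow> (\<forall>X\<in>Ob. \<forall>m\<in>el A X. module_laws_at A X m)"

text \<open>
  The tensor \<open>t\<close> is a candidate for $\rho(m)$. The four clauses are: the coordinates of \<open>t\<close> are the values
  of the operators, the counit law, coassociativity and compatibility with the arrows, the last two
  written in coordinates.
\<close>

definition coaction_at :: "('o, 'f, 'h, 'k, 'v) hopf_opmod \<Rightarrow> 'o \<Rightarrow> 'v \<Rightarrow> ('v, 'h, 'k) tensor \<Rightarrow> bool" where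
  "coaction_at A X m t \<longleftrightarrow>
    (\<forall>b\<in>B. cd (Grp A X) b t = rho A X b m) \<and>
    sw (Grp A X) t (\<lambda>v h. counit H h \<odot>\<^bsub>Grp A X\<^esub> v) = m \<and>
    (\<forall>c\<in>B. \<forall>b\<in>B. rho A X c (rho A X b m) =
      sw (Grp A X) t (\<lambda>v h. pairing c b (comult H h) \<odot>\<^bsub>Grp A X\<^esub> v)) \<and>
    (\<forall>Y\<in>Ob. \<forall>f\<in>DH X Y. \<forall>b\<in>B. rho A Y b (act A X Y f m) =
      sw (Grp A Y) (coact D X Y f) (\<lambda>f0 f1.
        sw (Grp A Y) t (\<lambda>v h. cf b (f1 \<cdot> h) \<odot>\<^bsub>Grp A Y\<^esub> act A X Y f0 v)))"

text \<open>These are the operator modules that come from relative Hopf modules, by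
  \<open>U_good\<close> and \<open>hopf_mod_of_relative\<close>.\<close>

definition good :: "('o, 'f, 'h, 'k, 'v) hopf_opmod \<Rightarrow> bool" where
  "good A \<longleftrightarrow> module_laws A \<and> (\<forall>X\<in>Ob. \<forall>m\<in>el A X. \<exists>t\<in>carrier (ten (Grp A X)). coaction_at A X m t)"

lemma module_lawsD:
  assumes "module_laws A" "X \<in> Ob" "m \<in> el A X"
  shows "\<And>Y f g. \<lbrakk>Y \<in> Ob; f \<in> DH X Y; g \<in> DH X Y\<rbrakk> \<Longrightarrow>
      act A X Y (f \<oplus>\<^bsub>LHom D X Y\<^esub> g) m = act A X Y f m \<oplus>\<^bsub>Grp A Y\<^esub> act A X Y g m"
    and "\<And>Y a f. \<lbrakk>Y \<in> Ob; a \<in> carrier K; f \<in> DH X Y\<rbrakk> \<Longrightarrow> act A X Y (a \<odot>\<^bsub>LHom D X Y\<^esub> f) m = a \<odot>\<^bsub>Grp A Y\<^esub> act A X Y f m"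
    and "act A X X (LIdent D X) m = m"
    and "\<And>Y Z f g. \<lbrakk>Y \<in> Ob; Z \<in> Ob; g \<in> DH X Y; f \<in> DH Y Z\<rbrakk> \<Longrightarrow>
      act A X Z (LComp D X Y Z f g) m = act A Y Z f (act A X Y g m)"
  using assms unfolding module_laws_def module_laws_at_def by simp_all

lemma act_bilinear:
  assumes A: "OS.is_opmod A" "module_laws A" and XY: "X \<in> Ob" "Y \<in> Ob"
  shows "bilin (LHom D X Y) (Grp A X) (Grp A Y) (act A X Y)"
proof (rule bilinear_mapI)
  show "lin (Grp A X) (Grp A Y) (act A X Y f)" if "f \<in> DH X Y" for f by (rule act_linear[OF A(1) XY that])
  show "lin (LHom D X Y) (Grp A Y) (\<lambda>f. act A X Y f m)" if "m \<in> el A X" for m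
    by (rule linear_mapI)
      (auto simp: module_lawsD[OF A(2) XY(1) that] XY linear_map_closed[OF act_linear[OF A(1) XY] that])
qed

lemma cf_mult_linear:
  assumes "b \<in> B"
  shows "x \<in> carrier H \<Longrightarrow> lin H (ground K) (\<lambda>y. cf b (x \<cdot> y))"
    and "y \<in> carrier H \<Longrightarrow> lin H (ground K) (\<lambda>x. cf b (x \<cdot> y))"
  using linear_map_compose[OF mult_left_linear cf_linear[OF assms]] linear_map_compose[OF mult_right_linear cf_linear[OF assms]] by auto

text \<open>The right hand side of the compatibility of the operator \<open>rho b\<close> with \<open>act f\<close>.\<close>

definition twist :: "('o, 'f, 'h, 'k, 'v) hopf_opmod \<Rightarrow> 'o \<Rightarrow> 'o \<Rightarrow> 'h \<Rightarrow> ('v, 'h, 'k) tensor \<Rightarrow> 'f \<Rightarrow> 'h \<Rightarrow> 'v" where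
  "twist A X Y b t f0 f1 = sw (Grp A Y) t (\<lambda>v h. cf b (f1 \<cdot> h) \<odot>\<^bsub>Grp A Y\<^esub> act A X Y f0 v)"

lemma twist_inner_bilinear:
  assumes A: "OS.is_opmod A" and XY: "X \<in> Ob" "Y \<in> Ob" and b: "b \<in> B" and f: "f0 \<in> DH X Y" "f1 \<in> carrier H"
  shows "bilin (Grp A X) H (Grp A Y) (\<lambda>v h. cf b (f1 \<cdot> h) \<odot>\<^bsub>Grp A Y\<^esub> act A X Y f0 v)"
  by (rule bilinear_functional_smult[OF OS.opmod_module[OF A XY(2)] cf_mult_linear(1)[OF b f(2)] act_linear[OF A XY f(1)]])

lemma twist_outer_bilinear:
  assumes A: "OS.is_opmod A" "module_laws A" and XY: "X \<in> Ob" "Y \<in> Ob" and b: "b \<in> B"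
    and v: "v \<in> el A X" and h: "h \<in> carrier H"
  shows "bilin (LHom D X Y) H (Grp A Y) (\<lambda>f0 f1. cf b (f1 \<cdot> h) \<odot>\<^bsub>Grp A Y\<^esub> act A X Y f0 v)"
  by (rule bilinear_functional_smult[OF OS.opmod_module[OF A(1) XY(2)] cf_mult_linear(2)[OF b h] bilinear_left[OF act_bilinear[OF A XY] v]])

lemma pairH: "module K V \<Longrightarrow> module_pair K V H" by (rule pairI)

lemma twist_bilinear:
  assumes A: "OS.is_opmod A" "module_laws A" and XY: "X \<in> Ob" "Y \<in> Ob" and b: "b \<in> B"
    and t: "t \<in> carrier (ten (Grp A X))"
  shows "bilin (LHom D X Y) H (Grp A Y) (twist A X Y b t)"
proof -
  interpret p: module_pair K "Grp A X" H by (rule pairH[OF OS.opmod_module[OF A(1) XY(1)]])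
  note Y = OS.opmod_module[OF A(1) XY(2)] and DXY = D_module[OF XY]
  show ?thesis unfolding twist_def
  proof (rule bilinear_mapI)
    show "lin H (Grp A Y) (\<lambda>f1. sw (Grp A Y) t (\<lambda>v h. cf b (f1 \<cdot> h) \<odot>\<^bsub>Grp A Y\<^esub> act A X Y f0 v))"
      if f0: "f0 \<in> DH X Y" for f0
      by (rule p.sweedler_param_linear[OF Y H_module twist_inner_bilinear[OF A(1) XY b f0]
            bilinear_right[OF twist_outer_bilinear[OF A XY b] f0] t])
    show "lin (LHom D X Y) (Grp A Y) (\<lambda>f0. sw (Grp A Y) t (\<lambda>v h. cf b (f1 \<cdot> h) \<odot>\<^bsub>Grp A Y\<^esub> act A X Y f0 v))"
      if f1: "f1 \<in> carrier H" for f1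
      by (rule p.sweedler_param_linear[OF Y DXY twist_inner_bilinear[OF A(1) XY b _ f1]
            bilinear_left[OF twist_outer_bilinear[OF A XY b] f1] t])
  qed
qed

definition twisted :: "('o, 'f, 'h, 'k, 'v) hopf_opmod \<Rightarrow> 'o \<Rightarrow> 'o \<Rightarrow> 'h \<Rightarrow> 'f \<Rightarrow> ('v, 'h, 'k) tensor \<Rightarrow> 'v" where
  "twisted A X Y b f t = sw (Grp A Y) (coact D X Y f) (twist A X Y b t)"

lemma coaction_at_iff:
  "coaction_at A X m t \<longleftrightarrow>
    (\<forall>b\<in>B. cd (Grp A X) b t = rho A X b m) \<and>
    sw (Grp A X) t (\<lambda>v h. counit H h \<odot>\<^bsub>Grp A X\<^esub> v) = m \<and>
    (\<forall>c\<in>B. \<forall>b\<in>B. rho A X c (rho A X b m) =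
      sw (Grp A X) t (\<lambda>v h. pairing c b (comult H h) \<odot>\<^bsub>Grp A X\<^esub> v)) \<and>
    (\<forall>Y\<in>Ob. \<forall>f\<in>DH X Y. \<forall>b\<in>B. rho A Y b (act A X Y f m) = twisted A X Y b f t)"
  unfolding coaction_at_def twisted_def twist_def ..

lemma twisted_linear:
  assumes A: "OS.is_opmod A" "module_laws A" and XY: "X \<in> Ob" "Y \<in> Ob" and b: "b \<in> B" and f: "f \<in> DH X Y"
  shows "lin (ten (Grp A X)) (Grp A Y) (twisted A X Y b f)"
proof -
  interpret p: module_pair K "Grp A X" H by (rule pairH[OF OS.opmod_module[OF A(1) XY(1)]])
  interpret q: module_pair K "LHom D X Y" H by (rule pairH[OF D_module[OF XY]])
  note Y = OS.opmod_module[OF A(1) XY(2)]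
  show ?thesis unfolding twisted_def
  proof (rule q.sweedler_param_linear[OF Y p.tensor_module twist_bilinear[OF A XY b] _ coact_closed[OF XY f]])
    fix f0 f1 assume "f0 \<in> DH X Y" "f1 \<in> carrier H"
    then show "lin (ten (Grp A X)) (Grp A Y) (\<lambda>t. twist A X Y b t f0 f1)"
      unfolding twist_def by (intro p.sweedler_linear[OF Y] twist_inner_bilinear[OF A(1) XY b])
  qed
qed

lemma coaction_at_linear_maps:
  assumes A: "OS.is_opmod A" "module_laws A" and X: "X \<in> Ob"
  shows "\<And>b. b \<in> B \<Longrightarrow> lin (ten (Grp A X)) (Grp A X) (cd (Grp A X) b)"
    "lin (ten (Grp A X)) (Grp A X) (\<lambda>t. sw (Grp A X) t (\<lambda>v h. counit H h \<odot>\<^bsub>Grp A X\<^esub> v))"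
    "\<And>c b. \<lbrakk>c \<in> B; b \<in> B\<rbrakk> \<Longrightarrow> lin (ten (Grp A X)) (Grp A X)
        (\<lambda>t. sw (Grp A X) t (\<lambda>v h. pairing c b (comult H h) \<odot>\<^bsub>Grp A X\<^esub> v))"
    "\<And>c b. \<lbrakk>c \<in> B; b \<in> B\<rbrakk> \<Longrightarrow> lin (Grp A X) (Grp A X) (\<lambda>m. rho A X c (rho A X b m))"
    "\<And>Y f b. \<lbrakk>Y \<in> Ob; f \<in> DH X Y; b \<in> B\<rbrakk> \<Longrightarrow> lin (Grp A X) (Grp A Y) (\<lambda>m. rho A Y b (act A X Y f m))"
proof -
  note Xm = OS.opmod_module[OF A(1) X]
  interpret p: module_pair K "Grp A X" H by (rule pairH[OF Xm])
  show "\<And>b. b \<in> B \<Longrightarrow> lin (ten (Grp A X)) (Grp A X) (cd (Grp A X) b)" by (rule cd_linear[OF Xm])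
  show "lin (ten (Grp A X)) (Grp A X) (\<lambda>t. sw (Grp A X) t (\<lambda>v h. counit H h \<odot>\<^bsub>Grp A X\<^esub> v))"
    by (rule p.sweedler_linear[OF Xm functional_bilinear[OF Xm counit_linear]])
  show "\<And>c b. \<lbrakk>c \<in> B; b \<in> B\<rbrakk> \<Longrightarrow> lin (ten (Grp A X)) (Grp A X)
        (\<lambda>t. sw (Grp A X) t (\<lambda>v h. pairing c b (comult H h) \<odot>\<^bsub>Grp A X\<^esub> v))"
    by (rule p.sweedler_linear[OF Xm functional_bilinear[OF Xm comult_pairing_linear]])
  show "\<And>c b. \<lbrakk>c \<in> B; b \<in> B\<rbrakk> \<Longrightarrow> lin (Grp A X) (Grp A X) (\<lambda>m. rho A X c (rho A X b m))"
    by (rule linear_map_compose[OF rho_linear[OF A(1) X] rho_linear[OF A(1) X]])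
  show "\<And>Y f b. \<lbrakk>Y \<in> Ob; f \<in> DH X Y; b \<in> B\<rbrakk> \<Longrightarrow> lin (Grp A X) (Grp A Y) (\<lambda>m. rho A Y b (act A X Y f m))"
    by (rule linear_map_compose[OF act_linear[OF A(1) X] rho_linear[OF A(1)]])
qed

text \<open>Every clause of \<open>coaction_at\<close> equates a linear function of m with a linear
  function of t. Collecting them in one set \<Phi> allows linear combinations to be treated
  uniformly instead of clause by clause.\<close>

lemma coaction_at_equations:
  assumes A: "OS.is_opmod A" "module_laws A" and X: "X \<in> Ob"
  obtains \<Phi> where "\<And>Y F G. (Y, F, G) \<in> \<Phi> \<Longrightarrow> Y \<in> Ob \<and> lin (Grp A X) (Grp A Y) F \<and> lin (ten (Grp A X)) (Grp A Y) G"
    "\<And>m t. coaction_at A X m t \<longleftrightarrow> (\<forall>Y F G. (Y, F, G) \<in> \<Phi> \<longrightarrow> F m = G t)"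
proof (rule that)
  let ?\<Phi> = "{(X, rho A X b, cd (Grp A X) b) | b. b \<in> B} \<union>
    {(X, \<lambda>m. m, \<lambda>t. sw (Grp A X) t (\<lambda>v h. counit H h \<odot>\<^bsub>Grp A X\<^esub> v))} \<union>
    {(X, \<lambda>m. rho A X c (rho A X b m), \<lambda>t. sw (Grp A X) t (\<lambda>v h. pairing c b (comult H h) \<odot>\<^bsub>Grp A X\<^esub> v)) | c b. c \<in> B \<and> b \<in> B} \<union>
    {(Y, \<lambda>m. rho A Y b (act A X Y f m), twisted A X Y b f) | Y b f. Y \<in> Ob \<and> b \<in> B \<and> f \<in> DH X Y}"
  note l = coaction_at_linear_maps[OF A X]
  show "Y \<in> Ob \<and> lin (Grp A X) (Grp A Y) F \<and> lin (ten (Grp A X)) (Grp A Y) G" if "(Y, F, G) \<in> ?\<Phi>" for Y F G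
    using that X l rho_linear[OF A(1) X] linear_map_id twisted_linear[OF A X] by auto
  show "coaction_at A X m t \<longleftrightarrow> (\<forall>Y F G. (Y, F, G) \<in> ?\<Phi> \<longrightarrow> F m = G t)" (is "_ \<longleftrightarrow> ?R") for m t
  proof
    show ?R if "coaction_at A X m t" using that unfolding coaction_at_iff by auto
    assume R: ?R
    show "coaction_at A X m t" unfolding coaction_at_iff
    proof (intro conjI ballI)
      show "cd (Grp A X) b t = rho A X b m" if "b \<in> B" for b
        by (rule R[rule_format, of X "rho A X b" "cd (Grp A X) b", symmetric]) (use that in blast)
      show "sw (Grp A X) t (\<lambda>v h. counit H h \<odot>\<^bsub>Grp A X\<^esub> v) = m"
        using R[rule_format, of X "\<lambda>m. m" "\<lambda>t. sw (Grp A X) t (\<lambda>v h. counit H h \<odot>\<^bsub>Grp A X\<^esub> v)"] by simp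
    qed (rule R[rule_format]; blast)+
  qed
qed

lemma coaction_at_combine:
  assumes A: "OS.is_opmod A" "module_laws A" and X: "X \<in> Ob"
  shows coaction_at_add: "\<And>m n s t. \<lbrakk>s \<in> carrier (ten (Grp A X)); m \<in> el A X; coaction_at A X m s;
      t \<in> carrier (ten (Grp A X)); n \<in> el A X; coaction_at A X n t\<rbrakk>
      \<Longrightarrow> coaction_at A X (m \<oplus>\<^bsub>Grp A X\<^esub> n) (s \<oplus>\<^bsub>ten (Grp A X)\<^esub> t)"
    and coaction_at_smult: "\<And>a m s. \<lbrakk>a \<in> carrier K; s \<in> carrier (ten (Grp A X)); m \<in> el A X; coaction_at A X m s\<rbrakk>
      \<Longrightarrow> coaction_at A X (a \<odot>\<^bsub>Grp A X\<^esub> m) (a \<odot>\<^bsub>ten (Grp A X)\<^esub> s)"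
    and coaction_at_zero: "coaction_at A X (nul A X) \<zero>\<^bsub>ten (Grp A X)\<^esub>"
proof -
  obtain \<Phi> where \<Phi>: "\<And>Y F G. (Y, F, G) \<in> \<Phi> \<Longrightarrow> Y \<in> Ob \<and> lin (Grp A X) (Grp A Y) F \<and> lin (ten (Grp A X)) (Grp A Y) G"
    and iff: "\<And>m t. coaction_at A X m t \<longleftrightarrow> (\<forall>Y F G. (Y, F, G) \<in> \<Phi> \<longrightarrow> F m = G t)"
    by (fact coaction_at_equations[OF A X])
  note M = OS.opmod_module[OF A(1)]
  note T = module_pair.tensor_module[OF pairH[OF M[OF X]]]
  have lF: "lin (Grp A X) (Grp A Y) F" and lG: "lin (ten (Grp A X)) (Grp A Y) G" and Y: "Y \<in> Ob"
    if "(Y, F, G) \<in> \<Phi>" for Y F G using \<Phi>[OF that] by simp_all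
  show "coaction_at A X (m \<oplus>\<^bsub>Grp A X\<^esub> n) (s \<oplus>\<^bsub>ten (Grp A X)\<^esub> t)"
    if "s \<in> carrier (ten (Grp A X))" "m \<in> el A X" "coaction_at A X m s"
      "t \<in> carrier (ten (Grp A X))" "n \<in> el A X" "coaction_at A X n t" for m n s t
    unfolding iff
  proof (intro allI impI)
    fix Y F G assume p: "(Y, F, G) \<in> \<Phi>"
    show "F (m \<oplus>\<^bsub>Grp A X\<^esub> n) = G (s \<oplus>\<^bsub>ten (Grp A X)\<^esub> t)"
      using that(3,6)[unfolded iff, rule_format, OF p] by (simp add: linear_map_add[OF lF[OF p] that(2,5)] linear_map_add[OF lG[OF p] that(1,4)])
  qed
  show "coaction_at A X (a \<odot>\<^bsub>Grp A X\<^esub> m) (a \<odot>\<^bsub>ten (Grp A X)\<^esub> s)"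
    if "a \<in> carrier K" "s \<in> carrier (ten (Grp A X))" "m \<in> el A X" "coaction_at A X m s" for a m s
    unfolding iff
  proof (intro allI impI)
    fix Y F G assume p: "(Y, F, G) \<in> \<Phi>"
    show "F (a \<odot>\<^bsub>Grp A X\<^esub> m) = G (a \<odot>\<^bsub>ten (Grp A X)\<^esub> s)"
      using that(4)[unfolded iff, rule_format, OF p] by (simp add: linear_map_smult[OF lF[OF p] that(1,3)] linear_map_smult[OF lG[OF p] that(1,2)])
  qed
  show "coaction_at A X (nul A X) \<zero>\<^bsub>ten (Grp A X)\<^esub>"
    unfolding iff by (auto simp: linear_map_zero[OF M[OF X] M[OF Y] lF] linear_map_zero[OF T M[OF Y] lG])
qed

text \<open>The first clause fixes all coordinates of the tensor. Hence the choice made in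
  \<open>hopf_mod_of\<close> is forced, and linearity of the coaction follows from that of the
  clauses.\<close>

lemma coaction_at_unique:
  assumes A: "OS.is_opmod A" and X: "X \<in> Ob" and s: "s \<in> carrier (ten (Grp A X))" "coaction_at A X m s"
    and t: "t \<in> carrier (ten (Grp A X))" "coaction_at A X m t"
  shows "s = t"
  by (rule cd_eqI[OF OS.opmod_module[OF A X] s(1) t(1)]) (use s(2) t(2) in \<open>simp add: coaction_at_def\<close>)

abbreviation "push A X \<eta> \<equiv> pushH (Grp A X) (\<eta> X)"

text \<open>Each quantity in \<open>coaction_at\<close> is natural: \<eta> \<otimes> id on the
  tensor corresponds to \<eta> on the value. Both preservation and reflection of
  \<open>coaction_at\<close> rest on this.\<close>

lemma push_quantities:
  assumes A: "OS.is_opmod A" "module_laws A" and A': "OS.is_opmod A'" "module_laws A'"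
    and \<eta>: "OS.ophom A A' \<eta>" and X: "X \<in> Ob" and t: "t \<in> carrier (ten (Grp A X))"
  shows "push A' X \<eta> t \<in> carrier (ten (Grp A' X))"
    "\<And>b. b \<in> B \<Longrightarrow> cd (Grp A' X) b (push A' X \<eta> t) = \<eta> X (cd (Grp A X) b t)"
    "sw (Grp A' X) (push A' X \<eta> t) (\<lambda>v h. counit H h \<odot>\<^bsub>Grp A' X\<^esub> v)
      = \<eta> X (sw (Grp A X) t (\<lambda>v h. counit H h \<odot>\<^bsub>Grp A X\<^esub> v))"
    "\<And>c b. \<lbrakk>c \<in> B; b \<in> B\<rbrakk> \<Longrightarrow> sw (Grp A' X) (push A' X \<eta> t) (\<lambda>v h. pairing c b (comult H h) \<odot>\<^bsub>Grp A' X\<^esub> v)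
      = \<eta> X (sw (Grp A X) t (\<lambda>v h. pairing c b (comult H h) \<odot>\<^bsub>Grp A X\<^esub> v))"
    "\<And>Y f b. \<lbrakk>Y \<in> Ob; f \<in> DH X Y; b \<in> B\<rbrakk> \<Longrightarrow> twisted A' X Y b f (push A' X \<eta> t) = \<eta> Y (twisted A X Y b f t)"
proof -
  note Xm = OS.opmod_module[OF A(1) X] and Xm' = OS.opmod_module[OF A'(1) X] and \<eta>l = OS.ophom_linear[OF \<eta> X]
  interpret p: module_pair K "Grp A X" H by (rule pairH[OF Xm])
  note sp = sweedler_push[OF Xm Xm' H_module \<eta>l _ _ t]
  show pc: "push A' X \<eta> t \<in> carrier (ten (Grp A' X))" by (rule linear_map_closed[OF tensor_push_linear[OF Xm Xm' H_module \<eta>l] t])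
  \<comment> \<open>Coordinates, counit and the coassociativity clause all contract the factor H
    with a functional, so one computation serves the three.\<close>
  have fn: "sw (Grp A' X) (push A' X \<eta> t) (\<lambda>v h. \<phi> h \<odot>\<^bsub>Grp A' X\<^esub> v) = \<eta> X (sw (Grp A X) t (\<lambda>v h. \<phi> h \<odot>\<^bsub>Grp A X\<^esub> v))"
    if \<phi>: "lin H (ground K) \<phi>" for \<phi>
  proof -
    have "\<eta> X (sw (Grp A X) t (\<lambda>v h. \<phi> h \<odot>\<^bsub>Grp A X\<^esub> v)) = sw (Grp A' X) t (\<lambda>v h. \<eta> X (\<phi> h \<odot>\<^bsub>Grp A X\<^esub> v))"
      by (rule p.linear_sweedler[OF Xm Xm' functional_bilinear[OF Xm \<phi>] \<eta>l t])
    also have "\<dots> = sw (Grp A' X) t (\<lambda>v h. \<phi> h \<odot>\<^bsub>Grp A' X\<^esub> \<eta> X v)"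
      by (rule p.sweedler_cong[OF Xm' bilinear_functional_smult[OF Xm' \<phi> \<eta>l] t])
        (use linear_map_smult[OF \<eta>l] linear_map_closed[OF \<phi>] in simp)
    finally show ?thesis using sp[OF Xm' functional_bilinear[OF Xm' \<phi>]] by simp
  qed
  show "\<And>b. b \<in> B \<Longrightarrow> cd (Grp A' X) b (push A' X \<eta> t) = \<eta> X (cd (Grp A X) b t)"
    unfolding cd_def by (rule fn[OF cf_linear])
  show "sw (Grp A' X) (push A' X \<eta> t) (\<lambda>v h. counit H h \<odot>\<^bsub>Grp A' X\<^esub> v)
      = \<eta> X (sw (Grp A X) t (\<lambda>v h. counit H h \<odot>\<^bsub>Grp A X\<^esub> v))" by (rule fn[OF counit_linear])
  show "\<And>c b. \<lbrakk>c \<in> B; b \<in> B\<rbrakk> \<Longrightarrow> sw (Grp A' X) (push A' X \<eta> t) (\<lambda>v h. pairing c b (comult H h) \<odot>\<^bsub>Grp A' X\<^esub> v)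
      = \<eta> X (sw (Grp A X) t (\<lambda>v h. pairing c b (comult H h) \<odot>\<^bsub>Grp A X\<^esub> v))" by (rule fn[OF comult_pairing_linear])
  fix Y f b assume Y: "Y \<in> Ob" and f: "f \<in> DH X Y" and b: "b \<in> B"
  note Ym = OS.opmod_module[OF A(1) Y] and Ym' = OS.opmod_module[OF A'(1) Y] and \<eta>Y = OS.ophom_linear[OF \<eta> Y]
  interpret q: module_pair K "LHom D X Y" H by (rule pairH[OF D_module[OF X Y]])
  have tw: "twist A' X Y b (push A' X \<eta> t) f0 f1 = \<eta> Y (twist A X Y b t f0 f1)" if f01: "f0 \<in> DH X Y" "f1 \<in> carrier H" for f0 f1
  proof -
    note bi = twist_inner_bilinear[OF A(1) X Y b f01] and bi' = twist_inner_bilinear[OF A'(1) X Y b f01]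
    have c: "cf b (f1 \<cdot> h) \<in> carrier K" if "h \<in> carrier H" for h using cf_closed[OF b H_mult_closed[OF f01(2) that]] .
    have "\<eta> Y (twist A X Y b t f0 f1) = sw (Grp A' Y) t (\<lambda>v h. \<eta> Y (cf b (f1 \<cdot> h) \<odot>\<^bsub>Grp A Y\<^esub> act A X Y f0 v))"
      unfolding twist_def by (rule p.linear_sweedler[OF Ym Ym' bi \<eta>Y t])
    also have "\<dots> = sw (Grp A' Y) t (\<lambda>v h. cf b (f1 \<cdot> h) \<odot>\<^bsub>Grp A' Y\<^esub> act A' X Y f0 (\<eta> X v))"
      by (rule p.sweedler_cong[OF Ym' bilinear_precompose[OF bi' \<eta>l linear_map_id] t])
        (simp add: linear_map_smult[OF \<eta>Y c linear_map_closed[OF act_linear[OF A(1) X Y f01(1)]]] ophom_act[OF \<eta> X Y f01(1)])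
    also have "\<dots> = twist A' X Y b (push A' X \<eta> t) f0 f1" unfolding twist_def by (rule sp[OF Ym' bi', symmetric])
    finally show ?thesis ..
  qed
  note tb = twist_bilinear[OF A X Y b t]
  have "\<eta> Y (twisted A X Y b f t) = sw (Grp A' Y) (coact D X Y f) (\<lambda>f0 f1. \<eta> Y (twist A X Y b t f0 f1))"
    unfolding twisted_def by (rule q.linear_sweedler[OF Ym Ym' tb \<eta>Y coact_closed[OF X Y f]])
  also have "\<dots> = twisted A' X Y b f (push A' X \<eta> t)"
    unfolding twisted_def
    by (rule q.sweedler_cong[OF Ym' twist_bilinear[OF A' X Y b pc] coact_closed[OF X Y f]]) (simp add: tw)
  finally show "twisted A' X Y b f (push A' X \<eta> t) = \<eta> Y (twisted A X Y b f t)" ..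
qed

lemma coaction_at_push:
  assumes A: "OS.is_opmod A" "module_laws A" and A': "OS.is_opmod A'" "module_laws A'"
    and \<eta>: "OS.ophom A A' \<eta>" and X: "X \<in> Ob" and m: "m \<in> el A X" and t: "t \<in> carrier (ten (Grp A X))"
    and c: "coaction_at A X m t"
  shows "coaction_at A' X (\<eta> X m) (push A' X \<eta> t)"
  using c unfolding coaction_at_iff
  by (simp add: push_quantities[OF A A' \<eta> X t] ophom_rho[OF \<eta> X _ m, symmetric] ophom_act[OF \<eta> X _ _ m, symmetric]
    ophom_rho[OF \<eta> X _ linear_map_closed[OF rho_linear[OF A(1) X] m], symmetric]
    ophom_rho[OF \<eta> _ _ linear_map_closed[OF act_linear[OF A(1) X] m], symmetric])

lemma opinjD: "\<lbrakk>OS.opinj A \<eta>; X \<in> Ob; \<eta> X x = \<eta> X y; x \<in> el A X; y \<in> el A X\<rbrakk> \<Longrightarrow> x = y"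
  unfolding OS.opinj_def by (meson inj_onD)

text \<open>A priori t' need not come from a tensor over A. But by injectivity \<rho>_b(m) is zero
  whenever the b-coordinate of t' is, so only finitely many values remain, and they are the
  coordinates of some t. Then \<eta> \<otimes> id sends t to t', and injectivity reflects each
  clause.\<close>

lemma coaction_at_reflect:
  assumes A: "OS.is_opmod A" "module_laws A" and A': "OS.is_opmod A'" "module_laws A'"
    and \<eta>: "OS.ophom A A' \<eta>" "OS.opinj A \<eta>" and X: "X \<in> Ob" and m: "m \<in> el A X"
    and t': "t' \<in> carrier (ten (Grp A' X))" and c: "coaction_at A' X (\<eta> X m) t'"
  shows "\<exists>t\<in>carrier (ten (Grp A X)). coaction_at A X m t"
proof -
  note Xm = OS.opmod_module[OF A(1) X] and Xm' = OS.opmod_module[OF A'(1) X]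
  have cd': "cd (Grp A' X) b t' = \<eta> X (rho A X b m)" if "b \<in> B" for b
    using c that ophom_rho[OF \<eta>(1) X that m] unfolding coaction_at_def by simp
  have rc: "rho A X b m \<in> el A X" if "b \<in> B" for b by (rule linear_map_closed[OF rho_linear[OF A(1) X that] m])
  obtain F where F: "finite F" "F \<subseteq> B" "\<And>b. b \<in> B - F \<Longrightarrow> cd (Grp A' X) b t' = nul A' X"
    by (rule cd_expand[OF Xm' t']) blast
  have z: "rho A X b m = nul A X" if b: "b \<in> B - F" for b
  proof (rule opinjD[OF \<eta>(2) X _ rc OS.opmod_zero_closed[OF A(1) X]])
    show "\<eta> X (rho A X b m) = \<eta> X (nul A X)"
      using F(3)[OF b] cd'[of b] b OS.ophom_zero[OF A(1) A'(1) \<eta>(1) X] by simp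
    show "b \<in> B" using b by blast
  qed
  obtain t where t: "t \<in> carrier (ten (Grp A X))" and tb: "\<And>b. b \<in> B \<Longrightarrow> cd (Grp A X) b t = rho A X b m"
    by (rule cd_of_family[where x = "\<lambda>b. rho A X b m", OF Xm F(1,2) rc z]) blast+
  interpret p: module_pair K "Grp A X" H by (rule pairH[OF Xm])
  note pq = push_quantities[OF A A' \<eta>(1) X t]
  have pt: "push A' X \<eta> t = t'" by (rule cd_eqI[OF Xm' pq(1) t']) (simp add: pq(2) tb cd')
  note l = coaction_at_linear_maps[OF A X]
  have "coaction_at A X m t" unfolding coaction_at_iff
  proof (intro conjI ballI tb)
    note inj = opinjD[OF \<eta>(2)]
    show "sw (Grp A X) t (\<lambda>v h. counit H h \<odot>\<^bsub>Grp A X\<^esub> v) = m"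
      by (rule inj[OF X _ linear_map_closed[OF l(2) t] m]) (use pq(3) c pt in \<open>simp add: coaction_at_iff\<close>)
    show "rho A X cc (rho A X b m) = sw (Grp A X) t (\<lambda>v h. pairing cc b (comult H h) \<odot>\<^bsub>Grp A X\<^esub> v)"
      if cb: "cc \<in> B" "b \<in> B" for cc b
    proof (rule inj[OF X _ linear_map_closed[OF l(4)[OF cb] m] linear_map_closed[OF l(3)[OF cb] t]])
      show "\<eta> X (rho A X cc (rho A X b m)) = \<eta> X (sw (Grp A X) t (\<lambda>v h. pairing cc b (comult H h) \<odot>\<^bsub>Grp A X\<^esub> v))"
        using c pq(4)[OF cb] cb ophom_rho[OF \<eta>(1) X cb(1) rc[OF cb(2)]] ophom_rho[OF \<eta>(1) X cb(2) m] unfolding coaction_at_iff pt by simp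
    qed
    show "rho A Y b (act A X Y f m) = twisted A X Y b f t" if Y: "Y \<in> Ob" and f: "f \<in> DH X Y" and b: "b \<in> B" for Y f b
    proof (rule inj[OF Y _ linear_map_closed[OF l(5)[OF Y f b] m] linear_map_closed[OF twisted_linear[OF A X Y b f] t]])
      show "\<eta> Y (rho A Y b (act A X Y f m)) = \<eta> Y (twisted A X Y b f t)"
        using c pq(5)[OF Y f b] Y f b ophom_rho[OF \<eta>(1) Y b linear_map_closed[OF act_linear[OF A(1) X Y f] m]]
          ophom_act[OF \<eta>(1) X Y f m] unfolding coaction_at_iff pt by simp
    qed
  qed
  then show ?thesis using t by blast
qed

lemma module_laws_reflect:
  assumes A: "OS.is_opmod A" and A': "module_laws A'" and \<eta>: "OS.ophom A A' \<eta>" "OS.opinj A \<eta>"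
  shows "module_laws A"
  unfolding module_laws_def
proof (intro ballI)
  fix X m assume X: "X \<in> Ob" and m: "m \<in> el A X"
  have e: "\<eta> X m \<in> el A' X" by (rule OS.ophom_closed[OF \<eta>(1) X m])
  note L = module_lawsD[OF A' X e] and inj = opinjD[OF \<eta>(2)] and oa = ophom_act[OF \<eta>(1) X]
  have ac: "act A X Y f m \<in> el A Y" if "Y \<in> Ob" "f \<in> DH X Y" for Y f
    by (rule linear_map_closed[OF act_linear[OF A X that] m])
  show "module_laws_at A X m" unfolding module_laws_at_def
  proof (intro conjI ballI)
    fix Y f g assume Y: "Y \<in> Ob" and f: "f \<in> DH X Y" and g: "g \<in> DH X Y"
    interpret DM: module K "LHom D X Y" by (rule D_module[OF X Y])
    interpret Y: module K "Grp A Y" by (rule OS.opmod_module[OF A Y])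
    have fg: "f \<oplus>\<^bsub>LHom D X Y\<^esub> g \<in> DH X Y" using f g by simp
    show "act A X Y (f \<oplus>\<^bsub>LHom D X Y\<^esub> g) m = act A X Y f m \<oplus>\<^bsub>Grp A Y\<^esub> act A X Y g m"
      by (rule inj[OF Y]) (use ac[OF Y] f g fg in \<open>simp_all add: oa[OF Y _ m] L(1)[OF Y f g]
          linear_map_add[OF OS.ophom_linear[OF \<eta>(1) Y]]\<close>)
  next
    fix Y a f assume Y: "Y \<in> Ob" and a: "a \<in> carrier K" and f: "f \<in> DH X Y"
    interpret DM: module K "LHom D X Y" by (rule D_module[OF X Y])
    interpret Y: module K "Grp A Y" by (rule OS.opmod_module[OF A Y])
    have af: "a \<odot>\<^bsub>LHom D X Y\<^esub> f \<in> DH X Y" using f a by simp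
    show "act A X Y (a \<odot>\<^bsub>LHom D X Y\<^esub> f) m = a \<odot>\<^bsub>Grp A Y\<^esub> act A X Y f m"
      by (rule inj[OF Y]) (use ac[OF Y] f a af in \<open>simp_all add: oa[OF Y _ m] L(2)[OF Y a f]
          linear_map_smult[OF OS.ophom_linear[OF \<eta>(1) Y]]\<close>)
  next
    show "act A X X (LIdent D X) m = m"
      by (rule inj[OF X]) (simp_all add: oa[OF X D_Ident_closed[OF X] m] L(3) ac[OF X D_Ident_closed[OF X]] m)
  next
    fix Y Z g f assume Y: "Y \<in> Ob" and Z: "Z \<in> Ob" and g: "g \<in> DH X Y" and f: "f \<in> DH Y Z"
    show "act A X Z (LComp D X Y Z f g) m = act A Y Z f (act A X Y g m)"
      by (rule inj[OF Z])
        (simp_all add: oa[OF Z D_Comp_closed[OF X Y Z g f] m] L(4)[OF Y Z g f] ophom_act[OF \<eta>(1) Y Z f ac[OF Y g]] oa[OF Y g m]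
          ac[OF Z D_Comp_closed[OF X Y Z g f]] linear_map_closed[OF act_linear[OF A Y Z f] ac[OF Y g]])
  qed
qed

lemma good_reflect:
  assumes A: "OS.is_opmod A" and A': "OS.is_opmod A'" "good A'" and \<eta>: "OS.ophom A A' \<eta>" "OS.opinj A \<eta>"
  shows "good A"
proof -
  have l': "module_laws A'" using A'(2) unfolding good_def by blast
  have l: "module_laws A" by (rule module_laws_reflect[OF A l' \<eta>])
  show ?thesis unfolding good_def
  proof (intro conjI l ballI)
    fix X m assume X: "X \<in> Ob" and m: "m \<in> el A X"
    obtain t' where t': "t' \<in> carrier (ten (Grp A' X))" "coaction_at A' X (\<eta> X m) t'"
      using A'(2) X OS.ophom_closed[OF \<eta>(1) X m] unfolding good_def by blast
    show "\<exists>t\<in>carrier (ten (Grp A X)). coaction_at A X m t"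
      by (rule coaction_at_reflect[OF A l A'(1) l' \<eta> X m t'])
  qed
qed

lemma module_laws_at_push:
  assumes A': "OS.is_opmod A'" "module_laws A'" and \<eta>: "OS.ophom A' A \<eta>" and X: "X \<in> Ob" and m: "m \<in> el A' X"
  shows "module_laws_at A X (\<eta> X m)"
proof -
  note L = module_lawsD[OF A'(2) X m] and oa = ophom_act[OF \<eta> X]
  have ac: "act A' X Y f m \<in> el A' Y" if "Y \<in> Ob" "f \<in> DH X Y" for Y f
    by (rule linear_map_closed[OF act_linear[OF A'(1) X that] m])
  show ?thesis unfolding module_laws_at_def
  proof (intro conjI ballI)
    fix Y f g assume Y: "Y \<in> Ob" and f: "f \<in> DH X Y" and g: "g \<in> DH X Y"
    interpret DM: module K "LHom D X Y" by (rule D_module[OF X Y])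
    have fg: "f \<oplus>\<^bsub>LHom D X Y\<^esub> g \<in> DH X Y" using f g by simp
    show "act A X Y (f \<oplus>\<^bsub>LHom D X Y\<^esub> g) (\<eta> X m) = act A X Y f (\<eta> X m) \<oplus>\<^bsub>Grp A Y\<^esub> act A X Y g (\<eta> X m)"
      using f g by (simp add: oa[OF Y _ m, symmetric] fg L(1)[OF Y f g]
          linear_map_add[OF OS.ophom_linear[OF \<eta> Y] ac[OF Y f] ac[OF Y g]])
  next
    fix Y a f assume Y: "Y \<in> Ob" and a: "a \<in> carrier K" and f: "f \<in> DH X Y"
    interpret DM: module K "LHom D X Y" by (rule D_module[OF X Y])
    have af: "a \<odot>\<^bsub>LHom D X Y\<^esub> f \<in> DH X Y" using f a by simp
    show "act A X Y (a \<odot>\<^bsub>LHom D X Y\<^esub> f) (\<eta> X m) = a \<odot>\<^bsub>Grp A Y\<^esub> act A X Y f (\<eta> X m)"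
      using f by (simp add: oa[OF Y _ m, symmetric] af L(2)[OF Y a f]
          linear_map_smult[OF OS.ophom_linear[OF \<eta> Y] a ac[OF Y f]])
  next
    show "act A X X (LIdent D X) (\<eta> X m) = \<eta> X m" using oa[OF X D_Ident_closed[OF X] m] L(3) by simp
  next
    fix Y Z g f assume Y: "Y \<in> Ob" and Z: "Z \<in> Ob" and g: "g \<in> DH X Y" and f: "f \<in> DH Y Z"
    show "act A X Z (LComp D X Y Z f g) (\<eta> X m) = act A Y Z f (act A X Y g (\<eta> X m))"
      using oa[OF Z D_Comp_closed[OF X Y Z g f] m] oa[OF Y g m] ophom_act[OF \<eta> Y Z f ac[OF Y g]] L(4)[OF Y Z g f] by simp
  qed
qed

text \<open>The elements that satisfy the conditions form submodules that contain the images of all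
  good modules. The module laws come first: the linearity in the tensor of the last clause of
  \<open>coaction_at\<close> is derived from them.\<close>

lemma good_cover:
  fixes A :: "('o, 'f, 'h, 'k, 'v) hopf_opmod"
  assumes A: "OS.is_opmod A"
    and cov: "\<And>X N. \<lbrakk>X \<in> Ob; submodule N K (Grp A X);
        \<And>A' \<eta>. \<lbrakk>OS.is_opmod A'; good A'; OS.ophom A' A \<eta>\<rbrakk> \<Longrightarrow> \<eta> X ` el (A' :: ('o, 'f, 'h, 'k, 'v) hopf_opmod) X \<subseteq> N\<rbrakk>
      \<Longrightarrow> el A X \<subseteq> N"
  shows "good A"
proof -
  \<comment> \<open>F and G will be the two sides of a module law; their equalizer is a submodule
    that contains the images of all good modules.\<close>
  have eqI: "F m = G m" if X: "X \<in> Ob" and Y: "Y \<in> Ob"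
    and F: "lin (Grp A X) (Grp A Y) F" and G: "lin (Grp A X) (Grp A Y) G"
    and eq: "\<And>m. module_laws_at A X m \<Longrightarrow> F m = G m" and m: "m \<in> el A X" for X Y F G m
  proof -
    have "el A X \<subseteq> {x \<in> el A X. F x = G x}"
    proof (rule cov[OF X submodule_equalizer[OF OS.opmod_module[OF A X] OS.opmod_module[OF A Y] F G]])
      fix A' :: "('o, 'f, 'h, 'k, 'v) hopf_opmod" and \<eta>
      assume A': "OS.is_opmod A'" "good A'" and \<eta>: "OS.ophom A' A \<eta>"
      show "\<eta> X ` el A' X \<subseteq> {x \<in> el A X. F x = G x}"
        using eq[OF module_laws_at_push[OF A'(1) conjunct1[OF A'(2)[unfolded good_def]] \<eta> X]] OS.ophom_closed[OF \<eta> X] by auto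
    qed
    then show ?thesis using m by auto
  qed
  have "module_laws_at A X m" if X: "X \<in> Ob" and m: "m \<in> el A X" for X m
    unfolding module_laws_at_def
  proof (intro conjI ballI)
    note al = act_linear[OF A X]
    fix Y f g assume Y: "Y \<in> Ob" and f: "f \<in> DH X Y" and g: "g \<in> DH X Y"
    interpret DM: module K "LHom D X Y" by (rule D_module[OF X Y])
    show "act A X Y (f \<oplus>\<^bsub>LHom D X Y\<^esub> g) m = act A X Y f m \<oplus>\<^bsub>Grp A Y\<^esub> act A X Y g m"
      by (rule eqI[OF X Y al[OF Y DM.a_closed[OF f g]] linear_map_plus[OF OS.opmod_module[OF A Y] al[OF Y f] al[OF Y g]] _ m])
        (use Y f g in \<open>simp add: module_laws_at_def\<close>)
  next
    note al = act_linear[OF A X]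
    fix Y a f assume Y: "Y \<in> Ob" and a: "a \<in> carrier K" and f: "f \<in> DH X Y"
    interpret DM: module K "LHom D X Y" by (rule D_module[OF X Y])
    show "act A X Y (a \<odot>\<^bsub>LHom D X Y\<^esub> f) m = a \<odot>\<^bsub>Grp A Y\<^esub> act A X Y f m"
      by (rule eqI[OF X Y al[OF Y DM.smult_closed[OF a f]] linear_map_scale[OF OS.opmod_module[OF A Y] al[OF Y f] a] _ m])
        (use Y f a in \<open>simp add: module_laws_at_def\<close>)
  next
    show "act A X X (LIdent D X) m = m"
      by (rule eqI[OF X X act_linear[OF A X X D_Ident_closed[OF X]] linear_map_id _ m]) (simp add: module_laws_at_def)
  next
    fix Y Z g f assume Y: "Y \<in> Ob" and Z: "Z \<in> Ob" and g: "g \<in> DH X Y" and f: "f \<in> DH Y Z"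
    show "act A X Z (LComp D X Y Z f g) m = act A Y Z f (act A X Y g m)"
      by (rule eqI[OF X Z act_linear[OF A X Z D_Comp_closed[OF X Y Z g f]]
            linear_map_compose[OF act_linear[OF A X Y g] act_linear[OF A Y Z f]] _ m])
        (use Y Z f g in \<open>simp add: module_laws_at_def\<close>)
  qed
  then have l: "module_laws A" unfolding module_laws_def by blast
  have "el A X \<subseteq> {m. m \<in> el A X \<and> (\<exists>t\<in>carrier (ten (Grp A X)). coaction_at A X m t)}" if X: "X \<in> Ob" for X
  proof (rule cov[OF X])
    note Xm = OS.opmod_module[OF A X]
    interpret X: module K "Grp A X" by (rule Xm)
    interpret p: module_pair K "Grp A X" H by (rule pairH[OF Xm])
    interpret T: module K "ten (Grp A X)" by (rule p.tensor_module)
    show "submodule {m. m \<in> el A X \<and> (\<exists>t\<in>carrier (ten (Grp A X)). coaction_at A X m t)} K (Grp A X)"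
    proof (rule X.submodule_memI)
      show "nul A X \<in> el A X \<and> (\<exists>t\<in>carrier (ten (Grp A X)). coaction_at A X (nul A X) t)" using coaction_at_zero[OF A l X] by blast
    next
      fix m n assume m: "m \<in> el A X \<and> (\<exists>t\<in>carrier (ten (Grp A X)). coaction_at A X m t)"
        and n: "n \<in> el A X \<and> (\<exists>t\<in>carrier (ten (Grp A X)). coaction_at A X n t)"
      obtain s where s: "s \<in> carrier (ten (Grp A X))" "coaction_at A X m s" using m by blast
      obtain t where t: "t \<in> carrier (ten (Grp A X))" "coaction_at A X n t" using n by blast
      have "coaction_at A X (m \<oplus>\<^bsub>Grp A X\<^esub> n) (s \<oplus>\<^bsub>ten (Grp A X)\<^esub> t)"
        by (rule coaction_at_add[OF A l X s(1) _ s(2) t(1) _ t(2)]) (use m n in auto)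
      then show "m \<oplus>\<^bsub>Grp A X\<^esub> n \<in> el A X \<and> (\<exists>t\<in>carrier (ten (Grp A X)). coaction_at A X (m \<oplus>\<^bsub>Grp A X\<^esub> n) t)"
        using m n s t T.a_closed X.a_closed by blast
    next
      fix a m assume a: "a \<in> carrier K" and m: "m \<in> el A X \<and> (\<exists>t\<in>carrier (ten (Grp A X)). coaction_at A X m t)"
      obtain s where s: "s \<in> carrier (ten (Grp A X))" "coaction_at A X m s" using m by blast
      have "coaction_at A X (a \<odot>\<^bsub>Grp A X\<^esub> m) (a \<odot>\<^bsub>ten (Grp A X)\<^esub> s)"
        by (rule coaction_at_smult[OF A l X a s(1) _ s(2)]) (use m in auto)
      then show "a \<odot>\<^bsub>Grp A X\<^esub> m \<in> el A X \<and> (\<exists>t\<in>carrier (ten (Grp A X)). coaction_at A X (a \<odot>\<^bsub>Grp A X\<^esub> m) t)"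
        using a m s T.smult_closed X.smult_closed by blast
    qed simp
    fix A' :: "('o, 'f, 'h, 'k, 'v) hopf_opmod" and \<eta>
    assume A': "OS.is_opmod A'" "good A'" and \<eta>: "OS.ophom A' A \<eta>"
    have l': "module_laws A'" using A'(2) unfolding good_def by blast
    show "\<eta> X ` el A' X \<subseteq> {m. m \<in> el A X \<and> (\<exists>t\<in>carrier (ten (Grp A X)). coaction_at A X m t)}"
    proof (intro subsetI CollectI conjI)
      fix y assume "y \<in> \<eta> X ` el A' X"
      then obtain m where m: "m \<in> el A' X" and y: "y = \<eta> X m" by blast
      show "y \<in> el A X" unfolding y by (rule OS.ophom_closed[OF \<eta> X m])
      obtain t where t: "t \<in> carrier (ten (Grp A' X))" "coaction_at A' X m t" using A'(2) X m unfolding good_def by blast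
      show "\<exists>t\<in>carrier (ten (Grp A X)). coaction_at A X y t" unfolding y
        using coaction_at_push[OF A'(1) l' A l \<eta> X m t] push_quantities(1)[OF A'(1) l' A l \<eta> X t(1)] by blast
    qed
  qed
  then show ?thesis unfolding good_def using l by blast
qed

lemma cd_push:
  assumes V: "module K V" and V': "module K V'" and \<eta>: "lin V V' \<eta>" and b: "b \<in> B" and t: "t \<in> carrier (ten V)"
  shows "cd V' b (pushH V' \<eta> t) = \<eta> (cd V b t)"
proof -
  interpret p: module_pair K V H by (rule pairH[OF V])
  note l = tensor_push_linear[OF V V' H_module \<eta>]
  show ?thesis
  proof (rule p.tensor_hom_eqI[OF V' linear_map_compose[OF l cd_linear[OF V' b]] linear_map_compose[OF cd_linear[OF V b] \<eta>] _ t])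
    fix v h assume vh: "v \<in> carrier V" "h \<in> carrier H"
    show "cd V' b (pushH V' \<eta> (ptH V v h)) = \<eta> (cd V b (ptH V v h))"
      using vh by (simp add: tensor_push_pure[OF V V' H_module \<eta>] cd_pure[OF V b] cd_pure[OF V' b] linear_map_closed[OF \<eta>]
          linear_map_smult[OF \<eta> cf_closed[OF b]])
  qed
qed

section \<open>Coassociativity in coordinates\<close>

lemma inner3_bilinear: "\<lbrakk>module K V; h \<in> carrier H\<rbrakk> \<Longrightarrow>
  bilin V H (tenW V) (\<lambda>v x. ptW V v (ptH H x h))"
  by (rule bilinear_pure[OF _ WW_module linear_map_id linear_pure_left[OF H_module H_module linear_map_id]])

lemma inner3_linear: "\<lbrakk>module K V; v \<in> carrier V; x \<in> carrier H\<rbrakk> \<Longrightarrow>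
  lin H (tenW V) (\<lambda>h. ptW V v (ptH H x h))"
  by (rule linear_pure_right[OF _ WW_module linear_pure_right[OF H_module H_module linear_map_id]])

lemma outer3_bilinear:
  assumes V: "module K V" and \<rho>: "lin V (ten V) \<rho>"
  shows "bilin V H (tenW V) (\<lambda>v0 v1. sw (tenW V) (\<rho> v0)
     (\<lambda>v00 v01. ptW V v00 (ptH H v01 v1)))"
proof -
  interpret p: module_pair K V H by (rule pairH[OF V])
  interpret q: module_pair K V WW by (rule pair_V_WW[OF V])
  show ?thesis
  proof (rule bilinear_mapI)
    fix v assume v: "v \<in> carrier V"
    show "lin H (tenW V) (\<lambda>v1. sw (tenW V) (\<rho> v)
      (\<lambda>v00 v01. ptW V v00 (ptH H v01 v1)))"
      by (rule p.sweedler_param_linear[OF q.tensor_module H_module inner3_bilinear[OF V] inner3_linear[OF V] linear_map_closed[OF \<rho> v]])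
  next
    fix h assume h: "h \<in> carrier H"
    show "lin V (tenW V) (\<lambda>v0. sw (tenW V) (\<rho> v0)
      (\<lambda>v00 v01. ptW V v00 (ptH H v01 h)))"
      by (rule linear_map_compose[OF \<rho> p.sweedler_linear[OF q.tensor_module inner3_bilinear[OF V h]]])
  qed
qed

lemma right3_bilinear: "module K V \<Longrightarrow> bilin V H (tenW V) (\<lambda>v0 v1. ptW V v0 (comult H v1))"
  by (rule bilinear_pure[OF _ WW_module linear_map_id comult_linear])

lemma coassoc_lhs_apply:
  assumes V: "module K V" and \<rho>: "lin V (ten V) \<rho>" and Pm: "module K Pm"
    and \<Lambda>: "lin (tenW V) Pm \<Lambda>" and t: "t \<in> carrier (ten V)"
  shows "\<Lambda> (sw (tenW V) t (\<lambda>v0 v1. sw (tenW V) (\<rho> v0)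
      (\<lambda>v00 v01. ptW V v00 (ptH H v01 v1)))) =
    sw Pm t (\<lambda>v0 v1. sw Pm (\<rho> v0) (\<lambda>v00 v01. \<Lambda> (ptW V v00 (ptH H v01 v1))))"
proof -
  interpret p: module_pair K V H by (rule pairH[OF V])
  interpret q: module_pair K V WW by (rule pair_V_WW[OF V])
  have i: "\<Lambda> (sw (tenW V) (\<rho> v0) (\<lambda>v00 v01. ptW V v00 (ptH H v01 v1)))
    = sw Pm (\<rho> v0) (\<lambda>v00 v01. \<Lambda> (ptW V v00 (ptH H v01 v1)))"
    if "v0 \<in> carrier V" "v1 \<in> carrier H" for v0 v1
    by (rule p.linear_sweedler[OF q.tensor_module Pm inner3_bilinear[OF V that(2)] \<Lambda> linear_map_closed[OF \<rho> that(1)]])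
  show ?thesis
    unfolding p.linear_sweedler[OF q.tensor_module Pm outer3_bilinear[OF V \<rho>] \<Lambda> t]
    by (rule p.sweedler_cong[OF Pm bilinear_compose[OF outer3_bilinear[OF V \<rho>] \<Lambda>] t, symmetric]) (simp add: i)
qed

lemma coassoc_rhs_apply:
  assumes V: "module K V" and Pm: "module K Pm"
    and \<Lambda>: "lin (tenW V) Pm \<Lambda>" and t: "t \<in> carrier (ten V)"
  shows "\<Lambda> (sw (tenW V) t (\<lambda>v0 v1. ptW V v0 (comult H v1))) =
    sw Pm t (\<lambda>v0 v1. \<Lambda> (ptW V v0 (comult H v1)))"
proof -
  interpret p: module_pair K V H by (rule pairH[OF V])
  interpret q: module_pair K V WW by (rule pair_V_WW[OF V])
  show ?thesis by (rule p.linear_sweedler[OF q.tensor_module Pm right3_bilinear[OF V] \<Lambda> t])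
qed

text \<open>Coassociativity seen through an arbitrary linear map \<Lambda> on V \<otimes> (H
  \<otimes> H). It is used with the coordinates \<open>cd2\<close>, with a contraction of the last
  factor in \<open>coaction_ophom\<close>, and with the map constructed in
  \<open>cofree_twisted_pure\<close>.\<close>

lemma comodule_coassoc_apply:
  assumes V: "module K V" and \<rho>: "lin V (ten V) \<rho>" and Pm: "module K Pm"
    and \<Lambda>: "lin (tenW V) Pm \<Lambda>" and c: "right_comodule K H V \<rho>" and v: "v \<in> carrier V"
  shows "sw Pm (\<rho> v) (\<lambda>v0 v1. sw Pm (\<rho> v0) (\<lambda>v00 v01. \<Lambda> (ptW V v00 (ptH H v01 v1))))
    = sw Pm (\<rho> v) (\<lambda>v0 v1. \<Lambda> (ptW V v0 (comult H v1)))"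
  using coassoc_lhs_apply[OF V \<rho> Pm \<Lambda> linear_map_closed[OF \<rho> v]] coassoc_rhs_apply[OF V Pm \<Lambda> linear_map_closed[OF \<rho> v]]
    right_comodule.coaction_coassoc[OF c v] by simp

text \<open>The composite of \<rho>_b and then \<rho>_c contracts the tensor (\<rho> \<otimes> id)
  \<rho>(v): the operator applied first uses the last factor H, the second one the middle
  factor.\<close>

lemma coaction_cd_eq:
  assumes V: "module K V" and \<rho>: "lin V (ten V) \<rho>" and cb: "c \<in> B" "b \<in> B" and v: "v \<in> carrier V"
  shows "cd V c (\<rho> (cd V b (\<rho> v))) =
    sw V (\<rho> v) (\<lambda>v0 v1. sw V (\<rho> v0) (\<lambda>v00 v01. cd2 V c b (ptW V v00 (ptH H v01 v1))))"
proof -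
  interpret V: module K V by fact
  interpret p: module_pair K V H by (rule pairH[OF V])
  note \<rho>v = linear_map_closed[OF \<rho> v]
  have l: "lin V V (\<lambda>x. cd V c (\<rho> x))" by (rule linear_map_compose[OF \<rho> cd_linear[OF V cb(1)]])
  have "cd V c (\<rho> (cd V b (\<rho> v))) = sw V (\<rho> v) (\<lambda>v0 v1. cd V c (\<rho> (cf b v1 \<odot>\<^bsub>V\<^esub> v0)))"
    unfolding cd_def[of V b] by (rule p.linear_sweedler[OF V V cd_bilinear[OF V cb(2)] l \<rho>v])
  also have "\<dots> = sw V (\<rho> v) (\<lambda>v0 v1. sw V (\<rho> v0) (\<lambda>v00 v01. cd2 V c b (ptW V v00 (ptH H v01 v1))))"
  proof (rule p.sweedler_cong[OF V bilinear_compose[OF outer3_bilinear[OF V \<rho>] cd2_linear[OF V cb]] \<rho>v, THEN trans])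
    interpret q: module_pair K V WW by (rule pair_V_WW[OF V])
    fix v0 v1 assume v01: "v0 \<in> carrier V" "v1 \<in> carrier H"
    note r0 = linear_map_closed[OF \<rho> v01(1)] and k = cf_closed[OF cb(2) v01(2)]
    have "cd V c (\<rho> (cf b v1 \<odot>\<^bsub>V\<^esub> v0)) = cf b v1 \<odot>\<^bsub>V\<^esub> cd V c (\<rho> v0)" by (rule linear_map_smult[OF l k v01(1)])
    also have "\<dots> = sw V (\<rho> v0) (\<lambda>v00 v01. cf b v1 \<odot>\<^bsub>V\<^esub> (cf c v01 \<odot>\<^bsub>V\<^esub> v00))"
      unfolding cd_def by (rule p.linear_sweedler[OF V V cd_bilinear[OF V cb(1)] linear_map_scale[OF V linear_map_id k] r0])
    also have "\<dots> = sw V (\<rho> v0) (\<lambda>v00 v01. cd2 V c b (ptW V v00 (ptH H v01 v1)))"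
    proof (rule p.sweedler_cong[OF V bilinear_compose[OF inner3_bilinear[OF V v01(2)] cd2_linear[OF V cb]] r0])
      fix v00 x assume vx: "v00 \<in> carrier V" "x \<in> carrier H"
      show "cf b v1 \<odot>\<^bsub>V\<^esub> (cf c x \<odot>\<^bsub>V\<^esub> v00) = cd2 V c b (ptW V v00 (ptH H x v1))"
        using cd2_pure[OF V cb vx(1) module_pair.pure_tensor_closed[OF pair_WW vx(2) v01(2)]] pairing_pure[OF cb vx(2) v01(2)]
          V.smult_assoc1[OF k cf_closed[OF cb(1) vx(2)] vx(1)] R.m_comm[OF k cf_closed[OF cb(1) vx(2)]] by simp
    qed
    also have "\<dots> = cd2 V c b (sw (tenW V) (\<rho> v0) (\<lambda>v00 v01. ptW V v00 (ptH H v01 v1)))"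
      by (rule p.linear_sweedler[OF q.tensor_module V inner3_bilinear[OF V v01(2)] cd2_linear[OF V cb] r0, symmetric])
    finally show "cd V c (\<rho> (cf b v1 \<odot>\<^bsub>V\<^esub> v0)) = cd2 V c b (sw (tenW V) (\<rho> v0) (\<lambda>v00 v01. ptW V v00 (ptH H v01 v1)))" .
  next
    interpret q: module_pair K V WW by (rule pair_V_WW[OF V])
    show "sw V (\<rho> v) (\<lambda>v0 v1. cd2 V c b (sw (tenW V) (\<rho> v0) (\<lambda>v00 v01. ptW V v00 (ptH H v01 v1)))) =
      sw V (\<rho> v) (\<lambda>v0 v1. sw V (\<rho> v0) (\<lambda>v00 v01. cd2 V c b (ptW V v00 (ptH H v01 v1))))"
      using coassoc_lhs_apply[OF V \<rho> V cd2_linear[OF V cb] \<rho>v]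
        p.linear_sweedler[OF q.tensor_module V outer3_bilinear[OF V \<rho>] cd2_linear[OF V cb] \<rho>v] by simp
  qed
  finally show ?thesis .
qed

lemma cd2_rhs_eq:
  assumes V: "module K V" and cb: "c \<in> B" "b \<in> B" and t: "t \<in> carrier (ten V)"
  shows "sw V t (\<lambda>v0 v1. cd2 V c b (ptW V v0 (comult H v1)))
    = sw V t (\<lambda>v h. pairing c b (comult H h) \<odot>\<^bsub>V\<^esub> v)"
proof -
  interpret p: module_pair K V H by (rule pairH[OF V])
  show ?thesis
    by (rule p.sweedler_cong[OF V functional_bilinear[OF V comult_pairing_linear[OF cb]] t]) (rule cd2_pure[OF V cb _ comult_closed])
qed

text \<open>The form in which coassociativity enters \<open>coaction_at\<close>.\<close>

lemma comodule_coassoc_cd: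
  assumes c: "right_comodule K H V \<rho>" and cb: "c \<in> B" "b \<in> B" and v: "v \<in> carrier V"
  shows "cd V c (\<rho> (cd V b (\<rho> v))) = sw V (\<rho> v) (\<lambda>v h. pairing c b (comult H h) \<odot>\<^bsub>V\<^esub> v)"
proof -
  have V: "module K V" using c by (simp add: right_comodule_def)
  note \<rho> = right_comodule.coaction_linear[OF c]
  show ?thesis
    unfolding coaction_cd_eq[OF V \<rho> cb v] comodule_coassoc_apply[OF V \<rho> V cd2_linear[OF V cb] c v]
    by (rule cd2_rhs_eq[OF V cb linear_map_closed[OF \<rho> v]])
qed

text \<open>The right hand side of the compatibility condition of relative Hopf modules, in coordinates.\<close>

lemma compat_rhs:
  assumes A: "OS.is_opmod A" "module_laws A" and XY: "X \<in> Ob" "Y \<in> Ob" and t: "t \<in> carrier (ten (Grp A X))"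
    and f: "f \<in> DH X Y"
  defines "r \<equiv> sw (ten (Grp A Y)) (coact D X Y f) (\<lambda>f0 f1.
    sw (ten (Grp A Y)) t (\<lambda>m0 m1. ptH (Grp A Y) (act A X Y f0 m0) (f1 \<cdot> m1)))"
  shows "r \<in> carrier (ten (Grp A Y))" "\<And>b. b \<in> B \<Longrightarrow> cd (Grp A Y) b r = twisted A X Y b f t"
proof -
  note Xm = OS.opmod_module[OF A(1) XY(1)] and Ym = OS.opmod_module[OF A(1) XY(2)]
  interpret p: module_pair K "Grp A X" H by (rule pairH[OF Xm])
  interpret y: module_pair K "Grp A Y" H by (rule pairH[OF Ym])
  interpret q: module_pair K "LHom D X Y" H by (rule pairH[OF D_module[OF XY]])
  note T = y.tensor_module and fc = coact_closed[OF XY f]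
  have ib: "bilin (Grp A X) H (ten (Grp A Y)) (\<lambda>m0 m1. ptH (Grp A Y) (act A X Y f0 m0) (f1 \<cdot> m1))"
    if "f0 \<in> DH X Y" "f1 \<in> carrier H" for f0 f1
    by (rule bilinear_pure[OF Ym H_module act_linear[OF A(1) XY that(1)] mult_left_linear[OF that(2)]])
  have ob: "bilin (LHom D X Y) H (ten (Grp A Y)) (\<lambda>f0 f1. sw (ten (Grp A Y)) t
      (\<lambda>m0 m1. ptH (Grp A Y) (act A X Y f0 m0) (f1 \<cdot> m1)))"
  proof (rule bilinear_mapI)
    show "lin H (ten (Grp A Y)) (\<lambda>f1. sw (ten (Grp A Y)) t
        (\<lambda>m0 m1. ptH (Grp A Y) (act A X Y f0 m0) (f1 \<cdot> m1)))" if f0: "f0 \<in> DH X Y" for f0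
      by (rule p.sweedler_param_linear[OF T H_module ib[OF f0] linear_pure_right[OF Ym H_module mult_right_linear
          linear_map_closed[OF act_linear[OF A(1) XY f0]]] t])
    show "lin (LHom D X Y) (ten (Grp A Y)) (\<lambda>f0. sw (ten (Grp A Y)) t
        (\<lambda>m0 m1. ptH (Grp A Y) (act A X Y f0 m0) (f1 \<cdot> m1)))" if f1: "f1 \<in> carrier H" for f1
      by (rule p.sweedler_param_linear[OF T D_module[OF XY] ib[OF _ f1] linear_pure_left[OF Ym H_module
          bilinear_left[OF act_bilinear[OF A XY]] H_mult_closed[OF f1]] t])
  qed
  show "r \<in> carrier (ten (Grp A Y))" unfolding r_def by (rule q.sweedler_closed[OF T ob fc])
  fix b assume b: "b \<in> B"
  note cl = cd_linear[OF Ym b]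
  have tw: "cd (Grp A Y) b (sw (ten (Grp A Y)) t (\<lambda>m0 m1. ptH (Grp A Y) (act A X Y f0 m0) (f1 \<cdot> m1)))
      = twist A X Y b t f0 f1" if f01: "f0 \<in> DH X Y" "f1 \<in> carrier H" for f0 f1
    unfolding twist_def p.linear_sweedler[OF T Ym ib[OF f01] cl t]
    by (rule p.sweedler_cong[OF Ym twist_inner_bilinear[OF A(1) XY b f01] t])
      (rule cd_pure[OF Ym b linear_map_closed[OF act_linear[OF A(1) XY f01(1)]] H_mult_closed[OF f01(2)]])
  show "cd (Grp A Y) b r = twisted A X Y b f t"
    unfolding r_def twisted_def q.linear_sweedler[OF T Ym ob cl fc]
    by (rule q.sweedler_cong[OF Ym twist_bilinear[OF A XY b t] fc]) (rule tw)
qed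

section \<open>The passage between Hopf modules and operator modules\<close>

definition U :: "('o, 'f, 'k, 'h, 'v) hopf_mod \<Rightarrow> ('o, 'f, 'h, 'k, 'v) hopf_opmod" where
  "U M = \<lparr>Grp = MObj M, Op = (\<lambda>p. case p of Inl (X, Y, f) \<Rightarrow> MAct M X Y f
     | Inr (X, b) \<Rightarrow> (\<lambda>m. cd (MObj M X) b (MCoact M X m)))\<rparr>"

lemma U_sel [simp]: "Grp (U M) = MObj M" "act (U M) X Y f = MAct M X Y f" "rho (U M) X b = (\<lambda>m. cd (MObj M X) b (MCoact M X m))"
  unfolding U_def by auto

lemma U_opmodI:
  assumes "left_module K D M" and "\<And>X. X \<in> Ob \<Longrightarrow> lin (MObj M X) (ten (MObj M X)) (MCoact M X)"
  shows "OS.is_opmod (U M)" "module_laws (U M)"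
proof -
  note m = left_module.MObj_module[OF assms(1)]
  show "OS.is_opmod (U M)" unfolding OS.is_opmod_def
  proof (intro conjI ballI)
    fix p assume "p \<in> ops"
    then show "lin (Grp (U M) (op_src p)) (Grp (U M) (op_tgt p)) (Op (U M) p)"
    proof (cases rule: ops_cases)
      case (1 X Y f)
      then show ?thesis using left_module.MAct_linear[OF assms(1)] by simp
    next
      case (2 X b)
      then show ?thesis using linear_map_compose[OF assms(2) cd_linear[OF m]] by simp
    qed
  qed (simp add: m)
  show "module_laws (U M)" unfolding module_laws_def module_laws_at_def
    by (auto simp: left_module.MAct_add[OF assms(1)] left_module.MAct_smult[OF assms(1)] left_module.MAct_Ident[OF assms(1)]
      left_module.MAct_Comp[OF assms(1)])
qed

lemma relative_coaction_linear:
  "\<lbrakk>relative_hopf_module K H D M; X \<in> Ob\<rbrakk> \<Longrightarrow> lin (MObj M X) (ten (MObj M X)) (MCoact M X)"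
  by (rule right_comodule.coaction_linear[OF relative_hopf_module.MObj_comodule])

lemma U_good:
  assumes M: "relative_hopf_module K H D M"
  shows "OS.is_opmod (U M)" "good (U M)"
    and U_coaction: "\<And>X m. \<lbrakk>X \<in> Ob; m \<in> carrier (MObj M X)\<rbrakk> \<Longrightarrow> coaction_at (U M) X m (MCoact M X m)"
proof -
  have lm: "left_module K D M" using M by (simp add: relative_hopf_module_def)
  note cl = relative_coaction_linear[OF M] and com = relative_hopf_module.MObj_comodule[OF M]
  note U = U_opmodI[OF lm cl]
  show "OS.is_opmod (U M)" by (rule U(1))
  show ca: "coaction_at (U M) X m (MCoact M X m)" if X: "X \<in> Ob" and m: "m \<in> carrier (MObj M X)" for X m
    unfolding coaction_at_iff
  proof (intro conjI ballI)
    show "sw (Grp (U M) X) (MCoact M X m) (\<lambda>v h. counit H h \<odot>\<^bsub>Grp (U M) X\<^esub> v) = m"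
      using right_comodule.coaction_counit[OF com[OF X] m] by simp
    show "rho (U M) X c (rho (U M) X b m) =
        sw (Grp (U M) X) (MCoact M X m) (\<lambda>v h. pairing c b (comult H h) \<odot>\<^bsub>Grp (U M) X\<^esub> v)" if "c \<in> B" "b \<in> B" for c b
      using comodule_coassoc_cd[OF com[OF X] that m] by simp
    show "rho (U M) Y b (act (U M) X Y f m) = twisted (U M) X Y b f (MCoact M X m)" if "Y \<in> Ob" "f \<in> DH X Y" "b \<in> B" for Y f b
      using compat_rhs(2)[OF U X that(1) _ that(2,3), of "MCoact M X m"] linear_map_closed[OF cl[OF X] m]
        relative_hopf_module.MCoact_MAct[OF M X that(1,2) m] by simp
  qed simp
  show "good (U M)" unfolding good_def
  proof (intro conjI U(2) ballI)
    fix X m assume "X \<in> Ob" "m \<in> el (U M) X"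
    then show "\<exists>t\<in>carrier (ten (Grp (U M) X)). coaction_at (U M) X m t"
      using ca linear_map_closed[OF cl] by (intro bexI[of _ "MCoact M X m"]) auto
  qed
qed

definition hopf_mod_of :: "('o, 'f, 'h, 'k, 'v) hopf_opmod \<Rightarrow> ('o, 'f, 'k, 'h, 'v) hopf_mod" where
  "hopf_mod_of A = \<lparr>MObj = Grp A, MAct = (\<lambda>X Y f. act A X Y f),
     MCoact = (\<lambda>X m. SOME t. t \<in> carrier (ten (Grp A X)) \<and> coaction_at A X m t)\<rparr>"

text \<open>Identities in V \<otimes> H and in V \<otimes> (H \<otimes> H) are tested on
  coordinates, by \<open>cd_eqI\<close> and \<open>cd2_eqI\<close>; in coordinates they are the
  clauses of \<open>coaction_at\<close>.\<close>

lemma hopf_mod_of_relative: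
  assumes A: "OS.is_opmod A" "good A"
  shows "relative_hopf_module K H D (hopf_mod_of A)" "OS.ophom A (U (hopf_mod_of A)) (\<lambda>X x. x)"
proof -
  let ?M = "hopf_mod_of A"
  have l: "module_laws A" using A(2) unfolding good_def by blast
  define \<rho> where "\<rho> X m = (SOME t. t \<in> carrier (ten (Grp A X)) \<and> coaction_at A X m t)" for X m
  have sel: "MObj ?M = Grp A" "MAct ?M X Y f = act A X Y f" "MCoact ?M = \<rho>" for X Y f
    unfolding hopf_mod_of_def \<rho>_def by auto
  have \<rho>: "\<rho> X m \<in> carrier (ten (Grp A X))" "coaction_at A X m (\<rho> X m)" if "X \<in> Ob" "m \<in> el A X" for X m
  proof -
    have "\<exists>t. t \<in> carrier (ten (Grp A X)) \<and> coaction_at A X m t" using A(2) that unfolding good_def by blast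
    from someI_ex[OF this] show "\<rho> X m \<in> carrier (ten (Grp A X))" "coaction_at A X m (\<rho> X m)" unfolding \<rho>_def by auto
  qed
  have rl: "lin (Grp A X) (ten (Grp A X)) (\<rho> X)" if X: "X \<in> Ob" for X
  proof -
    note Xm = OS.opmod_module[OF A(1) X]
    interpret X: module K "Grp A X" by (rule Xm)
    interpret p: module_pair K "Grp A X" H by (rule pairH[OF Xm])
    interpret T: module K "ten (Grp A X)" by (rule p.tensor_module)
    show ?thesis
    proof (rule linear_mapI)
      fix m n assume mn: "m \<in> el A X" "n \<in> el A X"
      note r = \<rho>[OF X mn(1)] \<rho>[OF X mn(2)]
      show "\<rho> X (m \<oplus>\<^bsub>Grp A X\<^esub> n) = \<rho> X m \<oplus>\<^bsub>ten (Grp A X)\<^esub> \<rho> X n"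
        by (rule coaction_at_unique[OF A(1) X \<rho>[OF X] _ coaction_at_add[OF A(1) l X r(1) mn(1) r(2,3) mn(2) r(4)]])
          (use mn r in auto)
    next
      fix a m assume a: "a \<in> carrier K" and m: "m \<in> el A X"
      note r = \<rho>[OF X m]
      show "\<rho> X (a \<odot>\<^bsub>Grp A X\<^esub> m) = a \<odot>\<^bsub>ten (Grp A X)\<^esub> \<rho> X m"
        by (rule coaction_at_unique[OF A(1) X \<rho>[OF X] _ coaction_at_smult[OF A(1) l X a r(1) m r(2)]])
          (use a m r in auto)
    qed (rule \<rho>(1)[OF X])
  qed
  have lm: "left_module K D ?M"
    by (rule left_module.intro) (auto simp: sel OS.opmod_module[OF A(1)] act_linear[OF A(1)] module_lawsD[OF l])
  have com: "right_comodule K H (Grp A X) (\<rho> X)" if X: "X \<in> Ob" for X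
  proof -
    note Xm = OS.opmod_module[OF A(1) X]
    interpret p: module_pair K "Grp A X" H by (rule pairH[OF Xm])
    interpret q: module_pair K "Grp A X" WW by (rule pair_V_WW[OF Xm])
    have "right_comodule_axioms K H (Grp A X) (\<rho> X)"
    proof (rule right_comodule_axioms.intro[OF rl[OF X]])
      fix m assume m: "m \<in> el A X"
      note r = \<rho>[OF X m]
      show "sw (Grp A X) (\<rho> X m) (\<lambda>v0 v1. counit H v1 \<odot>\<^bsub>Grp A X\<^esub> v0) = m"
        using r(2) unfolding coaction_at_iff by blast
      show "sw (tenW (Grp A X)) (\<rho> X m)
         (\<lambda>v0 v1. sw (tenW (Grp A X)) (\<rho> X v0)
            (\<lambda>v00 v01. ptW (Grp A X) v00 (ptH H v01 v1))) =
        sw (tenW (Grp A X)) (\<rho> X m) (\<lambda>v0 v1. ptW (Grp A X) v0 (comult H v1))"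
      proof (rule cd2_eqI[OF Xm p.sweedler_closed[OF q.tensor_module outer3_bilinear[OF Xm rl[OF X]] r(1)]
              p.sweedler_closed[OF q.tensor_module right3_bilinear[OF Xm] r(1)]])
        fix c b assume cb: "c \<in> B" "b \<in> B"
        have e: "rho A X b n = cd (Grp A X) b (\<rho> X n)" if "n \<in> el A X" "b \<in> B" for n b
          using \<rho>(2)[OF X that(1)] that(2) unfolding coaction_at_iff by simp
        have bm: "rho A X b m \<in> el A X" by (rule linear_map_closed[OF rho_linear[OF A(1) X cb(2)] m])
        have "cd (Grp A X) c (\<rho> X (cd (Grp A X) b (\<rho> X m))) = rho A X c (rho A X b m)"
          using e[OF m cb(2)] e[OF bm cb(1)] by simp
        also have "\<dots> = sw (Grp A X) (\<rho> X m) (\<lambda>v h. pairing c b (comult H h) \<odot>\<^bsub>Grp A X\<^esub> v)"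
          using r(2) cb unfolding coaction_at_iff by blast
        finally show "cd2 (Grp A X) c b (sw (tenW (Grp A X)) (\<rho> X m)
             (\<lambda>v0 v1. sw (tenW (Grp A X)) (\<rho> X v0)
               (\<lambda>v00 v01. ptW (Grp A X) v00 (ptH H v01 v1)))) =
           cd2 (Grp A X) c b (sw (tenW (Grp A X)) (\<rho> X m) (\<lambda>v0 v1. ptW (Grp A X) v0 (comult H v1)))"
          unfolding coassoc_lhs_apply[OF Xm rl[OF X] Xm cd2_linear[OF Xm cb] r(1)]
            coassoc_rhs_apply[OF Xm Xm cd2_linear[OF Xm cb] r(1)] cd2_rhs_eq[OF Xm cb r(1)]
            coaction_cd_eq[OF Xm rl[OF X] cb m] .
      qed
    qed
    then show ?thesis using Xm by (simp add: right_comodule_def)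
  qed
  have "relative_hopf_module_axioms K H D ?M"
  proof (rule relative_hopf_module_axioms.intro)
    show "right_comodule K H (MObj ?M X) (MCoact ?M X)" if "X \<in> Ob" for X unfolding sel by (rule com[OF that])
    fix X Y f m assume XY: "X \<in> Ob" "Y \<in> Ob" and f: "f \<in> DH X Y" and m0: "m \<in> carrier (MObj ?M X)"
    then have m: "m \<in> el A X" by (simp add: sel)
    note r = \<rho>[OF XY(1) m]
    have fm: "act A X Y f m \<in> el A Y" by (rule linear_map_closed[OF act_linear[OF A(1) XY f] m])
    note rr = \<rho>[OF XY(2) fm]
    note cr = compat_rhs[OF A(1) l XY r(1) f]
    have "\<rho> Y (act A X Y f m) = sw (ten (Grp A Y)) (coact D X Y f) (\<lambda>f0 f1.
        sw (ten (Grp A Y)) (\<rho> X m) (\<lambda>m0 m1. ptH (Grp A Y) (act A X Y f0 m0) (f1 \<cdot> m1)))"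
    proof (rule cd_eqI[OF OS.opmod_module[OF A(1) XY(2)] rr(1) cr(1)])
      fix b assume b: "b \<in> B"
      have "cd (Grp A Y) b (\<rho> Y (act A X Y f m)) = rho A Y b (act A X Y f m)" using rr(2) b unfolding coaction_at_iff by blast
      also have "\<dots> = twisted A X Y b f (\<rho> X m)" using r(2) XY f b unfolding coaction_at_iff by blast
      finally show "cd (Grp A Y) b (\<rho> Y (act A X Y f m)) = cd (Grp A Y) b (sw (ten (Grp A Y)) (coact D X Y f) (\<lambda>f0 f1.
        sw (ten (Grp A Y)) (\<rho> X m) (\<lambda>m0 m1. ptH (Grp A Y) (act A X Y f0 m0) (f1 \<cdot> m1))))"
        using cr(2)[OF b] by simp
    qed
    then show "MCoact ?M Y (MAct ?M X Y f m) = sw (ten (MObj ?M Y)) (coact D X Y f) (\<lambda>f0 f1.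
        sw (ten (MObj ?M Y)) (MCoact ?M X m) (\<lambda>m0 m1. ptH (MObj ?M Y) (MAct ?M X Y f0 m0) (f1 \<cdot> m1)))"
      by (simp add: sel)
  qed
  then show "relative_hopf_module K H D ?M" using lm by (simp add: relative_hopf_module_def)
  show "OS.ophom A (U ?M) (\<lambda>X x. x)"
  proof (rule OS.ophomI)
    fix p x assume p: "p \<in> ops" and x: "x \<in> el A (op_src p)"
    from p show "Op A p x = Op (U ?M) p x"
    proof (cases rule: ops_cases)
      case (1 X Y f)
      then show ?thesis by (simp add: sel)
    next
      case (2 X b)
      then have "cd (Grp A X) b (\<rho> X x) = rho A X b x" using \<rho>(2)[of X x] x unfolding coaction_at_iff by simp
      then show ?thesis using 2 by (simp add: sel)
    qed
  qed (simp add: sel linear_map_id)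
qed

text \<open>Colinearity is an identity in N(X) \<otimes> H, and coordinates separate tensors, so it
  amounts to commuting with every \<rho>_b. This makes \<open>U\<close> full and faithful.\<close>

lemma hopf_mod_homs_eq:
  assumes M: "relative_hopf_module K H D M" and N: "relative_hopf_module K H D N"
  shows "hopf_mod_homs K H D M N = {\<eta>. \<eta> \<in> extensional (Ob) \<and>
    (\<forall>X\<in>Ob. \<eta> X \<in> extensional (el (U M) X)) \<and> OS.ophom (U M) (U N) \<eta>}"
proof -
  have lm: "left_module K D M" "left_module K D N" using M N unfolding relative_hopf_module_def by blast+
  note Mm = left_module.MObj_module[OF lm(1)] and Nm = left_module.MObj_module[OF lm(2)]
  have col: "colinear K H (MObj M X) (MCoact M X) (MObj N X) (MCoact N X) \<phi> \<longleftrightarrow>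
      (\<forall>b\<in>B. \<forall>m\<in>carrier (MObj M X). \<phi> (cd (MObj M X) b (MCoact M X m)) = cd (MObj N X) b (MCoact N X (\<phi> m)))"
    if X: "X \<in> Ob" and \<phi>: "lin (MObj M X) (MObj N X) \<phi>" for X \<phi>
  proof -
    have c: "MCoact M X m \<in> carrier (ten (MObj M X))" if "m \<in> carrier (MObj M X)" for m
      by (rule linear_map_closed[OF relative_coaction_linear[OF M X] that])
    have d: "MCoact N X (\<phi> m) \<in> carrier (ten (MObj N X))" if "m \<in> carrier (MObj M X)" for m
      by (rule linear_map_closed[OF relative_coaction_linear[OF N X] linear_map_closed[OF \<phi> that]])
    have p: "pushH (MObj N X) \<phi> (MCoact M X m) \<in> carrier (ten (MObj N X))" if "m \<in> carrier (MObj M X)" for m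
      by (rule linear_map_closed[OF tensor_push_linear[OF Mm[OF X] Nm[OF X] H_module \<phi>] c[OF that]])
    have "MCoact N X (\<phi> m) = pushH (MObj N X) \<phi> (MCoact M X m) \<longleftrightarrow>
      (\<forall>b\<in>B. \<phi> (cd (MObj M X) b (MCoact M X m)) = cd (MObj N X) b (MCoact N X (\<phi> m)))" if m: "m \<in> carrier (MObj M X)" for m
      using cd_eqI[OF Nm[OF X] d[OF m] p[OF m]] cd_push[OF Mm[OF X] Nm[OF X] \<phi> _ c[OF m]] by metis
    then show ?thesis unfolding colinear_def tensor_push_def by auto
  qed
  have "OS.ophom (U M) (U N) \<eta> \<longleftrightarrow> (\<forall>X\<in>Ob. lin (MObj M X) (MObj N X) (\<eta> X) \<and>
        colinear K H (MObj M X) (MCoact M X) (MObj N X) (MCoact N X) (\<eta> X)) \<and>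
      (\<forall>X\<in>Ob. \<forall>Y\<in>Ob. \<forall>f\<in>DH X Y. \<forall>m\<in>carrier (MObj M X). \<eta> Y (MAct M X Y f m) = MAct N X Y f (\<eta> X m))" for \<eta>
  proof -
    have "OS.ophom (U M) (U N) \<eta> \<longleftrightarrow> (\<forall>X\<in>Ob. lin (MObj M X) (MObj N X) (\<eta> X)) \<and>
      (\<forall>X\<in>Ob. \<forall>Y\<in>Ob. \<forall>f\<in>DH X Y. \<forall>m\<in>carrier (MObj M X). \<eta> Y (MAct M X Y f m) = MAct N X Y f (\<eta> X m)) \<and>
      (\<forall>X\<in>Ob. \<forall>b\<in>B. \<forall>m\<in>carrier (MObj M X). \<eta> X (cd (MObj M X) b (MCoact M X m)) = cd (MObj N X) b (MCoact N X (\<eta> X m)))"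
      (is "?L \<longleftrightarrow> ?R")
    proof
      assume L: ?L
      show ?R
        using OS.ophom_linear[OF L] ophom_act[OF L] ophom_rho[OF L] by simp
    next
      assume R: ?R
      show ?L
      proof (rule OS.ophomI)
        fix p x assume p: "p \<in> ops" and x: "x \<in> el (U M) (op_src p)"
        from p show "\<eta> (op_tgt p) (Op (U M) p x) = Op (U N) p (\<eta> (op_src p) x)"
          by (cases rule: ops_cases) (use R x in auto)
      qed (use R in simp)
    qed
    then show ?thesis using col by blast
  qed
  then show ?thesis unfolding hopf_mod_homs_def by auto
qed

section \<open>The Hopf module $N \otimes H$\<close>

lemma H_comodule: "right_comodule K H H (comult H)"
  unfolding right_comodule_def right_comodule_axioms_def
  using H_module comult_linear coalgebra.comult_coassoc[OF coalgebra_H] coalgebra.counit_right[OF coalgebra_H] by simp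

text \<open>The operator \<rho>_b of H as a comodule over itself.\<close>

definition comult_coord :: "'h \<Rightarrow> 'h \<Rightarrow> 'h" where
  "comult_coord b h = cd H b (comult H h)"

lemma comult_coord_linear: "b \<in> B \<Longrightarrow> lin H H (comult_coord b)"
  unfolding comult_coord_def by (rule linear_map_compose[OF comult_linear cd_linear[OF H_module]])

lemma comult_coord_closed: "\<lbrakk>b \<in> B; h \<in> carrier H\<rbrakk> \<Longrightarrow> comult_coord b h \<in> carrier H"
  by (rule linear_map_closed[OF comult_coord_linear])

text \<open>The b-coordinate, in the second factor, of the product (x \<otimes> y)
  \<Delta>(h).\<close>

definition mult_coord :: "'h \<Rightarrow> 'h \<Rightarrow> 'h \<Rightarrow> 'h \<Rightarrow> 'h" where
  "mult_coord b h x y = sw H (comult H h) (\<lambda>h1 h2. cf b (y \<cdot> h2) \<odot>\<^bsub>H\<^esub> (x \<cdot> h1))"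

lemma mult_coord_inner: "\<lbrakk>b \<in> B; x \<in> carrier H; y \<in> carrier H\<rbrakk> \<Longrightarrow>
    bilin H H H (\<lambda>h1 h2. cf b (y \<cdot> h2) \<odot>\<^bsub>H\<^esub> (x \<cdot> h1))"
  by (rule bilinear_functional_smult[OF H_module cf_mult_linear(1) mult_left_linear])

lemma mult_coord_outer: "\<lbrakk>b \<in> B; h1 \<in> carrier H; h2 \<in> carrier H\<rbrakk> \<Longrightarrow>
    bilin H H H (\<lambda>x y. cf b (y \<cdot> h2) \<odot>\<^bsub>H\<^esub> (x \<cdot> h1))"
  by (rule bilinear_functional_smult[OF H_module cf_mult_linear(2) mult_right_linear])

lemma mult_coord_bilinear:
  assumes b: "b \<in> B" and h: "h \<in> carrier H"
  shows "bilin H H H (mult_coord b h)"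
  unfolding mult_coord_def
proof (rule bilinear_mapI)
  show "lin H H (\<lambda>y. sw H (comult H h) (\<lambda>h1 h2. cf b (y \<cdot> h2) \<odot>\<^bsub>H\<^esub> (x \<cdot> h1)))" if "x \<in> carrier H" for x
    by (rule module_pair.sweedler_param_linear[OF pair_WW H_module H_module mult_coord_inner[OF b that]
        bilinear_right[OF mult_coord_outer[OF b] that] comult_closed[OF h]])
  show "lin H H (\<lambda>x. sw H (comult H h) (\<lambda>h1 h2. cf b (y \<cdot> h2) \<odot>\<^bsub>H\<^esub> (x \<cdot> h1)))" if "y \<in> carrier H" for y
    by (rule module_pair.sweedler_param_linear[OF pair_WW H_module H_module mult_coord_inner[OF b _ that]
        bilinear_left[OF mult_coord_outer[OF b] that] comult_closed[OF h]])
qed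

text \<open>This is the b-coordinate of the identity \<Delta>(x h) = \<Delta>(x)
  \<Delta>(h).\<close>

lemma comult_coord_mult:
  assumes b: "b \<in> B" and x: "x \<in> carrier H" and h: "h \<in> carrier H"
  shows "comult_coord b (x \<cdot> h) = sw H (comult H x) (mult_coord b h)"
proof -
  interpret p: module_pair K H H by (rule pair_WW)
  note cx = comult_closed[OF x] and ch = comult_closed[OF h] and l = cd_linear[OF H_module b]
  have ib: "bilin H H WW (\<lambda>y1 y2. ptH H (x1 \<cdot> y1) (x2 \<cdot> y2))" if "x1 \<in> carrier H" "x2 \<in> carrier H" for x1 x2
    by (rule bilinear_pure[OF H_module H_module mult_left_linear[OF that(1)] mult_left_linear[OF that(2)]])
  have ob: "bilin H H WW (\<lambda>x1 x2. sw WW (comult H h) (\<lambda>y1 y2. ptH H (x1 \<cdot> y1) (x2 \<cdot> y2)))"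
  proof (rule bilinear_mapI)
    show "lin H WW (\<lambda>x2. sw WW (comult H h) (\<lambda>y1 y2. ptH H (x1 \<cdot> y1) (x2 \<cdot> y2)))" if "x1 \<in> carrier H" for x1
      by (rule p.sweedler_param_linear[OF WW_module H_module ib[OF that]
        linear_pure_right[OF H_module H_module mult_right_linear H_mult_closed[OF that]] ch])
    show "lin H WW (\<lambda>x1. sw WW (comult H h) (\<lambda>y1 y2. ptH H (x1 \<cdot> y1) (x2 \<cdot> y2)))" if "x2 \<in> carrier H" for x2
      by (rule p.sweedler_param_linear[OF WW_module H_module ib[OF _ that]
        linear_pure_left[OF H_module H_module mult_right_linear H_mult_closed[OF that]] ch])
  qed
  have i: "cd H b (sw WW (comult H h) (\<lambda>y1 y2. ptH H (x1 \<cdot> y1) (x2 \<cdot> y2))) = mult_coord b h x1 x2"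
    if x12: "x1 \<in> carrier H" "x2 \<in> carrier H" for x1 x2
    unfolding mult_coord_def p.linear_sweedler[OF WW_module H_module ib[OF x12] l ch]
    by (rule p.sweedler_cong[OF H_module mult_coord_inner[OF b x12] ch]) (rule cd_pure[OF H_module b H_mult_closed[OF x12(1)] H_mult_closed[OF x12(2)]])
  show ?thesis
    unfolding comult_coord_def hopf_algebra.comult_mult[OF hopf x h] p.linear_sweedler[OF WW_module H_module ob l cx]
    by (rule p.sweedler_cong[OF H_module mult_coord_bilinear[OF b h] cx]) (rule i)
qed

text \<open>The diagonal action. With it, the compatibility law of a relative Hopf module M says
  that \<rho> is a map of D-modules from M to M \<otimes> H.\<close>

definition cofree_act :: "('o, 'f, 'k, 'h, 'v) hopf_mod \<Rightarrow> 'o \<Rightarrow> 'o \<Rightarrow> 'f \<Rightarrow> ('v, 'h, 'k) tensor \<Rightarrow> ('v, 'h, 'k) tensor" where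
  "cofree_act N X Y f t = sw (ten (MObj N Y)) (coact D X Y f) (\<lambda>f0 f1.
     sw (ten (MObj N Y)) t (\<lambda>n h. ptH (MObj N Y) (MAct N X Y f0 n) (f1 \<cdot> h)))"

text \<open>The coaction is that of H on the second factor, so no coaction on N is required.\<close>

definition cofree_rho :: "('o, 'f, 'k, 'h, 'v) hopf_mod \<Rightarrow> 'o \<Rightarrow> 'h \<Rightarrow> ('v, 'h, 'k) tensor \<Rightarrow> ('v, 'h, 'k) tensor" where
  "cofree_rho N X b t = sw (ten (MObj N X)) t (\<lambda>n h. ptH (MObj N X) n (comult_coord b h))"

text \<open>The Hopf module $N \otimes H$ of a left \<open>D\<close>-module \<open>N\<close>; the field \<open>MCoact\<close> of \<open>N\<close> is ignored.\<close>

definition cofree :: "('o, 'f, 'k, 'h, 'v) hopf_mod \<Rightarrow> ('o, 'f, 'h, 'k, ('v, 'h, 'k) tensor) hopf_opmod" where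
  "cofree N = \<lparr>Grp = (\<lambda>X. ten (MObj N X)), Op = (\<lambda>p. case p of Inl (X, Y, f) \<Rightarrow> cofree_act N X Y f
     | Inr (X, b) \<Rightarrow> cofree_rho N X b)\<rparr>"

lemma cofree_sel [simp]: "Grp (cofree N) X = ten (MObj N X)" "act (cofree N) X Y f = cofree_act N X Y f" "rho (cofree N) X b = cofree_rho N X b"
  unfolding cofree_def by auto

context
  fixes N :: "('o, 'f, 'k, 'h, 'v) hopf_mod"
  assumes N: "left_module K D N"
begin

lemmas N_module = left_module.MObj_module[OF N]
lemmas N_act_linear = left_module.MAct_linear[OF N]

lemma N_act_closed: "\<lbrakk>X \<in> Ob; Y \<in> Ob; f \<in> DH X Y; n \<in> carrier (MObj N X)\<rbrakk> \<Longrightarrow> MAct N X Y f n \<in> carrier (MObj N Y)"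
  by (rule linear_map_closed[OF N_act_linear])

lemma NH_pair: "X \<in> Ob \<Longrightarrow> module_pair K (MObj N X) H"
  by (rule pairH[OF N_module])

lemma NH_module: "X \<in> Ob \<Longrightarrow> module K (ten (MObj N X))"
  by (rule module_pair.tensor_module[OF NH_pair])

lemma N_act_arrow_linear: "\<lbrakk>X \<in> Ob; Y \<in> Ob; n \<in> carrier (MObj N X)\<rbrakk> \<Longrightarrow> lin (LHom D X Y) (MObj N Y) (\<lambda>f. MAct N X Y f n)"
  by (rule linear_mapI) (auto simp: N_act_closed left_module.MAct_add[OF N] left_module.MAct_smult[OF N])

lemma cofree_inner: "\<lbrakk>X \<in> Ob; Y \<in> Ob; f0 \<in> DH X Y; f1 \<in> carrier H\<rbrakk> \<Longrightarrow>
    bilin (MObj N X) H (ten (MObj N Y)) (\<lambda>n h. ptH (MObj N Y) (MAct N X Y f0 n) (f1 \<cdot> h))"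
  by (rule bilinear_pure[OF N_module H_module N_act_linear mult_left_linear])

lemma cofree_outer: "\<lbrakk>X \<in> Ob; Y \<in> Ob; n \<in> carrier (MObj N X); h \<in> carrier H\<rbrakk> \<Longrightarrow>
    bilin (LHom D X Y) H (ten (MObj N Y)) (\<lambda>f0 f1. ptH (MObj N Y) (MAct N X Y f0 n) (f1 \<cdot> h))"
  by (rule bilinear_pure[OF N_module H_module N_act_arrow_linear mult_right_linear])

lemma cofree_nested:
  assumes XY: "X \<in> Ob" "Y \<in> Ob" and t: "t \<in> carrier (ten (MObj N X))"
  shows "bilin (LHom D X Y) H (ten (MObj N Y)) (\<lambda>f0 f1.
     sw (ten (MObj N Y)) t (\<lambda>n h. ptH (MObj N Y) (MAct N X Y f0 n) (f1 \<cdot> h)))"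
proof (rule bilinear_mapI)
  show "lin H (ten (MObj N Y)) (\<lambda>f1. sw (ten (MObj N Y)) t (\<lambda>n h. ptH (MObj N Y) (MAct N X Y f0 n) (f1 \<cdot> h)))"
    if "f0 \<in> DH X Y" for f0
    by (rule module_pair.sweedler_param_linear[OF NH_pair[OF XY(1)] NH_module[OF XY(2)] H_module cofree_inner[OF XY that]
        bilinear_right[OF cofree_outer[OF XY] that] t])
  show "lin (LHom D X Y) (ten (MObj N Y)) (\<lambda>f0. sw (ten (MObj N Y)) t (\<lambda>n h. ptH (MObj N Y) (MAct N X Y f0 n) (f1 \<cdot> h)))"
    if "f1 \<in> carrier H" for f1
    by (rule module_pair.sweedler_param_linear[OF NH_pair[OF XY(1)] NH_module[OF XY(2)] D_module[OF XY] cofree_inner[OF XY _ that]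
        bilinear_left[OF cofree_outer[OF XY] that] t])
qed

lemma cofree_act_linear:
  assumes XY: "X \<in> Ob" "Y \<in> Ob" and f: "f \<in> DH X Y"
  shows "lin (ten (MObj N X)) (ten (MObj N Y)) (cofree_act N X Y f)"
  unfolding cofree_act_def
  by (rule module_pair.sweedler_param_linear[OF pairH[OF D_module[OF XY]] NH_module[OF XY(2)] NH_module[OF XY(1)]
      cofree_nested[OF XY] module_pair.sweedler_linear[OF NH_pair[OF XY(1)] NH_module[OF XY(2)] cofree_inner[OF XY]] coact_closed[OF XY f]])

lemma cofree_act_arrow_linear:
  assumes XY: "X \<in> Ob" "Y \<in> Ob" and t: "t \<in> carrier (ten (MObj N X))"
  shows "lin (LHom D X Y) (ten (MObj N Y)) (\<lambda>f. cofree_act N X Y f t)"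
  unfolding cofree_act_def
  by (rule linear_map_compose[OF coact_linear[OF XY]
      module_pair.sweedler_linear[OF pairH[OF D_module[OF XY]] NH_module[OF XY(2)] cofree_nested[OF XY t]]])

lemma cofree_act_pure:
  assumes XY: "X \<in> Ob" "Y \<in> Ob" and f: "f \<in> DH X Y" and n: "n \<in> carrier (MObj N X)" and h: "h \<in> carrier H"
  shows "cofree_act N X Y f (ptH (MObj N X) n h) = sw (ten (MObj N Y)) (coact D X Y f) (\<lambda>f0 f1. ptH (MObj N Y) (MAct N X Y f0 n) (f1 \<cdot> h))"
  unfolding cofree_act_def
  by (rule module_pair.sweedler_cong[OF pairH[OF D_module[OF XY]] NH_module[OF XY(2)] cofree_outer[OF XY n h] coact_closed[OF XY f]])
    (rule module_pair.sweedler_pure[OF NH_pair[OF XY(1)] NH_module[OF XY(2)] cofree_inner[OF XY] n h])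

lemma cofree_rho_bilinear: "\<lbrakk>X \<in> Ob; b \<in> B\<rbrakk> \<Longrightarrow> bilin (MObj N X) H (ten (MObj N X)) (\<lambda>n h. ptH (MObj N X) n (comult_coord b h))"
  by (rule bilinear_pure[OF N_module H_module linear_map_id comult_coord_linear])

lemma cofree_rho_linear: "\<lbrakk>X \<in> Ob; b \<in> B\<rbrakk> \<Longrightarrow> lin (ten (MObj N X)) (ten (MObj N X)) (cofree_rho N X b)"
  unfolding cofree_rho_def by (rule module_pair.sweedler_linear[OF NH_pair NH_module cofree_rho_bilinear])

lemma cofree_rho_pure: "\<lbrakk>X \<in> Ob; b \<in> B; n \<in> carrier (MObj N X); h \<in> carrier H\<rbrakk> \<Longrightarrow>
    cofree_rho N X b (ptH (MObj N X) n h) = ptH (MObj N X) n (comult_coord b h)"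
  unfolding cofree_rho_def by (rule module_pair.sweedler_pure[OF NH_pair NH_module cofree_rho_bilinear])

lemma cofree_opmod: "OS.is_opmod (cofree N)"
  unfolding OS.is_opmod_def
proof (intro conjI ballI)
  fix p assume "p \<in> ops"
  then show "lin (Grp (cofree N) (op_src p)) (Grp (cofree N) (op_tgt p)) (Op (cofree N) p)"
    by (cases rule: ops_cases) (simp_all add: cofree_act_linear cofree_rho_linear)
qed (simp add: NH_module)

lemma NH_eqI:
  assumes X: "X \<in> Ob" and P: "module K P" and l: "lin (ten (MObj N X)) P f" "lin (ten (MObj N X)) P g"
    and eq: "\<And>n h. \<lbrakk>n \<in> carrier (MObj N X); h \<in> carrier H\<rbrakk> \<Longrightarrow> f (ptH (MObj N X) n h) = g (ptH (MObj N X) n h)"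
    and t: "t \<in> carrier (ten (MObj N X))"
  shows "f t = g t"
  by (rule module_pair.tensor_hom_eqI[OF NH_pair[OF X] P l eq t])

lemma cofree_act_Ident:
  assumes X: "X \<in> Ob" and t: "t \<in> carrier (ten (MObj N X))"
  shows "cofree_act N X X (LIdent D X) t = t"
proof (rule NH_eqI[OF X NH_module[OF X] cofree_act_linear[OF X X D_Ident_closed[OF X]] linear_map_id _ t])
  fix n h assume n: "n \<in> carrier (MObj N X)" and h: "h \<in> carrier H"
  interpret ring H by (rule ring_H)
  show "cofree_act N X X (LIdent D X) (ptH (MObj N X) n h) = ptH (MObj N X) n h"
    unfolding cofree_act_pure[OF X X D_Ident_closed[OF X] n h] right_co_category.coact_Ident[OF co_category X]
    using module_pair.sweedler_pure[OF pairH[OF D_module[OF X X]] NH_module[OF X] cofree_outer[OF X X n h] D_Ident_closed[OF X] one_closed]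
      left_module.MAct_Ident[OF N X n] h by simp
qed

text \<open>At n \<otimes> h both sides are the sum of f_0 g_0 n \<otimes> f_1 g_1 h, by
  multiplicativity of the coaction of D and associativity of H.\<close>

lemma cofree_act_Comp:
  assumes o: "X \<in> Ob" "Y \<in> Ob" "Z \<in> Ob" and g: "g \<in> DH X Y" and f: "f \<in> DH Y Z" and t: "t \<in> carrier (ten (MObj N X))"
  shows "cofree_act N X Z (LComp D X Y Z f g) t = cofree_act N Y Z f (cofree_act N X Y g t)"
proof (rule NH_eqI[OF o(1) NH_module[OF o(3)] cofree_act_linear[OF o(1,3) D_Comp_closed[OF o g f]]
      linear_map_compose[OF cofree_act_linear[OF o(1,2) g] cofree_act_linear[OF o(2,3) f]] _ t])
  fix n h assume n: "n \<in> carrier (MObj N X)" and h: "h \<in> carrier H"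
  let ?P = "ten (MObj N Z)" and ?Q = "ten (LHom D X Z)"
  interpret Hr: ring H by (rule ring_H)
  interpret pf: module_pair K "LHom D Y Z" H by (rule pairH[OF D_module[OF o(2,3)]])
  interpret pg: module_pair K "LHom D X Y" H by (rule pairH[OF D_module[OF o(1,2)]])
  interpret pfg: module_pair K "LHom D X Z" H by (rule pairH[OF D_module[OF o(1,3)]])
  interpret py: module_pair K "MObj N Y" H by (rule NH_pair[OF o(2)])
  note cf = coact_closed[OF o(2,3) f] and cg = coact_closed[OF o(1,2) g] and P = NH_module[OF o(3)] and Q = pfg.tensor_module
  have ib: "bilin (LHom D X Y) H ?Q (\<lambda>g0 g1. ptH (LHom D X Z) (LComp D X Y Z f0 g0) (f1 \<cdot> g1))"
    if "f0 \<in> DH Y Z" "f1 \<in> carrier H" for f0 f1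
    by (rule bilinear_pure[OF D_module[OF o(1,3)] H_module D_Comp_right[OF o that(1)] mult_left_linear[OF that(2)]])
  have ob: "bilin (LHom D Y Z) H ?Q (\<lambda>f0 f1. sw ?Q (coact D X Y g) (\<lambda>g0 g1.
      ptH (LHom D X Z) (LComp D X Y Z f0 g0) (f1 \<cdot> g1)))"
  proof (rule bilinear_mapI)
    show "lin H ?Q (\<lambda>f1. sw ?Q (coact D X Y g) (\<lambda>g0 g1. ptH (LHom D X Z) (LComp D X Y Z f0 g0) (f1 \<cdot> g1)))"
      if "f0 \<in> DH Y Z" for f0
      by (rule pg.sweedler_param_linear[OF Q H_module ib[OF that]
        linear_pure_right[OF D_module[OF o(1,3)] H_module mult_right_linear D_Comp_closed[OF o _ that]] cg])
    show "lin (LHom D Y Z) ?Q (\<lambda>f0. sw ?Q (coact D X Y g) (\<lambda>g0 g1. ptH (LHom D X Z) (LComp D X Y Z f0 g0) (f1 \<cdot> g1)))"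
      if "f1 \<in> carrier H" for f1
      by (rule pg.sweedler_param_linear[OF Q D_module[OF o(2,3)] ib[OF _ that]
        linear_pure_left[OF D_module[OF o(1,3)] H_module D_Comp_left[OF o] H_mult_closed[OF that]] cg])
  qed
  \<comment> \<open>L lets an element of D(X, Z) \<otimes> H act on n \<otimes> h; applying it to
    \<open>coact_Comp\<close> gives the law at n \<otimes> h.\<close>
  define L where "L k = sw ?P k (\<lambda>k0 k1. ptH (MObj N Z) (MAct N X Z k0 n) (k1 \<cdot> h))" for k
  have Ll: "lin ?Q ?P L" unfolding L_def by (rule pfg.sweedler_linear[OF P cofree_outer[OF o(1,3) n h]])
  have Lp: "L (ptH (LHom D X Z) k0 k1) = ptH (MObj N Z) (MAct N X Z k0 n) (k1 \<cdot> h)" if "k0 \<in> DH X Z" "k1 \<in> carrier H" for k0 k1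
    unfolding L_def by (rule pfg.sweedler_pure[OF P cofree_outer[OF o(1,3) n h] that])
  let ?y = "cofree_act N X Y g (ptH (MObj N X) n h)"
  have yc: "?y \<in> carrier (ten (MObj N Y))"
    by (rule linear_map_closed[OF cofree_act_linear[OF o(1,2) g] module_pair.pure_tensor_closed[OF NH_pair[OF o(1)] n h]])
  have inner: "L (sw ?Q (coact D X Y g) (\<lambda>g0 g1. ptH (LHom D X Z) (LComp D X Y Z f0 g0) (f1 \<cdot> g1)))
    = sw ?P ?y (\<lambda>m k. ptH (MObj N Z) (MAct N Y Z f0 m) (f1 \<cdot> k))" if f01: "f0 \<in> DH Y Z" "f1 \<in> carrier H" for f0 f1
  proof -
    let ?M = "\<lambda>y. sw ?P y (\<lambda>m k. ptH (MObj N Z) (MAct N Y Z f0 m) (f1 \<cdot> k))"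
    note ci = cofree_inner[OF o(2,3) f01]
    have Ml: "lin (ten (MObj N Y)) ?P ?M" by (rule py.sweedler_linear[OF P ci])
    have "?M ?y = sw ?P (coact D X Y g) (\<lambda>g0 g1. ?M (ptH (MObj N Y) (MAct N X Y g0 n) (g1 \<cdot> h)))"
      unfolding cofree_act_pure[OF o(1,2) g n h]
      by (rule pg.linear_sweedler[OF NH_module[OF o(2)] P cofree_outer[OF o(1,2) n h] Ml cg])
    also have "\<dots> = sw ?P (coact D X Y g) (\<lambda>g0 g1. L (ptH (LHom D X Z) (LComp D X Y Z f0 g0) (f1 \<cdot> g1)))"
    proof (rule pg.sweedler_cong[OF P bilinear_compose[OF ib[OF f01] Ll] cg])
      fix g0 g1 assume g01: "g0 \<in> DH X Y" "g1 \<in> carrier H"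
      show "?M (ptH (MObj N Y) (MAct N X Y g0 n) (g1 \<cdot> h)) = L (ptH (LHom D X Z) (LComp D X Y Z f0 g0) (f1 \<cdot> g1))"
        unfolding py.sweedler_pure[OF P ci N_act_closed[OF o(1,2) g01(1) n] H_mult_closed[OF g01(2) h]]
          Lp[OF D_Comp_closed[OF o g01(1) f01(1)] H_mult_closed[OF f01(2) g01(2)]] left_module.MAct_Comp[OF N o g01(1) f01(1) n]
        using Hr.m_assoc[OF f01(2) g01(2) h] by simp
    qed
    also have "\<dots> = L (sw ?Q (coact D X Y g) (\<lambda>g0 g1. ptH (LHom D X Z) (LComp D X Y Z f0 g0) (f1 \<cdot> g1)))"
      by (rule pg.linear_sweedler[OF Q P ib[OF f01] Ll cg, symmetric])
    finally show ?thesis ..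
  qed
  have "cofree_act N X Z (LComp D X Y Z f g) (ptH (MObj N X) n h) = L (coact D X Z (LComp D X Y Z f g))"
    unfolding cofree_act_pure[OF o(1,3) D_Comp_closed[OF o g f] n h] L_def ..
  also have "\<dots> = sw ?P (coact D Y Z f) (\<lambda>f0 f1. L (sw ?Q (coact D X Y g) (\<lambda>g0 g1.
      ptH (LHom D X Z) (LComp D X Y Z f0 g0) (f1 \<cdot> g1))))"
    unfolding right_co_category.coact_Comp[OF co_category o g f] by (rule pf.linear_sweedler[OF Q P ob Ll cf])
  also have "\<dots> = cofree_act N Y Z f ?y"
    unfolding cofree_act_def[of N Y Z] by (rule pf.sweedler_cong[OF P cofree_nested[OF o(2,3) yc] cf]) (rule inner)
  finally show "cofree_act N X Z (LComp D X Y Z f g) (ptH (MObj N X) n h) = cofree_act N Y Z f ?y" .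
qed

lemma cofree_module_laws: "module_laws (cofree N)"
  unfolding module_laws_def module_laws_at_def
  by (auto simp: cofree_act_Ident cofree_act_Comp linear_map_add[OF cofree_act_arrow_linear] linear_map_smult[OF cofree_act_arrow_linear])

text \<open>On n \<otimes> h this is the sum of (n \<otimes> h_1) \<otimes> h_2. It is written as
  the image of \<Delta>(h) under a map tensored with id so that \<open>sweedler_push\<close>
  applies.\<close>

definition cofree_coact :: "'o \<Rightarrow> ('v, 'h, 'k) tensor \<Rightarrow> (('v, 'h, 'k) tensor, 'h, 'k) tensor" where
  "cofree_coact X t = sw (ten (ten (MObj N X))) t (\<lambda>n h. pushH (ten (MObj N X)) (ptH (MObj N X) n) (comult H h))"

lemma pt_right: "\<lbrakk>X \<in> Ob; n \<in> carrier (MObj N X)\<rbrakk> \<Longrightarrow> lin H (ten (MObj N X)) (ptH (MObj N X) n)"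
  by (rule linear_pure_right[OF N_module H_module linear_map_id])

lemma NHH_module: "X \<in> Ob \<Longrightarrow> module K (ten (ten (MObj N X)))"
  by (rule module_pair.tensor_module[OF pairH[OF NH_module]])

lemma cofree_coact_bilinear:
  assumes X: "X \<in> Ob"
  shows "bilin (MObj N X) H (ten (ten (MObj N X))) (\<lambda>n h. pushH (ten (MObj N X)) (ptH (MObj N X) n) (comult H h))"
proof (rule bilinear_mapI)
  show "lin H (ten (ten (MObj N X))) (\<lambda>h. pushH (ten (MObj N X)) (ptH (MObj N X) n) (comult H h))" if "n \<in> carrier (MObj N X)" for n
    by (rule linear_map_compose[OF comult_linear tensor_push_linear[OF H_module NH_module[OF X] H_module pt_right[OF X that]]])
  show "lin (MObj N X) (ten (ten (MObj N X))) (\<lambda>n. pushH (ten (MObj N X)) (ptH (MObj N X) n) (comult H h))" if h: "h \<in> carrier H" for h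
    unfolding tensor_push_def
  proof (rule module_pair.sweedler_param_linear[OF pair_WW NHH_module[OF X] N_module[OF X] _ _ comult_closed[OF h]])
    show "bilin H H (ten (ten (MObj N X))) (\<lambda>u h. ptH (ten (MObj N X)) (ptH (MObj N X) n u) h)" if "n \<in> carrier (MObj N X)" for n
      by (rule bilinear_pure[OF NH_module[OF X] H_module pt_right[OF X that] linear_map_id])
    show "lin (MObj N X) (ten (ten (MObj N X))) (\<lambda>n. ptH (ten (MObj N X)) (ptH (MObj N X) n x) y)" if "x \<in> carrier H" "y \<in> carrier H" for x y
      by (rule linear_pure_left[OF NH_module[OF X] H_module linear_pure_left[OF N_module[OF X] H_module linear_map_id that(1)] that(2)])
  qed
qed

lemma cofree_coact_linear: "X \<in> Ob \<Longrightarrow> lin (ten (MObj N X)) (ten (ten (MObj N X))) (cofree_coact X)"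
  unfolding cofree_coact_def by (rule module_pair.sweedler_linear[OF NH_pair NHH_module cofree_coact_bilinear])

lemma cofree_coact_pure: "\<lbrakk>X \<in> Ob; n \<in> carrier (MObj N X); h \<in> carrier H\<rbrakk> \<Longrightarrow>
    cofree_coact X (ptH (MObj N X) n h) = pushH (ten (MObj N X)) (ptH (MObj N X) n) (comult H h)"
  unfolding cofree_coact_def by (rule module_pair.sweedler_pure[OF NH_pair NHH_module cofree_coact_bilinear])

text \<open>Serves the counit clause and the coassociativity clause of \<open>coaction_at\<close>,
  with \<phi> the counit or a \<open>pairing\<close> after \<Delta>.\<close>

lemma cofree_coact_functional:
  assumes X: "X \<in> Ob" and n: "n \<in> carrier (MObj N X)" and h: "h \<in> carrier H" and \<phi>: "lin H (ground K) \<phi>"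
  shows "sw (ten (MObj N X)) (cofree_coact X (ptH (MObj N X) n h)) (\<lambda>v x. \<phi> x \<odot>\<^bsub>ten (MObj N X)\<^esub> v)
    = ptH (MObj N X) n (sw H (comult H h) (\<lambda>h1 h2. \<phi> h2 \<odot>\<^bsub>H\<^esub> h1))"
proof -
  interpret p: module_pair K H H by (rule pair_WW)
  note NH = NH_module[OF X] and pr = pt_right[OF X n] and ch = comult_closed[OF h]
  have "sw (ten (MObj N X)) (cofree_coact X (ptH (MObj N X) n h)) (\<lambda>v x. \<phi> x \<odot>\<^bsub>ten (MObj N X)\<^esub> v)
    = sw (ten (MObj N X)) (comult H h) (\<lambda>h1 h2. \<phi> h2 \<odot>\<^bsub>ten (MObj N X)\<^esub> ptH (MObj N X) n h1)"
    unfolding cofree_coact_pure[OF X n h] by (rule sweedler_push[OF H_module NH H_module pr NH functional_bilinear[OF NH \<phi>] ch])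
  also have "\<dots> = sw (ten (MObj N X)) (comult H h) (\<lambda>h1 h2. ptH (MObj N X) n (\<phi> h2 \<odot>\<^bsub>H\<^esub> h1))"
    by (rule p.sweedler_cong[OF NH bilinear_compose[OF functional_bilinear[OF H_module \<phi>] pr] ch])
      (use linear_map_smult[OF pr] linear_map_closed[OF \<phi>] in simp)
  also have "\<dots> = ptH (MObj N X) n (sw H (comult H h) (\<lambda>h1 h2. \<phi> h2 \<odot>\<^bsub>H\<^esub> h1))"
    by (rule p.linear_sweedler[OF H_module NH functional_bilinear[OF H_module \<phi>] pr ch, symmetric])
  finally show ?thesis .
qed

text \<open>As \<Delta> is multiplicative, the left side is the sum of f_0 n \<otimes> f_11 h_1
  scaled by the b-coordinate of f_12 h_2. The right side is the sum of f_00 n \<otimes> f_01 h_1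
  scaled by the b-coordinate of f_1 h_2. Coassociativity of the coaction of D equates them.\<close>

lemma cofree_twisted_pure:
  assumes XY: "X \<in> Ob" "Y \<in> Ob" and f: "f \<in> DH X Y" and b: "b \<in> B" and n: "n \<in> carrier (MObj N X)" and h: "h \<in> carrier H"
  shows "cofree_rho N Y b (cofree_act N X Y f (ptH (MObj N X) n h)) = twisted (cofree N) X Y b f (cofree_coact X (ptH (MObj N X) n h))"
proof -
  let ?P = "ten (MObj N Y)"
  note P = NH_module[OF XY(2)] and Ym = N_module[OF XY(2)] and DXY = D_module[OF XY] and cf' = coact_closed[OF XY f] and ch = comult_closed[OF h]
  interpret q: module_pair K "LHom D X Y" H by (rule pairH[OF DXY])
  interpret qq: module_pair K "LHom D X Y" WW by (rule pair_V_WW[OF DXY])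
  interpret hh: module_pair K H H by (rule pair_WW)
  note mb = mult_coord_bilinear[OF b h]
  have mc: "mult_coord b h x y \<in> carrier H" if "x \<in> carrier H" "y \<in> carrier H" for x y by (rule bilinear_closed[OF mb that])
  \<comment> \<open>At x \<otimes> y, E k is the sum of k n \<otimes> x h_1 scaled by the
    b-coordinate of y h_2. The map \<Lambda> sends k \<otimes> (x \<otimes> y) to this value, and
    the two sides of the claim are \<Lambda> of the two sides of coassociativity.\<close>
  define E where "E k u = sw ?P u (\<lambda>x y. ptH (MObj N Y) (MAct N X Y k n) (mult_coord b h x y))" for k u
  have Ei: "bilin H H ?P (\<lambda>x y. ptH (MObj N Y) (MAct N X Y k n) (mult_coord b h x y))" if "k \<in> DH X Y" for k
    by (rule bilinear_compose[OF mb pt_right[OF XY(2) N_act_closed[OF XY that n]]])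
  have El: "lin (LHom D X Y) ?P (\<lambda>k. ptH (MObj N Y) (MAct N X Y k n) (mult_coord b h x y))" if "x \<in> carrier H" "y \<in> carrier H" for x y
    by (rule linear_pure_left[OF Ym H_module N_act_arrow_linear[OF XY n] mc[OF that]])
  have Eb: "bilin (LHom D X Y) WW ?P E" unfolding E_def by (rule sweedler_bilinear[OF P DXY H_module H_module Ei El])
  have Ep: "E k (ptH H x y) = ptH (MObj N Y) (MAct N X Y k n) (mult_coord b h x y)" if "k \<in> DH X Y" "x \<in> carrier H" "y \<in> carrier H" for k x y
    unfolding E_def by (rule hh.sweedler_pure[OF P Ei[OF that(1)] that(2,3)])
  have Ed: "E k (comult H x) = ptH (MObj N Y) (MAct N X Y k n) (comult_coord b (x \<cdot> h))" if k: "k \<in> DH X Y" and x: "x \<in> carrier H" for k x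
    unfolding E_def comult_coord_mult[OF b x h]
    by (rule hh.linear_sweedler[OF H_module P mb pt_right[OF XY(2) N_act_closed[OF XY k n]] comult_closed[OF x], symmetric])
  define \<Lambda> where "\<Lambda> s = sw ?P s E" for s
  have \<Lambda>: "lin (tenW (LHom D X Y)) ?P \<Lambda>" unfolding \<Lambda>_def by (rule qq.sweedler_linear[OF P Eb])
  have \<Lambda>p: "\<Lambda> (ptW (LHom D X Y) k u) = E k u" if "k \<in> DH X Y" "u \<in> carrier WW" for k u
    unfolding \<Lambda>_def by (rule qq.sweedler_pure[OF P Eb that])
  have "cofree_rho N Y b (cofree_act N X Y f (ptH (MObj N X) n h))
    = sw ?P (coact D X Y f) (\<lambda>f0 f1. cofree_rho N Y b (ptH (MObj N Y) (MAct N X Y f0 n) (f1 \<cdot> h)))"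
    unfolding cofree_act_pure[OF XY f n h]
    by (rule q.linear_sweedler[OF P P cofree_outer[OF XY n h] cofree_rho_linear[OF XY(2) b] cf'])
  also have "\<dots> = sw ?P (coact D X Y f) (\<lambda>f0 f1. \<Lambda> (ptW (LHom D X Y) f0 (comult H f1)))"
  proof (rule q.sweedler_cong[OF P bilinear_compose[OF right3_bilinear[OF DXY] \<Lambda>] cf'])
    fix f0 f1 assume f01: "f0 \<in> DH X Y" "f1 \<in> carrier H"
    show "cofree_rho N Y b (ptH (MObj N Y) (MAct N X Y f0 n) (f1 \<cdot> h)) = \<Lambda> (ptW (LHom D X Y) f0 (comult H f1))"
      unfolding \<Lambda>p[OF f01(1) comult_closed[OF f01(2)]] Ed[OF f01]
      by (rule cofree_rho_pure[OF XY(2) b N_act_closed[OF XY f01(1) n] H_mult_closed[OF f01(2) h]])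
  qed
  also have "\<dots> = sw ?P (coact D X Y f) (\<lambda>f0 f1. sw ?P (coact D X Y f0)
      (\<lambda>f00 f01. \<Lambda> (ptW (LHom D X Y) f00 (ptH H f01 f1))))"
    by (rule comodule_coassoc_apply[OF DXY coact_linear[OF XY] P \<Lambda> D_comodule[OF XY] f, symmetric])
  also have "\<dots> = twisted (cofree N) X Y b f (cofree_coact X (ptH (MObj N X) n h))"
    unfolding twisted_def cofree_sel
  proof (rule q.sweedler_cong[OF P _ cf'])
    have ct: "cofree_coact X (ptH (MObj N X) n h) \<in> carrier (ten (Grp (cofree N) X))"
      using linear_map_closed[OF cofree_coact_linear[OF XY(1)] module_pair.pure_tensor_closed[OF NH_pair[OF XY(1)] n h]] by simp
    show "bilin (LHom D X Y) H ?P (twist (cofree N) X Y b (cofree_coact X (ptH (MObj N X) n h)))"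
      using twist_bilinear[OF cofree_opmod cofree_module_laws XY b ct] by simp
    fix f0 f1 assume f01: "f0 \<in> DH X Y" "f1 \<in> carrier H"
    note c0 = coact_closed[OF XY f01(1)]
    note NX = NH_module[OF XY(1)] and pr = pt_right[OF XY(1) n]
    have tb: "bilin (ten (MObj N X)) H ?P (\<lambda>v x. cf b (f1 \<cdot> x) \<odot>\<^bsub>?P\<^esub> cofree_act N X Y f0 v)"
      by (rule bilinear_functional_smult[OF P cf_mult_linear(1)[OF b f01(2)] cofree_act_linear[OF XY f01(1)]])
    let ?b = "\<lambda>h1 h2 k0 k1. cf b (f1 \<cdot> h2) \<odot>\<^bsub>?P\<^esub> ptH (MObj N Y) (MAct N X Y k0 n) (k1 \<cdot> h1)"
    have k: "cf b (f1 \<cdot> h2) \<in> carrier K" if "h2 \<in> carrier H" for h2 by (rule cf_closed[OF b H_mult_closed[OF f01(2) that]])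
    have b1: "bilin (LHom D X Y) H ?P (?b h1 h2)" if "h1 \<in> carrier H" "h2 \<in> carrier H" for h1 h2
      by (rule bilinear_compose[OF cofree_outer[OF XY n that(1)] linear_map_scale[OF P linear_map_id k[OF that(2)]]])
    have b2: "bilin H H ?P (\<lambda>h1 h2. ?b h1 h2 k0 k1)" if "k0 \<in> DH X Y" "k1 \<in> carrier H" for k0 k1
      by (rule bilinear_functional_smult[OF P cf_mult_linear(1)[OF b f01(2)]
          linear_map_compose[OF mult_left_linear[OF that(2)] pt_right[OF XY(2) N_act_closed[OF XY that(1) n]]]])
    have "twist (cofree N) X Y b (cofree_coact X (ptH (MObj N X) n h)) f0 f1
      = sw ?P (comult H h) (\<lambda>h1 h2. cf b (f1 \<cdot> h2) \<odot>\<^bsub>?P\<^esub> cofree_act N X Y f0 (ptH (MObj N X) n h1))"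
      unfolding twist_def cofree_sel cofree_coact_pure[OF XY(1) n h]
      by (rule sweedler_push[OF H_module NX H_module pr P tb ch])
    also have "\<dots> = sw ?P (comult H h) (\<lambda>h1 h2. sw ?P (coact D X Y f0) (?b h1 h2))"
    proof (rule sym, rule hh.sweedler_cong[OF P bilinear_precompose[OF tb pr linear_map_id] ch])
      fix h1 h2 assume h12: "h1 \<in> carrier H" "h2 \<in> carrier H"
      show "sw ?P (coact D X Y f0) (?b h1 h2) = cf b (f1 \<cdot> h2) \<odot>\<^bsub>?P\<^esub> cofree_act N X Y f0 (ptH (MObj N X) n h1)"
        unfolding cofree_act_pure[OF XY f01(1) n h12(1)]
        by (rule q.linear_sweedler[OF P P cofree_outer[OF XY n h12(1)] linear_map_scale[OF P linear_map_id k[OF h12(2)]] c0, symmetric])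
    qed
    \<comment> \<open>The sums over \<Delta>(h) and over the coaction of f0 are independent, so they
      may be exchanged.\<close>
    also have "\<dots> = sw ?P (coact D X Y f0) (\<lambda>k0 k1. sw ?P (comult H h) (\<lambda>h1 h2. ?b h1 h2 k0 k1))"
      by (rule sweedler_swap[OF P H_module H_module DXY H_module ch c0 b1 b2])
    also have "\<dots> = sw ?P (coact D X Y f0) (\<lambda>f00 f01. \<Lambda> (ptW (LHom D X Y) f00 (ptH H f01 f1)))"
    proof (rule q.sweedler_cong[OF P bilinear_compose[OF inner3_bilinear[OF DXY f01(2)] \<Lambda>] c0])
      fix k0 k1 assume k01: "k0 \<in> DH X Y" "k1 \<in> carrier H"
      note pk = pt_right[OF XY(2) N_act_closed[OF XY k01(1) n]] and mi = mult_coord_inner[OF b k01(2) f01(2)]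
      have "\<Lambda> (ptW (LHom D X Y) k0 (ptH H k1 f1)) = ptH (MObj N Y) (MAct N X Y k0 n) (mult_coord b h k1 f1)"
        unfolding \<Lambda>p[OF k01(1) hh.pure_tensor_closed[OF k01(2) f01(2)]] by (rule Ep[OF k01(1,2) f01(2)])
      also have "\<dots> = sw ?P (comult H h) (\<lambda>h1 h2. ptH (MObj N Y) (MAct N X Y k0 n) (cf b (f1 \<cdot> h2) \<odot>\<^bsub>H\<^esub> (k1 \<cdot> h1)))"
        unfolding mult_coord_def by (rule hh.linear_sweedler[OF H_module P mi pk ch])
      also have "\<dots> = sw ?P (comult H h) (\<lambda>h1 h2. ?b h1 h2 k0 k1)"
        by (rule hh.sweedler_cong[OF P b2[OF k01] ch]) (rule linear_map_smult[OF pk k H_mult_closed[OF k01(2)]])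
      finally show "sw ?P (comult H h) (\<lambda>h1 h2. ?b h1 h2 k0 k1) = \<Lambda> (ptW (LHom D X Y) k0 (ptH H k1 f1))" ..
    qed
    finally show "sw ?P (coact D X Y f0) (\<lambda>f00 f01. \<Lambda> (ptW (LHom D X Y) f00 (ptH H f01 f1)))
      = twist (cofree N) X Y b (cofree_coact X (ptH (MObj N X) n h)) f0 f1" ..
  qed
  finally show ?thesis .
qed

text \<open>The clauses of \<open>coaction_at\<close> equate linear functions of t, so pure tensors
  suffice. There the counit and coassociativity clauses become the laws of H, and the last clause is
  \<open>cofree_twisted_pure\<close>.\<close>

lemma cofree_good: "good (cofree N)"
  unfolding good_def
proof (intro conjI cofree_module_laws ballI)
  fix X t assume X: "X \<in> Ob" and "t \<in> el (cofree N) X"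
  then have t: "t \<in> carrier (ten (MObj N X))" by simp
  note cl = cofree_coact_linear[OF X] and NH = NH_module[OF X]
  note cm = coaction_at_linear_maps[OF cofree_opmod cofree_module_laws X, unfolded cofree_sel]
  have "coaction_at (cofree N) X t (cofree_coact X t)"
    unfolding coaction_at_iff cofree_sel
  proof (intro conjI ballI)
    fix b assume b: "b \<in> B"
    show "cd (ten (MObj N X)) b (cofree_coact X t) = cofree_rho N X b t"
    proof (rule NH_eqI[OF X NH linear_map_compose[OF cl cm(1)[OF b]] cofree_rho_linear[OF X b] _ t])
      fix n h assume nh: "n \<in> carrier (MObj N X)" "h \<in> carrier H"
      show "cd (ten (MObj N X)) b (cofree_coact X (ptH (MObj N X) n h)) = cofree_rho N X b (ptH (MObj N X) n h)"
        unfolding cofree_coact_pure[OF X nh] cofree_rho_pure[OF X b nh] comult_coord_def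
        by (rule cd_push[OF H_module NH pt_right[OF X nh(1)] b comult_closed[OF nh(2)]])
    qed
  next
    show "sw (ten (MObj N X)) (cofree_coact X t) (\<lambda>v h. counit H h \<odot>\<^bsub>ten (MObj N X)\<^esub> v) = t"
    proof (rule NH_eqI[OF X NH linear_map_compose[OF cl cm(2)] linear_map_id _ t])
      fix n h assume nh: "n \<in> carrier (MObj N X)" "h \<in> carrier H"
      show "sw (ten (MObj N X)) (cofree_coact X (ptH (MObj N X) n h)) (\<lambda>v h. counit H h \<odot>\<^bsub>ten (MObj N X)\<^esub> v) = ptH (MObj N X) n h"
        unfolding cofree_coact_functional[OF X nh counit_linear] coalgebra.counit_right[OF coalgebra_H nh(2)] ..
    qed
  next
    fix c b assume cb: "c \<in> B" "b \<in> B"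
    show "cofree_rho N X c (cofree_rho N X b t) =
      sw (ten (MObj N X)) (cofree_coact X t) (\<lambda>v h. pairing c b (comult H h) \<odot>\<^bsub>ten (MObj N X)\<^esub> v)"
    proof (rule NH_eqI[OF X NH cm(4)[OF cb] linear_map_compose[OF cl cm(3)[OF cb]] _ t])
      fix n h assume nh: "n \<in> carrier (MObj N X)" "h \<in> carrier H"
      show "cofree_rho N X c (cofree_rho N X b (ptH (MObj N X) n h)) =
        sw (ten (MObj N X)) (cofree_coact X (ptH (MObj N X) n h)) (\<lambda>v h. pairing c b (comult H h) \<odot>\<^bsub>ten (MObj N X)\<^esub> v)"
        unfolding cofree_coact_functional[OF X nh comult_pairing_linear[OF cb]] cofree_rho_pure[OF X cb(2) nh]
          cofree_rho_pure[OF X cb(1) nh(1) comult_coord_closed[OF cb(2) nh(2)]]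
        unfolding comult_coord_def comodule_coassoc_cd[OF H_comodule cb nh(2)] ..
    qed
  next
    fix Y f b assume Y: "Y \<in> Ob" and f: "f \<in> DH X Y" and b: "b \<in> B"
    note tl = twisted_linear[OF cofree_opmod cofree_module_laws X Y b f, unfolded cofree_sel]
    show "cofree_rho N Y b (cofree_act N X Y f t) = twisted (cofree N) X Y b f (cofree_coact X t)"
      by (rule NH_eqI[OF X NH_module[OF Y] cm(5)[OF Y f b] linear_map_compose[OF cl tl] cofree_twisted_pure[OF X Y f b] t])
  qed
  then show "\<exists>s\<in>carrier (ten (Grp (cofree N) X)). coaction_at (cofree N) X t s"
    using linear_map_closed[OF cl t] by (intro bexI[of _ "cofree_coact X t"]) auto
qed

end

text \<open>The coaction commutes with the arrows by the compatibility law and with the coordinate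
  operators by coassociativity; it is injective by the counit law.\<close>

lemma coaction_ophom:
  assumes M: "relative_hopf_module K H D M"
  shows "OS.ophom (U M) (cofree M) (MCoact M)" "OS.opinj (U M) (MCoact M)"
proof -
  have lm: "left_module K D M" using M by (simp add: relative_hopf_module_def)
  note Mm = left_module.MObj_module[OF lm] and cl = relative_coaction_linear[OF M] and com = relative_hopf_module.MObj_comodule[OF M]
  show "OS.ophom (U M) (cofree M) (MCoact M)"
  proof (rule OS.ophomI)
    fix p x assume p: "p \<in> ops" and x: "x \<in> el (U M) (op_src p)"
    from p show "MCoact M (op_tgt p) (Op (U M) p x) = Op (cofree M) p (MCoact M (op_src p) x)"
    proof (cases rule: ops_cases)
      case (1 X Y f)
      then show ?thesis using relative_hopf_module.MCoact_MAct[OF M, of X Y f x] x by (simp add: cofree_act_def)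
    next
      case (2 X b)
      then have X: "X \<in> Ob" and b: "b \<in> B" and xc: "x \<in> carrier (MObj M X)" using x by auto
      let ?V = "MObj M X" and ?\<rho> = "MCoact M X"
      note V = Mm[OF X] and \<rho>l = cl[OF X]
      note \<rho>x = linear_map_closed[OF \<rho>l xc]
      interpret p: module_pair K ?V H by (rule pairH[OF V])
      interpret q: module_pair K ?V WW by (rule pair_V_WW[OF V])
      \<comment> \<open>\<Lambda> contracts the last factor with \<open>cf b\<close>. It turns the
        two sides of coassociativity into \<rho>(\<rho>_b(x)) and the image of \<rho>(x) under id
        \<otimes> \<open>comult_coord b\<close>.\<close>
      define \<Lambda> where "\<Lambda> s = sw (ten ?V) s (\<lambda>v u. ptH ?V v (cd H b u))" for s
      have \<Lambda>b: "bilin ?V WW (ten ?V) (\<lambda>v u. ptH ?V v (cd H b u))"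
        by (rule bilinear_pure[OF V H_module linear_map_id cd_linear[OF H_module b]])
      have \<Lambda>: "lin (tenW ?V) (ten ?V) \<Lambda>" unfolding \<Lambda>_def by (rule q.sweedler_linear[OF p.tensor_module \<Lambda>b])
      have \<Lambda>p: "\<Lambda> (ptW ?V v u) = ptH ?V v (cd H b u)" if "v \<in> carrier ?V" "u \<in> carrier WW" for v u
        unfolding \<Lambda>_def by (rule q.sweedler_pure[OF p.tensor_module \<Lambda>b that])
      have "?\<rho> (cd ?V b (?\<rho> x)) = sw (ten ?V) (?\<rho> x) (\<lambda>v0 v1. ?\<rho> (cf b v1 \<odot>\<^bsub>?V\<^esub> v0))"
        unfolding cd_def by (rule p.linear_sweedler[OF V p.tensor_module cd_bilinear[OF V b] \<rho>l \<rho>x])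
      also have "\<dots> = sw (ten ?V) (?\<rho> x) (\<lambda>v0 v1. sw (ten ?V) (?\<rho> v0)
          (\<lambda>v00 v01. \<Lambda> (ptW ?V v00 (ptH H v01 v1))))"
      proof (rule sym, rule p.sweedler_cong[OF p.tensor_module bilinear_compose[OF cd_bilinear[OF V b] \<rho>l] \<rho>x])
        fix v0 v1 assume v: "v0 \<in> carrier ?V" "v1 \<in> carrier H"
        note k = cf_closed[OF b v(2)] and \<rho>0 = linear_map_closed[OF \<rho>l v(1)]
        have s: "lin (ten ?V) (ten ?V) (\<lambda>t. cf b v1 \<odot>\<^bsub>ten ?V\<^esub> t)" by (rule linear_map_scale[OF p.tensor_module linear_map_id k])
        have "?\<rho> (cf b v1 \<odot>\<^bsub>?V\<^esub> v0) = cf b v1 \<odot>\<^bsub>ten ?V\<^esub> sw (ten ?V) (?\<rho> v0) (ptH ?V)"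
          unfolding p.sweedler_pure_id[OF \<rho>0] by (rule linear_map_smult[OF \<rho>l k v(1)])
        also have "\<dots> = sw (ten ?V) (?\<rho> v0) (\<lambda>v00 v01. cf b v1 \<odot>\<^bsub>ten ?V\<^esub> ptH ?V v00 v01)"
          by (rule p.linear_sweedler[OF p.tensor_module p.tensor_module p.pure_tensor_bilinear s \<rho>0])
        also have "\<dots> = sw (ten ?V) (?\<rho> v0) (\<lambda>v00 v01. \<Lambda> (ptW ?V v00 (ptH H v01 v1)))"
        proof (rule p.sweedler_cong[OF p.tensor_module bilinear_compose[OF inner3_bilinear[OF V v(2)] \<Lambda>] \<rho>0])
          fix v00 y assume vy: "v00 \<in> carrier ?V" "y \<in> carrier H"
          show "cf b v1 \<odot>\<^bsub>ten ?V\<^esub> ptH ?V v00 y = \<Lambda> (ptW ?V v00 (ptH H y v1))"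
            unfolding \<Lambda>p[OF vy(1) module_pair.pure_tensor_closed[OF pair_WW vy(2) v(2)]] cd_pure[OF H_module b vy(2) v(2)]
            by (rule linear_map_smult[OF bilinear_right[OF p.pure_tensor_bilinear vy(1)] k vy(2), symmetric])
        qed
        finally show "sw (ten ?V) (?\<rho> v0) (\<lambda>v00 v01. \<Lambda> (ptW ?V v00 (ptH H v01 v1))) = ?\<rho> (cf b v1 \<odot>\<^bsub>?V\<^esub> v0)" ..
      qed
      also have "\<dots> = sw (ten ?V) (?\<rho> x) (\<lambda>v0 v1. \<Lambda> (ptW ?V v0 (comult H v1)))"
        by (rule comodule_coassoc_apply[OF V \<rho>l p.tensor_module \<Lambda> com[OF X] xc])
      also have "\<dots> = cofree_rho M X b (?\<rho> x)"
        unfolding cofree_rho_def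
        by (rule p.sweedler_cong[OF p.tensor_module cofree_rho_bilinear[OF lm X b] \<rho>x])
          (simp add: \<Lambda>p comult_closed comult_coord_def)
      finally show ?thesis using 2 by simp
    qed
  qed (simp add: cl)
  show "OS.opinj (U M) (MCoact M)" unfolding OS.opinj_def
  proof (intro ballI inj_onI)
    fix X x y assume X: "X \<in> Ob" and "x \<in> el (U M) X" "y \<in> el (U M) X" and e: "MCoact M X x = MCoact M X y"
    then show "x = y" using right_comodule.coaction_counit[OF com[OF X]] by (metis U_sel(1))
  qed
qed

text \<open>D-linearity of \<theta> is enough: the coaction of N \<otimes> H sits on the factor H,
  which \<theta> \<otimes> id does not touch.\<close>

lemma cofree_map_ophom:
  assumes N: "left_module K D N" and M: "left_module K D M"
    and \<theta>: "\<And>X. X \<in> Ob \<Longrightarrow> lin (MObj N X) (MObj M X) (\<theta> X)"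
    and nat: "\<And>X Y f n. \<lbrakk>X \<in> Ob; Y \<in> Ob; f \<in> DH X Y; n \<in> carrier (MObj N X)\<rbrakk> \<Longrightarrow> \<theta> Y (MAct N X Y f n) = MAct M X Y f (\<theta> X n)"
  shows "OS.ophom (cofree N) (cofree M) (\<lambda>X. pushH (MObj M X) (\<theta> X))"
proof (rule OS.ophomI)
  note Nm = left_module.MObj_module[OF N] and Mm = left_module.MObj_module[OF M]
  have tl: "lin (ten (MObj N X)) (ten (MObj M X)) (pushH (MObj M X) (\<theta> X))" if "X \<in> Ob" for X
    by (rule tensor_push_linear[OF Nm[OF that] Mm[OF that] H_module \<theta>[OF that]])
  have tp: "pushH (MObj M X) (\<theta> X) (ptH (MObj N X) n h) = ptH (MObj M X) (\<theta> X n) h" if "X \<in> Ob" "n \<in> carrier (MObj N X)" "h \<in> carrier H" for X n h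
    by (rule tensor_push_pure[OF Nm[OF that(1)] Mm[OF that(1)] H_module \<theta>[OF that(1)] that(2,3)])
  show "lin (Grp (cofree N) X) (Grp (cofree M) X) (pushH (MObj M X) (\<theta> X))" if "X \<in> Ob" for X
    using tl[OF that] by simp
  fix p t assume p: "p \<in> ops" and t: "t \<in> el (cofree N) (op_src p)"
  from p show "pushH (MObj M (op_tgt p)) (\<theta> (op_tgt p)) (Op (cofree N) p t) = Op (cofree M) p (pushH (MObj M (op_src p)) (\<theta> (op_src p)) t)"
  proof (cases rule: ops_cases)
    case (1 X Y f)
    note XY = 1(2,3) and f = 1(4)
    have t': "t \<in> carrier (ten (MObj N X))" using t 1 by simp
    have "pushH (MObj M Y) (\<theta> Y) (cofree_act N X Y f t) = cofree_act M X Y f (pushH (MObj M X) (\<theta> X) t)"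
    proof (rule NH_eqI[OF N XY(1) NH_module[OF M XY(2)] linear_map_compose[OF cofree_act_linear[OF N XY f] tl[OF XY(2)]]
          linear_map_compose[OF tl[OF XY(1)] cofree_act_linear[OF M XY f]] _ t'])
      fix n h assume nh: "n \<in> carrier (MObj N X)" "h \<in> carrier H"
      note \<theta>n = linear_map_closed[OF \<theta>[OF XY(1)] nh(1)]
      interpret q: module_pair K "LHom D X Y" H by (rule pairH[OF D_module[OF XY]])
      show "pushH (MObj M Y) (\<theta> Y) (cofree_act N X Y f (ptH (MObj N X) n h)) =
        cofree_act M X Y f (pushH (MObj M X) (\<theta> X) (ptH (MObj N X) n h))"
        unfolding tp[OF XY(1) nh] cofree_act_pure[OF N XY f nh] cofree_act_pure[OF M XY f \<theta>n nh(2)]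
          q.linear_sweedler[OF NH_module[OF N XY(2)] NH_module[OF M XY(2)] cofree_outer[OF N XY nh] tl[OF XY(2)] coact_closed[OF XY f]]
        by (rule q.sweedler_cong[OF NH_module[OF M XY(2)] cofree_outer[OF M XY \<theta>n nh(2)] coact_closed[OF XY f]])
          (simp add: tp XY nh N_act_closed[OF N] H_mult_closed nat)
    qed
    then show ?thesis using 1 by simp
  next
    case (2 X b)
    note X = 2(2) and b = 2(3)
    have t': "t \<in> carrier (ten (MObj N X))" using t 2 by simp
    have "pushH (MObj M X) (\<theta> X) (cofree_rho N X b t) = cofree_rho M X b (pushH (MObj M X) (\<theta> X) t)"
      by (rule NH_eqI[OF N X NH_module[OF M X] linear_map_compose[OF cofree_rho_linear[OF N X b] tl[OF X]]
            linear_map_compose[OF tl[OF X] cofree_rho_linear[OF M X b]] _ t'])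
        (simp add: cofree_rho_pure[OF N X b] cofree_rho_pure[OF M X b] tp X comult_coord_closed b linear_map_closed[OF \<theta>[OF X]])
    then show ?thesis using 2 by simp
  qed
qed

end

section \<open>Generators\<close>

text \<open>A tensor product is an image of the free module on pairs, whose elements are finitely
  supported functions.\<close>

lemma (in module_pair) small_in_tensor:
  assumes u: "universe small" and V: "small_in small (carrier V)" and W: "small_in small (carrier W)" and K: "small_in small (carrier K)"
  shows "small_in small (carrier T)"
proof -
  interpret universe small by (rule u)
  let ?S = "carrier V \<times> carrier W"
  have "small_in small {f. finite {s\<in>?S. f s \<noteq> \<zero>\<^bsub>K\<^esub>} \<and> (\<forall>s\<in>?S. f s \<in> carrier K) \<and> (\<forall>s. s \<notin> ?S \<longrightarrow> f s = \<zero>\<^bsub>K\<^esub>)}"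
    by (rule small_in_finite_support[where A = "\<lambda>_. carrier K" and z = "\<lambda>_. \<zero>\<^bsub>K\<^esub>", OF small_in_Sigma[OF V W] K])
  then have "small_in small (carrier F)"
    by (rule small_in_subset) (auto simp: free_module_sel elim: rev_finite_subset)
  then show ?thesis unfolding tensor_carrier by (rule small_in_image)
qed

context hopf_setting
begin

text \<open>Left modules enter \<open>cofree\<close> as records whose field \<open>MCoact\<close> is never read.\<close>

definition rep :: "'o \<Rightarrow> ('o, 'f, 'k, 'h, ('f, 'h, 'k) tensor) hopf_mod" where
  "rep X = \<lparr>MObj = (\<lambda>Y. ten (LHom D X Y)), MAct = (\<lambda>Y Z f. pushH (LHom D X Z) (LComp D X Y Z f)), MCoact = undefined\<rparr>"

lemma rep_sel [simp]: "MObj (rep X) Y = ten (LHom D X Y)" "MAct (rep X) Y Z f = pushH (LHom D X Z) (LComp D X Y Z f)"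
  by (simp_all add: rep_def)

text \<open>Composition acts on the factor D(X, -) only, so the laws are checked on pure tensors,
  where they are laws of D.\<close>

lemma rep_left_module:
  assumes X: "X \<in> Ob"
  shows "left_module K D (rep X)"
proof -
  have T: "module K (ten (LHom D X Y))" if "Y \<in> Ob" for Y
    by (rule module_pair.tensor_module[OF pairH[OF D_module[OF X that]]])
  have l: "lin (ten (LHom D X Y)) (ten (LHom D X Z)) (pushH (LHom D X Z) (LComp D X Y Z f))"
    if "Y \<in> Ob" "Z \<in> Ob" "f \<in> DH Y Z" for Y Z f
    by (rule tensor_push_linear[OF D_module[OF X that(1)] D_module[OF X that(2)] H_module D_Comp_right[OF X that]])
  have p: "pushH (LHom D X Z) (LComp D X Y Z f) (ptH (LHom D X Y) g h) = ptH (LHom D X Z) (LComp D X Y Z f g) h"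
    if "Y \<in> Ob" "Z \<in> Ob" "f \<in> DH Y Z" "g \<in> DH X Y" "h \<in> carrier H" for Y Z f g h
    by (rule tensor_push_pure[OF D_module[OF X that(1)] D_module[OF X that(2)] H_module D_Comp_right[OF X that(1-3)] that(4,5)])
  have eqI: "F t = G t" if "Y \<in> Ob" "Z \<in> Ob"
      "lin (ten (LHom D X Y)) (ten (LHom D X Z)) F" "lin (ten (LHom D X Y)) (ten (LHom D X Z)) G"
      "\<And>g h. \<lbrakk>g \<in> DH X Y; h \<in> carrier H\<rbrakk> \<Longrightarrow> F (ptH (LHom D X Y) g h) = G (ptH (LHom D X Y) g h)"
      "t \<in> carrier (ten (LHom D X Y))" for Y Z F G t
    by (rule module_pair.tensor_hom_eqI[OF pairH[OF D_module[OF X that(1)]] T[OF that(2)] that(3-6)])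
  have lin: "lin (LHom D Y Z) (ten (LHom D X Z)) (\<lambda>f. ptH (LHom D X Z) (LComp D X Y Z f g) h)"
    if "Y \<in> Ob" "Z \<in> Ob" "g \<in> DH X Y" "h \<in> carrier H" for Y Z g h
    by (rule linear_pure_left[OF D_module[OF X that(2)] H_module D_Comp_left[OF X that(1-3)] that(4)])
  have Dm: "f \<oplus>\<^bsub>LHom D Y Z\<^esub> g \<in> DH Y Z" "a \<odot>\<^bsub>LHom D Y Z\<^esub> f \<in> DH Y Z"
    if "Y \<in> Ob" "Z \<in> Ob" "f \<in> DH Y Z" "g \<in> DH Y Z" "a \<in> carrier K" for Y Z f g a
  proof -
    interpret m: module K "LHom D Y Z" by (rule D_module[OF that(1,2)])
    show "f \<oplus>\<^bsub>LHom D Y Z\<^esub> g \<in> DH Y Z" "a \<odot>\<^bsub>LHom D Y Z\<^esub> f \<in> DH Y Z" using that by auto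
  qed
  have K0: "\<zero>\<^bsub>K\<^esub> \<in> carrier K" by simp
  show ?thesis
  proof (rule left_module.intro, unfold rep_sel)
    fix Y Z f g t assume o: "Y \<in> Ob" "Z \<in> Ob" and f: "f \<in> DH Y Z" and g: "g \<in> DH Y Z" and t: "t \<in> carrier (ten (LHom D X Y))"
    show "pushH (LHom D X Z) (LComp D X Y Z (f \<oplus>\<^bsub>LHom D Y Z\<^esub> g)) t =
      pushH (LHom D X Z) (LComp D X Y Z f) t \<oplus>\<^bsub>ten (LHom D X Z)\<^esub> pushH (LHom D X Z) (LComp D X Y Z g) t"
      by (rule eqI[OF o l[OF o Dm(1)[OF o f g K0]] linear_map_plus[OF T[OF o(2)] l[OF o f] l[OF o g]] _ t])
        (simp add: p o f g Dm(1)[OF o f g K0] linear_map_add[OF lin[OF o]])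
  next
    fix Y Z a f t assume o: "Y \<in> Ob" "Z \<in> Ob" and a: "a \<in> carrier K" and f: "f \<in> DH Y Z" and t: "t \<in> carrier (ten (LHom D X Y))"
    show "pushH (LHom D X Z) (LComp D X Y Z (a \<odot>\<^bsub>LHom D Y Z\<^esub> f)) t =
      a \<odot>\<^bsub>ten (LHom D X Z)\<^esub> pushH (LHom D X Z) (LComp D X Y Z f) t"
      by (rule eqI[OF o l[OF o Dm(2)[OF o f f a]] linear_map_scale[OF T[OF o(2)] l[OF o f] a] _ t])
        (simp add: p o f a Dm(2)[OF o f f a] linear_map_smult[OF lin[OF o]])
  next
    fix Y t assume o: "Y \<in> Ob" and t: "t \<in> carrier (ten (LHom D X Y))"
    show "pushH (LHom D X Y) (LComp D X Y Y (LIdent D Y)) t = t"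
      by (rule eqI[OF o o l[OF o o D_Ident_closed[OF o]] linear_map_id _ t])
        (simp add: p o D_Ident_closed D_Comp_Ident X)
  next
    fix Y Z Z' g f t assume o: "Y \<in> Ob" "Z \<in> Ob" "Z' \<in> Ob" and g: "g \<in> DH Y Z" and f: "f \<in> DH Z Z'"
      and t: "t \<in> carrier (ten (LHom D X Y))"
    note c = D_Comp_closed[OF o g f]
    show "pushH (LHom D X Z') (LComp D X Y Z' (LComp D Y Z Z' f g)) t =
      pushH (LHom D X Z') (LComp D X Z Z' f) (pushH (LHom D X Z) (LComp D X Y Z g) t)"
      by (rule eqI[OF o(1,3) l[OF o(1,3) c] linear_map_compose[OF l[OF o(1,2) g] l[OF o(2,3) f]] _ t])
        (simp add: p o f g c X D_Comp_closed D_Comp_assoc)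
  qed (simp_all add: T l)
qed

text \<open>
  The map \<open>\<theta>\<close> sends $g \otimes h$ to $M(g)(m(h))$, where $m(h)$ is linear in $h$ and takes the finitely
  many basis elements $b$ that occur in $\rho(m)$ to the corresponding coordinates of $\rho(m)$.
\<close>

lemma element_of_rep:
  assumes M: "relative_hopf_module K H D M" and X: "X \<in> Ob" and m: "m \<in> carrier (MObj M X)"
  obtains u \<theta> where "u \<in> carrier (ten (ten (LHom D X X)))"
    "\<And>Y. Y \<in> Ob \<Longrightarrow> lin (MObj (rep X) Y) (MObj M Y) (\<theta> Y)"
    "\<And>Y Z f n. \<lbrakk>Y \<in> Ob; Z \<in> Ob; f \<in> DH Y Z; n \<in> carrier (MObj (rep X) Y)\<rbrakk>
      \<Longrightarrow> \<theta> Z (MAct (rep X) Y Z f n) = MAct M Y Z f (\<theta> Y n)"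
    "pushH (MObj M X) (\<theta> X) u = MCoact M X m"
proof -
  have lm: "left_module K D M" using M by (simp add: relative_hopf_module_def)
  note Mm = left_module.MObj_module[OF lm]
  let ?V = "MObj M X" and ?t = "MCoact M X m" and ?E = "LHom D X X"
  interpret V: module K ?V by (rule Mm[OF X])
  interpret pE: module_pair K ?E H by (rule pairH[OF D_module[OF X X]])
  interpret pEE: module_pair K "ten ?E" H by (rule pairH[OF pE.tensor_module])
  interpret TT: module K "ten (ten ?E)" by (rule pEE.tensor_module)
  have t: "?t \<in> carrier (ten ?V)" by (rule linear_map_closed[OF relative_coaction_linear[OF M X] m])
  obtain F where F: "finite F" "F \<subseteq> B" and
    sumF: "(\<Oplus>\<^bsub>ten ?V\<^esub>b\<in>F. ptH ?V (cd ?V b ?t) b) = ?t"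
    by (rule cd_expand[OF Mm[OF X] t]) blast
  define mm where "mm h = (\<Oplus>\<^bsub>?V\<^esub>b\<in>F. cf b h \<odot>\<^bsub>?V\<^esub> cd ?V b ?t)" for h
  have cdc: "cd ?V b ?t \<in> carrier ?V" if "b \<in> F" for b using cd_closed[OF Mm[OF X] _ t] that F by auto
  have mml: "lin H ?V mm" unfolding mm_def
    by (rule linear_map_finsum_fun[OF Mm[OF X] F(1)]) (use F in \<open>auto intro!: linear_functional_smult[OF Mm[OF X] cf_linear cdc]\<close>)
  have mmb: "mm b = cd ?V b ?t" if b: "b \<in> F" for b
  proof -
    have "mm b = (\<Oplus>\<^bsub>?V\<^esub>c\<in>F. if b = c then cd ?V c ?t else \<zero>\<^bsub>?V\<^esub>)"
      unfolding mm_def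
    proof (rule V.finsum_cong'[OF refl])
      show "(\<lambda>c. if b = c then cd ?V c ?t else \<zero>\<^bsub>?V\<^esub>) \<in> F \<rightarrow> carrier ?V" using cdc by auto
      fix c assume c: "c \<in> F"
      have "cf c b = (if c = b then \<one>\<^bsub>K\<^esub> else \<zero>\<^bsub>K\<^esub>)" by (rule cf_delta) (use b c F in auto)
      then show "cf c b \<odot>\<^bsub>?V\<^esub> cd ?V c ?t = (if b = c then cd ?V c ?t else \<zero>\<^bsub>?V\<^esub>)"
        using cdc[OF c] by (auto simp: V.smult_l_null)
    qed
    also have "\<dots> = cd ?V b ?t" by (rule V.finsum_singleton[OF b F(1)]) (use cdc in auto)
    finally show ?thesis .
  qed
  have bil: "bilin (LHom D X Y) H (MObj M Y) (\<lambda>g h. MAct M X Y g (mm h))" if Y: "Y \<in> Ob" for Y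
  proof (rule bilinear_mapI)
    show "lin H (MObj M Y) (\<lambda>h. MAct M X Y g (mm h))" if "g \<in> DH X Y" for g
      by (rule linear_map_compose[OF mml left_module.MAct_linear[OF lm X Y that]])
    show "lin (LHom D X Y) (MObj M Y) (\<lambda>g. MAct M X Y g (mm h))" if "h \<in> carrier H" for h
      by (rule N_act_arrow_linear[OF lm X Y linear_map_closed[OF mml that]])
  qed
  define \<theta> where "\<theta> Y s = sw (MObj M Y) s (\<lambda>g h. MAct M X Y g (mm h))" for Y s
  have \<theta>l: "lin (ten (LHom D X Y)) (MObj M Y) (\<theta> Y)" if Y: "Y \<in> Ob" for Y
    unfolding \<theta>_def by (rule module_pair.sweedler_linear[OF pairH[OF D_module[OF X Y]] Mm[OF Y] bil[OF Y]])
  \<comment> \<open>u depends on X and F only. Since \<theta> sends id \<otimes> b to \<rho>_b(m),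
    the image of u is the expansion of \<rho>(m) in the basis.\<close>
  define u where "u = (\<Oplus>\<^bsub>ten (ten ?E)\<^esub>b\<in>F. ptH (ten ?E) (ptH ?E (LIdent D X) b) b)"
  have bH: "b \<in> carrier H" if "b \<in> F" for b using that F B_closed by auto
  have ic: "ptH ?E (LIdent D X) b \<in> carrier (ten ?E)" if "b \<in> F" for b by (rule pE.pure_tensor_closed[OF D_Ident_closed[OF X] bH[OF that]])
  have uc: "ptH (ten ?E) (ptH ?E (LIdent D X) b) b \<in> carrier (ten (ten ?E))" if "b \<in> F" for b
    by (rule pEE.pure_tensor_closed[OF ic[OF that] bH[OF that]])
  show thesis
  proof (rule that[of u \<theta>])
    show "u \<in> carrier (ten (ten ?E))" unfolding u_def by (rule TT.finsum_closed) (use uc in auto)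
    show "lin (MObj (rep X) Y) (MObj M Y) (\<theta> Y)" if "Y \<in> Ob" for Y using \<theta>l[OF that] by simp
    show "\<theta> Z (MAct (rep X) Y Z f n) = MAct M Y Z f (\<theta> Y n)"
      if o: "Y \<in> Ob" "Z \<in> Ob" and f: "f \<in> DH Y Z" and "n \<in> carrier (MObj (rep X) Y)" for Y Z f n
    proof -
      interpret p: module_pair K "LHom D X Y" H by (rule pairH[OF D_module[OF X o(1)]])
      have n: "n \<in> carrier (ten (LHom D X Y))" using that by simp
      have "\<theta> Z (MAct (rep X) Y Z f n) = sw (MObj M Z) n (\<lambda>g h. MAct M X Z (LComp D X Y Z f g) (mm h))"
        unfolding \<theta>_def rep_sel
        by (rule sweedler_push[OF D_module[OF X o(1)] D_module[OF X o(2)] H_module D_Comp_right[OF X o f] Mm[OF o(2)] bil[OF o(2)] n])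
      also have "\<dots> = sw (MObj M Z) n (\<lambda>g h. MAct M Y Z f (MAct M X Y g (mm h)))"
        by (rule p.sweedler_cong[OF Mm[OF o(2)] bilinear_compose[OF bil[OF o(1)] left_module.MAct_linear[OF lm o f]] n])
          (rule left_module.MAct_Comp[OF lm X o _ f linear_map_closed[OF mml]])
      also have "\<dots> = MAct M Y Z f (\<theta> Y n)"
        unfolding \<theta>_def by (rule p.linear_sweedler[OF Mm[OF o(1)] Mm[OF o(2)] bil[OF o(1)] left_module.MAct_linear[OF lm o f] n, symmetric])
      finally show ?thesis .
    qed
    interpret TV: module K "ten ?V" by (rule NH_module[OF lm X])
    have "pushH ?V (\<theta> X) u = (\<Oplus>\<^bsub>ten ?V\<^esub>b\<in>F. pushH ?V (\<theta> X) (ptH (ten ?E) (ptH ?E (LIdent D X) b) b))"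
      unfolding u_def
      by (rule linear_map_finsum[OF pEE.tensor_module NH_module[OF lm X] tensor_push_linear[OF pE.tensor_module Mm[OF X] H_module \<theta>l[OF X]] F(1) uc])
    also have "\<dots> = (\<Oplus>\<^bsub>ten ?V\<^esub>b\<in>F. ptH ?V (cd ?V b ?t) b)"
    proof (rule TV.finsum_cong'[OF refl])
      show "(\<lambda>b. ptH ?V (cd ?V b ?t) b) \<in> F \<rightarrow> carrier (ten ?V)" using module_pair.pure_tensor_closed[OF NH_pair[OF lm X] cdc bH] by auto
      fix b assume b: "b \<in> F"
      have "\<theta> X (ptH ?E (LIdent D X) b) = cd ?V b ?t"
        unfolding \<theta>_def pE.sweedler_pure[OF Mm[OF X] bil[OF X] D_Ident_closed[OF X] bH[OF b]] mmb[OF b]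
        by (rule left_module.MAct_Ident[OF lm X cdc[OF b]])
      then show "pushH ?V (\<theta> X) (ptH (ten ?E) (ptH ?E (LIdent D X) b) b) = ptH ?V (cd ?V b ?t) b"
        by (simp add: tensor_push_pure[OF pE.tensor_module Mm[OF X] H_module \<theta>l[OF X] ic[OF b] bH[OF b]])
    qed
    also have "\<dots> = ?t" by (rule sumF)
    finally show "pushH ?V (\<theta> X) u = ?t" .
  qed
qed

text \<open>A and the operator module of \<open>hopf_mod_of A\<close> have the same groups, and
  their operators agree on elements, so the identity is a map in both directions.\<close>

lemma hopf_mod_of_object:
  assumes A: "OS.is_opmod A" "good A" and sm: "\<And>X. X \<in> Ob \<Longrightarrow> small (el A X)"
  shows "hopf_mod_of A \<in> Obj (hopf_mod_category small K H D)"
    and "OS.ophom A (U (hopf_mod_of A)) (\<lambda>X x. x)" "OS.opinj A (\<lambda>X x. x)" "OS.opsurj A (U (hopf_mod_of A)) (\<lambda>X x. x)"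
    and "OS.ophom (U (hopf_mod_of A)) A (\<lambda>X x. x)"
proof -
  have g: "Grp (U (hopf_mod_of A)) = Grp A" by (simp add: hopf_mod_of_def)
  show "hopf_mod_of A \<in> Obj (hopf_mod_category small K H D)"
    using hopf_mod_of_relative(1)[OF A] sm by (simp add: hopf_mod_category_def hopf_mod_of_def)
  show h: "OS.ophom A (U (hopf_mod_of A)) (\<lambda>X x. x)" by (rule hopf_mod_of_relative(2)[OF A])
  show "OS.opinj A (\<lambda>X x. x)" by (simp add: OS.opinj_def)
  show "OS.opsurj A (U (hopf_mod_of A)) (\<lambda>X x. x)" unfolding OS.opsurj_def g by simp
  show "OS.ophom (U (hopf_mod_of A)) A (\<lambda>X x. x)"
  proof (rule OS.ophomI, unfold g)
    fix p x assume "p \<in> ops" "x \<in> el A (op_src p)"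
    then show "Op (U (hopf_mod_of A)) p x = Op A p x" by (rule OS.ophom_Op[OF h, symmetric])
  qed (rule linear_map_id)
qed

text \<open>Every element that is obtained from \<open>u\<close> as in \<open>element_of_rep\<close> is in the image of a map from \<open>G\<close>.\<close>

definition represents :: "'o \<Rightarrow> (('f, 'h, 'k) tensor, 'h, 'k) tensor \<Rightarrow> ('o, 'f, 'k, 'h, 'u) hopf_mod \<Rightarrow> bool" where
  "represents X u G \<longleftrightarrow> (\<forall>M \<theta> m. relative_hopf_module K H D (M :: ('o, 'f, 'k, 'h, 'u) hopf_mod) \<longrightarrow>
    (\<forall>Y\<in>Ob. lin (MObj (rep X) Y) (MObj M Y) (\<theta> Y)) \<longrightarrow>
    (\<forall>Y\<in>Ob. \<forall>Z\<in>Ob. \<forall>f\<in>DH Y Z. \<forall>n\<in>carrier (MObj (rep X) Y). \<theta> Z (MAct (rep X) Y Z f n) = MAct M Y Z f (\<theta> Y n)) \<longrightarrow>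
    m \<in> carrier (MObj M X) \<longrightarrow> pushH (MObj M X) (\<theta> X) u = MCoact M X m \<longrightarrow>
    (\<exists>\<eta>. OS.ophom (U G) (U M) \<eta> \<and> m \<in> \<eta> X ` el (U G) X))"

text \<open>G is a copy in \<open>'u\<close> of the subobject generated by u. For given M and
  \<theta>, the elements that \<theta> \<otimes> id sends into \<rho>(M) form a subobject that
  contains u, so the whole of G is sent there; as \<rho> is injective, this gives a map from G to
  M.\<close>

lemma cyclic_generator:
  fixes small :: "'u set \<Rightarrow> bool"
  assumes univ: "universe small" and sK: "small_in small (carrier K)" and sH: "small_in small (carrier H)"
    and sD: "\<And>X Y. \<lbrakk>X \<in> Ob; Y \<in> Ob\<rbrakk> \<Longrightarrow> small_in small (DH X Y)"
    and X: "X \<in> Ob" and u: "u \<in> carrier (ten (ten (LHom D X X)))"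
  shows "\<exists>G\<in>Obj (hopf_mod_category small K H D). represents X u G"
proof -
  interpret universe small by (rule univ)
  define E where "E = cofree (rep X)"
  define N where "N = OS.opgen E (\<lambda>Y. if Y = X then {u} else {})"
  define G0 where "G0 = OS.sub_opmod E N"
  note lm = rep_left_module[OF X]
  have E: "OS.is_opmod E" "good E" unfolding E_def by (rule cofree_opmod[OF lm], rule cofree_good[OF lm])
  have uE: "u \<in> el E X" using u by (simp add: E_def)
  have N: "OS.opsub E N" unfolding N_def by (rule OS.opsub_opgen[OF E(1)])
  have G0: "OS.is_opmod G0" "OS.ophom G0 E (\<lambda>X x. x)" unfolding G0_def by (rule OS.sub_opmod[OF E(1) N])+
  have G0c: "el G0 Y = N Y" for Y by (simp add: G0_def)
  have uN: "u \<in> N X" unfolding N_def by (rule OS.opgen_incl[OF X _ uE]) simp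
  have small_G0: "small_in small (el G0 Y)" if Y: "Y \<in> Ob" for Y
  proof -
    note p = pairH[OF D_module[OF X Y]]
    have "small_in small (carrier (ten (ten (LHom D X Y))))"
      by (rule module_pair.small_in_tensor[OF pairH[OF module_pair.tensor_module[OF p]] univ
            module_pair.small_in_tensor[OF p univ sD[OF X Y] sH sK] sH sK])
    then show ?thesis unfolding G0c by (rule small_in_subset) (use OS.opsub_subset[OF E(1) N Y] in \<open>simp add: E_def\<close>)
  qed
  \<comment> \<open>Dividing by zero copies the submodule, whose elements are iterated tensors, into
    \<open>'u\<close>.\<close>
  obtain Q :: "('o, 'f, 'h, 'k, 'u) hopf_opmod" and q where
    Q: "OS.is_opmod Q" "OS.ophom G0 Q q" "OS.opsurj G0 Q q" and
    q0: "\<And>Y x. \<lbrakk>Y \<in> Ob; x \<in> el G0 Y\<rbrakk> \<Longrightarrow> q Y x = nul Q Y \<longleftrightarrow> x \<in> {nul G0 Y}" and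
    sQ: "\<And>Y. Y \<in> Ob \<Longrightarrow> small (el Q Y)"
    by (rule OS.opmod_quotient[OF univ G0(1) OS.opsub_zero[OF G0(1)] small_G0]) (assumption, erule (2) that, blast, blast)
  have ker: "\<eta> Y x = nul W Y" if "OS.is_opmod W" "OS.ophom G0 W \<eta>" "Y \<in> Ob" "x \<in> el G0 Y" "q Y x = nul Q Y"
    for W :: "('o, 'f, 'h, 'k, 'z) hopf_opmod" and \<eta> Y x
  proof -
    have "x = nul G0 Y" using q0[OF that(3,4)] that(5) by simp
    then show ?thesis using OS.ophom_zero[OF G0(1) that(1-3)] by simp
  qed
  \<comment> \<open>The inverse of the copying map embeds Q into the good module E, so Q is good by
    \<open>good_reflect\<close>.\<close>
  obtain r where r: "OS.ophom Q E r" and rq: "\<And>Y x. \<lbrakk>Y \<in> Ob; x \<in> el G0 Y\<rbrakk> \<Longrightarrow> r Y (q Y x) = x"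
    by (rule OS.ophom_lift_surj[OF G0(1) Q(1) E(1) Q(2,3) G0(2) ker[OF E(1) G0(2)]]) (assumption, assumption, assumption, erule that, blast)
  have "OS.opinj Q r" unfolding OS.opinj_def
  proof (intro ballI)
    fix Y assume Y: "Y \<in> Ob"
    have "el Q Y = q Y ` el G0 Y" using Q(3) Y by (simp add: OS.opsurj_def)
    then show "inj_on (r Y) (el Q Y)" using rq[OF Y] by (auto intro!: inj_onI)
  qed
  then have gQ: "good Q" by (rule good_reflect[OF Q(1) E r])
  note obj = hopf_mod_of_object[where small = small, OF Q(1) gQ sQ]
  show ?thesis
  proof (intro bexI[OF _ obj(1)] allI impI, unfold represents_def, intro allI impI)
    fix M :: "('o, 'f, 'k, 'h, 'u) hopf_mod" and \<theta> m
    assume M: "relative_hopf_module K H D M" and \<theta>: "\<forall>Y\<in>Ob. lin (MObj (rep X) Y) (MObj M Y) (\<theta> Y)"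
      and nat: "\<forall>Y\<in>Ob. \<forall>Z\<in>Ob. \<forall>f\<in>DH Y Z. \<forall>n\<in>carrier (MObj (rep X) Y). \<theta> Z (MAct (rep X) Y Z f n) = MAct M Y Z f (\<theta> Y n)"
      and m: "m \<in> carrier (MObj M X)" and um: "pushH (MObj M X) (\<theta> X) u = MCoact M X m"
    have lM: "left_module K D M" using M by (simp add: relative_hopf_module_def)
    let ?\<Theta> = "\<lambda>Y. pushH (MObj M Y) (\<theta> Y)" and ?\<rho> = "MCoact M"
    note UM = U_good(1)[OF M] and \<rho> = coaction_ophom[OF M] and CM = cofree_opmod[OF lM]
    have \<Theta>: "OS.ophom E (cofree M) ?\<Theta>" unfolding E_def by (rule cofree_map_ophom[OF lm lM]) (use \<theta> nat in auto)
    have im: "?\<Theta> Y x \<in> ?\<rho> Y ` el (U M) Y" if Y: "Y \<in> Ob" and x: "x \<in> el G0 Y" for Y x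
    proof -
      let ?S = "\<lambda>Y. {x \<in> el E Y. ?\<Theta> Y x \<in> ?\<rho> Y ` el (U M) Y}"
      have "OS.opsub E ?S" by (rule OS.opsub_vimage[OF E(1) CM \<Theta> OS.opsub_range[OF UM CM \<rho>(1)]])
      moreover have "(if Z = X then {u} else {}) \<subseteq> ?S Z" for Z using uE um m by auto
      ultimately have "N Y \<subseteq> ?S Y" unfolding N_def by (rule OS.opgen_least[OF _ _ Y])
      then show ?thesis using x G0c by auto
    qed
    obtain v where v: "OS.ophom G0 (U M) v" and \<rho>v: "\<And>Y x. \<lbrakk>Y \<in> Ob; x \<in> el G0 Y\<rbrakk> \<Longrightarrow> ?\<rho> Y (v Y x) = ?\<Theta> Y x"
      by (rule OS.ophom_lift_inj[OF UM CM G0(1) \<rho> OS.ophom_compose[OF G0(2) \<Theta>] im]) (assumption, assumption, erule that, blast)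
    obtain w where w: "OS.ophom Q (U M) w" and wq: "\<And>Y x. \<lbrakk>Y \<in> Ob; x \<in> el G0 Y\<rbrakk> \<Longrightarrow> w Y (q Y x) = v Y x"
      by (rule OS.ophom_lift_surj[OF G0(1) Q(1) UM Q(2,3) v ker[OF UM v]]) (assumption, assumption, assumption, erule that, blast)
    have uG: "u \<in> el G0 X" using uN G0c by simp
    have "v X u = m"
      by (rule opinjD[OF \<rho>(2) X]) (use \<rho>v[OF X uG] um m OS.ophom_closed[OF v X uG] in auto)
    then have "m = w X (q X u)" using wq[OF X uG] by simp
    moreover have "q X u \<in> el (U (hopf_mod_of Q)) X" using OS.ophom_closed[OF Q(2) X uG] by (simp add: hopf_mod_of_def)
    ultimately show "\<exists>\<eta>. OS.ophom (U (hopf_mod_of Q)) (U M) \<eta> \<and> m \<in> \<eta> X ` el (U (hopf_mod_of Q)) X"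
      using OS.ophom_compose[OF obj(5) w] by (intro exI[of _ w]) auto
  qed
qed

text \<open>Closure under subobjects is \<open>good_reflect\<close> and closure under covers is
  \<open>good_cover\<close>; what remains is to assemble a small set of generators.\<close>

lemma hopf_mod_opcat:
  fixes small :: "'u set \<Rightarrow> bool"
  assumes univ: "universe small" and sK: "small_in small (carrier K)" and sH: "small_in small (carrier H)" and sO: "small_in small (Ob)"
    and sD: "\<And>X Y. \<lbrakk>X \<in> Ob; Y \<in> Ob\<rbrakk> \<Longrightarrow> small_in small (DH X Y)"
  shows "opcat K (Ob) ops op_src op_tgt small (hopf_mod_category small K H D) U"
proof -
  interpret universe small by (rule univ)
  let ?C = "hopf_mod_category small K H D"
  have obj: "relative_hopf_module K H D M" "\<And>X. X \<in> Ob \<Longrightarrow> small (carrier (MObj M X))" if "M \<in> Obj ?C" for M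
    using that by (auto simp: hopf_mod_category_def)
  show ?thesis
  proof (unfold_locales)
    show "OS.is_opmod (U M)" if "M \<in> Obj ?C" for M by (rule U_good(1)[OF obj(1)[OF that]])
    show "small (el (U M) X)" if "M \<in> Obj ?C" "X \<in> Ob" for M X using obj(2)[OF that] by simp
    show "Hom ?C M N = {\<eta>. \<eta> \<in> extensional (Ob) \<and> (\<forall>X\<in>Ob. \<eta> X \<in> extensional (el (U M) X)) \<and> OS.ophom (U M) (U N) \<eta>}"
      if "M \<in> Obj ?C" "N \<in> Obj ?C" for M N
      using hopf_mod_homs_eq[OF obj(1)[OF that(1)] obj(1)[OF that(2)]] by (simp add: hopf_mod_category_def)
    show "Comp ?C M N Q \<zeta> \<eta> = (\<lambda>X\<in>Ob. compose (el (U M) X) (\<zeta> X) (\<eta> X))" for M N Q \<zeta> \<eta>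
      by (simp add: hopf_mod_category_def)
    show "Ident ?C M = (\<lambda>X\<in>Ob. \<lambda>m\<in>el (U M) X. m)" for M by (simp add: hopf_mod_category_def)
  next
    fix A :: "('o, 'f, 'h, 'k, 'u) hopf_opmod" and M \<eta>
    assume A: "OS.is_opmod A" and M: "M \<in> Obj ?C" and \<eta>: "OS.ophom A (U M) \<eta>" "OS.opinj A \<eta>"
      and sm: "\<And>X. X \<in> Ob \<Longrightarrow> small (el A X)"
    have "good A" by (rule good_reflect[OF A U_good(1,2)[OF obj(1)[OF M]] \<eta>])
    note h = hopf_mod_of_object[where small = small, OF A this sm]
    show "\<exists>M'\<in>Obj ?C. \<exists>\<beta>. OS.ophom A (U M') \<beta> \<and> OS.opinj A \<beta> \<and> OS.opsurj A (U M') \<beta>"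
      using h(1-4) by blast
  next
    fix A :: "('o, 'f, 'h, 'k, 'u) hopf_opmod"
    assume A: "OS.is_opmod A" and sm: "\<And>X. X \<in> Ob \<Longrightarrow> small (el A X)"
      and cov: "\<And>X N. \<lbrakk>X \<in> Ob; submodule N K (Grp A X);
          \<And>M \<eta>. \<lbrakk>M \<in> Obj ?C; OS.ophom (U M) A \<eta>\<rbrakk> \<Longrightarrow> \<eta> X ` el (U M) X \<subseteq> N\<rbrakk> \<Longrightarrow> el A X \<subseteq> N"
    have "good A"
    proof (rule good_cover[OF A])
      fix X N assume X: "X \<in> Ob" "submodule N K (Grp A X)"
        and im: "\<And>A' \<eta>. \<lbrakk>OS.is_opmod A'; good A'; OS.ophom A' A \<eta>\<rbrakk> \<Longrightarrow> \<eta> X ` el (A' :: ('o, 'f, 'h, 'k, 'u) hopf_opmod) X \<subseteq> N"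
      show "el A X \<subseteq> N"
        by (rule cov[OF X]) (rule im[OF U_good(1,2)[OF obj(1)]])
    qed
    note h = hopf_mod_of_object[where small = small, OF A this sm]
    show "\<exists>M'\<in>Obj ?C. \<exists>\<beta>. OS.ophom A (U M') \<beta> \<and> OS.opinj A \<beta> \<and> OS.opsurj A (U M') \<beta>"
      using h(1-4) by blast
  next
    \<comment> \<open>One generator for each pair (X, u), chosen before any M is considered.\<close>
    let ?I = "SIGMA X:Ob. carrier (ten (ten (LHom D X X)))"
    let ?P = "\<lambda>i G. G \<in> Obj ?C \<and> represents (fst i) (snd i) G"
    have "\<forall>i\<in>?I. \<exists>G. ?P i G"
      using cyclic_generator[OF univ sK sH sD] unfolding Bex_def by auto
    from bchoice[OF this] obtain \<Gamma> where "\<forall>i\<in>?I. ?P i (\<Gamma> i)" ..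
    note \<Gamma> = bspec[OF this]
    have "small_in small (carrier (ten (ten (LHom D X X))))" if X: "X \<in> Ob" for X
    proof -
      note p = pairH[OF D_module[OF X X]]
      show ?thesis by (rule module_pair.small_in_tensor[OF pairH[OF module_pair.tensor_module[OF p]] univ
            module_pair.small_in_tensor[OF p univ sD[OF X X] sH sK] sH sK])
    qed
    then have "small_in small ?I" by (rule small_in_Sigma[OF sO])
    then obtain j where j: "inj_on j ?I" "small (j ` ?I)" by (auto simp: small_in_def)
    \<comment> \<open>\<open>generators\<close> wants a small index set inside \<open>'u\<close>, so
      the pairs are replaced by their codes under j.\<close>
    let ?\<Gamma> = "\<lambda>i. \<Gamma> (the_inv_into ?I j i)"
    have \<Gamma>j: "?\<Gamma> (j i) = \<Gamma> i" if "i \<in> ?I" for i using the_inv_into_f_f[OF j(1) that] by simp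
    show "\<exists>I \<Gamma>. small I \<and> (\<forall>i\<in>I. \<Gamma> i \<in> Obj ?C) \<and> (\<forall>M\<in>Obj ?C. \<forall>X\<in>Ob. \<forall>m\<in>el (U M) X.
        \<exists>i\<in>I. \<exists>\<eta>. OS.ophom (U (\<Gamma> i)) (U M) \<eta> \<and> m \<in> \<eta> X ` el (U (\<Gamma> i)) X)"
    proof (intro exI[of _ "j ` ?I"] exI[of _ ?\<Gamma>] conjI ballI j(2))
      fix k assume "k \<in> j ` ?I"
      then obtain i where "i \<in> ?I" "k = j i" by blast
      then show "?\<Gamma> k \<in> Obj ?C" using \<Gamma>[of i] \<Gamma>j[of i] by simp
    next
      fix M X m assume M: "M \<in> Obj ?C" and X: "X \<in> Ob" and m: "m \<in> el (U M) X"
      have m': "m \<in> carrier (MObj M X)" using m by simp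
      obtain u \<theta> where u: "u \<in> carrier (ten (ten (LHom D X X)))"
        and \<theta>: "\<And>Y. Y \<in> Ob \<Longrightarrow> lin (MObj (rep X) Y) (MObj M Y) (\<theta> Y)"
        and nat: "\<And>Y Z f n. \<lbrakk>Y \<in> Ob; Z \<in> Ob; f \<in> DH Y Z; n \<in> carrier (MObj (rep X) Y)\<rbrakk>
          \<Longrightarrow> \<theta> Z (MAct (rep X) Y Z f n) = MAct M Y Z f (\<theta> Y n)"
        and um: "pushH (MObj M X) (\<theta> X) u = MCoact M X m"
        by (fact element_of_rep[OF obj(1)[OF M] X m'])
      have i: "(X, u) \<in> ?I" using X u by simp
      have "\<exists>\<eta>. OS.ophom (U (\<Gamma> (X, u))) (U M) \<eta> \<and> m \<in> \<eta> X ` el (U (\<Gamma> (X, u))) X"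
        using conjunct2[OF \<Gamma>[OF i], unfolded represents_def fst_conv snd_conv, rule_format, OF obj(1)[OF M] \<theta> nat m' um] .
      then show "\<exists>k\<in>j ` ?I. \<exists>\<eta>. OS.ophom (U (?\<Gamma> k)) (U M) \<eta> \<and> m \<in> \<eta> X ` el (U (?\<Gamma> k)) X"
        using i \<Gamma>j[OF i] by (intro bexI[of _ "j (X, u)"]) simp_all
    qed
  qed
qed

end

theorem proposition5p6:
  fixes small :: "'u set \<Rightarrow> bool"
    and K :: "'k ring"
    and H :: "('k, 'h) hopf"
    and D :: "('o, 'f, 'k, 'h) co_cat"
  assumes "universe small"
    and "field K"
    and "hopf_algebra K H"
    and "bij_betw (antipode H) (carrier H) (carrier H)"
    and "right_co_category K H D"
    and "small_in small (carrier K)"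
    and "small_in small (carrier H)"
    and "small_in small (LObj D)"
    and "\<And>X Y. \<lbrakk>X \<in> LObj D; Y \<in> LObj D\<rbrakk> \<Longrightarrow> small_in small (carrier (LHom D X Y))"
  shows "grothendieck_category small (hopf_mod_category small K H D)"
proof -
  have "module K H" using assms(3) by (simp add: hopf_algebra_def assoc_algebra_def)
  then obtain B cf where "based_module K H B cf" using basis_ex[OF assms(2)] by blast
  then interpret hopf_setting K H B cf D
    using assms(3,5) by (simp add: hopf_setting_def hopf_setting_axioms_def)
  show ?thesis
    by (rule opcat.grothendieck_C[OF hopf_mod_opcat[OF assms(1,6-9)]])
qed

end
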